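(* Assume the resolution condition $H/\varepsilon\le\left(2C_{I_H}\sqrt{C_{\rm ol}V_{\max}(1+C_{I_H}C_{\rm ol}\gamma)}\right)^{-1}$ and the oversampling condition $$m\ge\frac{C_d\log(1/H)+\log(\varepsilon^2C_{\rm st}(\varepsilon,V))}{|\log\beta|},\qquad C_d=\tfrac{3d}{2}+2.$$ There is a constant $C>0$, independent of $\varepsilon,\delta,m,H$ and of $f$, such that the following holds. Let $f\in L^2(\Omega)$, let $u\in H^1_P(\Omega)$ be the solution of $a(u,v)=(f,v)$ for all $v\in H^1_P(\Omega)$, and let $u_{H,m}\in\Psi_{H,m}$ be its Galerkin approximation, i.e. $a(u_{H,m},v)=(f,v)$ for all $v\in\Psi_{H,m}$. Then $$\|u-u_{H,m}\|_e\le C\frac{H}{\varepsilon}\|f\|,\qquad \|u-u_{H,m}\|\le C\frac{H^2}{\varepsilon^2}\|f\|.$$ Moreover, if $f\in H^1(\Omega)$, then $$\|u-u_{H,m}\|_e\le C\frac{H^2}{\varepsilon}\|f\|_{H^1},\qquad \|u-u_{H,m}\|\le C\frac{H^3}{\varepsilon^2}\|f\|_{H^1}.$$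
   Context: Setting. $\Omega=[0,2\pi]^d$; functions are complex-valued; $(v,w)=\int_\Omega v\bar w$, $\|\cdot\|$ is the $L^2(\Omega)$ norm, $\|\cdot\|_K$ the $L^2(K)$ norm for $K\subset\Omega$, $\|\cdot\|_{H^1}$ the $H^1(\Omega)$ norm; $H^1_P(\Omega)=\{w\in H^1(\Omega): w \text{ is periodic on }\partial\Omega\}$. The small parameters satisfy $0<\varepsilon\ll1$, $0<\delta\ll1$. $V=V^\delta$ is a real potential with $V_{\min}\le V\le V_{\max}$ on $\Omega$, where $0<V_{\min}\le V_{\max}$ do not depend on $\varepsilon,\delta$, and $\|D^{\sigma}_xV\|_\infty\le C\delta^{-|\sigma|}$ for multi-indices $\sigma$. Set $a(v,w)=\frac12\varepsilon^2(\nabla v,\nabla w)+(Vv,w)$ and $\|w\|_e=a(w,w)^{1/2}$. The variational problem above is the weak form of $-\frac12\varepsilon^2\Delta u+Vu=f$ with periodic boundary conditions; $C_{\rm st}(\varepsilon,V)$ is a constant such that its solution satisfies $\|u\|_e\le C_{\rm st}(\varepsilon,V)\|f\|$ for every $f\in L^2(\Omega)$. Mesh. $\mathcal T_H$ is a quasi-uniform, shape-regular simplicial mesh of $\Omega$ of mesh size $H$, compatible with the periodic boundary conditions (opposite faces of $\Omega$ are identified). For a union $K$ of elements, $N(K)=\bigcup\{G\in\mathcal T_H: G\cap K\ne\emptyset\}$, $N^0(K)=K$, $N^{m+1}(K)=N(N^m(K))$. $\Phi_H\subset H^1_P(\Omega)$ is the space of functions that are polynomials of degree $\le1$ on each element,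 with nodal basis $\phi_1,\dots,\phi_{N_H}$ (one for each vertex, vertices identified by periodicity being counted once); $S_j=\mathrm{supp}(\phi_j)$. The Clément-type interpolation is $I_Hv=\sum_{j=1}^{N_H}\frac{(v,\phi_j)}{(1,\phi_j)}\phi_j$ for $v\in H^1_P(\Omega)$. Constants, independent of $\varepsilon,\delta,m,H$: $C_{\rm ol}$ with $\max_{T\in\mathcal T_H}\mathrm{card}\{G\in\mathcal T_H: G\subset N(T)\}\le C_{\rm ol}$; $C_{I_H}$ with $H^{-1}\|v-I_Hv\|_T+\|\nabla(v-I_Hv)\|_T\le C_{I_H}\|\nabla v\|_{N(T)}$ for all $T\in\mathcal T_H$, $v\in H^1_P(\Omega)$; $\gamma$ with $H\|\nabla\eta\|_\infty\le\gamma$ for all cutoffs $\eta(x)=\frac{\mathrm{dist}(x,N^m(K))}{\mathrm{dist}(x,N^m(K))+\mathrm{dist}(x,\Omega\setminus N^{m+1}(K))}$. Multiscale bases. The global basis function $\psi_j$ is the minimizer of $a(\psi,\psi)$ over $\psi\in H^1_P(\Omega)$ subject to $(\psi,\phi_k)=\delta_{jk}$ (Kronecker delta), $k=1,\dots,N_H$. The localized basis function $\psi_j^{{\rm loc},m}$ ($m\in\mathbb N$, the oversampling size) is the minimizer of the same problem with the additional constraint $\psi=0$ in $\Omega\setminus N^m(S_j)$. $\Psi_{H,m}=\mathrm{span}\{\psi_j^{{\rm loc},m}: j=1,\dots,N_H\}$. The constant $\beta\in(0,1)$ is independent of $\varepsilon,\delta,m,H$ and is the exponential decay rate of the global basis: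 under the resolution condition, $\|\nabla\psi_j\|_{\Omega\setminus N^m(S_j)}\le\beta^m\|\nabla\psi_j\|$ for all $j$ and all $m\in\mathbb N$.
   Formalization: The "Moreover" part is stated for f in H^1_P(Ω) (periodic traces) instead of all f in H^1(Ω); for non-periodic f, e.g. f(x)=x with d=1 and V=1, the energy error is only of order H^{3/2}, so the claimed H^2 bound fails. *)

theory Defs
  imports "HOL-Analysis.Analysis"
begin

text \<open>
  The space dimension is \<open>CARD('d)\<close>.  Functions on the cube \<open>\<Omega> = [0,2\<pi>]^d\<close> are total functions on
  \<open>real ^ 'd\<close> of which only the values on the cube matter; elements of Lebesgue and Sobolev spaces
  are represented by arbitrary almost-everywhere representatives.
\<close>

definition Omega :: "(real ^ 'd) set"
  where "Omega = cbox 0 (\<chi> i. 2 * pi)"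


section \<open>Lebesgue and Sobolev spaces\<close>

definition L2 :: "(real ^ 'd \<Rightarrow> 'b::euclidean_space) set"
  where "L2 = {f. f \<in> borel_measurable (lebesgue_on Omega) \<and>
                  integrable (lebesgue_on Omega) (\<lambda>x. (norm (f x))\<^sup>2)}"

definition norm_L2 :: "(real ^ 'd) set \<Rightarrow> (real ^ 'd \<Rightarrow> 'b::euclidean_space) \<Rightarrow> real"
  where "norm_L2 K f = sqrt (\<integral>x. (norm (f x))\<^sup>2 \<partial>lebesgue_on K)"

definition inner_L2 :: "(real ^ 'd \<Rightarrow> complex) \<Rightarrow> (real ^ 'd \<Rightarrow> complex) \<Rightarrow> complex"
  where "inner_L2 v w = (\<integral>x. v x * cnj (w x) \<partial>lebesgue_on Omega)"

definition inner_L2_vec :: "(real ^ 'd \<Rightarrow> complex ^ 'd) \<Rightarrow> (real ^ 'd \<Rightarrow> complex ^ 'd) \<Rightarrow> complex"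
  where "inner_L2_vec p q = (\<integral>x. (\<Sum>i\<in>UNIV. p x $ i * cnj (q x $ i)) \<partial>lebesgue_on Omega)"

text \<open>
  \<open>all_partials S f D\<close>: the function \<open>f\<close> is infinitely differentiable on the open set \<open>S\<close>, and
  \<open>D \<sigma>\<close> is its partial derivative for the multi-index \<open>\<sigma>\<close>.
\<close>
definition all_partials ::
    "(real ^ 'd) set \<Rightarrow> (real ^ 'd \<Rightarrow> real) \<Rightarrow> (('d \<Rightarrow> nat) \<Rightarrow> real ^ 'd \<Rightarrow> real) \<Rightarrow> bool"
  where "all_partials S f D \<longleftrightarrow>
    (\<forall>x\<in>S. D (\<lambda>_. 0) x = f x) \<and>
    (\<forall>\<sigma>. \<forall>x\<in>S. (D \<sigma> has_derivative (\<lambda>h. \<Sum>i\<in>UNIV. h $ i * D (\<sigma>(i := Suc (\<sigma> i))) x)) (at x))"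

definition test_function :: "(real ^ 'd \<Rightarrow> real) \<Rightarrow> bool"
  where "test_function \<theta> \<longleftrightarrow>
    (\<exists>D. all_partials UNIV \<theta> D) \<and>
    compact (closure {x. \<theta> x \<noteq> 0}) \<and> closure {x. \<theta> x \<noteq> 0} \<subseteq> interior Omega"

definition weak_gradient :: "(real ^ 'd \<Rightarrow> complex) \<Rightarrow> (real ^ 'd \<Rightarrow> complex ^ 'd) \<Rightarrow> bool"
  where "weak_gradient u g \<longleftrightarrow>
    (\<forall>\<theta> i. test_function \<theta> \<longrightarrow>
       (\<integral>x. frechet_derivative \<theta> (at x) (axis i 1) *\<^sub>R u x \<partial>lebesgue_on Omega)
         = - (\<integral>x. \<theta> x *\<^sub>R (g x $ i) \<partial>lebesgue_on Omega))"

definition H1 :: "(real ^ 'd \<Rightarrow> complex) set"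
  where "H1 = {u \<in> L2. \<exists>g\<in>L2. weak_gradient u g}"

text \<open>The weak gradient is unique up to a null set, so the choice is immaterial.\<close>
definition grad :: "(real ^ 'd \<Rightarrow> complex) \<Rightarrow> real ^ 'd \<Rightarrow> complex ^ 'd"
  where "grad u = (SOME g. g \<in> L2 \<and> weak_gradient u g)"

definition norm_H1 :: "(real ^ 'd \<Rightarrow> complex) \<Rightarrow> real"
  where "norm_H1 u = sqrt ((norm_L2 Omega u)\<^sup>2 + (norm_L2 Omega (grad u))\<^sup>2)"

definition set_coord :: "'d \<Rightarrow> real \<Rightarrow> real ^ 'd \<Rightarrow> real ^ 'd"
  where "set_coord i c x = (\<chi> j. if j = i then c else x $ j)"

text \<open>
  Equality of the traces on opposite faces.  The trace operator is the continuous extension, from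
  \<open>H1\<close> to \<open>L\<^sup>2\<close> of a face, of the restriction of functions that are continuous on the closed cube;
  hence the difference of the traces on the faces \<open>x\<^sub>i = 0\<close> and \<open>x\<^sub>i = 2\<pi>\<close> is the limit of the
  differences of the boundary values along any approximating sequence of such functions.  The
  functions measured by the last norm do not depend on \<open>x\<^sub>i\<close>, so that this norm is
  \<open>sqrt (2\<pi>)\<close> times the \<open>L\<^sup>2\<close> norm on the face.
\<close>
definition periodic_traces :: "(real ^ 'd \<Rightarrow> complex) \<Rightarrow> bool"
  where "periodic_traces u \<longleftrightarrow>
    (\<exists>w. (\<forall>n::nat. w n \<in> H1 \<and> continuous_on Omega (w n)) \<and>
         (\<lambda>n. norm_H1 (\<lambda>x. w n x - u x)) \<longlonglongrightarrow> 0 \<and>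
         (\<forall>i. (\<lambda>n. norm_L2 Omega
                    (\<lambda>x. w n (set_coord i 0 x) - w n (set_coord i (2 * pi) x))) \<longlonglongrightarrow> 0))"

definition H1P :: "(real ^ 'd \<Rightarrow> complex) set"
  where "H1P = {u \<in> H1. periodic_traces u}"


section \<open>The variational problem\<close>

definition potential ::
    "real \<Rightarrow> real \<Rightarrow> (('d \<Rightarrow> nat) \<Rightarrow> real) \<Rightarrow> real \<Rightarrow> (real ^ 'd \<Rightarrow> real) \<Rightarrow> bool"
  where "potential Vmin Vmax CV \<delta> V \<longleftrightarrow>
    (\<forall>x\<in>Omega. Vmin \<le> V x \<and> V x \<le> Vmax) \<and>
    (\<exists>D. all_partials (interior Omega) V D \<and>
         (\<forall>\<sigma>. \<forall>x\<in>interior Omega. \<bar>D \<sigma> x\<bar> \<le> CV \<sigma> / \<delta> ^ (\<Sum>i\<in>UNIV. \<sigma> i)))"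

definition form_a ::
    "real \<Rightarrow> (real ^ 'd \<Rightarrow> real) \<Rightarrow> (real ^ 'd \<Rightarrow> complex) \<Rightarrow> (real ^ 'd \<Rightarrow> complex) \<Rightarrow> complex"
  where "form_a \<epsilon> V v w =
    complex_of_real (\<epsilon>\<^sup>2 / 2) * inner_L2_vec (grad v) (grad w)
      + inner_L2 (\<lambda>x. complex_of_real (V x) * v x) w"

text \<open>The value \<open>form_a \<epsilon> V w w\<close> is real.\<close>
definition norm_e :: "real \<Rightarrow> (real ^ 'd \<Rightarrow> real) \<Rightarrow> (real ^ 'd \<Rightarrow> complex) \<Rightarrow> real"
  where "norm_e \<epsilon> V w = sqrt (Re (form_a \<epsilon> V w w))"

text \<open>With \<open>X = H1P\<close> this is the weak solution, with \<open>X\<close> a subspace its Galerkin approximation.\<close>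
definition galerkin_solution ::
    "real \<Rightarrow> (real ^ 'd \<Rightarrow> real) \<Rightarrow> (real ^ 'd \<Rightarrow> complex) set \<Rightarrow>
     (real ^ 'd \<Rightarrow> complex) \<Rightarrow> (real ^ 'd \<Rightarrow> complex) \<Rightarrow> bool"
  where "galerkin_solution \<epsilon> V X f u \<longleftrightarrow> u \<in> X \<and> (\<forall>v\<in>X. form_a \<epsilon> V u v = inner_L2 f v)"

definition stability_constant :: "real \<Rightarrow> (real ^ 'd \<Rightarrow> real) \<Rightarrow> real \<Rightarrow> bool"
  where "stability_constant \<epsilon> V Cst \<longleftrightarrow>
    0 < Cst \<and>
    (\<forall>f\<in>L2. \<forall>u. galerkin_solution \<epsilon> V H1P f u \<longrightarrow> norm_e \<epsilon> V u \<le> Cst * norm_L2 Omega f)"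


section \<open>Periodic simplicial meshes and finite elements\<close>

text \<open>Opposite faces of the cube are identified.\<close>
definition per_eq :: "real ^ 'd \<Rightarrow> real ^ 'd \<Rightarrow> bool"
  where "per_eq x y \<longleftrightarrow> (\<forall>i. \<exists>k::int. x $ i - y $ i = 2 * pi * of_int k)"

definition per_ext :: "(real ^ 'd) set \<Rightarrow> (real ^ 'd) set"
  where "per_ext K = {x. \<exists>y\<in>K. per_eq x y}"

text \<open>
  A mesh of size \<open>H\<close>; quasi-uniformity and shape regularity are quantified by \<open>\<kappa>\<close>.  The clause on
  \<open>per_eq p 0\<close> says that the \<open>2\<pi>\<close>-periodic translates of the mesh fit together to a conforming
  simplicial mesh of the whole space, i.e. that the meshes induced on opposite faces match.
\<close>
definition periodic_mesh :: "real \<Rightarrow> real \<Rightarrow> (real ^ 'd) set set \<Rightarrow> bool"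
  where "periodic_mesh \<kappa> H \<T> \<longleftrightarrow>
    triangulation \<T> \<and> (\<forall>T\<in>\<T>. int CARD('d) simplex T) \<and> \<Union>\<T> = Omega \<and>
    (\<forall>T\<in>\<T>. \<forall>G\<in>\<T>. \<forall>p. per_eq p 0 \<longrightarrow>
       (T \<inter> (\<lambda>x. p + x) ` G) face_of T \<and> (T \<inter> (\<lambda>x. p + x) ` G) face_of ((\<lambda>x. p + x) ` G)) \<and>
    H = Max (diameter ` \<T>) \<and>
    (\<forall>T\<in>\<T>. \<kappa> * H \<le> diameter T) \<and>
    (\<forall>T\<in>\<T>. \<exists>c. cball c (\<kappa> * diameter T) \<subseteq> T)"

definition patch :: "(real ^ 'd) set set \<Rightarrow> (real ^ 'd) set \<Rightarrow> (real ^ 'd) set"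
  where "patch \<T> K = \<Union>{G \<in> \<T>. G \<inter> per_ext K \<noteq> {}}"

definition patch_pow :: "(real ^ 'd) set set \<Rightarrow> nat \<Rightarrow> (real ^ 'd) set \<Rightarrow> (real ^ 'd) set"
  where "patch_pow \<T> m K = (patch \<T> ^^ m) K"

definition mesh_vertices :: "(real ^ 'd) set set \<Rightarrow> (real ^ 'd) set"
  where "mesh_vertices \<T> = {v. \<exists>T\<in>\<T>. v extreme_point_of T}"

definition P1_space :: "(real ^ 'd) set set \<Rightarrow> (real ^ 'd \<Rightarrow> complex) set"
  where "P1_space \<T> = {v \<in> H1P. \<forall>T\<in>\<T>. \<exists>(a :: complex ^ 'd) b. \<forall>x\<in>T.
           v x = b + (\<Sum>i\<in>UNIV. a $ i * complex_of_real (x $ i))}"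

text \<open>
  \<open>z 1, \<dots>, z N\<close> represent the vertices modulo periodicity, \<open>\<phi> j\<close> is the hat function of \<open>z j\<close>.
\<close>
definition nodal_basis ::
    "(real ^ 'd) set set \<Rightarrow> nat \<Rightarrow> (nat \<Rightarrow> real ^ 'd) \<Rightarrow> (nat \<Rightarrow> real ^ 'd \<Rightarrow> complex) \<Rightarrow> bool"
  where "nodal_basis \<T> N z \<phi> \<longleftrightarrow>
    (\<forall>j\<in>{1..N}. z j \<in> mesh_vertices \<T>) \<and>
    (\<forall>v\<in>mesh_vertices \<T>. \<exists>!j. j \<in> {1..N} \<and> per_eq v (z j)) \<and>
    (\<forall>j\<in>{1..N}. \<phi> j \<in> P1_space \<T> \<and>
       (\<forall>v\<in>mesh_vertices \<T>. \<phi> j v = (if per_eq v (z j) then 1 else 0)))"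

definition supp :: "(real ^ 'd \<Rightarrow> complex) \<Rightarrow> (real ^ 'd) set"
  where "supp v = closure {x \<in> Omega. v x \<noteq> 0}"

definition clement :: "nat \<Rightarrow> (nat \<Rightarrow> real ^ 'd \<Rightarrow> complex) \<Rightarrow> (real ^ 'd \<Rightarrow> complex) \<Rightarrow> real ^ 'd \<Rightarrow> complex"
  where "clement N \<phi> v x =
    (\<Sum>j\<in>{1..N}. inner_L2 v (\<phi> j) / inner_L2 (\<lambda>_. 1) (\<phi> j) * \<phi> j x)"

text \<open>The distance is the periodic one.\<close>
definition cutoff :: "(real ^ 'd) set set \<Rightarrow> nat \<Rightarrow> (real ^ 'd) set \<Rightarrow> real ^ 'd \<Rightarrow> real"
  where "cutoff \<T> m K x =
    infdist x (per_ext (patch_pow \<T> m K)) /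
      (infdist x (per_ext (patch_pow \<T> m K))
        + infdist x (per_ext (Omega - patch_pow \<T> (Suc m) K)))"

definition overlap_constant :: "(real ^ 'd) set set \<Rightarrow> real \<Rightarrow> bool"
  where "overlap_constant \<T> Col \<longleftrightarrow> (\<forall>T\<in>\<T>. real (card {G \<in> \<T>. G \<subseteq> patch \<T> T}) \<le> Col)"

definition interpolation_constant ::
    "(real ^ 'd) set set \<Rightarrow> real \<Rightarrow> nat \<Rightarrow> (nat \<Rightarrow> real ^ 'd \<Rightarrow> complex) \<Rightarrow> real \<Rightarrow> bool"
  where "interpolation_constant \<T> H N \<phi> CI \<longleftrightarrow>
    (\<forall>T\<in>\<T>. \<forall>v\<in>H1P.
       inverse H * norm_L2 T (\<lambda>x. v x - clement N \<phi> v x)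
         + norm_L2 T (grad (\<lambda>x. v x - clement N \<phi> v x))
       \<le> CI * norm_L2 (patch \<T> T) (grad v))"

text \<open>
  \<open>K\<close> ranges over the nonempty unions of elements.  If the larger patch is all of \<open>\<Omega>\<close>, the distance
  to its empty complement is infinite and the cutoff vanishes identically; this case has to be
  excluded since \<open>infdist x {} = 0\<close>.
\<close>
definition cutoff_constant :: "(real ^ 'd) set set \<Rightarrow> real \<Rightarrow> real \<Rightarrow> bool"
  where "cutoff_constant \<T> H \<gamma> \<longleftrightarrow>
    (\<forall>\<K> m. \<K> \<subseteq> \<T> \<and> \<K> \<noteq> {} \<and> patch_pow \<T> (Suc m) (\<Union>\<K>) \<noteq> Omega \<longrightarrow>
       (AE x in lebesgue_on Omega.
          H * norm (grad (\<lambda>y. complex_of_real (cutoff \<T> m (\<Union>\<K>) y)) x) \<le> \<gamma>))"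


section \<open>Multiscale bases\<close>

definition biorthogonal ::
    "nat \<Rightarrow> (nat \<Rightarrow> real ^ 'd \<Rightarrow> complex) \<Rightarrow> nat \<Rightarrow> (real ^ 'd \<Rightarrow> complex) \<Rightarrow> bool"
  where "biorthogonal N \<phi> j \<psi> \<longleftrightarrow>
    (\<forall>k\<in>{1..N}. inner_L2 \<psi> (\<phi> k) = (if j = k then 1 else 0))"

definition energy_minimizer ::
    "real \<Rightarrow> (real ^ 'd \<Rightarrow> real) \<Rightarrow> (real ^ 'd \<Rightarrow> complex) set \<Rightarrow> (real ^ 'd \<Rightarrow> complex) \<Rightarrow> bool"
  where "energy_minimizer \<epsilon> V X \<psi> \<longleftrightarrow>
    \<psi> \<in> X \<and> (\<forall>w\<in>X. Re (form_a \<epsilon> V \<psi> \<psi>) \<le> Re (form_a \<epsilon> V w w))"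

definition global_basis ::
    "real \<Rightarrow> (real ^ 'd \<Rightarrow> real) \<Rightarrow> nat \<Rightarrow> (nat \<Rightarrow> real ^ 'd \<Rightarrow> complex) \<Rightarrow>
     nat \<Rightarrow> (real ^ 'd \<Rightarrow> complex) \<Rightarrow> bool"
  where "global_basis \<epsilon> V N \<phi> j \<psi> \<longleftrightarrow>
    energy_minimizer \<epsilon> V {w \<in> H1P. biorthogonal N \<phi> j w} \<psi>"

definition local_basis ::
    "real \<Rightarrow> (real ^ 'd \<Rightarrow> real) \<Rightarrow> (real ^ 'd) set set \<Rightarrow> nat \<Rightarrow> (nat \<Rightarrow> real ^ 'd \<Rightarrow> complex) \<Rightarrow>
     nat \<Rightarrow> nat \<Rightarrow> (real ^ 'd \<Rightarrow> complex) \<Rightarrow> bool"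
  where "local_basis \<epsilon> V \<T> N \<phi> m j \<psi> \<longleftrightarrow>
    energy_minimizer \<epsilon> V
      {w \<in> H1P. biorthogonal N \<phi> j w \<and>
        (AE x in lebesgue_on Omega. x \<notin> patch_pow \<T> m (supp (\<phi> j)) \<longrightarrow> w x = 0)} \<psi>"

definition complex_span :: "nat \<Rightarrow> (nat \<Rightarrow> real ^ 'd \<Rightarrow> complex) \<Rightarrow> (real ^ 'd \<Rightarrow> complex) set"
  where "complex_span N \<psi> = {v. \<exists>c. v = (\<lambda>x. \<Sum>j\<in>{1..N}. c j * \<psi> j x)}"

definition decay_rate ::
    "real \<Rightarrow> (real ^ 'd \<Rightarrow> real) \<Rightarrow> (real ^ 'd) set set \<Rightarrow> nat \<Rightarrow> (nat \<Rightarrow> real ^ 'd \<Rightarrow> complex) \<Rightarrow>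
     real \<Rightarrow> bool"
  where "decay_rate \<epsilon> V \<T> N \<phi> \<beta> \<longleftrightarrow>
    (\<forall>j\<in>{1..N}. \<forall>\<psi>. global_basis \<epsilon> V N \<phi> j \<psi> \<longrightarrow>
       (\<forall>m. norm_L2 (Omega - patch_pow \<T> m (supp (\<phi> j))) (grad \<psi>)
              \<le> \<beta> ^ m * norm_L2 Omega (grad \<psi>)))"

end

theory Submission
  imports Defs
begin

text \<open>
  The span of the global basis functions is the energy orthogonal complement of the kernel of
  the Clement-type interpolation.  Hence the error \<open>w\<close> of the ideal Galerkin approximation lies in this kernel,
  where \<open>\<parallel>w\<parallel> \<le> C H \<parallel>\<nabla>w\<parallel>\<close>, and \<open>a(w,w) = (f,w)\<close> gives the energy estimate; if \<open>f\<close> is in \<open>H\<^sup>1\<close>,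
  subtracting its interpolation from \<open>f\<close> gains another factor \<open>H\<close>.

  The localised basis function is at least as close to the global one as any competitor with the same
  support.  A competitor is obtained by multiplying the global function with a smooth cutoff and
  repairing the constraints with bubbles that are dual to the hat functions and supported in single
  elements, so that its distance is controlled by the exponentially small tail.  The oversampling
  condition makes the sum of these errors smaller than the ideal error.  The estimates in \<open>L\<^sup>2\<close> follow
  by duality.
\<close>

section \<open>Minimisation in semi-inner product spaces of functions\<close>

text \<open>Weak gradients are tested with infinitely smooth functions, so the product rule proved
  here covers smooth factors only. The cutoff is therefore not the quotient of distances from the
  setting: it is assembled from a smooth partition of unity on a uniform grid finer than the mesh,
  and shape regularity tells how fine. The bubbles must evaluate affine functions at a vertex while
  living inside a single element; their norms scale with \<open>H\<close> exactly so that the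
  correction costs no power of \<open>H\<close>. The exponent \<open>3d/2 + 2\<close> arises as
  follows. A localised basis function is off by a multiple of
  \<open>\<epsilon> \<beta>^m / H^(d/2 + 1)\<close> in energy, and the coefficients
  \<open>(u, \<phi>_j)\<close> have a sum of order \<open>Cst\<close> times the norm of
  \<open>f\<close>. The oversampling condition turns the product into
  \<open>H^(d+1) / \<epsilon>\<close>, which is of order \<open>H^2 / \<epsilon>\<close> since
  \<open>d \<ge> 1\<close> and \<open>H\<close> is bounded.\<close>

locale semi_ip =
  fixes X :: "('x \<Rightarrow> 'b::real_vector) set"
    and B :: "('x \<Rightarrow> 'b) \<Rightarrow> ('x \<Rightarrow> 'b) \<Rightarrow> real"
  assumes zero_closed: "(\<lambda>x. 0) \<in> X"
    and add_closed: "\<And>f g. f \<in> X \<Longrightarrow> g \<in> X \<Longrightarrow> (\<lambda>x. f x + g x) \<in> X"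
    and scale_closed: "\<And>f c. f \<in> X \<Longrightarrow> (\<lambda>x. c *\<^sub>R f x) \<in> X"
    and B_add: "\<And>f g h. f \<in> X \<Longrightarrow> g \<in> X \<Longrightarrow> h \<in> X \<Longrightarrow> B (\<lambda>x. f x + g x) h = B f h + B g h"
    and B_scale: "\<And>f h c. f \<in> X \<Longrightarrow> h \<in> X \<Longrightarrow> B (\<lambda>x. c *\<^sub>R f x) h = c * B f h"
    and B_sym: "\<And>f g. f \<in> X \<Longrightarrow> g \<in> X \<Longrightarrow> B f g = B g f"
    and B_nonneg: "\<And>f. f \<in> X \<Longrightarrow> 0 \<le> B f f"
begin

text \<open>Only a seminorm: functions vanishing almost everywhere have norm zero. The carrier stays
  a set of representatives and no quotient is formed.\<close>

definition nrm :: "('x \<Rightarrow> 'b) \<Rightarrow> real" where "nrm f = sqrt (B f f)"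

lemma diff_closed: "f \<in> X \<Longrightarrow> g \<in> X \<Longrightarrow> (\<lambda>x. f x - g x) \<in> X"
  using add_closed[of f "\<lambda>x. (-1) *\<^sub>R g x"] scale_closed[of g "-1"] by simp

lemma sum_closed: "(\<And>i. i \<in> I \<Longrightarrow> f i \<in> X) \<Longrightarrow> (\<lambda>x. \<Sum>i\<in>I. f i x) \<in> X"
proof (induction I rule: infinite_finite_induct)
  case (insert i I)
  then show ?case using add_closed[of "f i" "\<lambda>x. \<Sum>i\<in>I. f i x"] by simp
qed (simp_all add: zero_closed)

lemma B_add_right: "f \<in> X \<Longrightarrow> g \<in> X \<Longrightarrow> h \<in> X \<Longrightarrow> B h (\<lambda>x. f x + g x) = B h f + B h g"
  using B_add[of f g h] B_sym[of h "\<lambda>x. f x + g x"] B_sym[of h f] B_sym[of h g] add_closed[of f g] by simp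

lemma B_scale_right: "f \<in> X \<Longrightarrow> h \<in> X \<Longrightarrow> B h (\<lambda>x. c *\<^sub>R f x) = c * B h f"
  using B_scale[of f h c] B_sym[of h "\<lambda>x. c *\<^sub>R f x"] B_sym[of h f] scale_closed[of f c] by simp

lemma B_diff: assumes "f \<in> X" "g \<in> X" "h \<in> X" shows "B (\<lambda>x. f x - g x) h = B f h - B g h"
  using B_add[OF assms(1) scale_closed[OF assms(2), of "-1"] assms(3)] B_scale[OF assms(2,3), of "-1"]
  by simp

lemma B_diff_right: "f \<in> X \<Longrightarrow> g \<in> X \<Longrightarrow> h \<in> X \<Longrightarrow> B h (\<lambda>x. f x - g x) = B h f - B h g"
  using B_diff[of f g h] B_sym[of h "\<lambda>x. f x - g x"] B_sym[of h f] B_sym[of h g] diff_closed[of f g] by simp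

lemma B_zero: "h \<in> X \<Longrightarrow> B (\<lambda>x. 0) h = 0"
  using B_scale[OF zero_closed, of h 0] by simp

lemma B_sum:
  "(\<And>i. i \<in> I \<Longrightarrow> f i \<in> X) \<Longrightarrow> h \<in> X \<Longrightarrow> B (\<lambda>x. \<Sum>i\<in>I. f i x) h = (\<Sum>i\<in>I. B (f i) h)"
proof (induction I rule: infinite_finite_induct)
  case (insert i I)
  then show ?case using B_add[of "f i" "\<lambda>x. \<Sum>i\<in>I. f i x" h] sum_closed[of I f] by simp
qed (simp_all add: B_zero)

lemma nrm_sq: "f \<in> X \<Longrightarrow> (nrm f)\<^sup>2 = B f f"
  by (simp add: nrm_def B_nonneg)

lemma nrm_nonneg: "f \<in> X \<Longrightarrow> 0 \<le> nrm f"
  by (simp add: nrm_def B_nonneg)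

lemma B_expand:
  assumes "f \<in> X" "g \<in> X"
  shows "B (\<lambda>x. f x + t *\<^sub>R g x) (\<lambda>x. f x + t *\<^sub>R g x) = B f f + 2 * t * B f g + t\<^sup>2 * B g g"
  using assms B_sym[OF assms(2,1)]
  by (simp add: B_add B_add_right B_scale B_scale_right add_closed scale_closed power2_eq_square)

lemma B_diff_self:
  assumes "f \<in> X" "g \<in> X"
  shows "B (\<lambda>x. f x - g x) (\<lambda>x. f x - g x) = B f f - 2 * B f g + B g g"
  using B_expand[OF assms, of "-1"] by simp

lemma quadratic_nonneg_discriminant:
  fixes a b c :: real
  assumes "\<And>t. 0 \<le> a + 2 * t * b + t\<^sup>2 * c" "0 \<le> a" "0 \<le> c"
  shows "b\<^sup>2 \<le> a * c"
proof (cases "c = 0")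
  case True
  have "b = 0"
  proof (rule ccontr)
    assume "b \<noteq> 0"
    \<comment> \<open>This \<open>t\<close> gives \<open>a + 2 * t * b = - 1\<close>.\<close>
    have "0 \<le> a + 2 * (- (a + 1) / (2 * b)) * b" using assms(1)[of "- (a + 1) / (2 * b)"] True by simp
    then show False using \<open>b \<noteq> 0\<close> by (simp add: field_simps)
  qed
  then show ?thesis using True by simp
next
  case False
  then have "c > 0" using assms(3) by simp
  have "0 \<le> a + 2 * (- b / c) * b + (- b / c)\<^sup>2 * c" by (rule assms(1))
  then have "0 \<le> (a + 2 * (- b / c) * b + (- b / c)\<^sup>2 * c) * c" using \<open>c > 0\<close> by simp
  also have "\<dots> = a * c - b\<^sup>2" using \<open>c > 0\<close> by (simp add: field_simps power2_eq_square)
  finally show ?thesis by simp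
qed

lemma cauchy_schwarz:
  assumes "f \<in> X" "g \<in> X" shows "\<bar>B f g\<bar> \<le> nrm f * nrm g"
proof -
  have "0 \<le> B f f + 2 * t * B f g + t\<^sup>2 * B g g" for t
    using B_nonneg[of "\<lambda>x. f x + t *\<^sub>R g x"] B_expand[OF assms, of t] assms
    by (simp add: add_closed scale_closed)
  then have "(B f g)\<^sup>2 \<le> B f f * B g g"
    using quadratic_nonneg_discriminant assms B_nonneg by blast
  then have "sqrt ((B f g)\<^sup>2) \<le> sqrt (B f f * B g g)" by (rule real_sqrt_le_mono)
  then show ?thesis by (simp add: nrm_def real_sqrt_mult)
qed

lemma nrm_scale: "f \<in> X \<Longrightarrow> nrm (\<lambda>x. c *\<^sub>R f x) = \<bar>c\<bar> * nrm f"
  unfolding nrm_def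
  by (simp add: B_scale B_scale_right scale_closed real_sqrt_mult flip: mult.assoc)

lemma nrm_triangle:
  assumes "f \<in> X" "g \<in> X" shows "nrm (\<lambda>x. f x + g x) \<le> nrm f + nrm g"
proof (rule power2_le_imp_le)
  have "(nrm (\<lambda>x. f x + g x))\<^sup>2 = (nrm f)\<^sup>2 + 2 * B f g + (nrm g)\<^sup>2"
    using B_expand[OF assms, of 1] assms by (simp add: nrm_sq add_closed)
  also have "\<dots> \<le> (nrm f)\<^sup>2 + 2 * (nrm f * nrm g) + (nrm g)\<^sup>2"
    using cauchy_schwarz[OF assms] by simp
  also have "\<dots> = (nrm f + nrm g)\<^sup>2" by (simp add: power2_sum)
  finally show "(nrm (\<lambda>x. f x + g x))\<^sup>2 \<le> (nrm f + nrm g)\<^sup>2" .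
qed (use assms nrm_nonneg in auto)

lemma nrm_triangle_diff:
  assumes "f \<in> X" "g \<in> X" shows "nrm (\<lambda>x. f x - g x) \<le> nrm f + nrm g"
  using nrm_triangle[OF assms(1) scale_closed[OF assms(2), of "-1"]] nrm_scale[OF assms(2), of "-1"]
  by simp

lemma nrm_triangle3:
  assumes "f \<in> X" "g \<in> X" "h \<in> X"
  shows "nrm (\<lambda>x. f x - h x) \<le> nrm (\<lambda>x. f x - g x) + nrm (\<lambda>x. g x - h x)"
  using nrm_triangle[of "\<lambda>x. f x - g x" "\<lambda>x. g x - h x"] assms by (simp add: diff_closed)

lemma nrm_zero: "nrm (\<lambda>x. 0) = 0"
  using B_zero[OF zero_closed] by (simp add: nrm_def)

lemma nrm_sum:
  "(\<And>i. i \<in> I \<Longrightarrow> f i \<in> X) \<Longrightarrow> nrm (\<lambda>x. \<Sum>i\<in>I. f i x) \<le> (\<Sum>i\<in>I. nrm (f i))"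
proof (induction I rule: infinite_finite_induct)
  case (insert i I)
  have "nrm (\<lambda>x. f i x + (\<Sum>i\<in>I. f i x)) \<le> nrm (f i) + nrm (\<lambda>x. \<Sum>i\<in>I. f i x)"
    using insert by (intro nrm_triangle sum_closed) auto
  with insert show ?case by simp
qed (simp_all add: nrm_zero)

text \<open>The parallelogram identity makes every minimising sequence a Cauchy sequence.\<close>
lemma minimiser_exists:
  fixes l :: "('x \<Rightarrow> 'b) \<Rightarrow> real"
  assumes A: "A \<subseteq> X" "A \<noteq> {}"
    and mid: "\<And>u v. u \<in> A \<Longrightarrow> v \<in> A \<Longrightarrow> (\<lambda>x. (1/2) *\<^sub>R (u x + v x)) \<in> A"
    and l_add: "\<And>u v. u \<in> X \<Longrightarrow> v \<in> X \<Longrightarrow> l (\<lambda>x. u x + v x) = l u + l v"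
    and l_scale: "\<And>u c. u \<in> X \<Longrightarrow> l (\<lambda>x. c *\<^sub>R u x) = c * l u"
    and l_bound: "\<And>u. u \<in> X \<Longrightarrow> \<bar>l u\<bar> \<le> K * nrm u"
    and complete: "\<And>w. (\<forall>n::nat. w n \<in> A) \<Longrightarrow>
        (\<forall>e>0. \<exists>n0. \<forall>m\<ge>n0. \<forall>n\<ge>n0. nrm (\<lambda>x. w m x - w n x) < e) \<Longrightarrow>
        \<exists>u\<in>A. (\<lambda>n. nrm (\<lambda>x. w n x - u x)) \<longlonglongrightarrow> 0"
  shows "\<exists>u\<in>A. \<forall>v\<in>A. B u u - 2 * l u \<le> B v v - 2 * l v"
proof -
  define J where "J v = B v v - 2 * l v" for v
  define j where "j = Inf (J ` A)"
  \<comment> \<open>Completing the square, \<open>J v\<close> is at least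
    \<open>(nrm v - K)^2 - K^2\<close>, so the infimum \<open>j\<close> is finite.\<close>
  have J_lower: "- K\<^sup>2 \<le> J v" if "v \<in> X" for v
  proof -
    have "J v \<ge> (nrm v)\<^sup>2 - 2 * (K * nrm v)"
      using l_bound[OF that] by (simp add: J_def nrm_sq that)
    moreover have "(nrm v)\<^sup>2 - 2 * (K * nrm v) + K\<^sup>2 = (nrm v - K)\<^sup>2"
      by (simp add: power2_eq_square algebra_simps)
    moreover have "(nrm v - K)\<^sup>2 \<ge> 0" by simp
    ultimately show ?thesis by linarith
  qed
  have bdd: "bdd_below (J ` A)"
    using J_lower A by (intro bdd_belowI[of _ "- K\<^sup>2"]) auto
  have j_le: "j \<le> J v" if "v \<in> A" for v
    unfolding j_def by (intro cInf_lower bdd imageI that)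
  have "\<exists>v\<in>A. J v < j + e" if "e > 0" for e
    using cInf_less_iff[of "J ` A" "j + e"] bdd A(2) that by (auto simp: j_def)
  then have "\<exists>v\<in>A. J v < j + inverse (real (Suc n))" for n by simp
  then obtain w where w: "\<And>n. w n \<in> A" "\<And>n. J (w n) < j + inverse (real (Suc n))" by metis
  have l_diff: "l (\<lambda>x. u x - v x) = l u - l v" if "u \<in> X" "v \<in> X" for u v
    using l_add[OF that(1) scale_closed[OF that(2), of "-1"]] l_scale[OF that(2), of "-1"] by simp
  \<comment> \<open>\<open>2 * J u + 2 * J v\<close> minus four times the value of \<open>J\<close>
    at the midpoint equals \<open>B\<close> of the difference with itself, because the linear parts
    cancel; the midpoint value is at least \<open>j\<close>.\<close>
  have para: "(nrm (\<lambda>x. u x - v x))\<^sup>2 \<le> 2 * (J u - j) + 2 * (J v - j)" if "u \<in> A" "v \<in> A" for u v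
  proof -
    have uv: "u \<in> X" "v \<in> X" using that A by auto
    have m: "j \<le> J (\<lambda>x. (1/2) *\<^sub>R (u x + v x))" by (intro j_le mid that)
    have e1: "B (\<lambda>x. (1/2) *\<^sub>R (u x + v x)) (\<lambda>x. (1/2) *\<^sub>R (u x + v x)) = 1/4 * (B u u + 2 * B u v + B v v)"
      using B_expand[OF uv, of 1] uv by (simp only: B_scale B_scale_right add_closed scale_closed) simp
    have e2: "l (\<lambda>x. (1/2) *\<^sub>R (u x + v x)) = 1/2 * (l u + l v)"
      using uv by (simp only: l_scale add_closed l_add)
    have "(nrm (\<lambda>x. u x - v x))\<^sup>2 = B u u - 2 * B u v + B v v"
      using uv by (simp add: nrm_sq diff_closed B_diff_self)
    then show ?thesis using m[unfolded J_def e1 e2] unfolding J_def by argo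
  qed
  have cauchy: "\<exists>n0. \<forall>m\<ge>n0. \<forall>n\<ge>n0. nrm (\<lambda>x. w m x - w n x) < e" if "e > 0" for e
  proof -
    have "0 < e\<^sup>2 / 4" using that by simp
    then obtain n0 where n0: "inverse (real (Suc n0)) < e\<^sup>2 / 4"
      using reals_Archimedean by blast
    have "nrm (\<lambda>x. w m x - w n x) < e" if mn: "m \<ge> n0" "n \<ge> n0" for m n
    proof (rule power2_less_imp_less)
      have Jk: "J (w k) - j < e\<^sup>2 / 4" if "k \<ge> n0" for k
      proof -
        have "inverse (real (Suc k)) \<le> inverse (real (Suc n0))" using that by simp
        then show ?thesis using w(2)[of k] n0 by linarith
      qed
      then show "(nrm (\<lambda>x. w m x - w n x))\<^sup>2 < e\<^sup>2"
        using para[OF w(1) w(1), of m n] Jk[OF mn(1)] Jk[OF mn(2)] by argo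
    qed (use \<open>e > 0\<close> in simp)
    then show ?thesis by blast
  qed
  obtain u where u: "u \<in> A" "(\<lambda>n. nrm (\<lambda>x. w n x - u x)) \<longlonglongrightarrow> 0"
    using complete[of w] w(1) cauchy by blast
  have "J u \<le> j"
  proof (rule LIMSEQ_le_const)
    define d where "d n = (\<lambda>x. w n x - u x)" for n
    have uX: "u \<in> X" and dX: "d n \<in> X" for n using u w A by (auto simp: d_def intro!: diff_closed)
    have eq: "J u = J (w n) - 2 * B u (d n) - B (d n) (d n) + 2 * l (d n)" for n
    proof -
      have wX: "w n \<in> X" using w A by auto
      have "B (w n) (w n) = B (\<lambda>x. u x + 1 *\<^sub>R d n x) (\<lambda>x. u x + 1 *\<^sub>R d n x)" by (simp add: d_def)
      also have "\<dots> = B u u + 2 * B u (d n) + B (d n) (d n)" using B_expand[OF uX dX, of 1] by simp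
      finally show ?thesis using l_diff[OF wX uX] by (simp add: J_def d_def)
    qed
    have lim: "(\<lambda>n. j + inverse (real (Suc n)) + 2 * (nrm u * nrm (d n)) + 2 * (K * nrm (d n))) \<longlonglongrightarrow> j + 0 + 2 * (nrm u * 0) + 2 * (K * 0)"
      using u(2) unfolding d_def by (intro tendsto_intros LIMSEQ_inverse_real_of_nat)
    then show "(\<lambda>n. j + inverse (real (Suc n)) + 2 * (nrm u * nrm (d n)) + 2 * (K * nrm (d n))) \<longlonglongrightarrow> j"
      by simp
    have "J u \<le> j + inverse (real (Suc n)) + 2 * (nrm u * nrm (d n)) + 2 * (K * nrm (d n))" for n
      using eq[of n] w(2)[of n] cauchy_schwarz[OF uX dX[of n]] l_bound[OF dX[of n]] B_nonneg[OF dX[of n]]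
      unfolding abs_le_iff by argo
    then show "\<exists>n0. \<forall>n\<ge>n0. J u \<le> j + inverse (real (Suc n)) + 2 * (nrm u * nrm (d n)) + 2 * (K * nrm (d n))"
      by blast
  qed
  then show ?thesis using u(1) j_le unfolding J_def by force
qed

text \<open>Minimality is demanded only along the line through \<open>u\<close> in direction
  \<open>w\<close>, so minimisation under linear constraints is covered, with \<open>w\<close> a
  direction that preserves them. The increment is a quadratic in \<open>t\<close> without constant
  term, and its discriminant forces the linear coefficient to vanish.\<close>

lemma minimiser_orthogonal:
  fixes l :: "('x \<Rightarrow> 'b) \<Rightarrow> real"
  assumes "u \<in> X" "w \<in> X"
    and l_add: "\<And>u v. u \<in> X \<Longrightarrow> v \<in> X \<Longrightarrow> l (\<lambda>x. u x + v x) = l u + l v"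
    and l_scale: "\<And>u c. u \<in> X \<Longrightarrow> l (\<lambda>x. c *\<^sub>R u x) = c * l u"
    and min: "\<And>t. B u u - 2 * l u
        \<le> B (\<lambda>x. u x + t *\<^sub>R w x) (\<lambda>x. u x + t *\<^sub>R w x) - 2 * l (\<lambda>x. u x + t *\<^sub>R w x)"
  shows "B u w = l w"
proof -
  have "0 \<le> 0 + 2 * t * (B u w - l w) + t\<^sup>2 * B w w" for t
    using min[of t] assms(1,2) by (simp add: B_expand l_add l_scale scale_closed algebra_simps)
  then have "(B u w - l w)\<^sup>2 \<le> 0 * B w w"
    using quadratic_nonneg_discriminant[of 0 "B u w - l w" "B w w"] B_nonneg[OF assms(2)] by fastforce
  then show ?thesis by simp
qed

end

section \<open>Square-integrable functions\<close>

definition sq_int :: "'x measure \<Rightarrow> ('x \<Rightarrow> 'b::euclidean_space) set"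
  where "sq_int M = {f \<in> borel_measurable M. integrable M (\<lambda>x. (norm (f x))\<^sup>2)}"

lemma sq_int_prod:
  fixes h :: "'x \<Rightarrow> 'c::{banach, second_countable_topology}"
  assumes "f \<in> sq_int M" "g \<in> sq_int M" and h: "h \<in> borel_measurable M"
    and le: "\<And>x. x \<in> space M \<Longrightarrow> norm (h x) \<le> norm (f x) * norm (g x)"
  shows "integrable M h"
proof (rule Bochner_Integration.integrable_bound[OF _ h])
  show "integrable M (\<lambda>x. (norm (f x))\<^sup>2 + (norm (g x))\<^sup>2)"
    using assms by (auto simp: sq_int_def)
  have "norm (f x) * norm (g x) \<le> (norm (f x))\<^sup>2 + (norm (g x))\<^sup>2" for x
    using sum_squares_bound[of "norm (f x)" "norm (g x)"]
      mult_nonneg_nonneg[OF norm_ge_zero norm_ge_zero, of "f x" "g x"] by linarith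
  then show "AE x in M. norm (h x) \<le> norm ((norm (f x))\<^sup>2 + (norm (g x))\<^sup>2)"
    using le order_trans by fastforce
qed

lemma sq_int_inner: "f \<in> sq_int M \<Longrightarrow> g \<in> sq_int M \<Longrightarrow> integrable M (\<lambda>x. f x \<bullet> g x)"
  by (rule sq_int_prod[of f M g]) (auto simp: sq_int_def norm_cauchy_schwarz intro: Cauchy_Schwarz_ineq2)

lemma sq_int_bound:
  assumes "f \<in> sq_int M" "g \<in> borel_measurable M" "\<And>x. x \<in> space M \<Longrightarrow> norm (g x) \<le> K * norm (f x)"
  shows "g \<in> sq_int M"
proof -
  have "integrable M (\<lambda>x. (norm (g x))\<^sup>2)"
  proof (rule Bochner_Integration.integrable_bound)
    show "integrable M (\<lambda>x. K\<^sup>2 * (norm (f x))\<^sup>2)" using assms(1) by (auto simp: sq_int_def)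
    have "(norm (g x))\<^sup>2 \<le> (K * norm (f x))\<^sup>2" if "x \<in> space M" for x
      using assms(3)[OF that] by (intro power_mono) auto
    then show "AE x in M. norm ((norm (g x))\<^sup>2) \<le> norm (K\<^sup>2 * (norm (f x))\<^sup>2)"
      by (auto simp: power_mult_distrib abs_mult)
  qed (use assms(2) in measurable)
  then show ?thesis using assms by (simp add: sq_int_def)
qed

lemma sq_int_add:
  assumes "f \<in> sq_int M" "g \<in> sq_int M" shows "(\<lambda>x. f x + g x) \<in> sq_int M"
proof -
  have "integrable M (\<lambda>x. (norm (f x + g x))\<^sup>2)"
  proof (rule Bochner_Integration.integrable_bound)
    show "integrable M (\<lambda>x. 2 * (norm (f x))\<^sup>2 + 2 * (norm (g x))\<^sup>2)" using assms by (auto simp: sq_int_def)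
    have "(norm (f x + g x))\<^sup>2 \<le> 2 * (norm (f x))\<^sup>2 + 2 * (norm (g x))\<^sup>2" for x
    proof -
      have "(norm (f x + g x))\<^sup>2 \<le> (norm (f x) + norm (g x))\<^sup>2"
        by (intro power_mono norm_triangle_ineq) auto
      also have "\<dots> \<le> 2 * (norm (f x))\<^sup>2 + 2 * (norm (g x))\<^sup>2"
        using sum_squares_bound[of "norm (f x)" "norm (g x)"] by (simp add: power2_sum)
      finally show ?thesis .
    qed
    then show "AE x in M. norm ((norm (f x + g x))\<^sup>2) \<le> norm (2 * (norm (f x))\<^sup>2 + 2 * (norm (g x))\<^sup>2)"
      by simp
  qed (use assms in \<open>auto simp: sq_int_def\<close>)
  then show ?thesis using assms by (auto simp: sq_int_def)
qed

lemma sq_int_scale: "f \<in> sq_int M \<Longrightarrow> (\<lambda>x. c *\<^sub>R f x) \<in> sq_int M"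
  by (rule sq_int_bound[of f M _ "\<bar>c\<bar>"]) (auto simp: sq_int_def)

lemma sq_int_zero: "(\<lambda>x. 0) \<in> sq_int M"
  by (simp add: sq_int_def)

text \<open>For complex values \<open>\<bullet>\<close> is the real part of
  \<open>f x * cnj (g x)\<close>: the analysis runs over the reals, and the complex identities are
  brought back by testing with \<open>\<i>\<close> times a function.\<close>

interpretation L2: semi_ip "sq_int M" "\<lambda>f g. \<integral>x. f x \<bullet> g x \<partial>M" for M
  by standard (auto simp: sq_int_zero sq_int_add sq_int_scale sq_int_inner inner_add_left
      intro: inner_commute intro!: integral_nonneg Bochner_Integration.integral_cong)

lemma L2_nrm_eq: "L2.nrm M f = sqrt (\<integral>x. (norm (f x))\<^sup>2 \<partial>M)"
  by (simp add: L2.nrm_def dot_square_norm)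

lemma L2_nrm_mono:
  assumes "f \<in> sq_int M" "g \<in> sq_int M" "AE x in M. norm (g x) \<le> K * norm (f x)" "0 \<le> K"
  shows "L2.nrm M g \<le> K * L2.nrm M f"
proof -
  have "(\<integral>x. (norm (g x))\<^sup>2 \<partial>M) \<le> (\<integral>x. K\<^sup>2 * (norm (f x))\<^sup>2 \<partial>M)"
  proof (rule integral_mono_AE)
    show "AE x in M. (norm (g x))\<^sup>2 \<le> K\<^sup>2 * (norm (f x))\<^sup>2"
      using assms(3) by eventually_elim (use power_mono in \<open>fastforce simp flip: power_mult_distrib\<close>)
  qed (use assms in \<open>auto simp: sq_int_def\<close>)
  then have "sqrt (\<integral>x. (norm (g x))\<^sup>2 \<partial>M) \<le> sqrt (K\<^sup>2 * (\<integral>x. (norm (f x))\<^sup>2 \<partial>M))"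
    by (intro real_sqrt_le_mono) simp
  then show ?thesis using assms(4) by (simp add: L2_nrm_eq real_sqrt_mult)
qed

lemma L2_nrm_cong_AE:
  assumes "f \<in> borel_measurable M" "g \<in> borel_measurable M" "AE x in M. f x = g x"
  shows "L2.nrm M f = L2.nrm M g"
proof -
  have "(\<integral>x. (norm (f x))\<^sup>2 \<partial>M) = (\<integral>x. (norm (g x))\<^sup>2 \<partial>M)"
    using assms by (intro integral_cong_AE) auto
  then show ?thesis by (simp add: L2_nrm_eq)
qed

text \<open>Riesz-Fischer. A subsequence with increments below \<open>(1/2)^k\<close> converges
  almost everywhere, because on a finite measure space the \<open>L1\<close> norms of the increments
  are summable as well; Fatou's lemma then turns the pointwise limit into a limit in norm.\<close>

lemma L2_complete:
  fixes w :: "nat \<Rightarrow> 'x \<Rightarrow> 'b::euclidean_space"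
  assumes M: "finite_measure M" and w: "\<And>n. w n \<in> sq_int M"
    and cauchy: "\<And>e. e > 0 \<Longrightarrow> \<exists>n0. \<forall>m\<ge>n0. \<forall>n\<ge>n0. L2.nrm M (\<lambda>x. w m x - w n x) < e"
  shows "\<exists>u\<in>sq_int M. (\<lambda>n. L2.nrm M (\<lambda>x. w n x - u x)) \<longlonglongrightarrow> 0"
proof -
  interpret finite_measure M by fact
  have [measurable]: "w n \<in> borel_measurable M" for n using w[of n] by (simp add: sq_int_def)
  define K where "K = L2.nrm M (\<lambda>_. 1::real)"
  have one: "(\<lambda>_. 1::real) \<in> sq_int M" by (simp add: sq_int_def)
  have L1: "integrable M f" "(\<integral>x. norm (f x) \<partial>M) \<le> K * L2.nrm M f" if "f \<in> sq_int M" for f :: "'x \<Rightarrow> 'b"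
  proof -
    show "integrable M f"
      using that by (intro sq_int_prod[OF one that]) (auto simp: sq_int_def)
    have "(\<lambda>x. norm (f x)) \<in> sq_int M" using that by (auto simp: sq_int_def)
    from L2.cauchy_schwarz[OF one this] show "(\<integral>x. norm (f x) \<partial>M) \<le> K * L2.nrm M f"
      unfolding K_def L2_nrm_eq by simp
  qed
  have "\<exists>n0. \<forall>m\<ge>n0. \<forall>n\<ge>n0. L2.nrm M (\<lambda>x. w m x - w n x) < (1/2)^k" for k
    by (rule cauchy) simp
  then obtain n0 where n0: "\<And>k m n. m \<ge> n0 k \<Longrightarrow> n \<ge> n0 k \<Longrightarrow> L2.nrm M (\<lambda>x. w m x - w n x) < (1/2)^k"
    by metis
  \<comment> \<open>Partial sums make \<open>r k\<close> at least \<open>n0 i\<close> for every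
    \<open>i \<le> k\<close>, so the tail of the subsequence obeys all earlier thresholds.\<close>
  define r where "r k = (\<Sum>i\<le>k. n0 i)" for k
  have r: "r k \<ge> n0 k" "r (Suc k) \<ge> n0 k" for k
    unfolding r_def using member_le_sum[of k "{..k}" n0] by auto
  define v where "v k = w (r k)" for k
  have v: "v k \<in> sq_int M" for k using w by (simp add: v_def)
  have [measurable]: "v k \<in> borel_measurable M" for k by (simp add: v_def)
  define d where "d k = (\<lambda>x. v (Suc k) x - v k x)" for k
  have d: "d k \<in> sq_int M" for k unfolding d_def by (intro L2.diff_closed v)
  have [measurable]: "d k \<in> borel_measurable M" for k by (simp add: d_def)
  have dn: "L2.nrm M (d k) < (1/2)^k" for k
    unfolding d_def v_def by (intro n0 r)
  have K0: "K \<ge> 0" unfolding K_def by (rule L2.nrm_nonneg[OF one])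
  have "(\<integral>\<^sup>+x. (\<Sum>k. ennreal (norm (d k x))) \<partial>M) = (\<Sum>k. \<integral>\<^sup>+x. ennreal (norm (d k x)) \<partial>M)"
    by (rule nn_integral_suminf) measurable
  also have "\<dots> \<le> (\<Sum>k. ennreal (K * (1/2)^k))"
  proof (rule suminf_le)
    fix k
    have "(\<integral>\<^sup>+x. ennreal (norm (d k x)) \<partial>M) = ennreal (\<integral>x. norm (d k x) \<partial>M)"
      using L1(1)[OF d] by (intro nn_integral_eq_integral) auto
    also have "(\<integral>x. norm (d k x) \<partial>M) \<le> K * (1/2)^k"
      using L1(2)[OF d, of k] dn[of k] K0 by (meson less_imp_le mult_left_mono order_trans)
    finally show "(\<integral>\<^sup>+x. ennreal (norm (d k x)) \<partial>M) \<le> ennreal (K * (1/2)^k)"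
      by (simp add: ennreal_leI)
  qed auto
  also have "\<dots> = ennreal (\<Sum>k. K * (1/2)^k)"
    using K0 by (intro suminf_ennreal2) (auto intro!: summable_mult)
  finally have fin: "(\<integral>\<^sup>+x. (\<Sum>k. ennreal (norm (d k x))) \<partial>M) \<noteq> \<infinity>"
    by (auto simp: top_unique)
  have AEfin: "AE x in M. (\<Sum>k. ennreal (norm (d k x))) \<noteq> \<infinity>"
    by (rule nn_integral_noteq_infinite[OF _ fin]) measurable
  have AEconv: "AE x in M. convergent (\<lambda>k. v k x)"
    using AEfin
  proof eventually_elim
    case (elim x)
    have "summable (\<lambda>k. norm (d k x))"
      using elim by (intro summable_suminf_not_top) auto
    then have "summable (\<lambda>k. d k x)" by (rule summable_norm_cancel)
    then have "convergent (\<lambda>n. \<Sum>k<n. d k x)" by (simp add: summable_iff_convergent)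
    moreover have "(\<Sum>k<n. d k x) = v n x - v 0 x" for n
      unfolding d_def by (rule sum_lessThan_telescope)
    ultimately have "convergent (\<lambda>n. (v n x - v 0 x) + v 0 x)"
      by (intro convergent_add convergent_const) simp
    then show ?case by simp
  qed
  define u where "u x = lim (\<lambda>k. v k x)" for x
  have [measurable]: "u \<in> borel_measurable M" unfolding u_def by measurable
  have AElim: "AE x in M. (\<lambda>k. v k x) \<longlonglongrightarrow> u x"
    using AEconv by eventually_elim (simp add: u_def convergent_LIMSEQ_iff)
  \<comment> \<open>Fatou is applied along the subsequence with \<open>n\<close> fixed; it yields
    integrability of the difference and an explicit rate at once.\<close>
  have fatou: "integrable M (\<lambda>x. (norm (w n x - u x))\<^sup>2) \<and> L2.nrm M (\<lambda>x. w n x - u x) \<le> (1/2)^k"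
    if n: "n \<ge> n0 k" for n k
  proof -
    have "(\<integral>\<^sup>+x. ennreal ((norm (w n x - u x))\<^sup>2) \<partial>M)
        = (\<integral>\<^sup>+x. liminf (\<lambda>i. ennreal ((norm (w n x - v i x))\<^sup>2)) \<partial>M)"
    proof (rule nn_integral_cong_AE, use AElim in eventually_elim)
      case (elim x)
      have "(\<lambda>i. ennreal ((norm (w n x - v i x))\<^sup>2)) \<longlonglongrightarrow> ennreal ((norm (w n x - u x))\<^sup>2)"
        by (intro tendsto_intros elim)
      then show ?case by (intro lim_imp_Liminf[symmetric]) simp_all
    qed
    also have "\<dots> \<le> liminf (\<lambda>i. \<integral>\<^sup>+x. ennreal ((norm (w n x - v i x))\<^sup>2) \<partial>M)"
      by (rule nn_integral_liminf) measurable
    also have "\<dots> \<le> ennreal (((1/2)^k)\<^sup>2)"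
    proof (rule Liminf_le)
      show "\<forall>\<^sub>F i in sequentially. (\<integral>\<^sup>+x. ennreal ((norm (w n x - v i x))\<^sup>2) \<partial>M) \<le> ennreal (((1/2)^k)\<^sup>2)"
      proof (rule eventually_sequentiallyI[of k])
        fix i assume "k \<le> i"
        then have ri: "r i \<ge> n0 k"
          unfolding r_def using member_le_sum[of k "{..i}" n0] by auto
        have wv: "(\<lambda>x. w n x - v i x) \<in> sq_int M" by (intro L2.diff_closed w v)
        have "(\<integral>\<^sup>+x. ennreal ((norm (w n x - v i x))\<^sup>2) \<partial>M) = ennreal (\<integral>x. (norm (w n x - v i x))\<^sup>2 \<partial>M)"
          using wv by (intro nn_integral_eq_integral) (auto simp: sq_int_def)
        also have "(\<integral>x. (norm (w n x - v i x))\<^sup>2 \<partial>M) = (L2.nrm M (\<lambda>x. w n x - v i x))\<^sup>2"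
          by (simp add: L2_nrm_eq)
        also have "\<dots> \<le> ((1/2)^k)\<^sup>2"
          using n0[OF n ri] L2.nrm_nonneg[OF wv] by (intro power_mono) (auto simp: v_def)
        finally show "(\<integral>\<^sup>+x. ennreal ((norm (w n x - v i x))\<^sup>2) \<partial>M) \<le> ennreal (((1/2)^k)\<^sup>2)"
          by (simp add: ennreal_leI)
      qed
    qed simp
    finally have le: "(\<integral>\<^sup>+x. ennreal ((norm (w n x - u x))\<^sup>2) \<partial>M) \<le> ennreal (((1/2)^k)\<^sup>2)" .
    have int: "integrable M (\<lambda>x. (norm (w n x - u x))\<^sup>2)"
      using le by (intro integrableI_bounded) (auto simp: top_unique intro: le_less_trans)
    have "ennreal (\<integral>x. (norm (w n x - u x))\<^sup>2 \<partial>M) \<le> ennreal (((1/2)^k)\<^sup>2)"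
      using le nn_integral_eq_integral[OF int] by simp
    then have "(\<integral>x. (norm (w n x - u x))\<^sup>2 \<partial>M) \<le> ((1/2)^k)\<^sup>2" by (simp add: ennreal_le_iff)
    then have "L2.nrm M (\<lambda>x. w n x - u x) \<le> sqrt (((1/2)^k)\<^sup>2)"
      unfolding L2_nrm_eq by (rule real_sqrt_le_mono)
    with int show ?thesis by simp
  qed
  have "(\<lambda>x. w (n0 0) x - u x) \<in> sq_int M" using fatou[of 0 "n0 0"] by (simp add: sq_int_def)
  from L2.diff_closed[OF w[of "n0 0"] this] have uX: "u \<in> sq_int M" by simp
  have "(\<lambda>n. L2.nrm M (\<lambda>x. w n x - u x)) \<longlonglongrightarrow> 0"
  proof (rule LIMSEQ_I)
    fix e :: real assume "e > 0"
    then obtain k where k: "(1/2)^k < e" using real_arch_pow_inv[of e "1/2"] by auto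
    have "norm (L2.nrm M (\<lambda>x. w n x - u x) - 0) < e" if "n \<ge> n0 k" for n
      using fatou[OF that] k L2.nrm_nonneg[OF L2.diff_closed[OF w[of n] uX]] by simp
    then show "\<exists>no. \<forall>n\<ge>no. norm (L2.nrm M (\<lambda>x. w n x - u x) - 0) < e" by blast
  qed
  with uX show ?thesis by blast
qed

section \<open>Smooth functions\<close>

text \<open>A smooth function of one variable carried together with all its derivatives:
  \<open>F n\<close> is the derivative of order \<open>n\<close> of \<open>F 0\<close>. Explicit
  derivatives are what \<open>all_partials\<close> asks for.\<close>

definition smooth_seq :: "(nat \<Rightarrow> real \<Rightarrow> real) \<Rightarrow> bool"
  where "smooth_seq F \<longleftrightarrow> (\<forall>n t. (F n has_real_derivative F (Suc n) t) (at t))"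

lemma smooth_seq_diff: "smooth_seq F \<Longrightarrow> smooth_seq G \<Longrightarrow> smooth_seq (\<lambda>n t. F n t - G n t)"
  unfolding smooth_seq_def by (auto intro!: derivative_intros)

lemma smooth_seq_affine:
  assumes "smooth_seq F" shows "smooth_seq (\<lambda>n t. c ^ n * F n (c * t + d))"
  unfolding smooth_seq_def
proof (intro allI)
  fix n t
  have F: "(F n has_real_derivative F (Suc n) (c * t + d)) (at (c * t + d))"
    using assms by (simp add: smooth_seq_def)
  have "((\<lambda>t. F n (c * t + d)) has_real_derivative F (Suc n) (c * t + d) * c) (at t)"
    by (rule DERIV_chain2[where f = "F n" and g = "\<lambda>t. c * t + d", OF F]) (auto intro!: derivative_eq_intros)
  then have "((\<lambda>t. c ^ n * F n (c * t + d)) has_real_derivative c ^ n * (F (Suc n) (c * t + d) * c)) (at t)"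
    by (rule DERIV_cmult)
  then show "((\<lambda>t. c ^ n * F n (c * t + d)) has_real_derivative c ^ Suc n * F (Suc n) (c * t + d)) (at t)"
    by (simp add: mult_ac)
qed

text \<open>Leibniz rule for all orders at once; the passage from \<open>n\<close> to
  \<open>Suc n\<close> is Pascal's rule after an index shift.\<close>

lemma smooth_seq_mult:
  assumes F: "smooth_seq F" and G: "smooth_seq G"
  shows "smooth_seq (\<lambda>n t. \<Sum>k\<le>n. real (n choose k) * (F k t * G (n - k) t))"
  unfolding smooth_seq_def
proof (intro allI)
  fix n t
  have dF: "(F k has_real_derivative F (Suc k) t) (at t)" and dG: "(G k has_real_derivative G (Suc k) t) (at t)" for k
    using assms by (auto simp: smooth_seq_def)
  have "((\<lambda>t. \<Sum>k\<le>n. real (n choose k) * (F k t * G (n - k) t)) has_real_derivative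
        (\<Sum>k\<le>n. real (n choose k) * (F (Suc k) t * G (n - k) t + F k t * G (Suc (n - k)) t))) (at t)"
    by (auto intro!: derivative_eq_intros dF dG sum.cong simp: algebra_simps)
  moreover have "(\<Sum>k\<le>n. real (n choose k) * (F (Suc k) t * G (n - k) t + F k t * G (Suc (n - k)) t))
      = (\<Sum>k\<le>Suc n. real (Suc n choose k) * (F k t * G (Suc n - k) t))"
  proof -
    have "(\<Sum>k\<le>Suc n. real (Suc n choose k) * (F k t * G (Suc n - k) t))
        = F 0 t * G (Suc n) t + (\<Sum>k\<le>n. real (n choose k) * (F (Suc k) t * G (n - k) t))
          + (\<Sum>k\<le>n. real (n choose Suc k) * (F (Suc k) t * G (n - k) t))"
      by (subst sum.atMost_Suc_shift) (simp add: distrib_right sum.distrib)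
    moreover have "F 0 t * G (Suc n) t + (\<Sum>k\<le>n. real (n choose Suc k) * (F (Suc k) t * G (n - k) t))
        = (\<Sum>k\<le>Suc n. real (n choose k) * (F k t * G (Suc n - k) t))"
      by (subst sum.atMost_Suc_shift) simp
    moreover have "(\<Sum>k\<le>Suc n. real (n choose k) * (F k t * G (Suc n - k) t))
        = (\<Sum>k\<le>n. real (n choose k) * (F k t * G (Suc (n - k)) t))"
      by (simp add: Suc_diff_le binomial_eq_0)
    ultimately show ?thesis by (simp add: distrib_left sum.distrib)
  qed
  ultimately show "((\<lambda>t. \<Sum>k\<le>n. real (n choose k) * (F k t * G (n - k) t)) has_real_derivative
      (\<Sum>k\<le>Suc n. real (Suc n choose k) * (F k t * G (Suc n - k) t))) (at t)" by simp
qed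

section \<open>A smooth step function on the line\<close>

lemma poly_times_exp_tendsto_0:
  fixes p :: "real poly"
  shows "((\<lambda>u. u ^ k * poly p u * exp (- u)) \<longlongrightarrow> 0) at_top"
proof (induction p arbitrary: k)
  case (pCons a p)
  have "((\<lambda>u. a * (u ^ k / exp u) + u ^ Suc k * poly p u * exp (- u)) \<longlongrightarrow> a * 0 + 0) at_top"
    by (intro tendsto_intros tendsto_power_div_exp_0 pCons.IH)
  then show ?case by (simp add: algebra_simps exp_minus divide_inverse)
qed simp

text \<open>Differentiating \<open>P(1/t) exp(-1/t)\<close> gives
  \<open>(1/t)^2 (P - P')(1/t) exp(-1/t)\<close>; the recursion is this rule, read as an operation
  on polynomials in \<open>1/t\<close>.\<close>

primrec flat_poly :: "nat \<Rightarrow> real poly"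
  where "flat_poly 0 = 1"
  | "flat_poly (Suc n) = [:0, 0, 1:] * (flat_poly n - pderiv (flat_poly n))"

definition flat_exp :: "nat \<Rightarrow> real \<Rightarrow> real"
  where "flat_exp n t = (if t \<le> 0 then 0 else poly (flat_poly n) (1 / t) * exp (- (1 / t)))"

text \<open>Only the origin needs care: with \<open>u = 1/t\<close> the difference quotient from the
  right is a polynomial in \<open>u\<close> times \<open>exp (- u)\<close>, which tends to
  zero.\<close>

lemma smooth_flat_exp: "smooth_seq flat_exp"
  unfolding smooth_seq_def
proof (intro allI)
  fix n and t :: real
  consider "t < 0" | "t = 0" | "t > 0" by linarith
  then show "(flat_exp n has_real_derivative flat_exp (Suc n) t) (at t)"
  proof cases
    case 1
    have "((\<lambda>_. 0) has_real_derivative 0) (at t)" by simp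
    then have "(flat_exp n has_real_derivative 0) (at t)"
      by (rule has_field_derivative_transform_within_open[where S = "{..<0}"]) (use 1 in \<open>auto simp: flat_exp_def\<close>)
    then show ?thesis using 1 by (simp add: flat_exp_def)
  next
    case 2
    have "((\<lambda>u. u ^ 1 * poly (flat_poly n) u * exp (- u)) \<longlongrightarrow> 0) at_top"
      by (rule poly_times_exp_tendsto_0)
    moreover have "\<forall>\<^sub>F u in at_top. u ^ 1 * poly (flat_poly n) u * exp (- u) = (flat_exp n (inverse u) - flat_exp n 0) / (inverse u - 0)"
      using eventually_gt_at_top[of 0] by eventually_elim (simp add: flat_exp_def field_simps)
    ultimately have "((\<lambda>u. (flat_exp n (inverse u) - flat_exp n 0) / (inverse u - 0)) \<longlongrightarrow> 0) at_top"
      by (rule Lim_transform_eventually)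
    then have right: "((\<lambda>y. (flat_exp n y - flat_exp n 0) / (y - 0)) \<longlongrightarrow> 0) (at_right 0)"
      by (subst filterlim_at_right_to_top)
    have "\<forall>\<^sub>F y in at_left 0. 0 = (flat_exp n y - flat_exp n 0) / (y - 0)"
      by (simp add: eventually_at_filter flat_exp_def)
    then have left: "((\<lambda>y. (flat_exp n y - flat_exp n 0) / (y - 0)) \<longlongrightarrow> 0) (at_left 0)"
      by (rule Lim_transform_eventually[OF tendsto_const])
    have "((\<lambda>y. (flat_exp n y - flat_exp n 0) / (y - 0)) \<longlongrightarrow> 0) (at 0)"
      by (rule filterlim_split_at[OF left right])
    then have "(flat_exp n has_real_derivative 0) (at 0)"
      by (simp add: has_field_derivative_iff)
    then show ?thesis using 2 by (simp add: flat_exp_def)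
  next
    case 3
    have "((\<lambda>t. poly (flat_poly n) (1 / t) * exp (- (1 / t))) has_real_derivative
        poly (flat_poly (Suc n)) (1 / t) * exp (- (1 / t))) (at t)"
      using 3 by (auto intro!: derivative_eq_intros simp: power2_eq_square field_simps)
    then have "(flat_exp n has_real_derivative poly (flat_poly (Suc n)) (1 / t) * exp (- (1 / t))) (at t)"
      by (rule has_field_derivative_transform_within_open[where S = "{0<..}"]) (use 3 in \<open>auto simp: flat_exp_def\<close>)
    then show ?thesis using 3 by (simp add: flat_exp_def)
  qed
qed

lemma smooth_step_exists:
  "\<exists>F. smooth_seq F \<and> (\<forall>t\<le>0. F 0 t = 0) \<and> (\<forall>t\<ge>1. F 0 t = 1) \<and> (\<forall>t. 0 \<le> F 0 t \<and> F 0 t \<le> 1)"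
proof -
  \<comment> \<open>The derivatives of the bump \<open>flat_exp 0 t * flat_exp 0 (1 - t)\<close>,
    which is positive exactly on the open unit interval; the step is its normalised
    primitive.\<close>
  define Q where "Q n t = (\<Sum>k\<le>n. real (n choose k) * (flat_exp k t * ((-1) ^ (n - k) * flat_exp (n - k) (- 1 * t + 1))))" for n t
  have Q: "smooth_seq Q"
    unfolding Q_def by (intro smooth_seq_mult smooth_flat_exp smooth_seq_affine)
  define q where "q = Q 0"
  have q: "q t = flat_exp 0 t * flat_exp 0 (1 - t)" for t by (simp add: q_def Q_def)
  have q_zero: "q t = 0" if "t \<le> 0 \<or> t \<ge> 1" for t using that by (auto simp: q flat_exp_def)
  have q_pos: "q t > 0" if "0 < t" "t < 1" for t using that by (auto simp: q flat_exp_def)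
  have q_nonneg: "q t \<ge> 0" for t using q_zero[of t] q_pos[of t] by linarith
  have q_cont: "continuous_on S q" for S
    using Q unfolding smooth_seq_def q_def
    by (meson DERIV_continuous_on has_field_derivative_at_within)
  \<comment> \<open>The bump vanishes for negative arguments, so starting at \<open>-1\<close>
    instead of \<open>0\<close> leaves the value unchanged and makes \<open>t = 0\<close> an
    interior point for the fundamental theorem of calculus.\<close>
  define S where "S t = integral {-1..t} q" for t
  have S0: "S t = 0" if "t \<le> 0" for t
  proof -
    have "S t = integral {-1..t} (\<lambda>_. 0)"
      unfolding S_def using that by (intro integral_cong q_zero) auto
    then show ?thesis by simp
  qed
  have S: "(S has_real_derivative q t) (at t)" for t
  proof (cases "t < 0")
    case True
    have "((\<lambda>_. 0) has_real_derivative 0) (at t)" by simp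
    then have "(S has_real_derivative 0) (at t)"
      by (rule has_field_derivative_transform_within_open[where S = "{..<0}"]) (use True S0 in auto)
    then show ?thesis using True q_zero[of t] by simp
  next
    case False
    have "(S has_real_derivative q t) (at t within {-1..t+1})"
      unfolding S_def[abs_def] using False by (intro integral_has_real_derivative q_cont) auto
    then show ?thesis using False by (subst (asm) at_within_interior) auto
  qed
  have S_cont: "continuous_on A S" for A
    using S by (meson DERIV_continuous_on has_field_derivative_at_within)
  have S1: "S 1 > S 0"
  proof (rule DERIV_pos_imp_increasing_open[where f = S])
    show "\<exists>y. DERIV S x :> y \<and> 0 < y" if "0 < x" "x < 1" for x using S[of x] q_pos[OF that] by blast
  qed (simp_all add: S_cont)
  have S_mono: "S a \<le> S b" if "a \<le> b" for a b
    by (rule DERIV_nonneg_imp_nondecreasing[where f = S, OF that]) (use S q_nonneg in blast)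
  have S_const: "S t = S 1" if "t \<ge> 1" for t
  proof (cases "t = 1")
    case False
    then have "1 < t" using that by simp
    then show ?thesis
    proof (rule DERIV_isconst_end[where f = S])
      show "DERIV S x :> 0" if "1 < x" "x < t" for x using S[of x] q_zero[of x] that by simp
    qed (rule S_cont)
  qed simp
  define F where "F n = (case n of 0 \<Rightarrow> (\<lambda>t. S t / S 1) | Suc k \<Rightarrow> (\<lambda>t. Q k t / S 1))" for n
  have "smooth_seq F"
    unfolding smooth_seq_def
  proof (intro allI)
    fix n t
    show "(F n has_real_derivative F (Suc n) t) (at t)"
    proof (cases n)
      case 0
      then show ?thesis using DERIV_cdivide[OF S] by (simp add: F_def q_def)
    next
      case (Suc k)
      have "(Q k has_real_derivative Q (Suc k) t) (at t)" using Q by (simp add: smooth_seq_def)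
      then show ?thesis using DERIV_cdivide Suc by (simp add: F_def)
    qed
  qed
  moreover have "S 1 > 0" using S1 S0[of 0] by simp
  moreover have S_nonneg: "0 \<le> S t" and S_le: "S t \<le> S 1" for t
  proof -
    show "0 \<le> S t"
      using S0[of t] S0[of 0] S_mono[of 0 t] by (cases "t \<le> 0") auto
    show "S t \<le> S 1"
      using S_const[of t] S_mono[of t 1] by (cases "t \<ge> 1") auto
  qed
  moreover have F0: "F 0 t = S t / S 1" for t by (simp add: F_def)
  moreover have "F 0 t = 1" if "t \<ge> 1" for t using S_const[OF that] S1 S0[of 0] by (simp add: F0)
  moreover have "F 0 t = 0" if "t \<le> 0" for t using S0[OF that] by (simp add: F0)
  moreover have "0 \<le> F 0 t" "F 0 t \<le> 1" for t
    using S_nonneg[of t] S_le[of t] S1 S0[of 0] by (simp_all add: F0)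
  ultimately have "smooth_seq F \<and> (\<forall>t\<le>0. F 0 t = 0) \<and> (\<forall>t\<ge>1. F 0 t = 1) \<and> (\<forall>t. 0 \<le> F 0 t \<and> F 0 t \<le> 1)"
    by blast
  then show ?thesis by blast
qed

definition step_seq :: "nat \<Rightarrow> real \<Rightarrow> real"
  where "step_seq = (SOME F. smooth_seq F \<and> (\<forall>t\<le>0. F 0 t = 0) \<and> (\<forall>t\<ge>1. F 0 t = 1) \<and>
    (\<forall>t. 0 \<le> F 0 t \<and> F 0 t \<le> 1))"

lemma step_seq:
  "smooth_seq step_seq" "t \<le> 0 \<Longrightarrow> step_seq 0 t = 0" "t \<ge> 1 \<Longrightarrow> step_seq 0 t = 1"
  "0 \<le> step_seq 0 t" "step_seq 0 t \<le> 1"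
  using someI_ex[OF smooth_step_exists] unfolding step_seq_def by blast+

section \<open>Smooth functions of several variables\<close>

definition smooth_fn :: "(real ^ 'd \<Rightarrow> real) \<Rightarrow> bool"
  where "smooth_fn f \<longleftrightarrow> (\<exists>D. all_partials UNIV f D)"

text \<open>On a tensor product a multi-index derivative acts factor by factor, so one-dimensional
  derivative sequences give all partial derivatives explicitly.\<close>

lemma all_partials_tensor:
  fixes F :: "'d::finite \<Rightarrow> nat \<Rightarrow> real \<Rightarrow> real"
  assumes F: "\<And>i. smooth_seq (F i)"
  shows "all_partials UNIV (\<lambda>x :: real ^ 'd. \<Prod>i\<in>UNIV. F i 0 (x $ i)) (\<lambda>\<sigma> x. \<Prod>i\<in>UNIV. F i (\<sigma> i) (x $ i))"
  unfolding all_partials_def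
proof (intro conjI allI ballI)
  fix \<sigma> :: "'d \<Rightarrow> nat" and x :: "real ^ 'd"
  have "((\<lambda>x :: real ^ 'd. F i (\<sigma> i) (x $ i)) has_derivative (\<lambda>h. F i (Suc (\<sigma> i)) (x $ i) * h $ i)) (at x)" for i
  proof (rule has_derivative_compose[where g = "F i (\<sigma> i)" and g' = "(*) (F i (Suc (\<sigma> i)) (x $ i))"])
    show "((\<lambda>x :: real ^ 'd. x $ i) has_derivative (\<lambda>h. h $ i)) (at x)"
      by (intro bounded_linear_imp_has_derivative bounded_linear_vec_nth)
    show "(F i (\<sigma> i) has_derivative (*) (F i (Suc (\<sigma> i)) (x $ i))) (at (x $ i))"
      using F[of i] by (simp add: smooth_seq_def has_field_derivative_def)
  qed
  then have "((\<lambda>x :: real ^ 'd. \<Prod>i\<in>UNIV. F i (\<sigma> i) (x $ i)) has_derivative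
      (\<lambda>h. \<Sum>i\<in>UNIV. (F i (Suc (\<sigma> i)) (x $ i) * h $ i) * (\<Prod>j\<in>UNIV - {i}. F j (\<sigma> j) (x $ j)))) (at x)"
    by (intro has_derivative_prod) auto
  moreover have "(F i (Suc (\<sigma> i)) (x $ i) * h $ i) * (\<Prod>j\<in>UNIV - {i}. F j (\<sigma> j) (x $ j))
      = h $ i * (\<Prod>j\<in>UNIV. F j ((\<sigma>(i := Suc (\<sigma> i))) j) (x $ j))" for h :: "real ^ 'd" and i
  proof -
    have "(\<Prod>j\<in>UNIV. F j ((\<sigma>(i := Suc (\<sigma> i))) j) (x $ j))
        = F i (Suc (\<sigma> i)) (x $ i) * (\<Prod>j\<in>UNIV - {i}. F j (\<sigma> j) (x $ j))"
      by (subst prod.remove[of UNIV i]) (auto intro!: prod.cong)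
    then show ?thesis by simp
  qed
  ultimately show "((\<lambda>x :: real ^ 'd. \<Prod>i\<in>UNIV. F i (\<sigma> i) (x $ i)) has_derivative
      (\<lambda>h. \<Sum>i\<in>UNIV. h $ i * (\<Prod>j\<in>UNIV. F j ((\<sigma>(i := Suc (\<sigma> i))) j) (x $ j)))) (at x)"
    by simp
qed simp

lemma smooth_fn_tensor:
  fixes F :: "'d::finite \<Rightarrow> nat \<Rightarrow> real \<Rightarrow> real"
  assumes "\<And>i. smooth_seq (F i)"
  shows "smooth_fn (\<lambda>x :: real ^ 'd. \<Prod>i\<in>UNIV. F i 0 (x $ i))"
proof -
  have "all_partials UNIV (\<lambda>x :: real ^ 'd. \<Prod>i\<in>UNIV. F i 0 (x $ i)) (\<lambda>\<sigma> x. \<Prod>i\<in>UNIV. F i (\<sigma> i) (x $ i))"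
    by (rule all_partials_tensor[OF assms])
  then show ?thesis unfolding smooth_fn_def by blast
qed

lemma smooth_fn_sum:
  fixes f :: "'k \<Rightarrow> real ^ 'd::finite \<Rightarrow> real"
  assumes "\<And>k. k \<in> I \<Longrightarrow> smooth_fn (f k)"
  shows "smooth_fn (\<lambda>x. \<Sum>k\<in>I. f k x)"
proof -
  obtain D where D: "\<And>k. k \<in> I \<Longrightarrow> all_partials UNIV (f k) (D k)"
    using assms unfolding smooth_fn_def by metis
  have "all_partials UNIV (\<lambda>x. \<Sum>k\<in>I. f k x) (\<lambda>\<sigma> x. \<Sum>k\<in>I. D k \<sigma> x)"
    unfolding all_partials_def
  proof (intro conjI allI ballI)
    fix \<sigma> and x :: "real ^ 'd"
    have "((\<lambda>x. \<Sum>k\<in>I. D k \<sigma> x) has_derivative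
        (\<lambda>h. \<Sum>k\<in>I. \<Sum>i\<in>UNIV. h $ i * D k (\<sigma>(i := Suc (\<sigma> i))) x)) (at x)"
      using D by (intro has_derivative_sum) (auto simp: all_partials_def)
    then show "((\<lambda>x. \<Sum>k\<in>I. D k \<sigma> x) has_derivative
        (\<lambda>h. \<Sum>i\<in>UNIV. h $ i * (\<Sum>k\<in>I. D k (\<sigma>(i := Suc (\<sigma> i))) x))) (at x)"
      by (subst (asm) sum.swap) (simp add: sum_distrib_left)
  qed (use D in \<open>auto simp: all_partials_def intro!: sum.cong\<close>)
  then show ?thesis unfolding smooth_fn_def by blast
qed

text \<open>The Leibniz rule; the coefficient of the new multi-index follows from Pascal's rule in the
  coordinate that is differentiated.\<close>
lemma smooth_fn_mult:
  fixes f g :: "real ^ 'd \<Rightarrow> real"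
  assumes "smooth_fn f" "smooth_fn g"
  shows "smooth_fn (\<lambda>x. f x * g x)"
proof -
  obtain A B where A: "all_partials UNIV f A" and B: "all_partials UNIV g B"
    using assms unfolding smooth_fn_def by metis
  define R where "R \<sigma> = (PiE UNIV (\<lambda>i. {..\<sigma> i}))" for \<sigma> :: "'d \<Rightarrow> nat"
  have R: "\<tau> \<in> R \<sigma> \<longleftrightarrow> (\<forall>i. \<tau> i \<le> \<sigma> i)" for \<tau> \<sigma> by (auto simp: R_def)
  have finR: "finite (R \<sigma>)" for \<sigma> unfolding R_def by (intro finite_PiE) auto
  define c where "c \<sigma> \<tau> = (\<Prod>i\<in>UNIV. real (\<sigma> i choose \<tau> i))" for \<sigma> \<tau> :: "'d \<Rightarrow> nat"
  have c0: "c \<sigma> \<tau> = 0" if "\<tau> \<notin> R \<sigma>" for \<sigma> \<tau>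
    using that unfolding R c_def by (auto simp: not_le binomial_eq_0)
  define up where "up i \<sigma> = \<sigma>(i := Suc (\<sigma> i))" for i and \<sigma> :: "'d \<Rightarrow> nat"
  define D where "D \<sigma> x = (\<Sum>\<tau>\<in>R \<sigma>. c \<sigma> \<tau> * (A \<tau> x * B (\<lambda>i. \<sigma> i - \<tau> i) x))" for \<sigma> x
  have A': "(A \<tau> has_derivative (\<lambda>h. \<Sum>i\<in>UNIV. h $ i * A (up i \<tau>) x)) (at x)"
    and B': "(B \<tau> has_derivative (\<lambda>h. \<Sum>i\<in>UNIV. h $ i * B (up i \<tau>) x)) (at x)" for \<tau> x
    using A B by (auto simp: all_partials_def up_def)
  have leibniz: "(\<Sum>\<tau>\<in>R \<sigma>. c \<sigma> \<tau> * (A (up i \<tau>) x * B (\<lambda>i. \<sigma> i - \<tau> i) x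
      + A \<tau> x * B (up i (\<lambda>i. \<sigma> i - \<tau> i)) x)) = D (up i \<sigma>) x" for \<sigma> x i
  proof -
    define T where "T \<tau> = A \<tau> x * B (\<lambda>j. up i \<sigma> j - \<tau> j) x" for \<tau>
    \<comment> \<open>The second summand of Pascal's rule in coordinate \<open>i\<close>. It
      vanishes when \<open>\<tau> i = 0\<close>, so only multi-indices of the form
      \<open>up i \<tau>\<close> remain, and these can be shifted back.\<close>
    define e where "e \<tau> = (if \<tau> i = 0 then 0 else c \<sigma> (\<tau>(i := \<tau> i - 1)))" for \<tau>
    have pascal: "c (up i \<sigma>) \<tau> = c \<sigma> \<tau> + e \<tau>" for \<tau>
    proof -
      have split: "c \<rho> \<pi> = real (\<rho> i choose \<pi> i) * (\<Prod>j\<in>UNIV-{i}. real (\<rho> j choose \<pi> j))" for \<rho> \<pi>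
        unfolding c_def by (rule prod.remove) auto
      have [simp]: "(\<Prod>j\<in>UNIV-{i}. real (up i \<sigma> j choose \<tau> j)) = (\<Prod>j\<in>UNIV-{i}. real (\<sigma> j choose \<tau> j))"
        "(\<Prod>j\<in>UNIV-{i}. real (\<sigma> j choose (\<tau>(i := \<tau> i - 1)) j)) = (\<Prod>j\<in>UNIV-{i}. real (\<sigma> j choose \<tau> j))"
        by (auto intro!: prod.cong simp: up_def)
      show ?thesis
        unfolding e_def split by (cases "\<tau> i") (simp_all add: up_def distrib_right)
    qed
    have sub: "R \<sigma> \<subseteq> R (up i \<sigma>)" by (auto simp: R up_def le_SucI)
    have "D (up i \<sigma>) x = (\<Sum>\<tau>\<in>R (up i \<sigma>). c \<sigma> \<tau> * T \<tau>) + (\<Sum>\<tau>\<in>R (up i \<sigma>). e \<tau> * T \<tau>)"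
      unfolding D_def T_def pascal by (simp add: distrib_right sum.distrib)
    moreover have "(\<Sum>\<tau>\<in>R (up i \<sigma>). c \<sigma> \<tau> * T \<tau>) = (\<Sum>\<tau>\<in>R \<sigma>. c \<sigma> \<tau> * T \<tau>)"
      by (rule sum.mono_neutral_right) (auto simp: finR sub c0)
    moreover have "\<dots> = (\<Sum>\<tau>\<in>R \<sigma>. c \<sigma> \<tau> * (A \<tau> x * B (up i (\<lambda>i. \<sigma> i - \<tau> i)) x))"
    proof (rule sum.cong[OF refl])
      fix \<tau> assume "\<tau> \<in> R \<sigma>"
      then have "(\<lambda>j. up i \<sigma> j - \<tau> j) = up i (\<lambda>i. \<sigma> i - \<tau> i)"
        by (auto simp: R up_def Suc_diff_le)
      then show "c \<sigma> \<tau> * T \<tau> = c \<sigma> \<tau> * (A \<tau> x * B (up i (\<lambda>i. \<sigma> i - \<tau> i)) x)" by (simp add: T_def)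
    qed
    moreover have "(\<Sum>\<tau>\<in>R (up i \<sigma>). e \<tau> * T \<tau>) = (\<Sum>\<tau>\<in>up i ` R \<sigma>. e \<tau> * T \<tau>)"
    proof (rule sum.mono_neutral_right)
      show "up i ` R \<sigma> \<subseteq> R (up i \<sigma>)" by (auto simp: R up_def)
      show "\<forall>\<tau>\<in>R (up i \<sigma>) - up i ` R \<sigma>. e \<tau> * T \<tau> = 0"
      proof
        fix \<tau> assume \<tau>: "\<tau> \<in> R (up i \<sigma>) - up i ` R \<sigma>"
        have "\<tau> i = 0"
        proof (rule ccontr)
          assume nz: "\<tau> i \<noteq> 0"
          then have "\<tau> = up i (\<tau>(i := \<tau> i - 1))" by (auto simp: up_def)
          moreover have "\<tau>(i := \<tau> i - 1) \<in> R \<sigma>"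
            unfolding R
          proof
            fix j show "(\<tau>(i := \<tau> i - 1)) j \<le> \<sigma> j"
              using \<tau> nz by (cases "j = i") (auto simp: R up_def dest!: spec[of _ j])
          qed
          ultimately show False using \<tau> by blast
        qed
        then show "e \<tau> * T \<tau> = 0" by (simp add: e_def)
      qed
    qed (rule finR)
    moreover have "\<dots> = (\<Sum>\<tau>\<in>R \<sigma>. e (up i \<tau>) * T (up i \<tau>))"
    proof (rule sum.reindex_cong[where l = "up i"])
      show "inj_on (up i) (R \<sigma>)"
        by (rule inj_on_inverseI[where g = "\<lambda>\<tau>. \<tau>(i := \<tau> i - 1)"]) (auto simp: up_def)
    qed auto
    moreover have "\<dots> = (\<Sum>\<tau>\<in>R \<sigma>. c \<sigma> \<tau> * (A (up i \<tau>) x * B (\<lambda>i. \<sigma> i - \<tau> i) x))"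
    proof (rule sum.cong[OF refl])
      fix \<tau>
      have "(\<lambda>j. up i \<sigma> j - up i \<tau> j) = (\<lambda>j. \<sigma> j - \<tau> j)" by (auto simp: up_def)
      then show "e (up i \<tau>) * T (up i \<tau>) = c \<sigma> \<tau> * (A (up i \<tau>) x * B (\<lambda>i. \<sigma> i - \<tau> i) x)"
        by (simp add: e_def T_def) (simp add: up_def)
    qed
    ultimately show ?thesis by (simp add: distrib_left sum.distrib)
  qed
  have "all_partials UNIV (\<lambda>x. f x * g x) D"
    unfolding all_partials_def
  proof (intro conjI allI ballI)
    fix x :: "real ^ 'd"
    have "R (\<lambda>_. 0) = {\<lambda>_. 0}" by (auto simp: R)
    then show "D (\<lambda>_. 0) x = f x * g x"
      using A B by (simp add: D_def c_def all_partials_def)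
  next
    fix \<sigma> and x :: "real ^ 'd"
    have "(D \<sigma> has_derivative (\<lambda>h. \<Sum>\<tau>\<in>R \<sigma>. c \<sigma> \<tau> * (A \<tau> x * (\<Sum>i\<in>UNIV. h $ i * B (up i (\<lambda>i. \<sigma> i - \<tau> i)) x)
        + (\<Sum>i\<in>UNIV. h $ i * A (up i \<tau>) x) * B (\<lambda>i. \<sigma> i - \<tau> i) x))) (at x)"
      unfolding D_def by (intro has_derivative_sum has_derivative_mult_right has_derivative_mult A' B')
    moreover have "(\<Sum>\<tau>\<in>R \<sigma>. c \<sigma> \<tau> * (A \<tau> x * (\<Sum>i\<in>UNIV. h $ i * B (up i (\<lambda>i. \<sigma> i - \<tau> i)) x)
        + (\<Sum>i\<in>UNIV. h $ i * A (up i \<tau>) x) * B (\<lambda>i. \<sigma> i - \<tau> i) x))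
      = (\<Sum>i\<in>UNIV. h $ i * D (up i \<sigma>) x)" for h :: "real ^ 'd"
    proof -
      have "(\<Sum>\<tau>\<in>R \<sigma>. c \<sigma> \<tau> * (A \<tau> x * (\<Sum>i\<in>UNIV. h $ i * B (up i (\<lambda>i. \<sigma> i - \<tau> i)) x)
        + (\<Sum>i\<in>UNIV. h $ i * A (up i \<tau>) x) * B (\<lambda>i. \<sigma> i - \<tau> i) x))
        = (\<Sum>\<tau>\<in>R \<sigma>. \<Sum>i\<in>UNIV. h $ i * (c \<sigma> \<tau> * (A (up i \<tau>) x * B (\<lambda>i. \<sigma> i - \<tau> i) x
      + A \<tau> x * B (up i (\<lambda>i. \<sigma> i - \<tau> i)) x)))"
        by (simp add: sum_distrib_left sum_distrib_right distrib_left sum.distrib mult_ac)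
      also have "\<dots> = (\<Sum>i\<in>UNIV. h $ i * D (up i \<sigma>) x)"
        unfolding leibniz[symmetric] by (subst sum.swap) (simp add: sum_distrib_left)
      finally show ?thesis .
    qed
    ultimately show "(D \<sigma> has_derivative (\<lambda>h. \<Sum>i\<in>UNIV. h $ i * D (\<sigma>(i := Suc (\<sigma> i))) x)) (at x)"
      by (simp add: up_def)
  qed
  then show ?thesis unfolding smooth_fn_def by blast
qed

section \<open>Weak gradients\<close>

abbreviation \<mu> :: "(real ^ 'd) measure" where "\<mu> \<equiv> lebesgue_on Omega"

section \<open>Measure and square integrability on the cube\<close>

lemma Omega_sets [simp, intro]: "Omega \<in> sets lebesgue"
  by (simp add: Omega_def)

lemma mem_Omega: "x \<in> Omega \<longleftrightarrow> (\<forall>i. 0 \<le> x $ i \<and> x $ i \<le> 2 * pi)"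
  by (simp add: Omega_def mem_box_cart)

lemma mem_interior_Omega: "x \<in> interior Omega \<longleftrightarrow> (\<forall>i. 0 < x $ i \<and> x $ i < 2 * pi)"
  by (simp add: Omega_def mem_box_cart)

lemma compact_Omega: "compact Omega"
  by (simp add: Omega_def compact_cbox)

lemma finite_measure_Omega: "finite_measure (\<mu> :: (real ^ 'd::finite) measure)"
  by (rule finite_measure_lebesgue_on) (simp add: Omega_def)

text \<open>The faces form a null set, so pointwise facts that hold only inside the cube suffice
  under the integral.\<close>

lemma AE_interior: "AE x in (\<mu> :: (real ^ 'd::finite) measure). x \<in> interior Omega"
proof -
  have "negligible (Omega - interior Omega :: (real ^ 'd) set)"
    using negligible_convex_frontier[of "cbox 0 (\<chi> i. 2 * pi) :: (real ^ 'd) set"]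
    by (simp add: Omega_def frontier_def del: interior_cbox)
  then have "AE x :: real ^ 'd in lebesgue. x \<notin> Omega - interior Omega"
    by (intro AE_not_in) (simp only: negligible_iff_null_sets)
  then have "AE x :: real ^ 'd in lebesgue. x \<in> Omega \<longrightarrow> x \<in> interior Omega" by eventually_elim auto
  then show ?thesis by (simp add: AE_restrict_space_iff)
qed

lemma L2_eq: "L2 = sq_int \<mu>"
  by (simp add: L2_def sq_int_def)

lemma norm_L2_eq: "norm_L2 Omega f = L2.nrm \<mu> f"
  by (simp add: norm_L2_def L2_nrm_eq)

lemma continuous_measurable: "continuous_on Omega f \<Longrightarrow> f \<in> borel_measurable \<mu>"
  by (rule continuous_imp_measurable_on_sets_lebesgue) auto

lemma sq_int_bounded:
  fixes f :: "real ^ 'd::finite \<Rightarrow> 'b::euclidean_space"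
  assumes "f \<in> borel_measurable \<mu>" "\<And>x. x \<in> Omega \<Longrightarrow> norm (f x) \<le> K"
  shows "f \<in> sq_int \<mu>"
proof (rule sq_int_bound[where f = "\<lambda>_. 1::real" and K = K])
  interpret finite_measure "\<mu> :: (real ^ 'd) measure" by (rule finite_measure_Omega)
  show "(\<lambda>_. 1::real) \<in> sq_int (\<mu> :: (real ^ 'd) measure)" by (simp add: sq_int_def)
qed (use assms in auto)

lemma sq_int_continuous:
  fixes f :: "real ^ 'd::finite \<Rightarrow> 'b::euclidean_space"
  assumes "continuous_on Omega f" shows "f \<in> sq_int \<mu>"
proof -
  have "bounded (f ` Omega)" by (intro compact_imp_bounded compact_continuous_image assms compact_Omega)
  then obtain K where "\<And>x. x \<in> Omega \<Longrightarrow> norm (f x) \<le> K" unfolding bounded_iff by blast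
  then show ?thesis using sq_int_bounded continuous_measurable[OF assms] by blast
qed

lemma sq_int_integrable:
  fixes f :: "real ^ 'd::finite \<Rightarrow> 'b::euclidean_space"
  assumes "f \<in> sq_int \<mu>" shows "integrable \<mu> f"
proof (rule sq_int_prod[of "\<lambda>_. 1::real" _ f])
  show "(\<lambda>_. 1::real) \<in> sq_int (\<mu> :: (real ^ 'd) measure)" by (intro sq_int_continuous continuous_intros)
qed (use assms in \<open>auto simp: sq_int_def\<close>)

lemma sq_int_mult_cont:
  assumes "continuous_on Omega a" "f \<in> sq_int \<mu>"
  shows "(\<lambda>x :: real ^ 'd::finite. (a x :: real) *\<^sub>R (f x :: 'b::euclidean_space)) \<in> sq_int \<mu>"
proof -
  have "bounded (a ` Omega)" by (intro compact_imp_bounded compact_continuous_image assms compact_Omega)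
  then obtain K where K: "\<And>x. x \<in> Omega \<Longrightarrow> norm (a x) \<le> K" unfolding bounded_iff by blast
  show ?thesis
  proof (rule sq_int_bound[OF assms(2)])
    show "(\<lambda>x. a x *\<^sub>R f x) \<in> borel_measurable \<mu>"
      using assms continuous_measurable[of a] by (auto simp: sq_int_def)
    show "norm (a x *\<^sub>R f x) \<le> K * norm (f x)" if "x \<in> space \<mu>" for x
      using mult_right_mono[OF K norm_ge_zero, of x "f x"] that by simp
  qed
qed

lemma integral_mult_bound:
  assumes "a \<in> sq_int M" "f \<in> sq_int M"
  shows "norm (\<integral>x. (a x :: real) *\<^sub>R (f x :: 'b::euclidean_space) \<partial>M) \<le> L2.nrm M a * L2.nrm M f"
proof -
  have nn: "(\<lambda>x. norm (f x)) \<in> sq_int M" "(\<lambda>x. norm (a x)) \<in> sq_int M"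
    using assms by (auto simp: sq_int_def)
  have "norm (\<integral>x. a x *\<^sub>R f x \<partial>M) \<le> (\<integral>x. norm (a x *\<^sub>R f x) \<partial>M)" by (rule integral_norm_bound)
  also have "\<dots> = (\<integral>x. norm (a x) \<bullet> norm (f x) \<partial>M)" by simp
  also have "\<dots> \<le> L2.nrm M (\<lambda>x. norm (a x)) * L2.nrm M (\<lambda>x. norm (f x))"
    using L2.cauchy_schwarz[OF nn(2,1)] by linarith
  also have "\<dots> = L2.nrm M a * L2.nrm M f" unfolding L2_nrm_eq by simp
  finally show ?thesis .
qed

subsection \<open>The fundamental lemma of the calculus of variations\<close>

text \<open>Boxes are stable under intersection and generate the Borel sets. Sets over which
  \<open>f\<close> integrates to zero are closed under countable disjoint unions, and under
  complements as soon as the total integral vanishes. Lebesgue sets differ from Borel sets by null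
  sets only.\<close>

lemma AE_eq_0_of_box_integrals:
  fixes f :: "'a::euclidean_space \<Rightarrow> real"
  assumes f: "integrable lebesgue f"
    and box: "\<And>a b. (LINT x:box a b|lebesgue. f x) = 0"
  shows "AE x in lebesgue. f x = 0"
proof -
  have [measurable]: "f \<in> borel_measurable lebesgue" using f by simp
  have si: "set_integrable lebesgue A f" if "A \<in> sets lebesgue" for A
    unfolding set_integrable_def using integrable_mult_indicator[OF that f] .
  \<comment> \<open>The whole space is exhausted by growing boxes; the complement case below depends
    on this value.\<close>
  have UNIV0: "(\<integral>x. f x \<partial>lebesgue) = 0"
  proof -
    have "(\<lambda>n. LINT x:box (- real n *\<^sub>R One) (real n *\<^sub>R One)|lebesgue. f x) \<longlonglongrightarrow> (\<integral>x. f x \<partial>lebesgue)"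
      unfolding set_lebesgue_integral_def
    proof (rule integral_dominated_convergence[where w = "\<lambda>x. norm (f x)"])
      show "AE x in lebesgue. (\<lambda>n. indicat_real (box (- real n *\<^sub>R One) (real n *\<^sub>R One)) x *\<^sub>R f x) \<longlonglongrightarrow> f x"
      proof (rule AE_I2)
        fix x :: 'a
        obtain n0 :: nat where n0: "norm x < real n0" using reals_Archimedean2 by blast
        have "x \<in> box (- real n *\<^sub>R One) (real n *\<^sub>R One)" if "n \<ge> n0" for n
        proof -
          have "- real n < x \<bullet> i \<and> x \<bullet> i < real n" if "i \<in> Basis" for i
            using Basis_le_norm[OF that, of x] n0 \<open>n \<ge> n0\<close> by linarith
          then show ?thesis by (simp add: mem_box)
        qed
        then have "\<forall>\<^sub>F n in sequentially. f x = indicat_real (box (- real n *\<^sub>R One) (real n *\<^sub>R One)) x *\<^sub>R f x"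
          by (intro eventually_sequentiallyI[of n0]) simp
        then show "(\<lambda>n. indicat_real (box (- real n *\<^sub>R One) (real n *\<^sub>R One)) x *\<^sub>R f x) \<longlonglongrightarrow> f x"
          by (rule Lim_transform_eventually[OF tendsto_const])
      qed
      show "(\<lambda>x. indicat_real (box (- real n *\<^sub>R One) (real n *\<^sub>R One)) x *\<^sub>R f x) \<in> borel_measurable lebesgue" for n
        by (intro borel_measurable_scaleR borel_measurable_indicator sets_completionI_sets) auto
    qed (use f in \<open>auto split: split_indicator\<close>)
    then show ?thesis unfolding box by (simp add: LIMSEQ_const_iff)
  qed
  have borel: "(LINT x:A|lebesgue. f x) = 0" if A: "A \<in> sets borel" for A
  proof -
    have "Int_stable (range (\<lambda>(a, b). box a b :: 'a set))" by (auto simp: Int_stable_def box_Int_box)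
    moreover have "range (\<lambda>(a, b). box a b :: 'a set) \<subseteq> Pow UNIV" by auto
    moreover have "A \<in> sigma_sets UNIV (range (\<lambda>(a, b). box a b))" using A unfolding borel_eq_box by simp
    ultimately show ?thesis
    proof (induction rule: sigma_sets_induct_disjoint)
      case (basic A) then show ?case using box by auto
    next
      case empty then show ?case by (simp add: set_lebesgue_integral_def)
    next
      case (compl A)
      then have [measurable]: "A \<in> sets borel" by (simp add: borel_eq_box)
      then have A: "A \<in> sets lebesgue" by (auto intro: sets_completionI_sets)
      have "(LINT x:UNIV - A|lebesgue. f x) = (\<integral>x. f x - indicat_real A x *\<^sub>R f x \<partial>lebesgue)"
        unfolding set_lebesgue_integral_def by (intro Bochner_Integration.integral_cong) (auto split: split_indicator)
      also have "\<dots> = (\<integral>x. f x \<partial>lebesgue) - (LINT x:A|lebesgue. f x)"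
        using si[OF A] f unfolding set_lebesgue_integral_def set_integrable_def by simp
      finally show ?case using compl UNIV0 by simp
    next
      case (union B)
      then have "B i \<in> sets borel" for i by (auto simp: borel_eq_box)
      then have B: "B i \<in> sets lebesgue" for i by (auto intro: sets_completionI_sets)
      have "(LINT x:(\<Union>i. B i)|lebesgue. f x) = (\<Sum>i. (LINT x:B i|lebesgue. f x))"
        using union(1) B by (intro lebesgue_integral_countable_add si) (auto simp: disjoint_family_on_def)
      then show ?case using union by simp
    qed
  qed
  show ?thesis
  proof (rule density_unique_real[OF f, of "\<lambda>_. 0"])
    fix A :: "'a set" assume A: "A \<in> sets lebesgue"
    have "AE x in lebesgue. x \<in> main_part lborel A \<longleftrightarrow> x \<in> A"
      using AE_completion[OF AE_in_main_part[OF A]] .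
    then have "(LINT x:A|lebesgue. f x) = (LINT x:main_part lborel A|lebesgue. f x)"
      unfolding set_lebesgue_integral_def
      using A main_part_sets[OF A] by (intro integral_cong_AE) (auto elim!: eventually_mono split: split_indicator intro!: borel_measurable_times borel_measurable_indicator simp: sets_completionI_sets)
    also have "\<dots> = 0" using main_part_sets[OF A] by (intro borel) simp
    finally show "(LINT x:A|lebesgue. f x) = (LINT x:A|lebesgue. 0)" by (simp add: set_lebesgue_integral_def)
  qed simp
qed

text \<open>A smooth substitute for the indicator of \<open>box a b\<close>, with a transition layer
  of width \<open>1 / c\<close> inside the box that is later sent to zero.\<close>

lemma plateau_exists:
  fixes a b :: "real ^ 'd::finite"
  assumes "\<And>i. 0 < a $ i" "\<And>i. b $ i < 2 * pi" "0 < c"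
  defines "\<theta> \<equiv> (\<lambda>x :: real ^ 'd. \<Prod>i\<in>UNIV. step_seq 0 (c * (x $ i - a $ i)) * step_seq 0 (c * (b $ i - x $ i)))"
  shows "test_function \<theta>"
proof -
  \<comment> \<open>Both one-sided steps are affine images of \<open>step_seq\<close>; their product
    is written out by the Leibniz formula to fit \<open>smooth_fn_tensor\<close>.\<close>
  define F where "F i n t = (\<Sum>k\<le>n. real (n choose k) *
      ((c ^ k * step_seq k (c * t + (- c * a $ i))) * ((- c) ^ (n - k) * step_seq (n - k) (- c * t + c * b $ i))))" for i n t
  have F: "smooth_seq (F i)" for i
    unfolding F_def by (intro smooth_seq_mult smooth_seq_affine step_seq(1))
  have F0: "F i 0 t = step_seq 0 (c * (t - a $ i)) * step_seq 0 (c * (b $ i - t))" for i t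
    by (simp add: F_def right_diff_distrib)
  have "\<theta> = (\<lambda>x. \<Prod>i\<in>UNIV. F i 0 (x $ i))"
    unfolding \<theta>_def F0 ..
  then have "smooth_fn \<theta>" using smooth_fn_tensor[of F, OF F] by simp
  moreover have sub: "closure {x. \<theta> x \<noteq> 0} \<subseteq> cbox a b"
  proof (rule closure_minimal)
    show "{x. \<theta> x \<noteq> 0} \<subseteq> cbox a b"
    proof
      fix x assume "x \<in> {x. \<theta> x \<noteq> 0}"
      then have nz: "step_seq 0 (c * (x $ i - a $ i)) \<noteq> 0" "step_seq 0 (c * (b $ i - x $ i)) \<noteq> 0" for i
        unfolding \<theta>_def by auto
      have "a $ i \<le> x $ i \<and> x $ i \<le> b $ i" for i
      proof (rule conjI; rule ccontr)
        assume "\<not> a $ i \<le> x $ i"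
        then have "c * (x $ i - a $ i) \<le> 0" using \<open>0 < c\<close> by (simp add: mult_le_0_iff)
        then show False using nz(1)[of i] step_seq(2) by blast
      next
        assume "\<not> x $ i \<le> b $ i"
        then have "c * (b $ i - x $ i) \<le> 0" using \<open>0 < c\<close> by (simp add: mult_le_0_iff)
        then show False using nz(2)[of i] step_seq(2) by blast
      qed
      then show "x \<in> cbox a b" by (simp add: mem_box_cart)
    qed
  qed (rule closed_cbox)
  moreover have "cbox a b \<subseteq> interior Omega"
  proof
    fix x assume "x \<in> cbox a b"
    then have "0 < x $ i \<and> x $ i < 2 * pi" for i
      using assms(1,2)[of i] by (auto simp: mem_box_cart dest!: spec[of _ i])
    then show "x \<in> interior Omega" by (simp add: mem_interior_Omega)
  qed
  moreover have "compact (closure {x. \<theta> x \<noteq> 0})"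
    using sub by (meson bounded_cbox bounded_subset closed_closure compact_eq_bounded_closed)
  ultimately show ?thesis unfolding test_function_def smooth_fn_def by blast
qed

text \<open>Plateaus are test functions and converge boundedly to the indicator of a box intersected
  with the open cube; dominated convergence then makes every box integral of \<open>g\<close>
  vanish.\<close>

lemma fundamental_lemma:
  fixes g :: "real ^ 'd::finite \<Rightarrow> real"
  assumes g: "integrable \<mu> g"
    and test: "\<And>\<theta>. test_function \<theta> \<Longrightarrow> (\<integral>x. \<theta> x * g x \<partial>\<mu>) = 0"
  shows "AE x in \<mu>. g x = 0"
proof -
  define f where "f x = (if x \<in> Omega then g x else 0)" for x
  have f: "integrable lebesgue f"
    unfolding f_def by (rule Lebesgue_Measure.integrable_restrict_UNIV[OF Omega_sets, THEN iffD2, OF g])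
  have "AE x in lebesgue. f x = 0"
  proof (rule AE_eq_0_of_box_integrals[OF f])
    fix a b :: "real ^ 'd"
    define l where "l n = inverse (real (Suc n))" for n
    have l: "0 < l n" for n by (simp add: l_def)
    \<comment> \<open>The box is clipped to distance \<open>l n\<close> from the faces of the cube,
      and the same \<open>l n\<close> is the width of the transition layer; both shrink
      together.\<close>
    define a' where "a' n = (\<chi> i. max (a $ i) (l n))" for n
    define b' where "b' n = (\<chi> i. min (b $ i) (2 * pi - l n))" for n
    define \<theta> where "\<theta> n = (\<lambda>x :: real ^ 'd. \<Prod>i\<in>UNIV. step_seq 0 (inverse (l n) * (x $ i - a' n $ i)) * step_seq 0 (inverse (l n) * (b' n $ i - x $ i)))" for n
    have test_\<theta>: "test_function (\<theta> n)" for n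
      unfolding \<theta>_def using l[of n]
      by (intro plateau_exists) (auto simp: a'_def b'_def intro: less_le_trans)
    define U where "U = box a b \<inter> interior Omega"
    have lim_step: "(\<lambda>n. step_seq 0 (inverse (l n) * (t - max s (l n)))) \<longlonglongrightarrow> (if s < t \<and> 0 < t then 1 else 0)" for s t
    proof (cases "s < t \<and> 0 < t")
      case True
      then have "0 < min (t - s) t" by simp
      then obtain n0 where n0: "inverse (real (Suc n0)) < min (t - s) t / 2" using reals_Archimedean half_gt_zero by metis
      have "step_seq 0 (inverse (l n) * (t - max s (l n))) = 1" if "n \<ge> n0" for n
      proof (rule step_seq(3))
        have "l n \<le> l n0" unfolding l_def using that by simp
        moreover have "l n0 < (t - s) / 2" "l n0 < t / 2"
          using n0 unfolding l_def[symmetric] by (simp_all add: min_def split: if_splits)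
        ultimately have "l n \<le> t - s" "l n \<le> t - l n" using l[of n0] by argo+
        then have "l n \<le> t - max s (l n)" by (simp add: max_def)
        then show "1 \<le> inverse (l n) * (t - max s (l n))" using l[of n] by (simp add: field_simps)
      qed
      then have "\<forall>\<^sub>F n in sequentially. 1 = step_seq 0 (inverse (l n) * (t - max s (l n)))"
        by (intro eventually_sequentiallyI[of n0]) simp
      then show ?thesis using True by (simp add: Lim_transform_eventually[OF tendsto_const])
    next
      case False
      have "step_seq 0 (inverse (l n) * (t - max s (l n))) = 0" for n
        using False l[of n] by (intro step_seq(2)) (auto simp: mult_le_0_iff max_def)
      then show ?thesis by (simp only: if_not_P[OF False] tendsto_const)
    qed
    have lim: "(\<lambda>n. \<theta> n x) \<longlonglongrightarrow> indicator U x" for x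
    proof -
      have "(\<lambda>n. step_seq 0 (inverse (l n) * (b' n $ i - x $ i))) \<longlonglongrightarrow> (if x $ i < b $ i \<and> x $ i < 2 * pi then 1 else 0)" for i
      proof -
        have "b' n $ i - x $ i = (2 * pi - x $ i) - max (2 * pi - b $ i) (l n)" for n
          by (auto simp: b'_def min_def max_def)
        moreover have "2 * pi - b $ i < 2 * pi - x $ i \<and> 0 < 2 * pi - x $ i \<longleftrightarrow> x $ i < b $ i \<and> x $ i < 2 * pi" by auto
        ultimately show ?thesis using lim_step[of "2 * pi - x $ i" "2 * pi - b $ i"] by presburger
      qed
      moreover have "(\<lambda>n. step_seq 0 (inverse (l n) * (x $ i - a' n $ i))) \<longlonglongrightarrow> (if a $ i < x $ i \<and> 0 < x $ i then 1 else 0)" for i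
        using lim_step[of "x $ i" "a $ i"] by (simp add: a'_def)
      ultimately have "(\<lambda>n. \<theta> n x) \<longlonglongrightarrow> (\<Prod>i\<in>UNIV. (if a $ i < x $ i \<and> 0 < x $ i then 1 else 0) * (if x $ i < b $ i \<and> x $ i < 2 * pi then 1 else 0))"
        unfolding \<theta>_def by (intro tendsto_prod tendsto_mult)
      also have "(\<Prod>i\<in>UNIV. (if a $ i < x $ i \<and> 0 < x $ i then 1 else 0) * (if x $ i < b $ i \<and> x $ i < 2 * pi then 1 else 0)) = (indicator U x :: real)"
      proof (cases "x \<in> U")
        case True then show ?thesis by (simp add: U_def mem_interior_Omega mem_box_cart)
      next
        case False
        then obtain i where "\<not> (a $ i < x $ i \<and> x $ i < b $ i \<and> 0 < x $ i \<and> x $ i < 2 * pi)"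
          by (auto simp: U_def mem_interior_Omega mem_box_cart)
        then show ?thesis using False by (auto intro!: prod_zero bexI[of _ i])
      qed
      finally show ?thesis .
    qed
    have bnd: "\<bar>\<theta> n x\<bar> \<le> 1" for n x
      unfolding \<theta>_def abs_prod by (intro prod_le_1) (auto simp: abs_mult step_seq intro!: mult_le_one)
    have \<theta>_meas: "\<theta> n \<in> borel_measurable \<mu>" for n
    proof (rule continuous_measurable)
      have "\<theta> n differentiable (at x)" for x
        using test_\<theta>[of n] unfolding test_function_def all_partials_def differentiable_def
      proof (elim conjE exE)
        fix D assume D: "\<forall>x\<in>UNIV. D (\<lambda>_. 0) x = \<theta> n x" "\<forall>\<sigma>. \<forall>x\<in>UNIV. (D \<sigma> has_derivative (\<lambda>h. \<Sum>i\<in>UNIV. h $ i * D (\<sigma>(i := Suc (\<sigma> i))) x)) (at x)"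
        have "D (\<lambda>_. 0) = \<theta> n" using D(1) by auto
        moreover have "(D (\<lambda>_. 0) has_derivative (\<lambda>h. \<Sum>i\<in>UNIV. h $ i * D ((\<lambda>_. 0)(i := Suc 0)) x)) (at x)"
          using D(2) by simp
        ultimately show "\<exists>D. (\<theta> n has_derivative D) (at x)" by auto
      qed
      then show "continuous_on Omega (\<theta> n)"
        by (simp add: continuous_at_imp_continuous_on differentiable_imp_continuous_within)
    qed
    have Um: "U \<in> sets borel" unfolding U_def by simp
    have ind_meas: "(\<lambda>x. indicat_real A x * g x) \<in> borel_measurable \<mu>" if "A \<in> sets borel" for A
    proof -
      have "indicat_real A \<in> borel_measurable lebesgue"
        using that by (intro borel_measurable_indicator sets_completionI_sets) simp
      then have "indicat_real A \<in> borel_measurable \<mu>" by (rule measurable_restrict_space1)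
      then show ?thesis using g by (intro borel_measurable_times) auto
    qed
    have "(\<lambda>n. \<integral>x. \<theta> n x * g x \<partial>\<mu>) \<longlonglongrightarrow> (\<integral>x. indicat_real U x * g x \<partial>\<mu>)"
    proof (rule integral_dominated_convergence[where w = "\<lambda>x. norm (g x)"])
      show "AE x in \<mu>. (\<lambda>n. \<theta> n x * g x) \<longlonglongrightarrow> indicat_real U x * g x"
        by (intro AE_I2 tendsto_intros lim)
      show "AE x in \<mu>. norm (\<theta> n x * g x) \<le> norm (g x)" for n
        using bnd by (auto simp: abs_mult intro!: AE_I2 mult_left_le_one_le)
      show "(\<lambda>x. indicat_real U x * g x) \<in> borel_measurable \<mu>"
        by (rule ind_meas[OF Um])
    qed (use g \<theta>_meas in auto)
    then have "(\<integral>x. indicat_real U x * g x \<partial>\<mu>) = 0"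
      using test[OF test_\<theta>] by (simp add: LIMSEQ_const_iff)
    also have "(\<integral>x. indicat_real U x * g x \<partial>\<mu>) = (\<integral>x. indicat_real (box a b) x * g x \<partial>\<mu>)"
    proof (rule integral_cong_AE[OF ind_meas[OF Um] ind_meas])
      show "AE x in \<mu>. indicat_real U x * g x = indicat_real (box a b) x * g x"
        using AE_interior by eventually_elim (simp add: U_def indicator_def)
    qed simp
    also have "\<dots> = (LINT x:box a b|lebesgue. f x)"
      unfolding set_lebesgue_integral_def
      by (subst integral_restrict_space) (auto simp: f_def indicator_def intro!: Bochner_Integration.integral_cong)
    finally show "(LINT x:box a b|lebesgue. f x) = 0" .
  qed
  then have "AE x in lebesgue. x \<in> Omega \<longrightarrow> g x = 0" by eventually_elim (auto simp: f_def)
  then show ?thesis by (simp add: AE_restrict_space_iff)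
qed

subsection \<open>Calculus of weak gradients\<close>

definition pd :: "(real ^ 'd \<Rightarrow> real) \<Rightarrow> 'd \<Rightarrow> real ^ 'd \<Rightarrow> real"
  where "pd f i x = frechet_derivative f (at x) (axis i 1)"

lemma pd_eq: "(f has_derivative f') (at x) \<Longrightarrow> pd f i x = f' (axis i 1)"
  unfolding pd_def by (simp add: frechet_derivative_at[symmetric])

lemma pd_eq_sum:
  fixes P :: "'d::finite \<Rightarrow> real"
  assumes "(f has_derivative (\<lambda>h. \<Sum>i\<in>UNIV. h $ i * P i)) (at x)" shows "pd f i x = P i"
  using pd_eq[OF assms, of i] by (simp add: axis_def if_distrib[of "\<lambda>y. y * _"] cong: if_cong)

lemma smooth_fn_has_derivative:
  fixes f :: "real ^ 'd::finite \<Rightarrow> real"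
  assumes "smooth_fn f"
  shows "(f has_derivative (\<lambda>h. \<Sum>i\<in>UNIV. h $ i * pd f i x)) (at x)"
    and "continuous_on A (pd f i)" and "continuous_on A f"
proof -
  obtain D where D: "D (\<lambda>_. 0) = f"
    "\<And>\<sigma> x. (D \<sigma> has_derivative (\<lambda>h. \<Sum>i\<in>UNIV. h $ i * D (\<sigma>(i := Suc (\<sigma> i))) x)) (at x)"
    using assms by (auto simp: smooth_fn_def all_partials_def)
  have cont: "continuous_on A (D \<sigma>)" for \<sigma>
    using D(2) by (meson has_derivative_at_withinI has_derivative_continuous_on)
  have d: "(f has_derivative (\<lambda>h. \<Sum>i\<in>UNIV. h $ i * D ((\<lambda>_. 0)(i := Suc 0)) x)) (at x)" for x
    using D(2)[of "\<lambda>_. 0" x] D(1) by simp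
  have pd: "pd f i x = D ((\<lambda>_. 0)(i := Suc 0)) x" for x i by (rule pd_eq_sum[OF d])
  show "(f has_derivative (\<lambda>h. \<Sum>i\<in>UNIV. h $ i * pd f i x)) (at x)" unfolding pd by (rule d)
  have "pd f i = D ((\<lambda>_. 0)(i := Suc 0))" using pd by blast
  then show "continuous_on A (pd f i)" using cont by simp
  show "continuous_on A f" using cont D(1) by metis
qed

lemma has_derivative_mult_sum:
  fixes f g :: "real ^ 'd::finite \<Rightarrow> real"
  assumes "(f has_derivative (\<lambda>h. \<Sum>i\<in>UNIV. h $ i * P i)) (at x)"
    and "(g has_derivative (\<lambda>h. \<Sum>i\<in>UNIV. h $ i * Q i)) (at x)"
  shows "((\<lambda>x. f x * g x) has_derivative (\<lambda>h. \<Sum>i\<in>UNIV. h $ i * (f x * Q i + P i * g x))) (at x)"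
proof -
  have eq: "f x * (\<Sum>i\<in>UNIV. h $ i * Q i) + (\<Sum>i\<in>UNIV. h $ i * P i) * g x
      = (\<Sum>i\<in>UNIV. h $ i * (f x * Q i + P i * g x))" for h :: "real ^ 'd"
    by (simp add: sum_distrib_left sum_distrib_right sum.distrib distrib_left mult_ac)
  show ?thesis using has_derivative_mult[OF assms] unfolding eq .
qed

lemma pd_mult:
  fixes f g :: "real ^ 'd::finite \<Rightarrow> real"
  assumes "smooth_fn f" "smooth_fn g"
  shows "pd (\<lambda>x. f x * g x) i x = f x * pd g i x + pd f i x * g x"
  using has_derivative_mult_sum[OF smooth_fn_has_derivative(1)[OF assms(1)] smooth_fn_has_derivative(1)[OF assms(2)]]
  by (rule pd_eq_sum)

lemma test_function_smooth: "test_function \<theta> \<Longrightarrow> smooth_fn \<theta>"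
  by (simp add: test_function_def smooth_fn_def)

lemma test_function_mult:
  assumes "test_function \<theta>" "smooth_fn \<eta>"
  shows "test_function (\<lambda>x. \<theta> x * \<eta> x)"
proof -
  let ?A = "closure {x. \<theta> x \<noteq> 0}" and ?B = "closure {x. \<theta> x * \<eta> x \<noteq> 0}"
  have sub: "?B \<subseteq> ?A" by (intro closure_mono) auto
  have smooth: "smooth_fn (\<lambda>x. \<theta> x * \<eta> x)"
    by (intro smooth_fn_mult test_function_smooth assms)
  have A: "compact ?A" "?A \<subseteq> interior Omega"
    using assms(1) by (auto simp: test_function_def)
  have "compact (?A \<inter> ?B)" by (intro compact_Int_closed A closed_closure)
  then have "compact ?B" using sub by (simp add: Int_absorb1)
  then show ?thesis using sub A smooth unfolding test_function_def smooth_fn_def by simp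
qed

lemma weak_gradient_pd:
  "weak_gradient u g \<longleftrightarrow> (\<forall>\<theta> i. test_function \<theta> \<longrightarrow>
     (\<integral>x. pd \<theta> i x *\<^sub>R u x \<partial>\<mu>) = - (\<integral>x. \<theta> x *\<^sub>R (g x $ i) \<partial>\<mu>))"
  by (simp add: weak_gradient_def pd_def)

lemma sq_int_nth:
  fixes g :: "real ^ 'd \<Rightarrow> complex ^ 'e::finite"
  assumes "g \<in> sq_int M" shows "(\<lambda>x. g x $ i) \<in> sq_int M"
proof (rule sq_int_bound[OF assms, of _ 1])
  show "(\<lambda>x. g x $ i) \<in> borel_measurable M"
    using assms by (intro borel_measurable_continuous_on[of "\<lambda>v. v $ i"] continuous_intros) (auto simp: sq_int_def)
qed (simp add: Finite_Cartesian_Product.norm_nth_le)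

lemma vec_lambda_eq_sum_axis: "(\<chi> i. f i) = (\<Sum>i\<in>UNIV. axis i (f i :: 'a::comm_monoid_add))"
  by (simp add: vec_eq_iff axis_def)

lemma sq_int_vec:
  fixes f :: "'e::finite \<Rightarrow> 'x \<Rightarrow> complex"
  assumes "\<And>i. f i \<in> sq_int M" shows "(\<lambda>x. \<chi> i. f i x) \<in> sq_int M"
  unfolding vec_lambda_eq_sum_axis
proof (rule L2.sum_closed)
  fix i :: 'e
  have c: "continuous_on UNIV (\<lambda>z :: complex. axis i z :: complex ^ 'e)"
    unfolding axis_def
  proof (rule continuous_on_vec_lambda)
    fix j show "continuous_on UNIV (\<lambda>z :: complex. if j = i then z else 0)" by (cases "j = i") auto
  qed
  show "(\<lambda>x. axis i (f i x)) \<in> sq_int M"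
  proof (rule sq_int_bound[OF assms[of i], of _ 1])
    show "(\<lambda>x. axis i (f i x)) \<in> borel_measurable M"
      using assms[of i] by (intro borel_measurable_continuous_on[OF c]) (simp add: sq_int_def)
  qed (simp add: norm_eq_sqrt_inner inner_axis_axis)
qed

text \<open>Test functions are real, so real and imaginary part are tested separately.\<close>

lemma fundamental_lemma_complex:
  fixes g :: "real ^ 'd::finite \<Rightarrow> complex"
  assumes g: "g \<in> sq_int \<mu>" and test: "\<And>\<theta>. test_function \<theta> \<Longrightarrow> (\<integral>x. \<theta> x *\<^sub>R g x \<partial>\<mu>) = 0"
  shows "AE x in \<mu>. g x = 0"
proof -
  have int: "integrable \<mu> (\<lambda>x. \<theta> x *\<^sub>R g x)" if "test_function \<theta>" for \<theta>
    using smooth_fn_has_derivative(3)[OF test_function_smooth[OF that]]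
    by (intro sq_int_integrable sq_int_mult_cont g)
  have "AE x in \<mu>. Re (g x) = 0"
  proof (rule fundamental_lemma)
    fix \<theta> :: "real ^ 'd \<Rightarrow> real" assume \<theta>: "test_function \<theta>"
    have "(\<integral>x. Re (\<theta> x *\<^sub>R g x) \<partial>\<mu>) = Re (\<integral>x. \<theta> x *\<^sub>R g x \<partial>\<mu>)"
      by (rule integral_bounded_linear[OF bounded_linear_Re int[OF \<theta>]])
    then show "(\<integral>x. \<theta> x * Re (g x) \<partial>\<mu>) = 0" by (simp add: test[OF \<theta>])
  qed (rule integrable_bounded_linear[OF bounded_linear_Re sq_int_integrable[OF g]])
  moreover have "AE x in \<mu>. Im (g x) = 0"
  proof (rule fundamental_lemma)
    fix \<theta> :: "real ^ 'd \<Rightarrow> real" assume \<theta>: "test_function \<theta>"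
    have "(\<integral>x. Im (\<theta> x *\<^sub>R g x) \<partial>\<mu>) = Im (\<integral>x. \<theta> x *\<^sub>R g x \<partial>\<mu>)"
      by (rule integral_bounded_linear[OF bounded_linear_Im int[OF \<theta>]])
    then show "(\<integral>x. \<theta> x * Im (g x) \<partial>\<mu>) = 0" by (simp add: test[OF \<theta>])
  qed (rule integrable_bounded_linear[OF bounded_linear_Im sq_int_integrable[OF g]])
  ultimately show ?thesis by eventually_elim (simp add: complex_eq_iff)
qed

lemma int_test:
  fixes u :: "real ^ 'd::finite \<Rightarrow> complex"
  assumes "test_function \<theta>" "u \<in> sq_int \<mu>"
  shows "integrable \<mu> (\<lambda>x. \<theta> x *\<^sub>R u x)" "integrable \<mu> (\<lambda>x. pd \<theta> i x *\<^sub>R u x)"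
  using smooth_fn_has_derivative(2,3)[OF test_function_smooth[OF assms(1)]]
  by (intro sq_int_integrable sq_int_mult_cont assms(2); blast)+

lemma weak_gradient_unique:
  fixes u :: "real ^ 'd::finite \<Rightarrow> complex"
  assumes "g \<in> sq_int \<mu>" "h \<in> sq_int \<mu>" "weak_gradient u g" "weak_gradient u h"
  shows "AE x in \<mu>. g x = h x"
proof -
  have "AE x in \<mu>. g x $ i - h x $ i = 0" for i
  proof (rule fundamental_lemma_complex)
    have gi: "(\<lambda>x. g x $ i) \<in> sq_int \<mu>" "(\<lambda>x. h x $ i) \<in> sq_int \<mu>" by (intro sq_int_nth assms)+
    show "(\<lambda>x. g x $ i - h x $ i) \<in> sq_int \<mu>" by (intro L2.diff_closed gi)
    fix \<theta> :: "real ^ 'd \<Rightarrow> real" assume \<theta>: "test_function \<theta>"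
    have "(\<integral>x. pd \<theta> i x *\<^sub>R u x \<partial>\<mu>) = - (\<integral>x. \<theta> x *\<^sub>R g x $ i \<partial>\<mu>)"
      "(\<integral>x. pd \<theta> i x *\<^sub>R u x \<partial>\<mu>) = - (\<integral>x. \<theta> x *\<^sub>R h x $ i \<partial>\<mu>)"
      using assms(3,4) \<theta> unfolding weak_gradient_pd by blast+
    then have "(\<integral>x. \<theta> x *\<^sub>R g x $ i \<partial>\<mu>) = (\<integral>x. \<theta> x *\<^sub>R h x $ i \<partial>\<mu>)" by simp
    then show "(\<integral>x. \<theta> x *\<^sub>R (g x $ i - h x $ i) \<partial>\<mu>) = 0"
      using int_test(1)[OF \<theta> gi(1)] int_test(1)[OF \<theta> gi(2)] by (simp add: scaleR_diff_right)
  qed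
  then have "AE x in \<mu>. \<forall>i\<in>UNIV. g x $ i - h x $ i = 0" by (intro AE_finite_allI) auto
  then show ?thesis by eventually_elim (simp add: vec_eq_iff)
qed

lemma H1_D:
  assumes "u \<in> H1" shows "u \<in> sq_int \<mu>" "grad u \<in> sq_int \<mu>" "weak_gradient u (grad u)"
proof -
  show "u \<in> sq_int \<mu>" using assms by (simp add: H1_def L2_eq)
  have "\<exists>g. g \<in> L2 \<and> weak_gradient u g" using assms by (auto simp: H1_def)
  then have "grad u \<in> L2 \<and> weak_gradient u (grad u)" unfolding grad_def by (rule someI_ex)
  then show "grad u \<in> sq_int \<mu>" "weak_gradient u (grad u)" by (auto simp: L2_eq)
qed

text \<open>Since \<open>grad\<close> is a choice, a gradient computed by hand agrees with it only
  almost everywhere. All later rules for \<open>grad\<close> pass through this lemma.\<close>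

lemma H1_I:
  fixes u :: "real ^ 'd::finite \<Rightarrow> complex"
  assumes "u \<in> sq_int \<mu>" "g \<in> sq_int \<mu>" "weak_gradient u g"
  shows "u \<in> H1" "AE x in \<mu>. grad u x = g x"
proof -
  show "u \<in> H1" using assms by (auto simp: H1_def L2_eq)
  then show "AE x in \<mu>. grad u x = g x" using H1_D assms weak_gradient_unique by blast
qed

lemma weak_gradient_add:
  fixes u v :: "real ^ 'd::finite \<Rightarrow> complex"
  assumes "u \<in> sq_int \<mu>" "v \<in> sq_int \<mu>" "g \<in> sq_int \<mu>" "h \<in> sq_int \<mu>" "weak_gradient u g" "weak_gradient v h"
  shows "weak_gradient (\<lambda>x. u x + v x) (\<lambda>x. g x + h x)"
  unfolding weak_gradient_pd
proof (intro allI impI)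
  fix \<theta> :: "real ^ 'd \<Rightarrow> real" and i assume \<theta>: "test_function \<theta>"
  show "(\<integral>x. pd \<theta> i x *\<^sub>R (u x + v x) \<partial>\<mu>) = - (\<integral>x. \<theta> x *\<^sub>R (g x + h x) $ i \<partial>\<mu>)"
    using assms(5,6) \<theta> int_test(2)[OF \<theta> assms(1), of i] int_test(2)[OF \<theta> assms(2), of i]
      int_test(1)[OF \<theta> sq_int_nth[OF assms(3), of i]] int_test(1)[OF \<theta> sq_int_nth[OF assms(4), of i]]
    by (simp add: weak_gradient_pd scaleR_add_right)
qed

lemma weak_gradient_cmult:
  fixes u :: "real ^ 'd::finite \<Rightarrow> complex"
  assumes "weak_gradient u g"
  shows "weak_gradient (\<lambda>x. c * u x) (\<lambda>x. c *s g x)"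
  unfolding weak_gradient_pd
proof (intro allI impI)
  fix \<theta> :: "real ^ 'd \<Rightarrow> real" and i assume \<theta>: "test_function \<theta>"
  have "(\<integral>x. pd \<theta> i x *\<^sub>R (c * u x) \<partial>\<mu>) = c * (\<integral>x. pd \<theta> i x *\<^sub>R u x \<partial>\<mu>)"
    by (simp flip: mult_scaleR_right)
  also have "\<dots> = - (c * (\<integral>x. \<theta> x *\<^sub>R g x $ i \<partial>\<mu>))" using assms \<theta> by (simp add: weak_gradient_pd)
  also have "c * (\<integral>x. \<theta> x *\<^sub>R g x $ i \<partial>\<mu>) = (\<integral>x. \<theta> x *\<^sub>R (c *s g x) $ i \<partial>\<mu>)"
    by (simp flip: mult_scaleR_right)
  finally show "(\<integral>x. pd \<theta> i x *\<^sub>R (c * u x) \<partial>\<mu>) = - (\<integral>x. \<theta> x *\<^sub>R (c *s g x) $ i \<partial>\<mu>)" .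
qed

text \<open>The factor is moved onto the test function, and \<open>\<theta> x * \<eta> x\<close>
  must again be a test function. This is why the cutoffs of the proof are infinitely smooth and not
  merely Lipschitz.\<close>

lemma weak_gradient_smooth_mult:
  fixes u :: "real ^ 'd::finite \<Rightarrow> complex"
  assumes u: "u \<in> sq_int \<mu>" and g: "g \<in> sq_int \<mu>" and w: "weak_gradient u g" and \<eta>: "smooth_fn \<eta>"
  shows "weak_gradient (\<lambda>x. \<eta> x *\<^sub>R u x) (\<lambda>x. \<chi> i. \<eta> x *\<^sub>R g x $ i + pd \<eta> i x *\<^sub>R u x)"
  unfolding weak_gradient_pd
proof (intro allI impI)
  fix \<theta> :: "real ^ 'd \<Rightarrow> real" and i assume \<theta>: "test_function \<theta>"
  have s\<theta>: "smooth_fn \<theta>" by (rule test_function_smooth[OF \<theta>])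
  have t: "test_function (\<lambda>x. \<theta> x * \<eta> x)" by (rule test_function_mult[OF \<theta> \<eta>])
  have i1: "integrable \<mu> (\<lambda>x. (\<theta> x * pd \<eta> i x) *\<^sub>R u x)" "integrable \<mu> (\<lambda>x. (pd \<theta> i x * \<eta> x) *\<^sub>R u x)"
    "integrable \<mu> (\<lambda>x. (\<theta> x * \<eta> x) *\<^sub>R g x $ i)"
    using smooth_fn_has_derivative(2,3)[OF s\<theta>] smooth_fn_has_derivative(2,3)[OF \<eta>]
    by (intro sq_int_integrable sq_int_mult_cont u sq_int_nth[OF g] continuous_on_mult; blast)+
  have "(\<integral>x. pd (\<lambda>x. \<theta> x * \<eta> x) i x *\<^sub>R u x \<partial>\<mu>) = - (\<integral>x. (\<theta> x * \<eta> x) *\<^sub>R g x $ i \<partial>\<mu>)"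
    using w t unfolding weak_gradient_pd by blast
  moreover have "(\<integral>x. pd (\<lambda>x. \<theta> x * \<eta> x) i x *\<^sub>R u x \<partial>\<mu>)
      = (\<integral>x. (\<theta> x * pd \<eta> i x) *\<^sub>R u x \<partial>\<mu>) + (\<integral>x. (pd \<theta> i x * \<eta> x) *\<^sub>R u x \<partial>\<mu>)"
    unfolding pd_mult[OF s\<theta> \<eta>] scaleR_add_left by (rule Bochner_Integration.integral_add[OF i1(1,2)])
  moreover have "(\<integral>x. \<theta> x *\<^sub>R (\<eta> x *\<^sub>R g x $ i + pd \<eta> i x *\<^sub>R u x) \<partial>\<mu>)
      = (\<integral>x. (\<theta> x * \<eta> x) *\<^sub>R g x $ i \<partial>\<mu>) + (\<integral>x. (\<theta> x * pd \<eta> i x) *\<^sub>R u x \<partial>\<mu>)"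
    unfolding scaleR_add_right scaleR_scaleR by (rule Bochner_Integration.integral_add[OF i1(3,1)])
  ultimately show "(\<integral>x. pd \<theta> i x *\<^sub>R (\<eta> x *\<^sub>R u x) \<partial>\<mu>)
      = - (\<integral>x. \<theta> x *\<^sub>R (\<chi> i. \<eta> x *\<^sub>R g x $ i + pd \<eta> i x *\<^sub>R u x) $ i \<partial>\<mu>)"
    by (simp add: algebra_simps)
qed

lemma tendsto_integral_mult:
  fixes f :: "nat \<Rightarrow> real ^ 'd::finite \<Rightarrow> 'b::euclidean_space"
  assumes a: "continuous_on Omega a" and f: "\<And>n. f n \<in> sq_int \<mu>" "g \<in> sq_int \<mu>"
    and lim: "(\<lambda>n. L2.nrm \<mu> (\<lambda>x. f n x - g x)) \<longlonglongrightarrow> 0"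
  shows "(\<lambda>n. \<integral>x. a x *\<^sub>R f n x \<partial>\<mu>) \<longlonglongrightarrow> (\<integral>x. a x *\<^sub>R g x \<partial>\<mu>)"
proof -
  have "(\<lambda>n. (\<integral>x. a x *\<^sub>R f n x \<partial>\<mu>) - (\<integral>x. a x *\<^sub>R g x \<partial>\<mu>)) \<longlonglongrightarrow> 0"
  proof (rule Lim_null_comparison[where g = "\<lambda>n. L2.nrm \<mu> a * L2.nrm \<mu> (\<lambda>x. f n x - g x)"])
    have "(\<integral>x. a x *\<^sub>R f n x \<partial>\<mu>) - (\<integral>x. a x *\<^sub>R g x \<partial>\<mu>) = (\<integral>x. a x *\<^sub>R (f n x - g x) \<partial>\<mu>)" for n
      unfolding scaleR_diff_right
      by (intro Bochner_Integration.integral_diff[symmetric] sq_int_integrable sq_int_mult_cont a f)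
    then show "\<forall>\<^sub>F n in sequentially. norm ((\<integral>x. a x *\<^sub>R f n x \<partial>\<mu>) - (\<integral>x. a x *\<^sub>R g x \<partial>\<mu>))
        \<le> L2.nrm \<mu> a * L2.nrm \<mu> (\<lambda>x. f n x - g x)"
      using integral_mult_bound[OF sq_int_continuous[OF a] L2.diff_closed[OF f]] by simp
    show "(\<lambda>n. L2.nrm \<mu> a * L2.nrm \<mu> (\<lambda>x. f n x - g x)) \<longlonglongrightarrow> 0"
      using tendsto_mult_right_zero[OF lim] by simp
  qed
  then show ?thesis by (rule LIM_zero_cancel)
qed

text \<open>The weak gradient is a closed operator: for a fixed test function both sides of the
  defining identity are continuous in the \<open>L2\<close> norms.\<close>

lemma weak_gradient_limit:
  fixes u :: "real ^ 'd::finite \<Rightarrow> complex"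
  assumes w: "\<And>n. w n \<in> sq_int \<mu>" "\<And>n. p n \<in> sq_int \<mu>" "\<And>n. weak_gradient (w n) (p n)"
    and u: "u \<in> sq_int \<mu>" "g \<in> sq_int \<mu>"
    and lim: "(\<lambda>n. L2.nrm \<mu> (\<lambda>x. w n x - u x)) \<longlonglongrightarrow> 0" "(\<lambda>n. L2.nrm \<mu> (\<lambda>x. p n x - g x)) \<longlonglongrightarrow> 0"
  shows "weak_gradient u g"
  unfolding weak_gradient_pd
proof (intro allI impI)
  fix \<theta> :: "real ^ 'd \<Rightarrow> real" and i assume \<theta>: "test_function \<theta>"
  note c = smooth_fn_has_derivative(2,3)[OF test_function_smooth[OF \<theta>]]
  have lim_i: "(\<lambda>n. L2.nrm \<mu> (\<lambda>x. p n x $ i - g x $ i)) \<longlonglongrightarrow> 0"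
  proof (rule Lim_null_comparison[OF _ lim(2)])
    have "L2.nrm \<mu> (\<lambda>x. p n x $ i - g x $ i) \<le> 1 * L2.nrm \<mu> (\<lambda>x. p n x - g x)" for n
    proof (rule L2_nrm_mono)
      show "AE x in \<mu>. norm (p n x $ i - g x $ i) \<le> 1 * norm (p n x - g x)"
        using Finite_Cartesian_Product.norm_nth_le[of "p n _ - g _" i] by simp
    qed (auto intro!: L2.diff_closed sq_int_nth w u)
    moreover have "0 \<le> L2.nrm \<mu> (\<lambda>x. p n x $ i - g x $ i)" for n
      by (intro L2.nrm_nonneg L2.diff_closed sq_int_nth w u)
    ultimately show "\<forall>\<^sub>F n in sequentially. norm (L2.nrm \<mu> (\<lambda>x. p n x $ i - g x $ i)) \<le> L2.nrm \<mu> (\<lambda>x. p n x - g x)"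
      by simp
  qed
  have "(\<lambda>n. \<integral>x. pd \<theta> i x *\<^sub>R w n x \<partial>\<mu>) \<longlonglongrightarrow> (\<integral>x. pd \<theta> i x *\<^sub>R u x \<partial>\<mu>)"
    by (intro tendsto_integral_mult c w u lim)
  moreover have "(\<lambda>n. - (\<integral>x. \<theta> x *\<^sub>R p n x $ i \<partial>\<mu>)) \<longlonglongrightarrow> - (\<integral>x. \<theta> x *\<^sub>R g x $ i \<partial>\<mu>)"
    by (intro tendsto_minus tendsto_integral_mult c sq_int_nth w u lim_i)
  moreover have "(\<integral>x. pd \<theta> i x *\<^sub>R w n x \<partial>\<mu>) = - (\<integral>x. \<theta> x *\<^sub>R p n x $ i \<partial>\<mu>)" for n
    using w(3)[of n] \<theta> unfolding weak_gradient_pd by blast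
  ultimately show "(\<integral>x. pd \<theta> i x *\<^sub>R u x \<partial>\<mu>) = - (\<integral>x. \<theta> x *\<^sub>R g x $ i \<partial>\<mu>)"
    using LIMSEQ_unique by simp
qed

text \<open>Translation invariance of the Lebesgue measure makes the integral of every difference quotient
  vanish.\<close>
lemma integral_partial_derivative_0:
  fixes F :: "real ^ 'd::finite \<Rightarrow> real"
  assumes F: "\<And>x. (F has_derivative (\<lambda>h. \<Sum>i\<in>UNIV. h $ i * P i x)) (at x)"
    and P: "\<And>i. continuous_on UNIV (P i)"
    and S: "compact S" "S \<subseteq> Omega" "\<And>x. x \<notin> S \<Longrightarrow> F x = 0" "\<And>i x. x \<notin> S \<Longrightarrow> P i x = 0"
  shows "(\<integral>x. P i x \<partial>\<mu>) = 0"
proof -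
  define e where "e = (axis i 1 :: real ^ 'd)"
  have DERIV: "((\<lambda>t. F (x + t *\<^sub>R e)) has_real_derivative P i (x + t *\<^sub>R e)) (at t)" for x t
  proof -
    have "((\<lambda>t. x + t *\<^sub>R e) has_derivative (\<lambda>h. h *\<^sub>R e)) (at t)"
      by (auto intro!: derivative_eq_intros)
    from has_derivative_compose[OF this F]
    have "((\<lambda>t. F (x + t *\<^sub>R e)) has_derivative (\<lambda>h. \<Sum>j\<in>UNIV. (h *\<^sub>R e) $ j * P j (x + t *\<^sub>R e))) (at t)" .
    moreover have "(\<Sum>j\<in>UNIV. (h *\<^sub>R e) $ j * P j (x + t *\<^sub>R e)) = P i (x + t *\<^sub>R e) * h" for h
      by (simp add: e_def axis_def if_distrib[of "\<lambda>y. _ * y"] if_distrib[of "\<lambda>y. y * _"] cong: if_cong)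
    ultimately show ?thesis by (simp add: has_field_derivative_def)
  qed
  obtain R where R: "\<And>x. x \<in> S \<Longrightarrow> norm x \<le> R" using compact_imp_bounded[OF S(1)] unfolding bounded_iff by blast
  obtain K where K: "\<And>x. x \<in> S \<Longrightarrow> norm (P i x) \<le> K"
    using compact_imp_bounded[OF compact_continuous_image[OF continuous_on_subset[OF P] S(1)]]
    unfolding bounded_iff by blast
  \<comment> \<open>If \<open>S\<close> is empty, the bound \<open>K\<close> may be
    negative.\<close>
  define K' where "K' = max K 0"
  have K': "\<bar>P i x\<bar> \<le> K'" for x
    using K[of x] S(4)[of x i] by (cases "x \<in> S") (auto simp: K'_def)
  have F_cont: "continuous_on UNIV F" using F by (meson has_derivative_at_withinI has_derivative_continuous_on)
  have [measurable]: "F \<in> borel_measurable borel" using F_cont by (rule borel_measurable_continuous_onI)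
  have Pm[measurable]: "P i \<in> borel_measurable borel" using P by (rule borel_measurable_continuous_onI)
  define l where "l n = inverse (real (Suc n))" for n
  have l: "0 < l n" "l n \<le> 1" for n by (auto simp: l_def field_simps)
  define G where "G n x = (F (x + l n *\<^sub>R e) - F x) / l n" for n x
  have [measurable]: "G n \<in> borel_measurable borel" for n unfolding G_def by measurable
  have lim: "(\<lambda>n. G n x) \<longlonglongrightarrow> P i x" for x
  proof -
    have "((\<lambda>h. (F (x + h *\<^sub>R e) - F x) / h) \<longlongrightarrow> P i x) (at 0)"
      using DERIV[of x 0] by (simp add: DERIV_def)
    moreover have "filterlim l (at 0) sequentially"
      unfolding filterlim_at using l LIMSEQ_inverse_real_of_nat by (auto simp: l_def[abs_def])
    ultimately show ?thesis unfolding G_def by (rule filterlim_compose)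
  qed
  \<comment> \<open>By the mean value theorem a difference quotient is a value of
    \<open>P i\<close>. The increments are at most \<open>1\<close>, so all quotients vanish outside
    the ball of radius \<open>R + 1\<close>.\<close>
  have bound: "\<bar>G n x\<bar> \<le> K' * indicat_real (cball 0 (R + 1)) x" for n x
  proof (cases "x \<in> cball 0 (R + 1)")
    case True
    obtain z where "F (x + l n *\<^sub>R e) - F (x + 0 *\<^sub>R e) = (l n - 0) * P i (x + z *\<^sub>R e)"
      using MVT2[OF l(1)[of n], of "\<lambda>t. F (x + t *\<^sub>R e)" "\<lambda>t. P i (x + t *\<^sub>R e)"] DERIV by blast
    then have "G n x = P i (x + z *\<^sub>R e)" using l(1)[of n] by (simp add: G_def)
    then show ?thesis using True K' by simp
  next
    case False
    then have nx: "norm x > R + 1" by simp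
    then have "x \<notin> S" using R[of x] by force
    moreover have "x + l n *\<^sub>R e \<notin> S"
    proof
      assume "x + l n *\<^sub>R e \<in> S"
      then have "norm (x + l n *\<^sub>R e) \<le> R" by (rule R)
      moreover have "norm x \<le> norm (x + l n *\<^sub>R e) + norm (l n *\<^sub>R e)"
        using norm_triangle_ineq4[of "x + l n *\<^sub>R e" "l n *\<^sub>R e"] by simp
      moreover have "norm (l n *\<^sub>R e) \<le> 1" using l[of n] by (simp add: e_def)
      ultimately show False using nx by linarith
    qed
    ultimately show ?thesis using S(3) False by (simp add: G_def)
  qed
  have F_int: "integrable lborel F"
  proof -
    have "bounded (F ` S)" by (intro compact_imp_bounded compact_continuous_image continuous_on_subset[OF F_cont] S) auto
    then obtain B where B: "\<And>x. x \<in> S \<Longrightarrow> norm (F x) \<le> B" unfolding bounded_iff by blast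
    show ?thesis
    proof (rule Bochner_Integration.integrable_bound)
      show "integrable lborel (\<lambda>x. max B 0 * indicat_real (cball 0 R) x :: real)"
        by (intro integrable_mult_right integrable_real_indicator) (auto intro: emeasure_bounded_finite[simplified])
      have "norm (F x) \<le> norm (max B 0 * indicat_real (cball 0 R) x)" for x
        using B[of x] R[of x] S(3)[of x] by (cases "x \<in> S") (auto simp: indicator_def)
      then show "AE x in lborel. norm (F x) \<le> norm (max B 0 * indicat_real (cball 0 R) x)" by simp
    qed measurable
  qed
  have trans: "(\<integral>x. F (x + c) \<partial>lborel) = (\<integral>x. F x \<partial>lborel)" "integrable lborel (\<lambda>x. F (x + c))" for c
  proof -
    have "(\<integral>x. F x \<partial>distr lborel borel ((+) c)) = (\<integral>x. F (c + x) \<partial>lborel)"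
      by (rule integral_distr) measurable
    then show "(\<integral>x. F (x + c) \<partial>lborel) = (\<integral>x. F x \<partial>lborel)" by (simp add: lborel_distr_plus add.commute)
    have "integrable (distr lborel borel ((+) c)) F \<longleftrightarrow> integrable lborel (\<lambda>x. F (c + x))"
      by (rule integrable_distr_eq) measurable
    then show "integrable lborel (\<lambda>x. F (x + c))" using F_int by (simp add: lborel_distr_plus add.commute)
  qed
  have G0: "(\<integral>x. G n x \<partial>lborel) = 0" for n
    unfolding G_def using trans[of "l n *\<^sub>R e"] F_int by simp
  have "(\<lambda>n. \<integral>x. G n x \<partial>lborel) \<longlonglongrightarrow> (\<integral>x. P i x \<partial>lborel)"
  proof (rule integral_dominated_convergence[where w = "\<lambda>x. K' * indicat_real (cball 0 (R + 1)) x"])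
    show "integrable lborel (\<lambda>x :: real ^ 'd. K' * indicat_real (cball 0 (R + 1)) x)"
      by (intro integrable_mult_right integrable_real_indicator) (auto intro: emeasure_bounded_finite[simplified])
  qed (use lim bound in auto)
  then have "(\<integral>x. P i x \<partial>lborel) = 0" unfolding G0 by (simp add: LIMSEQ_const_iff)
  moreover have "(\<integral>x. P i x \<partial>\<mu>) = (\<integral>x. indicat_real Omega x *\<^sub>R P i x \<partial>lebesgue)"
    by (rule integral_restrict_space) simp
  moreover have "(\<lambda>x. indicat_real Omega x *\<^sub>R P i x) = P i"
    using S(2,4) by (auto simp: indicator_def fun_eq_iff)
  moreover have "(\<integral>x. P i x \<partial>lebesgue) = (\<integral>x. P i x \<partial>lborel)" by (rule integral_completion) simp
  ultimately show ?thesis by simp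
qed

text \<open>Integration by parts without boundary term: the partial derivatives of
  \<open>\<theta> x * b x\<close> integrate to zero. One continuous derivative of \<open>b\<close>
  is enough, which lets the bubbles be piecewise polynomial.\<close>

lemma weak_gradient_C1_compact_support:
  fixes b :: "real ^ 'd::finite \<Rightarrow> real"
  assumes b: "\<And>x. (b has_derivative (\<lambda>h. \<Sum>i\<in>UNIV. h $ i * P i x)) (at x)"
    and P: "\<And>i. continuous_on UNIV (P i)"
    and S: "compact S" "S \<subseteq> Omega" "\<And>x. x \<notin> S \<Longrightarrow> b x = 0" "\<And>i x. x \<notin> S \<Longrightarrow> P i x = 0"
  shows "weak_gradient (\<lambda>x. complex_of_real (b x)) (\<lambda>x. \<chi> i. complex_of_real (P i x))"
  unfolding weak_gradient_pd
proof (intro allI impI)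
  fix \<theta> :: "real ^ 'd \<Rightarrow> real" and i assume \<theta>: "test_function \<theta>"
  note s = smooth_fn_has_derivative[OF test_function_smooth[OF \<theta>]]
  have b_cont: "continuous_on A b" for A using b by (meson has_derivative_at_withinI has_derivative_continuous_on)
  have P_cont: "continuous_on A (P i)" for A using P continuous_on_subset by blast
  have "(\<integral>x. \<theta> x * P i x + pd \<theta> i x * b x \<partial>\<mu>) = 0"
  proof (rule integral_partial_derivative_0[where F = "\<lambda>x. \<theta> x * b x" and S = S and P = "\<lambda>i x. \<theta> x * P i x + pd \<theta> i x * b x"])
    show "((\<lambda>x. \<theta> x * b x) has_derivative (\<lambda>h. \<Sum>i\<in>UNIV. h $ i * (\<theta> x * P i x + pd \<theta> i x * b x))) (at x)" for x
      by (rule has_derivative_mult_sum[OF s(1) b])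
    show "continuous_on UNIV (\<lambda>x. \<theta> x * P i x + pd \<theta> i x * b x)" for i
      by (intro continuous_intros s P b_cont)
  qed (use S in auto)
  moreover have "integrable \<mu> (\<lambda>x. \<theta> x * P i x)" "integrable \<mu> (\<lambda>x. pd \<theta> i x * b x)"
    by (intro sq_int_integrable sq_int_continuous continuous_on_mult s P_cont b_cont)+
  ultimately have "(\<integral>x. pd \<theta> i x * b x \<partial>\<mu>) = - (\<integral>x. \<theta> x * P i x \<partial>\<mu>)"
    by simp
  moreover have "(\<integral>x. pd \<theta> i x *\<^sub>R complex_of_real (b x) \<partial>\<mu>) = complex_of_real (\<integral>x. pd \<theta> i x * b x \<partial>\<mu>)"
    "(\<integral>x. \<theta> x *\<^sub>R complex_of_real (P i x) \<partial>\<mu>) = complex_of_real (\<integral>x. \<theta> x * P i x \<partial>\<mu>)"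
    by (simp_all add: scaleR_conv_of_real flip: of_real_mult integral_complex_of_real)
  ultimately show "(\<integral>x. pd \<theta> i x *\<^sub>R complex_of_real (b x) \<partial>\<mu>)
      = - (\<integral>x. \<theta> x *\<^sub>R (\<chi> i. complex_of_real (P i x)) $ i \<partial>\<mu>)" by simp
qed

section \<open>The energy form\<close>

lemma complex_inner_mult_left: "(z * a) \<bullet> b = a \<bullet> (cnj z * b)" for a b z :: complex
  by (simp add: inner_complex_def algebra_simps)

lemma vec_inner_mult_left: "(z *s p) \<bullet> q = p \<bullet> (cnj z *s q)" for p q :: "complex ^ 'd"
  by (simp add: inner_vec_def complex_inner_mult_left)

lemma norm_complex_smult: "norm (z *s p) = norm z * norm p" for p :: "complex ^ 'd"
  by (simp add: norm_vec_def norm_mult L2_set_right_distrib)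

lemma H1_add:
  fixes u v :: "real ^ 'd::finite \<Rightarrow> complex"
  assumes "u \<in> H1" "v \<in> H1"
  shows "(\<lambda>x. u x + v x) \<in> H1" "AE x in \<mu>. grad (\<lambda>x. u x + v x) x = grad u x + grad v x"
  using H1_I[OF sq_int_add[OF H1_D(1)[OF assms(1)] H1_D(1)[OF assms(2)]]
      sq_int_add[OF H1_D(2)[OF assms(1)] H1_D(2)[OF assms(2)]]
      weak_gradient_add[OF H1_D(1)[OF assms(1)] H1_D(1)[OF assms(2)] H1_D(2)[OF assms(1)] H1_D(2)[OF assms(2)]
        H1_D(3)[OF assms(1)] H1_D(3)[OF assms(2)]]]
  by blast+

lemma sq_int_cmult:
  fixes u :: "'x \<Rightarrow> complex"
  assumes "u \<in> sq_int M" shows "(\<lambda>x. z * u x) \<in> sq_int M"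
  by (rule sq_int_bound[OF assms, of _ "norm z"]) (use assms in \<open>auto simp: sq_int_def norm_mult\<close>)

lemma sq_int_smult:
  fixes g :: "'x \<Rightarrow> complex ^ 'e::finite"
  assumes "g \<in> sq_int M" shows "(\<lambda>x. z *s g x) \<in> sq_int M"
proof (rule sq_int_bound[OF assms, of _ "norm z"])
  have "(\<lambda>x. \<chi> i. z * g x $ i) \<in> sq_int M"
  proof (rule sq_int_vec)
    fix i
    have "(\<lambda>x. g x $ i) \<in> sq_int M"
    proof (rule sq_int_bound[OF assms, of _ 1])
      show "(\<lambda>x. g x $ i) \<in> borel_measurable M"
        using assms by (intro borel_measurable_continuous_on[of "\<lambda>v. v $ i"] continuous_intros) (auto simp: sq_int_def)
    qed (simp add: Finite_Cartesian_Product.norm_nth_le)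
    then show "(\<lambda>x. z * g x $ i) \<in> sq_int M" by (rule sq_int_cmult)
  qed
  then show "(\<lambda>x. z *s g x) \<in> borel_measurable M" by (simp add: sq_int_def vector_scalar_mult_def)
qed (simp add: norm_complex_smult)

lemma H1_cmult:
  fixes u :: "real ^ 'd::finite \<Rightarrow> complex"
  assumes "u \<in> H1"
  shows "(\<lambda>x. z * u x) \<in> H1" "AE x in \<mu>. grad (\<lambda>x. z * u x) x = z *s grad u x"
  using H1_I[OF sq_int_cmult[OF H1_D(1)[OF assms]] sq_int_smult[OF H1_D(2)[OF assms]]
      weak_gradient_cmult[OF H1_D(3)[OF assms]]] by blast+

lemma H1_zero: "(\<lambda>x. 0) \<in> (H1 :: (real ^ 'd::finite \<Rightarrow> complex) set)"
  by (rule H1_I(1)[where g = "\<lambda>_. 0"]) (auto simp: sq_int_zero weak_gradient_def)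

lemma H1_scale:
  fixes u :: "real ^ 'd::finite \<Rightarrow> complex"
  assumes "u \<in> H1"
  shows "(\<lambda>x. r *\<^sub>R u x) \<in> H1" "AE x in \<mu>. grad (\<lambda>x. r *\<^sub>R u x) x = r *\<^sub>R grad u x"
proof -
  have e: "(\<lambda>x. r *\<^sub>R u x) = (\<lambda>x. complex_of_real r * u x)" by (simp add: scaleR_conv_of_real)
  have e': "complex_of_real r *s p = r *\<^sub>R p" for p :: "complex ^ 'd"
    by (simp add: vec_eq_iff scaleR_conv_of_real[where 'a = complex])
  show "(\<lambda>x. r *\<^sub>R u x) \<in> H1" "AE x in \<mu>. grad (\<lambda>x. r *\<^sub>R u x) x = r *\<^sub>R grad u x"
    using H1_cmult[OF assms, of "complex_of_real r"] unfolding e e' by auto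
qed

lemma ip_cong:
  assumes "f \<in> sq_int M" "f' \<in> sq_int M" "g \<in> sq_int M" "AE x in M. f x = f' x"
  shows "(\<integral>x. f x \<bullet> g x \<partial>M) = (\<integral>x. f' x \<bullet> g x \<partial>M)"
  using assms sq_int_inner[OF assms(1,3)] sq_int_inner[OF assms(2,3)]
  by (intro integral_cong_AE) (auto elim: eventually_mono)

definition en :: "real \<Rightarrow> (real ^ 'd \<Rightarrow> real) \<Rightarrow> (real ^ 'd \<Rightarrow> complex) \<Rightarrow> (real ^ 'd \<Rightarrow> complex) \<Rightarrow> real"
  where "en c \<rho> v w = c * (\<integral>x. grad v x \<bullet> grad w x \<partial>\<mu>) + (\<integral>x. (\<rho> x *\<^sub>R v x) \<bullet> w x \<partial>\<mu>)"

text \<open>Used twice: with \<open>c = 1\<close> and weight \<open>1\<close> the form is the real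
  \<open>H1\<close> inner product, with \<open>c = \<epsilon>^2 / 2\<close> and weight
  \<open>V\<close> it is the real part of \<open>form_a\<close>.\<close>

locale energy =
  fixes c :: real and \<rho> :: "real ^ 'd::finite \<Rightarrow> real" and R :: real
  assumes c_nonneg: "0 \<le> c" and \<rho>_meas: "\<rho> \<in> borel_measurable \<mu>"
    and \<rho>_nonneg: "\<And>x. x \<in> Omega \<Longrightarrow> 0 \<le> \<rho> x" and \<rho>_le: "\<And>x. x \<in> Omega \<Longrightarrow> \<rho> x \<le> R"
begin

lemma sq_int_weight: "v \<in> sq_int \<mu> \<Longrightarrow> (\<lambda>x. \<rho> x *\<^sub>R (v x :: complex)) \<in> sq_int \<mu>"
  by (rule sq_int_bound[of v \<mu> _ R])
    (use \<rho>_meas \<rho>_nonneg \<rho>_le in \<open>auto simp: sq_int_def intro: mult_right_mono\<close>)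

lemma en_add:
  assumes "u \<in> H1" "v \<in> H1" "w \<in> H1"
  shows "en c \<rho> (\<lambda>x. u x + v x) w = en c \<rho> u w + en c \<rho> v w"
proof -
  note g = H1_D(2)[OF assms(1)] H1_D(2)[OF assms(2)] H1_D(2)[OF assms(3)]
  have "(\<integral>x. grad (\<lambda>x. u x + v x) x \<bullet> grad w x \<partial>\<mu>) = (\<integral>x. (grad u x + grad v x) \<bullet> grad w x \<partial>\<mu>)"
    using H1_add[OF assms(1,2)] by (intro ip_cong sq_int_add g H1_D(2))
  also have "\<dots> = (\<integral>x. grad u x \<bullet> grad w x \<partial>\<mu>) + (\<integral>x. grad v x \<bullet> grad w x \<partial>\<mu>)"
    by (rule L2.B_add[OF g])
  finally show ?thesis
    using L2.B_add[OF sq_int_weight[OF H1_D(1)[OF assms(1)]] sq_int_weight[OF H1_D(1)[OF assms(2)]] H1_D(1)[OF assms(3)]]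
    by (simp add: en_def scaleR_add_right distrib_left)
qed

lemma en_scale:
  assumes "u \<in> H1" "w \<in> H1"
  shows "en c \<rho> (\<lambda>x. r *\<^sub>R u x) w = r * en c \<rho> u w"
proof -
  note g = H1_D(2)[OF assms(1)] H1_D(2)[OF assms(2)]
  have "(\<integral>x. grad (\<lambda>x. r *\<^sub>R u x) x \<bullet> grad w x \<partial>\<mu>) = (\<integral>x. (r *\<^sub>R grad u x) \<bullet> grad w x \<partial>\<mu>)"
    using H1_scale[OF assms(1)] by (intro ip_cong sq_int_scale g H1_D(2))
  then show ?thesis by (simp add: en_def distrib_left mult_ac scaleR_left_commute[of r])
qed

text \<open>The real form is not built for complex scalars; moving \<open>z\<close> to the other
  argument as its conjugate supplies what is needed of them, namely homogeneity of the norm and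
  orthogonality of complex multiples.\<close>

lemma en_cmult:
  assumes "u \<in> H1" "w \<in> H1"
  shows "en c \<rho> (\<lambda>x. z * u x) w = en c \<rho> u (\<lambda>x. cnj z * w x)"
proof -
  note g = H1_D(2)[OF assms(1)] H1_D(2)[OF assms(2)]
  have "(\<integral>x. grad (\<lambda>x. z * u x) x \<bullet> grad w x \<partial>\<mu>) = (\<integral>x. (z *s grad u x) \<bullet> grad w x \<partial>\<mu>)"
    using H1_cmult[OF assms(1)] by (intro ip_cong sq_int_smult g H1_D(2))
  also have "\<dots> = (\<integral>x. (cnj z *s grad w x) \<bullet> grad u x \<partial>\<mu>)"
    by (intro Bochner_Integration.integral_cong refl) (metis vec_inner_mult_left inner_commute)
  also have "\<dots> = (\<integral>x. grad (\<lambda>x. cnj z * w x) x \<bullet> grad u x \<partial>\<mu>)"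
    using H1_cmult[OF assms(2), of "cnj z"]
    by (intro ip_cong[symmetric] sq_int_smult g H1_D(2))
  also have "\<dots> = (\<integral>x. grad u x \<bullet> grad (\<lambda>x. cnj z * w x) x \<partial>\<mu>)"
    by (rule L2.B_sym[OF H1_D(2)[OF H1_cmult(1)[OF assms(2)]] g(1)])
  finally show ?thesis by (simp add: en_def complex_inner_mult_left)
qed

sublocale semi_ip H1 "en c \<rho>"
proof
  fix u v :: "real ^ 'd \<Rightarrow> complex" assume u: "u \<in> H1" and v: "v \<in> H1"
  have "(\<integral>x. (\<rho> x *\<^sub>R u x) \<bullet> v x \<partial>\<mu>) = (\<integral>x. (\<rho> x *\<^sub>R v x) \<bullet> u x \<partial>\<mu>)"
    by (simp add: inner_commute)
  moreover have "(\<integral>x. grad u x \<bullet> grad v x \<partial>\<mu>) = (\<integral>x. grad v x \<bullet> grad u x \<partial>\<mu>)"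
    by (rule L2.B_sym[OF H1_D(2)[OF u] H1_D(2)[OF v]])
  ultimately show "en c \<rho> u v = en c \<rho> v u" by (simp add: en_def)
next
  fix u :: "real ^ 'd \<Rightarrow> complex" assume u: "u \<in> H1"
  have "0 \<le> (\<integral>x. (\<rho> x *\<^sub>R u x) \<bullet> u x \<partial>\<mu>)"
    using \<rho>_nonneg by (intro Bochner_Integration.integral_nonneg) auto
  moreover have "0 \<le> (\<integral>x. grad u x \<bullet> grad u x \<partial>\<mu>)" by (rule L2.B_nonneg[OF H1_D(2)[OF u]])
  ultimately show "0 \<le> en c \<rho> u u" using c_nonneg by (simp add: en_def)
qed (rule H1_zero H1_add(1) H1_scale(1) en_add en_scale; assumption)+

lemma en_cmult_cmult:
  assumes "u \<in> H1" shows "en c \<rho> (\<lambda>x. z * u x) (\<lambda>x. z * u x) = (norm z)\<^sup>2 * en c \<rho> u u"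
proof -
  have "en c \<rho> (\<lambda>x. z * u x) (\<lambda>x. z * u x) = en c \<rho> u (\<lambda>x. (norm z)\<^sup>2 *\<^sub>R u x)"
    using en_cmult[OF assms H1_cmult(1)[OF assms]]
    by (simp add: mult.assoc[symmetric] mult.commute[of "cnj z"] complex_norm_square[symmetric] scaleR_conv_of_real)
  then show ?thesis using B_scale_right[OF assms assms] by simp
qed

lemma nrm_cmult: "u \<in> H1 \<Longrightarrow> nrm (\<lambda>x. z * u x) = norm z * nrm u"
  by (simp add: nrm_def en_cmult_cmult real_sqrt_mult)

lemma en_self:
  assumes "u \<in> H1"
  shows "en c \<rho> u u = c * (L2.nrm \<mu> (grad u))\<^sup>2 + (\<integral>x. \<rho> x * (norm (u x))\<^sup>2 \<partial>\<mu>)"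
  using L2.nrm_sq[OF H1_D(2)[OF assms]] by (simp add: en_def dot_square_norm)

lemma integrable_weight: "u \<in> sq_int \<mu> \<Longrightarrow> integrable \<mu> (\<lambda>x. \<rho> x * (norm (u x :: complex))\<^sup>2)"
  using sq_int_inner[OF sq_int_weight, of u u] by (simp add: dot_square_norm)

lemma nrm_le:
  assumes "u \<in> H1"
  shows "(nrm u)\<^sup>2 \<le> c * (L2.nrm \<mu> (grad u))\<^sup>2 + R * (L2.nrm \<mu> u)\<^sup>2"
proof -
  have u: "u \<in> sq_int \<mu>" by (rule H1_D(1)[OF assms])
  have "(\<integral>x. \<rho> x * (norm (u x))\<^sup>2 \<partial>\<mu>) \<le> (\<integral>x. R * (norm (u x))\<^sup>2 \<partial>\<mu>)"
    using u by (intro integral_mono integrable_weight) (auto simp: sq_int_def intro!: mult_right_mono \<rho>_le)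
  moreover have "(\<integral>x. (norm (u x))\<^sup>2 \<partial>\<mu>) = (L2.nrm \<mu> u)\<^sup>2"
    using L2.nrm_sq[OF u] by (simp add: dot_square_norm)
  ultimately show ?thesis by (simp add: nrm_sq assms en_self)
qed

lemma nrm_ge:
  assumes "u \<in> H1" and r: "\<And>x. x \<in> Omega \<Longrightarrow> r \<le> \<rho> x"
  shows "c * (L2.nrm \<mu> (grad u))\<^sup>2 + r * (L2.nrm \<mu> u)\<^sup>2 \<le> (nrm u)\<^sup>2"
proof -
  have u: "u \<in> sq_int \<mu>" by (rule H1_D(1)[OF assms(1)])
  have "(\<integral>x. r * (norm (u x))\<^sup>2 \<partial>\<mu>) \<le> (\<integral>x. \<rho> x * (norm (u x))\<^sup>2 \<partial>\<mu>)"
    using u by (intro integral_mono integrable_weight) (auto simp: sq_int_def intro!: mult_right_mono r)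
  moreover have "(\<integral>x. (norm (u x))\<^sup>2 \<partial>\<mu>) = (L2.nrm \<mu> u)\<^sup>2"
    using L2.nrm_sq[OF u] by (simp add: dot_square_norm)
  ultimately show ?thesis by (simp add: nrm_sq assms en_self)
qed

end

section \<open>Periodic Sobolev functions\<close>

interpretation HN: energy 1 "\<lambda>_ :: real ^ 'd::finite. 1" 1
  by standard auto

lemma norm_H1_eq:
  fixes u :: "real ^ 'd::finite \<Rightarrow> complex"
  assumes "u \<in> H1" shows "norm_H1 u = HN.nrm u"
proof -
  have "(L2.nrm \<mu> u)\<^sup>2 = (\<integral>x. (norm (u x))\<^sup>2 \<partial>\<mu>)"
    using L2.nrm_sq[OF H1_D(1)[OF assms]] by (simp add: dot_square_norm)
  then show ?thesis
    unfolding norm_H1_def HN.nrm_def HN.en_self[OF assms] norm_L2_eq by (simp add: add.commute)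
qed

lemma norm_H1_sq: "(norm_H1 u)\<^sup>2 = (L2.nrm \<mu> u)\<^sup>2 + (L2.nrm \<mu> (grad u))\<^sup>2"
  by (simp add: norm_H1_def norm_L2_eq)

lemma norm_H1_ge: "L2.nrm \<mu> u \<le> norm_H1 u" "L2.nrm \<mu> (grad u) \<le> norm_H1 u"
  unfolding norm_H1_def norm_L2_eq by (intro real_le_rsqrt; simp)+

lemma norm_H1_le_sum: "u \<in> H1 \<Longrightarrow> norm_H1 u \<le> L2.nrm \<mu> u + L2.nrm \<mu> (grad u)"
  unfolding norm_H1_def norm_L2_eq
  by (intro sqrt_sum_squares_le_sum L2.nrm_nonneg H1_D)

lemma H1_diff:
  fixes u v :: "real ^ 'd::finite \<Rightarrow> complex"
  assumes "u \<in> H1" "v \<in> H1"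
  shows "(\<lambda>x. u x - v x) \<in> H1" "AE x in \<mu>. grad (\<lambda>x. u x - v x) x = grad u x - grad v x"
proof -
  show "(\<lambda>x. u x - v x) \<in> H1" by (intro HN.diff_closed assms)
  have "AE x in \<mu>. grad (\<lambda>x. u x + (-1) *\<^sub>R v x) x = grad u x - grad v x"
    using H1_add(2)[OF assms(1) H1_scale(1)[OF assms(2), of "-1"]] H1_scale(2)[OF assms(2), of "-1"]
    by eventually_elim simp
  then show "AE x in \<mu>. grad (\<lambda>x. u x - v x) x = grad u x - grad v x" by simp
qed

section \<open>Linear structure and completeness of \<open>H1P\<close>\<close>

definition jump :: "(real ^ 'd \<Rightarrow> complex) \<Rightarrow> 'd \<Rightarrow> real ^ 'd \<Rightarrow> complex"
  where "jump w i x = w (set_coord i 0 x) - w (set_coord i (2 * pi) x)"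

lemma periodic_traces_jump:
  "periodic_traces u \<longleftrightarrow> (\<exists>w. (\<forall>n::nat. w n \<in> H1 \<and> continuous_on Omega (w n)) \<and>
     (\<lambda>n. norm_H1 (\<lambda>x. w n x - u x)) \<longlonglongrightarrow> 0 \<and> (\<forall>i. (\<lambda>n. L2.nrm \<mu> (jump (w n) i)) \<longlonglongrightarrow> 0))"
  by (simp add: periodic_traces_def norm_L2_eq jump_def[abs_def])

lemma set_coord_Omega: "x \<in> Omega \<Longrightarrow> 0 \<le> a \<Longrightarrow> a \<le> 2 * pi \<Longrightarrow> set_coord i a x \<in> Omega"
  by (simp add: mem_Omega set_coord_def)

lemma sq_int_jump:
  fixes w :: "real ^ 'd::finite \<Rightarrow> complex"
  assumes "continuous_on Omega w" shows "jump w i \<in> sq_int \<mu>"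
proof (rule sq_int_continuous)
  have c: "continuous_on Omega (set_coord i a :: real ^ 'd \<Rightarrow> _)" for a
    unfolding set_coord_def
  proof (rule continuous_on_vec_lambda)
    fix j show "continuous_on Omega (\<lambda>x :: real ^ 'd. if j = i then a else x $ j)"
      by (cases "j = i") (auto intro: continuous_intros)
  qed
  have "continuous_on Omega (\<lambda>x. w (set_coord i a x))" if "0 \<le> a" "a \<le> 2 * pi" for a
    by (rule continuous_on_compose2[OF assms c]) (use set_coord_Omega that in blast)
  then show "continuous_on Omega (jump w i)"
    unfolding jump_def[abs_def] by (intro continuous_on_diff) auto
qed

lemma H1P_H1: "u \<in> H1P \<Longrightarrow> u \<in> H1"
  by (simp add: H1P_def)

lemma H1P_approx:
  assumes "u \<in> H1P" "0 < e"
  shows "\<exists>w. w \<in> H1 \<and> continuous_on Omega w \<and> norm_H1 (\<lambda>x. w x - u x) < e \<and> (\<forall>i. L2.nrm \<mu> (jump w i) < e)"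
proof -
  obtain w where w: "\<And>n. w n \<in> H1 \<and> continuous_on Omega (w n)"
    "(\<lambda>n. norm_H1 (\<lambda>x. w n x - u x)) \<longlonglongrightarrow> 0" "\<And>i. (\<lambda>n. L2.nrm \<mu> (jump (w n) i)) \<longlonglongrightarrow> 0"
    using assms(1) unfolding H1P_def periodic_traces_jump by auto
  have "\<forall>\<^sub>F n in sequentially. norm_H1 (\<lambda>x. w n x - u x) < e"
    by (rule order_tendstoD(2)[OF w(2) assms(2)])
  moreover have "\<forall>\<^sub>F n in sequentially. \<forall>i. L2.nrm \<mu> (jump (w n) i) < e"
    by (intro eventually_all_finite order_tendstoD(2)[OF w(3) assms(2)])
  ultimately have "\<forall>\<^sub>F n in sequentially. norm_H1 (\<lambda>x. w n x - u x) < e \<and> (\<forall>i. L2.nrm \<mu> (jump (w n) i) < e)"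
    by (rule eventually_conj)
  then obtain n where "norm_H1 (\<lambda>x. w n x - u x) < e \<and> (\<forall>i. L2.nrm \<mu> (jump (w n) i) < e)"
    using eventually_happens by fastforce
  then show ?thesis using w(1) by blast
qed

text \<open>A criterion free of sequences: approximation within every tolerance suffices, the
  sequence of \<open>periodic_traces\<close> being chosen with tolerances
  \<open>1 / (n + 1)\<close>. Closure properties then deal with one approximant at a time.\<close>

lemma H1P_I:
  fixes u :: "real ^ 'd::finite \<Rightarrow> complex"
  assumes u: "u \<in> H1"
    and "\<And>e. 0 < e \<Longrightarrow> \<exists>w. w \<in> H1 \<and> continuous_on Omega w \<and> norm_H1 (\<lambda>x. w x - u x) < e \<and> (\<forall>i. L2.nrm \<mu> (jump w i) < e)"
  shows "u \<in> H1P"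
proof -
  define l where "l n = inverse (real (Suc n))" for n
  have "\<forall>n. \<exists>w. w \<in> H1 \<and> continuous_on Omega w \<and> norm_H1 (\<lambda>x. w x - u x) < l n \<and> (\<forall>i. L2.nrm \<mu> (jump w i) < l n)"
    by (intro allI assms(2)) (simp add: l_def)
  then have "\<exists>w. \<forall>n. w n \<in> H1 \<and> continuous_on Omega (w n) \<and> norm_H1 (\<lambda>x. w n x - u x) < l n \<and> (\<forall>i. L2.nrm \<mu> (jump (w n) i) < l n)"
    by (rule choice)
  then obtain w where "\<forall>n. w n \<in> H1 \<and> continuous_on Omega (w n) \<and> norm_H1 (\<lambda>x. w n x - u x) < l n \<and> (\<forall>i. L2.nrm \<mu> (jump (w n) i) < l n)" ..
  then have w: "\<And>n. w n \<in> H1" "\<And>n. continuous_on Omega (w n)"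
    "\<And>n. norm_H1 (\<lambda>x. w n x - u x) < l n" "\<And>n i. L2.nrm \<mu> (jump (w n) i) < l n" by auto
  have l0: "l \<longlonglongrightarrow> 0" unfolding l_def[abs_def] by (rule LIMSEQ_inverse_real_of_nat)
  have "(\<lambda>n. norm_H1 (\<lambda>x. w n x - u x)) \<longlonglongrightarrow> 0"
    by (rule Lim_null_comparison[OF _ l0])
      (use w(3) in \<open>auto simp: norm_H1_def intro!: always_eventually less_imp_le\<close>)
  moreover have "(\<lambda>n. L2.nrm \<mu> (jump (w n) i)) \<longlonglongrightarrow> 0" for i
    by (rule Lim_null_comparison[OF _ l0])
      (use w(4) L2.nrm_nonneg[OF sq_int_jump[OF w(2)]] in \<open>auto intro!: always_eventually less_imp_le\<close>)
  ultimately show ?thesis using u w unfolding H1P_def periodic_traces_jump by blast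
qed

lemma H1P_add:
  fixes u v :: "real ^ 'd::finite \<Rightarrow> complex"
  assumes "u \<in> H1P" "v \<in> H1P" shows "(\<lambda>x. u x + v x) \<in> H1P"
proof (rule H1P_I)
  note h = H1P_H1[OF assms(1)] H1P_H1[OF assms(2)]
  show "(\<lambda>x. u x + v x) \<in> H1" by (rule H1_add(1)[OF h])
  fix e :: real assume "0 < e"
  then have e2: "0 < e / 2" by simp
  obtain w where w: "w \<in> H1" "continuous_on Omega w" "norm_H1 (\<lambda>x. w x - u x) < e / 2" "\<And>i. L2.nrm \<mu> (jump w i) < e / 2"
    using H1P_approx[OF assms(1) e2] by blast
  obtain w' where w': "w' \<in> H1" "continuous_on Omega w'" "norm_H1 (\<lambda>x. w' x - v x) < e / 2" "\<And>i. L2.nrm \<mu> (jump w' i) < e / 2"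
    using H1P_approx[OF assms(2) e2] by blast
  have d: "(\<lambda>x. w x - u x) \<in> H1" "(\<lambda>x. w' x - v x) \<in> H1" by (intro HN.diff_closed w w' h)+
  have "norm_H1 (\<lambda>x. (w x + w' x) - (u x + v x)) \<le> norm_H1 (\<lambda>x. w x - u x) + norm_H1 (\<lambda>x. w' x - v x)"
    using HN.nrm_triangle[OF d] d by (simp add: norm_H1_eq H1_add(1) add_diff_add)
  then have n: "norm_H1 (\<lambda>x. (w x + w' x) - (u x + v x)) < e" using w w' by linarith
  have "L2.nrm \<mu> (jump (\<lambda>x. w x + w' x) i) < e" for i
  proof -
    have "jump (\<lambda>x. w x + w' x) i = (\<lambda>x. jump w i x + jump w' i x)" by (simp add: jump_def fun_eq_iff)
    then have "L2.nrm \<mu> (jump (\<lambda>x. w x + w' x) i) \<le> L2.nrm \<mu> (jump w i) + L2.nrm \<mu> (jump w' i)"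
      using L2.nrm_triangle[OF sq_int_jump sq_int_jump, OF w(2) w'(2)] by simp
    then show ?thesis using w(4)[of i] w'(4)[of i] by linarith
  qed
  then show "\<exists>w. w \<in> H1 \<and> continuous_on Omega w \<and> norm_H1 (\<lambda>x. w x - (u x + v x)) < e \<and> (\<forall>i. L2.nrm \<mu> (jump w i) < e)"
    using n H1_add(1)[OF w(1) w'(1)] continuous_on_add[OF w(2) w'(2)] by blast
qed

text \<open>Periodicity survives a map that respects differences, preserves continuity and is
  bounded both in the \<open>H1\<close> norm and on jumps. Applied to multiplication by scalars and
  by smooth periodic functions.\<close>

lemma H1P_bounded_op:
  fixes A :: "(real ^ 'd::finite \<Rightarrow> complex) \<Rightarrow> (real ^ 'd \<Rightarrow> complex)"
  assumes A: "\<And>v. v \<in> H1 \<Longrightarrow> A v \<in> H1" "\<And>v. continuous_on Omega v \<Longrightarrow> continuous_on Omega (A v)"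
    and lin: "\<And>v w. v \<in> H1 \<Longrightarrow> w \<in> H1 \<Longrightarrow> (\<lambda>x. A v x - A w x) = A (\<lambda>x. v x - w x)"
    and bound: "\<And>v. v \<in> H1 \<Longrightarrow> norm_H1 (A v) \<le> K * norm_H1 v"
    and jmp: "\<And>v i. continuous_on Omega v \<Longrightarrow> L2.nrm \<mu> (jump (A v) i) \<le> K * L2.nrm \<mu> (jump v i)"
    and K: "0 < K" and u: "u \<in> H1P"
  shows "A u \<in> H1P"
proof (rule H1P_I)
  have h: "u \<in> H1" by (rule H1P_H1[OF u])
  show "A u \<in> H1" by (rule A(1)[OF h])
  fix e :: real assume "0 < e"
  then have eK: "0 < e / K" using K by simp
  obtain w where w: "w \<in> H1" "continuous_on Omega w" "norm_H1 (\<lambda>x. w x - u x) < e / K" "\<And>i. L2.nrm \<mu> (jump w i) < e / K"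
    using H1P_approx[OF u eK] by blast
  have "norm_H1 (\<lambda>x. A w x - A u x) \<le> K * norm_H1 (\<lambda>x. w x - u x)"
    unfolding lin[OF w(1) h] by (intro bound HN.diff_closed w h)
  also have "\<dots> < e" using w(3) K by (simp add: field_simps)
  finally have n: "norm_H1 (\<lambda>x. A w x - A u x) < e" .
  have "L2.nrm \<mu> (jump (A w) i) < e" for i
  proof -
    have "K * L2.nrm \<mu> (jump w i) < e" using w(4)[of i] K by (simp add: field_simps)
    then show ?thesis using jmp[OF w(2), of i] by linarith
  qed
  then show "\<exists>w. w \<in> H1 \<and> continuous_on Omega w \<and> norm_H1 (\<lambda>x. w x - A u x) < e \<and> (\<forall>i. L2.nrm \<mu> (jump w i) < e)"
    using n A(1)[OF w(1)] A(2)[OF w(2)] by blast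
qed

lemma H1P_cmult:
  fixes u :: "real ^ 'd::finite \<Rightarrow> complex"
  assumes "u \<in> H1P" shows "(\<lambda>x. z * u x) \<in> H1P"
\<comment> \<open>The summand \<open>1\<close> keeps the bound positive for
  \<open>z = 0\<close>.\<close>
proof (rule H1P_bounded_op[where A = "\<lambda>u x. z * u x" and K = "norm z + 1"])
  show "norm_H1 (\<lambda>x. z * v x) \<le> (norm z + 1) * norm_H1 v" if "v \<in> H1" for v :: "real ^ 'd \<Rightarrow> complex"
    using HN.nrm_cmult[OF that, of z] HN.nrm_nonneg[OF that] that
    by (simp add: norm_H1_eq H1_cmult(1) distrib_right)
  show "L2.nrm \<mu> (jump (\<lambda>x. z * v x) i) \<le> (norm z + 1) * L2.nrm \<mu> (jump v i)"
    if "continuous_on Omega v" for v :: "real ^ 'd \<Rightarrow> complex" and i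
  proof (rule L2_nrm_mono)
    show "AE x in \<mu>. norm (jump (\<lambda>x. z * v x) i x) \<le> (norm z + 1) * norm (jump v i x)"
      by (simp add: jump_def right_diff_distrib[symmetric] norm_mult distrib_right)
  qed (use that in \<open>auto intro!: sq_int_jump continuous_intros\<close>)
  show "0 < norm z + 1" using norm_ge_zero[of z] by linarith
qed (use assms in \<open>auto simp: right_diff_distrib intro: H1_cmult continuous_intros\<close>)

lemma H1P_zero: "(\<lambda>x. 0) \<in> (H1P :: (real ^ 'd::finite \<Rightarrow> complex) set)"
proof (rule H1P_I[OF H1_zero])
  fix e :: real assume "0 < e"
  let ?z = "\<lambda>_ :: real ^ 'd. 0 :: complex"
  have "norm_H1 ?z = 0" by (simp add: norm_H1_eq H1_zero HN.nrm_zero)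
  moreover have "jump ?z i = ?z" for i by (simp add: jump_def fun_eq_iff)
  moreover have "L2.nrm \<mu> ?z = 0" by (rule L2.nrm_zero)
  ultimately show "\<exists>w :: real ^ 'd \<Rightarrow> complex. w \<in> H1 \<and> continuous_on Omega w \<and> norm_H1 (\<lambda>x. w x - 0) < e \<and> (\<forall>i. L2.nrm \<mu> (jump w i) < e)"
    using \<open>0 < e\<close> H1_zero by (intro exI[of _ ?z]) simp
qed

lemma H1P_scale: "(u :: real ^ 'd::finite \<Rightarrow> complex) \<in> H1P \<Longrightarrow> (\<lambda>x. r *\<^sub>R u x) \<in> H1P"
  using H1P_cmult[of u "complex_of_real r"] by (simp add: scaleR_conv_of_real[where 'a = complex])

lemma H1P_diff: "(u :: real ^ 'd::finite \<Rightarrow> complex) \<in> H1P \<Longrightarrow> v \<in> H1P \<Longrightarrow> (\<lambda>x. u x - v x) \<in> H1P"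
  using H1P_add[of u "\<lambda>x. -1 * v x"] H1P_cmult[of v "-1"] by simp

lemma H1P_sum:
  "(\<And>i. i \<in> I \<Longrightarrow> f i \<in> (H1P :: (real ^ 'd::finite \<Rightarrow> complex) set)) \<Longrightarrow> (\<lambda>x. \<Sum>i\<in>I. f i x) \<in> H1P"
proof (induction I rule: infinite_finite_induct)
  case (insert i I)
  then show ?case using H1P_add[of "f i" "\<lambda>x. \<Sum>i\<in>I. f i x"] by simp
qed (simp_all add: H1P_zero)

text \<open>Functions and gradients converge separately in \<open>L2\<close>, and closedness of the
  weak gradient identifies the second limit. Periodicity of the limit comes from a continuous
  approximant of a late member of the sequence.\<close>

lemma H1P_complete:
  fixes w :: "nat \<Rightarrow> real ^ 'd::finite \<Rightarrow> complex"
  assumes w: "\<And>n. w n \<in> H1P"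
    and cauchy: "\<And>e. e > 0 \<Longrightarrow> \<exists>n0. \<forall>m\<ge>n0. \<forall>n\<ge>n0. norm_H1 (\<lambda>x. w m x - w n x) < e"
  shows "\<exists>u\<in>H1P. (\<lambda>n. norm_H1 (\<lambda>x. w n x - u x)) \<longlonglongrightarrow> 0"
proof -
  have h: "w n \<in> H1" for n by (rule H1P_H1[OF w])
  have gd: "L2.nrm \<mu> (grad (\<lambda>x. w m x - w n x)) = L2.nrm \<mu> (\<lambda>x. grad (w m) x - grad (w n) x)" for m n
  proof (rule L2_nrm_cong_AE)
    show "AE x in \<mu>. grad (\<lambda>x. w m x - w n x) x = grad (w m) x - grad (w n) x" by (rule H1_diff(2)[OF h h])
  qed (use H1_D(2)[OF HN.diff_closed[OF h h]] L2.diff_closed[OF H1_D(2)[OF h] H1_D(2)[OF h]] in \<open>auto simp: sq_int_def\<close>)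
  have "\<exists>u\<in>sq_int \<mu>. (\<lambda>n. L2.nrm \<mu> (\<lambda>x. w n x - u x)) \<longlonglongrightarrow> 0"
  proof (rule L2_complete[OF finite_measure_Omega H1_D(1)[OF h]])
    fix e :: real assume "e > 0"
    then obtain n0 where "\<forall>m\<ge>n0. \<forall>n\<ge>n0. norm_H1 (\<lambda>x. w m x - w n x) < e" using cauchy by blast
    then show "\<exists>n0. \<forall>m\<ge>n0. \<forall>n\<ge>n0. L2.nrm \<mu> (\<lambda>x. w m x - w n x) < e"
      by (intro exI[of _ n0] allI impI le_less_trans[OF norm_H1_ge(1)]) simp
  qed
  then obtain u where u: "u \<in> sq_int \<mu>" "(\<lambda>n. L2.nrm \<mu> (\<lambda>x. w n x - u x)) \<longlonglongrightarrow> 0" by blast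
  have "\<exists>g\<in>sq_int \<mu>. (\<lambda>n. L2.nrm \<mu> (\<lambda>x. grad (w n) x - g x)) \<longlonglongrightarrow> 0"
  proof (rule L2_complete[OF finite_measure_Omega H1_D(2)[OF h]])
    fix e :: real assume "e > 0"
    then obtain n0 where "\<forall>m\<ge>n0. \<forall>n\<ge>n0. norm_H1 (\<lambda>x. w m x - w n x) < e" using cauchy by blast
    then show "\<exists>n0. \<forall>m\<ge>n0. \<forall>n\<ge>n0. L2.nrm \<mu> (\<lambda>x. grad (w m) x - grad (w n) x) < e"
      unfolding gd[symmetric] by (intro exI[of _ n0] allI impI le_less_trans[OF norm_H1_ge(2)]) simp
  qed
  then obtain g where g: "g \<in> sq_int \<mu>" "(\<lambda>n. L2.nrm \<mu> (\<lambda>x. grad (w n) x - g x)) \<longlonglongrightarrow> 0" by blast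
  have wg: "weak_gradient u g"
    by (rule weak_gradient_limit[OF H1_D(1)[OF h] H1_D(2)[OF h] H1_D(3)[OF h] u(1) g(1) u(2) g(2)])
  note uH = H1_I[OF u(1) g(1) wg]
  have gdu: "L2.nrm \<mu> (grad (\<lambda>x. w n x - u x)) = L2.nrm \<mu> (\<lambda>x. grad (w n) x - g x)" for n
  proof (rule L2_nrm_cong_AE)
    show "AE x in \<mu>. grad (\<lambda>x. w n x - u x) x = grad (w n) x - g x"
      using H1_diff(2)[OF h uH(1), of n] uH(2) by eventually_elim simp
  qed (use H1_D(2)[OF HN.diff_closed[OF h uH(1)]] L2.diff_closed[OF H1_D(2)[OF h] g(1)] in \<open>auto simp: sq_int_def\<close>)
  have lim: "(\<lambda>n. norm_H1 (\<lambda>x. w n x - u x)) \<longlonglongrightarrow> 0"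
  proof (rule Lim_null_comparison)
    show "(\<lambda>n. L2.nrm \<mu> (\<lambda>x. w n x - u x) + L2.nrm \<mu> (\<lambda>x. grad (w n) x - g x)) \<longlonglongrightarrow> 0"
      using tendsto_add[OF u(2) g(2)] by simp
    have "norm (norm_H1 (\<lambda>x. w n x - u x)) \<le> L2.nrm \<mu> (\<lambda>x. w n x - u x) + L2.nrm \<mu> (\<lambda>x. grad (w n) x - g x)" for n
      using norm_H1_le_sum[OF HN.diff_closed[OF h uH(1)], of n] by (simp add: gdu norm_H1_def)
    then show "\<forall>\<^sub>F n in sequentially. norm (norm_H1 (\<lambda>x. w n x - u x)) \<le> L2.nrm \<mu> (\<lambda>x. w n x - u x) + L2.nrm \<mu> (\<lambda>x. grad (w n) x - g x)"
      by simp
  qed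
  have "u \<in> H1P"
  proof (rule H1P_I[OF uH(1)])
    fix e :: real assume "0 < e"
    then have e2: "0 < e / 2" by simp
    obtain n where n: "norm_H1 (\<lambda>x. w n x - u x) < e / 2"
      using order_tendstoD(2)[OF lim e2] eventually_happens by fastforce
    obtain v where v: "v \<in> H1" "continuous_on Omega v" "norm_H1 (\<lambda>x. v x - w n x) < e / 2" "\<And>i. L2.nrm \<mu> (jump v i) < e / 2"
      using H1P_approx[OF w e2] by blast
    have "norm_H1 (\<lambda>x. v x - u x) \<le> norm_H1 (\<lambda>x. v x - w n x) + norm_H1 (\<lambda>x. w n x - u x)"
      using HN.nrm_triangle3[OF v(1) h uH(1)] by (simp add: norm_H1_eq HN.diff_closed v h uH(1))
    then have "norm_H1 (\<lambda>x. v x - u x) < e" using n v(3) by linarith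
    moreover have "L2.nrm \<mu> (jump v i) < e" for i using v(4)[of i] \<open>0 < e\<close> by linarith
    ultimately show "\<exists>w. w \<in> H1 \<and> continuous_on Omega w \<and> norm_H1 (\<lambda>x. w x - u x) < e \<and> (\<forall>i. L2.nrm \<mu> (jump w i) < e)"
      using v by blast
  qed
  with lim show ?thesis by blast
qed

section \<open>Smooth multipliers and functions supported inside the cube\<close>

lemma norm_vec_le_sum: "norm (p :: complex ^ 'd) \<le> (\<Sum>i\<in>UNIV. norm (p $ i))"
  unfolding norm_vec_def by (rule L2_set_le_sum) simp

lemma H1_smooth_mult:
  fixes u :: "real ^ 'd::finite \<Rightarrow> complex"
  assumes u: "u \<in> H1" and \<eta>: "smooth_fn \<eta>"
  shows "(\<lambda>x. \<eta> x *\<^sub>R u x) \<in> H1"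
    and "AE x in \<mu>. norm (grad (\<lambda>x. \<eta> x *\<^sub>R u x) x) \<le> \<bar>\<eta> x\<bar> * norm (grad u x) + (\<Sum>i\<in>UNIV. \<bar>pd \<eta> i x\<bar>) * norm (u x)"
proof -
  note s = smooth_fn_has_derivative[OF \<eta>]
  define G where "G = (\<lambda>x. \<chi> i. \<eta> x *\<^sub>R grad u x $ i + pd \<eta> i x *\<^sub>R u x)"
  have 1: "(\<lambda>x. \<eta> x *\<^sub>R u x) \<in> sq_int \<mu>" by (intro sq_int_mult_cont s H1_D(1) u)
  have 2: "G \<in> sq_int \<mu>"
    unfolding G_def by (intro sq_int_vec sq_int_add sq_int_mult_cont s H1_D(1) u sq_int_nth H1_D(2))
  have 3: "weak_gradient (\<lambda>x. \<eta> x *\<^sub>R u x) G"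
    unfolding G_def by (intro weak_gradient_smooth_mult H1_D u \<eta>)
  show "(\<lambda>x. \<eta> x *\<^sub>R u x) \<in> H1" by (rule H1_I(1)[OF 1 2 3])
  have "norm (G x) \<le> \<bar>\<eta> x\<bar> * norm (grad u x) + (\<Sum>i\<in>UNIV. \<bar>pd \<eta> i x\<bar>) * norm (u x)" for x
  proof -
    have "G x = \<eta> x *\<^sub>R grad u x + (\<chi> i. pd \<eta> i x *\<^sub>R u x)" by (simp add: G_def vec_eq_iff)
    then have "norm (G x) \<le> norm (\<eta> x *\<^sub>R grad u x) + norm (\<chi> i. pd \<eta> i x *\<^sub>R u x)"
      by (metis norm_triangle_ineq)
    also have "norm (\<chi> i. pd \<eta> i x *\<^sub>R u x) \<le> (\<Sum>i\<in>UNIV. \<bar>pd \<eta> i x\<bar> * norm (u x))"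
      using norm_vec_le_sum[of "\<chi> i. pd \<eta> i x *\<^sub>R u x"] by simp
    finally show ?thesis by (simp add: sum_distrib_right)
  qed
  then show "AE x in \<mu>. norm (grad (\<lambda>x. \<eta> x *\<^sub>R u x) x) \<le> \<bar>\<eta> x\<bar> * norm (grad u x) + (\<Sum>i\<in>UNIV. \<bar>pd \<eta> i x\<bar>) * norm (u x)"
    using H1_I(2)[OF 1 2 3] by (auto elim: eventually_mono)
qed

text \<open>By \<open>per\<close> the common boundary value of \<open>\<eta>\<close> factors out of
  the jump, so jumps are only multiplied by bounded numbers.\<close>

lemma H1P_smooth_mult:
  fixes u :: "real ^ 'd::finite \<Rightarrow> complex"
  assumes u: "u \<in> H1P" and \<eta>: "smooth_fn \<eta>"
    and per: "\<And>i x. x \<in> Omega \<Longrightarrow> \<eta> (set_coord i 0 x) = \<eta> (set_coord i (2 * pi) x)"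
  shows "(\<lambda>x. \<eta> x *\<^sub>R u x) \<in> H1P"
proof -
  note s = smooth_fn_has_derivative[OF \<eta>]
  have "bounded ((\<lambda>x. \<eta> x) ` Omega)" by (intro compact_imp_bounded compact_continuous_image s compact_Omega)
  then obtain A where A: "\<And>x. x \<in> Omega \<Longrightarrow> norm (\<eta> x) \<le> A" unfolding bounded_iff by blast
  have "bounded ((\<lambda>x. \<Sum>i\<in>UNIV. \<bar>pd \<eta> i x\<bar>) ` Omega)"
    by (intro compact_imp_bounded compact_continuous_image compact_Omega continuous_intros s)
  then obtain B where B: "\<And>x. x \<in> Omega \<Longrightarrow> norm (\<Sum>i\<in>UNIV. \<bar>pd \<eta> i x\<bar>) \<le> B" unfolding bounded_iff by blast
  \<comment> \<open>\<open>2 * \<bar>A\<bar> + \<bar>B\<bar>\<close> bounds the product in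
    \<open>H1\<close>, \<open>\<bar>A\<bar>\<close> bounds the jumps, and the summand
    \<open>1\<close> makes the constant positive.\<close>
  define K where "K = 2 * \<bar>A\<bar> + \<bar>B\<bar> + 1"
  show ?thesis
  proof (rule H1P_bounded_op[where A = "\<lambda>u x. \<eta> x *\<^sub>R u x" and K = K])
    show "norm_H1 (\<lambda>x. \<eta> x *\<^sub>R v x) \<le> K * norm_H1 v" if v: "v \<in> H1" for v :: "real ^ 'd \<Rightarrow> complex"
    proof -
      note h = H1_smooth_mult[OF v \<eta>]
      have a: "L2.nrm \<mu> (\<lambda>x. \<eta> x *\<^sub>R v x) \<le> \<bar>A\<bar> * L2.nrm \<mu> v"
      proof (rule L2_nrm_mono[OF H1_D(1)[OF v] H1_D(1)[OF h(1)]])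
        have "norm (\<eta> x *\<^sub>R v x) \<le> \<bar>A\<bar> * norm (v x)" if "x \<in> Omega" for x
          using mult_right_mono[OF order_trans[OF A[OF that] abs_ge_self] norm_ge_zero, of "v x"] by simp
        then show "AE x in \<mu>. norm (\<eta> x *\<^sub>R v x) \<le> \<bar>A\<bar> * norm (v x)" by (auto intro!: AE_I2)
      qed simp
      let ?q = "\<lambda>x. \<bar>A\<bar> *\<^sub>R norm (grad v x) + \<bar>B\<bar> *\<^sub>R norm (v x)"
      have n: "(\<lambda>x. norm (grad v x)) \<in> sq_int \<mu>" "(\<lambda>x. norm (v x)) \<in> sq_int \<mu>"
        using H1_D[OF v] by (auto simp: sq_int_def)
      have q: "?q \<in> sq_int \<mu>" by (intro sq_int_add sq_int_scale n)
      have b: "L2.nrm \<mu> (grad (\<lambda>x. \<eta> x *\<^sub>R v x)) \<le> 1 * L2.nrm \<mu> ?q"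
      proof (rule L2_nrm_mono[OF q H1_D(2)[OF h(1)]])
        have "\<bar>\<eta> x\<bar> * norm (grad v x) + (\<Sum>i\<in>UNIV. \<bar>pd \<eta> i x\<bar>) * norm (v x) \<le> \<bar>A\<bar> * norm (grad v x) + \<bar>B\<bar> * norm (v x)"
          if "x \<in> Omega" for x
          using A[OF that] B[OF that] by (intro add_mono mult_right_mono) auto
        then have "AE x in \<mu>. \<bar>\<eta> x\<bar> * norm (grad v x) + (\<Sum>i\<in>UNIV. \<bar>pd \<eta> i x\<bar>) * norm (v x) \<le> \<bar>A\<bar> * norm (grad v x) + \<bar>B\<bar> * norm (v x)"
          by (auto intro!: AE_I2)
        then show "AE x in \<mu>. norm (grad (\<lambda>x. \<eta> x *\<^sub>R v x) x) \<le> 1 * norm (?q x)"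
          using h(2) by eventually_elim simp
      qed simp
      have "L2.nrm \<mu> ?q \<le> \<bar>A\<bar> * L2.nrm \<mu> (\<lambda>x. norm (grad v x)) + \<bar>B\<bar> * L2.nrm \<mu> (\<lambda>x. norm (v x))"
        using L2.nrm_triangle[OF sq_int_scale sq_int_scale, OF n, of "\<bar>A\<bar>" "\<bar>B\<bar>"]
          L2.nrm_scale[OF n(1), of "\<bar>A\<bar>"] L2.nrm_scale[OF n(2), of "\<bar>B\<bar>"] by simp
      also have "L2.nrm \<mu> (\<lambda>x. norm (grad v x)) = L2.nrm \<mu> (grad v)" unfolding L2_nrm_eq by simp
      also have "L2.nrm \<mu> (\<lambda>x. norm (v x)) = L2.nrm \<mu> v" unfolding L2_nrm_eq by simp
      finally have "norm_H1 (\<lambda>x. \<eta> x *\<^sub>R v x) \<le> \<bar>A\<bar> * L2.nrm \<mu> v + (\<bar>A\<bar> * L2.nrm \<mu> (grad v) + \<bar>B\<bar> * L2.nrm \<mu> v)"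
        using a b norm_H1_le_sum[OF h(1)] by linarith
      also have "\<dots> \<le> \<bar>A\<bar> * norm_H1 v + (\<bar>A\<bar> * norm_H1 v + \<bar>B\<bar> * norm_H1 v)"
        by (intro add_mono mult_left_mono norm_H1_ge) auto
      also have "\<dots> \<le> K * norm_H1 v"
        by (simp add: K_def distrib_right norm_H1_def)
      finally show ?thesis .
    qed
    show "L2.nrm \<mu> (jump (\<lambda>x. \<eta> x *\<^sub>R v x) i) \<le> K * L2.nrm \<mu> (jump v i)"
      if v: "continuous_on Omega v" for v :: "real ^ 'd \<Rightarrow> complex" and i
    proof (rule L2_nrm_mono[OF sq_int_jump[OF v] sq_int_jump])
      show "continuous_on Omega (\<lambda>x. \<eta> x *\<^sub>R v x)" by (intro continuous_intros s v)
      have "norm (jump (\<lambda>x. \<eta> x *\<^sub>R v x) i x) \<le> K * norm (jump v i x)" if "x \<in> Omega" for x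
      proof -
        have m: "set_coord i (2 * pi) x \<in> Omega" by (rule set_coord_Omega[OF that]) auto
        have "jump (\<lambda>x. \<eta> x *\<^sub>R v x) i x = \<eta> (set_coord i (2 * pi) x) *\<^sub>R jump v i x"
          by (simp add: jump_def per[OF that] scaleR_diff_right)
        moreover have "\<bar>\<eta> (set_coord i (2 * pi) x)\<bar> \<le> K" using A[OF m] by (simp add: K_def)
        ultimately show ?thesis by (simp add: mult_right_mono)
      qed
      then show "AE x in \<mu>. norm (jump (\<lambda>x. \<eta> x *\<^sub>R v x) i x) \<le> K * norm (jump v i x)" by (auto intro!: AE_I2)
    qed (simp add: K_def)
    show "continuous_on Omega (\<lambda>x. \<eta> x *\<^sub>R v x)" if "continuous_on Omega v" for v :: "real ^ 'd \<Rightarrow> complex"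
      by (intro continuous_intros s that)
  qed (use u \<eta> H1_smooth_mult(1) in \<open>auto simp: K_def scaleR_diff_right add_pos_nonneg\<close>)
qed

text \<open>The function is continuous and vanishes on the faces, so it serves as its own
  approximating sequence, with zero jumps.\<close>

lemma H1P_C1_compact_support:
  fixes b :: "real ^ 'd::finite \<Rightarrow> real"
  assumes b: "\<And>x. (b has_derivative (\<lambda>h. \<Sum>i\<in>UNIV. h $ i * P i x)) (at x)"
    and P: "\<And>i. continuous_on UNIV (P i)"
    and S: "compact S" "S \<subseteq> interior Omega" "\<And>x. x \<notin> S \<Longrightarrow> b x = 0" "\<And>i x. x \<notin> S \<Longrightarrow> P i x = 0"
  shows "(\<lambda>x. complex_of_real (b x)) \<in> H1P"
    and "AE x in \<mu>. grad (\<lambda>x. complex_of_real (b x)) x = (\<chi> i. complex_of_real (P i x))"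
proof -
  have S': "S \<subseteq> Omega" using S(2) interior_subset by blast
  have bc: "continuous_on A b" for A using b by (meson has_derivative_at_withinI has_derivative_continuous_on)
  have Pc: "continuous_on A (P i)" for A i using P continuous_on_subset by blast
  have c: "continuous_on Omega (\<lambda>x. complex_of_real (b x))" by (intro continuous_intros bc)
  have "(\<lambda>x. complex_of_real (b x)) \<in> sq_int \<mu>" "(\<lambda>x. \<chi> i. complex_of_real (P i x)) \<in> sq_int \<mu>"
    by (intro sq_int_continuous c continuous_intros Pc)+
  moreover have "weak_gradient (\<lambda>x. complex_of_real (b x)) (\<lambda>x. \<chi> i. complex_of_real (P i x))"
    by (rule weak_gradient_C1_compact_support[OF b P S(1) S']) (simp_all add: S)
  ultimately have h: "(\<lambda>x. complex_of_real (b x)) \<in> H1"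
    "AE x in \<mu>. grad (\<lambda>x. complex_of_real (b x)) x = (\<chi> i. complex_of_real (P i x))"
    by (rule H1_I)+
  show "AE x in \<mu>. grad (\<lambda>x. complex_of_real (b x)) x = (\<chi> i. complex_of_real (P i x))" by (rule h(2))
  have "jump (\<lambda>x. complex_of_real (b x)) i = (\<lambda>_. 0)" for i
  proof
    fix x
    have "set_coord i a x \<notin> interior Omega" if "a = 0 \<or> a = 2 * pi" for a
      using that by (auto simp: set_coord_def mem_interior_Omega intro!: exI[of _ i])
    then have "set_coord i 0 x \<notin> S" "set_coord i (2 * pi) x \<notin> S"
      using S(2) by blast+
    then show "jump (\<lambda>x. complex_of_real (b x)) i x = 0" by (simp add: jump_def S(3))
  qed
  moreover have "L2.nrm \<mu> (\<lambda>_ :: real ^ 'd. 0 :: complex) = 0" by (rule L2.nrm_zero)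
  moreover have "norm_H1 (\<lambda>x. complex_of_real (b x) - complex_of_real (b x)) = 0"
    by (simp add: norm_H1_eq H1_zero HN.nrm_zero)
  ultimately show "(\<lambda>x. complex_of_real (b x)) \<in> H1P"
    using h(1) c by (intro H1P_I h exI[of _ "\<lambda>x. complex_of_real (b x)"]) simp
qed

section \<open>Geometry of periodic simplicial meshes\<close>

lemma per_eq_refl: "per_eq x x"
  unfolding per_eq_def by (auto intro: exI[of _ 0])

lemma per_eq_sym: assumes "per_eq x y" shows "per_eq y x"
  unfolding per_eq_def
proof
  fix i
  obtain k :: int where "x $ i - y $ i = 2 * pi * of_int k" using assms unfolding per_eq_def by blast
  then show "\<exists>k :: int. y $ i - x $ i = 2 * pi * of_int k" by (intro exI[of _ "- k"]) simp
qed

lemma per_eq_trans: assumes "per_eq x y" "per_eq y w" shows "per_eq x w"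
  unfolding per_eq_def
proof
  fix i
  obtain k l :: int where "x $ i - y $ i = 2 * pi * of_int k" "y $ i - w $ i = 2 * pi * of_int l"
    using assms unfolding per_eq_def by blast
  then show "\<exists>k :: int. x $ i - w $ i = 2 * pi * of_int k"
    by (intro exI[of _ "k + l"]) (simp add: distrib_left)
qed

lemma per_eq_diff_0: "per_eq x y \<longleftrightarrow> per_eq (x - y) 0"
  by (simp add: per_eq_def)

lemma per_ext_self: "x \<in> K \<Longrightarrow> x \<in> per_ext K"
  unfolding per_ext_def using per_eq_refl by blast

lemma Int_per_ext_commute: "A \<inter> per_ext B \<noteq> {} \<longleftrightarrow> B \<inter> per_ext A \<noteq> {}"
  unfolding per_ext_def using per_eq_sym by blast

lemma Omega_representative: "\<exists>y :: real ^ 'd::finite. y \<in> Omega \<and> per_eq x y"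
proof (intro exI conjI)
  let ?k = "\<lambda>i. \<lfloor>x $ i / (2 * pi)\<rfloor>"
  let ?y = "\<chi> i. x $ i - 2 * pi * of_int (?k i)"
  have "of_int (?k i) * (2 * pi) \<le> x $ i \<and> x $ i \<le> (of_int (?k i) + 1) * (2 * pi)" for i
  proof -
    have f: "of_int (?k i) \<le> x $ i / (2 * pi)" "x $ i / (2 * pi) \<le> of_int (?k i) + 1" by linarith+
    show ?thesis
      using mult_right_mono[OF f(1), of "2 * pi"] mult_right_mono[OF f(2), of "2 * pi"] by simp
  qed
  then show "?y \<in> Omega" by (simp add: mem_Omega algebra_simps)
  show "per_eq x ?y" by (auto simp: per_eq_def)
qed

section \<open>Affine functions on simplices\<close>

definition affine_on :: "'a::euclidean_space set \<Rightarrow> ('a \<Rightarrow> real) \<Rightarrow> bool"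
  where "affine_on T f \<longleftrightarrow> (\<exists>\<beta> \<alpha>. \<forall>x\<in>T. f x = \<beta> + \<alpha> \<bullet> x)"

text \<open>The bounds cut out two half-spaces, which are convex and contain the vertices, hence the
  hull.\<close>

lemma affine_on_bounds:
  assumes "affine_on T f" "T = convex hull E" "\<And>v. v \<in> E \<Longrightarrow> lo \<le> f v \<and> f v \<le> hi" "x \<in> T"
  shows "lo \<le> f x \<and> f x \<le> hi"
proof -
  obtain \<beta> \<alpha> where f: "\<And>x. x \<in> T \<Longrightarrow> f x = \<beta> + \<alpha> \<bullet> x" using assms(1) unfolding affine_on_def by blast
  let ?S = "{x. lo - \<beta> \<le> \<alpha> \<bullet> x} \<inter> {x. \<alpha> \<bullet> x \<le> hi - \<beta>}"
  have "E \<subseteq> T" unfolding assms(2) by (rule hull_subset)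
  have "E \<subseteq> ?S"
  proof
    fix v assume v: "v \<in> E"
    then have "f v = \<beta> + \<alpha> \<bullet> v" using f \<open>E \<subseteq> T\<close> by blast
    then show "v \<in> ?S" using assms(3)[OF v] by simp
  qed
  moreover have "convex ?S" by (intro convex_Int convex_halfspace_le convex_halfspace_ge[of "lo - \<beta>" \<alpha>, simplified])
  ultimately have "convex hull E \<subseteq> ?S" by (rule hull_minimal)
  then show ?thesis using assms(2,4) f[OF assms(4)] by auto
qed

lemma affine_on_eq:
  assumes "affine_on T f" "T = convex hull E" "\<And>v. v \<in> E \<Longrightarrow> f v = c" "x \<in> T"
  shows "f x = c"
  using affine_on_bounds[OF assms(1,2) _ assms(4), of c c] assms(3) by simp

lemma affine_on_sum:
  assumes "\<And>j. j \<in> J \<Longrightarrow> affine_on T (f j)" shows "affine_on T (\<lambda>x. \<Sum>j\<in>J. f j x)"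
proof -
  have "\<forall>j. \<exists>p. j \<in> J \<longrightarrow> (\<forall>x\<in>T. f j x = fst p + snd p \<bullet> x)"
    using assms unfolding affine_on_def by fastforce
  then have "\<exists>p. \<forall>j. j \<in> J \<longrightarrow> (\<forall>x\<in>T. f j x = fst (p j) + snd (p j) \<bullet> x)" by (rule choice)
  then obtain p where p: "\<And>j x. j \<in> J \<Longrightarrow> x \<in> T \<Longrightarrow> f j x = fst (p j) + snd (p j) \<bullet> x" by blast
  have "(\<Sum>j\<in>J. f j x) = (\<Sum>j\<in>J. fst (p j)) + (\<Sum>j\<in>J. snd (p j)) \<bullet> x" if "x \<in> T" for x
    using p that by (simp add: sum.distrib inner_sum_left)
  then show ?thesis unfolding affine_on_def by blast
qed

text \<open>Crossing the ball along a diameter in the direction of the slope changes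
  \<open>f\<close> by \<open>2 * r * norm \<alpha>\<close>, while the values of \<open>f\<close>
  stay in the unit interval.\<close>

lemma affine_on_slope:
  assumes f: "\<And>x. x \<in> T \<Longrightarrow> f x = \<beta> + \<alpha> \<bullet> x" and "cball c r \<subseteq> T" "0 < r"
    and "\<And>x. x \<in> T \<Longrightarrow> 0 \<le> f x \<and> f x \<le> 1"
  shows "norm \<alpha> \<le> 1 / (2 * r)"
proof (cases "\<alpha> = 0")
  case False
  define u where "u = (r / norm \<alpha>) *\<^sub>R \<alpha>"
  have "norm u = r" using False \<open>0 < r\<close> by (simp add: u_def)
  then have "c + u \<in> T" "c - u \<in> T" using assms(2) by (auto simp: subset_iff dist_norm)
  from this have "(\<beta> + \<alpha> \<bullet> (c + u)) - (\<beta> + \<alpha> \<bullet> (c - u)) \<le> 1" 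
    using f[OF \<open>c + u \<in> T\<close>] f[OF \<open>c - u \<in> T\<close>] assms(4)[OF \<open>c + u \<in> T\<close>] assms(4)[OF \<open>c - u \<in> T\<close>] by linarith
  then have "2 * (\<alpha> \<bullet> u) \<le> 1" by (simp add: inner_simps)
  moreover have "\<alpha> \<bullet> u = r * norm \<alpha>" using False by (simp add: u_def dot_square_norm power2_eq_square)
  ultimately show ?thesis using \<open>0 < r\<close> by (simp add: field_simps)
qed (use assms(3) in simp)

locale mesh =
  fixes \<kappa> H :: real and \<T> :: "(real ^ 'd::finite) set set" and N :: nat and z :: "nat \<Rightarrow> real ^ 'd"
    and \<phi> :: "nat \<Rightarrow> real ^ 'd \<Rightarrow> complex"
  assumes \<kappa>: "0 < \<kappa>" and mesh: "periodic_mesh \<kappa> H \<T>" and nodal: "nodal_basis \<T> N z \<phi>"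
begin

lemma finite_\<T>: "finite \<T>"
  using mesh by (simp add: periodic_mesh_def triangulation_def)

lemma Union_\<T>: "\<Union>\<T> = Omega"
  using mesh by (simp add: periodic_mesh_def)

lemma T_Omega: "T \<in> \<T> \<Longrightarrow> T \<subseteq> Omega"
  using Union_\<T> by blast

lemma T_simplex: "T \<in> \<T> \<Longrightarrow> int CARD('d) simplex T"
  using mesh by (simp add: periodic_mesh_def)

lemma T_compact: "T \<in> \<T> \<Longrightarrow> compact T" and T_convex: "T \<in> \<T> \<Longrightarrow> convex T"
  using T_simplex compact_simplex convex_simplex by blast+

lemma T_hull: "T \<in> \<T> \<Longrightarrow> T = convex hull {v. v extreme_point_of T}"
  by (intro Krein_Milman_Minkowski T_compact T_convex)

lemma T_vertices:
  assumes "T \<in> \<T>"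
  shows "finite {v. v extreme_point_of T}" "card {v. v extreme_point_of T} \<le> CARD('d) + 1"
proof -
  obtain C where C: "finite C" "int (card C) = int CARD('d) + 1" "T = convex hull C"
    using T_simplex[OF assms] unfolding simplex by auto
  have sub: "{v. v extreme_point_of T} \<subseteq> C" using C(3) extreme_point_of_convex_hull by blast
  show "finite {v. v extreme_point_of T}" by (rule finite_subset[OF sub C(1)])
  show "card {v. v extreme_point_of T} \<le> CARD('d) + 1" using card_mono[OF C(1) sub] C(2) by linarith
qed

lemma vertex: "T \<in> \<T> \<Longrightarrow> v extreme_point_of T \<Longrightarrow> v \<in> mesh_vertices \<T> \<and> v \<in> T"
  by (auto simp: mesh_vertices_def extreme_point_of_def)

lemma diameter_pos: assumes "T \<in> \<T>" shows "0 < diameter T"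
proof (rule ccontr)
  assume "\<not> 0 < diameter T"
  then have "dist x y \<le> 0" if "x \<in> T" "y \<in> T" for x y
    using diameter_bounded_bound[OF compact_imp_bounded[OF T_compact[OF assms]] that] by linarith
  then have "\<exists>a. T \<subseteq> {a}" by (metis dist_le_zero_iff insertCI subsetI)
  then have "aff_dim T \<le> 0" using aff_dim_subset aff_dim_sing by metis
  moreover have "aff_dim T = int CARD('d)" by (rule aff_dim_simplex[OF T_simplex[OF assms]])
  moreover have "0 < CARD('d)" by simp
  ultimately show False by linarith
qed

lemma \<T>_nonempty: "\<T> \<noteq> {}"
proof
  assume "\<T> = {}"
  moreover have "(0 :: real ^ 'd) \<in> Omega" by (simp add: mem_Omega)
  ultimately show False using Union_\<T> by blast
qed

lemma H_eq: "H = Max (diameter ` \<T>)"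
  using mesh by (simp add: periodic_mesh_def)

lemma diameter_le_H: "T \<in> \<T> \<Longrightarrow> diameter T \<le> H"
  unfolding H_eq using finite_\<T> by (intro Max_ge) auto

lemma H_pos: "0 < H"
  using \<T>_nonempty diameter_pos diameter_le_H by (metis all_not_in_conv less_le_trans)

text \<open>A crude bound through the sum of the coordinate differences; it serves to absorb surplus
  powers of \<open>H\<close> into constants.\<close>

lemma H_le: "H \<le> 2 * pi * real CARD('d)"
proof -
  have "H \<in> diameter ` \<T>" unfolding H_eq using finite_\<T> \<T>_nonempty by (intro Max_in) auto
  then obtain T where T: "T \<in> \<T>" "H = diameter T" by blast
  have "diameter T \<le> 2 * pi * real CARD('d)"
  proof (rule diameter_le)
    show "norm (x - y) \<le> 2 * pi * real CARD('d)" if "x \<in> T" "y \<in> T" for x y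
    proof -
      have "x \<in> Omega" "y \<in> Omega" using T_Omega[OF T(1)] that by auto
      then have c: "0 \<le> x $ i \<and> x $ i \<le> 2 * pi" "0 \<le> y $ i \<and> y $ i \<le> 2 * pi" for i
        by (simp_all add: mem_Omega)
      have "norm (x - y) \<le> (\<Sum>i\<in>UNIV. \<bar>(x - y) $ i\<bar>)" by (rule norm_le_l1_cart)
      also have "\<dots> \<le> (\<Sum>i\<in>(UNIV :: 'd set). 2 * pi)"
      proof (rule sum_mono)
        fix i show "\<bar>(x - y) $ i\<bar> \<le> 2 * pi" using c(1)[of i] c(2)[of i] by (simp add: abs_le_iff)
      qed
      finally show ?thesis by (simp add: mult.commute)
    qed
  qed simp
  then show ?thesis using T by simp
qed

definition \<rho>\<^sub>0 :: real where "\<rho>\<^sub>0 = \<kappa>\<^sup>2 * H"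

lemma \<rho>0_pos: "0 < \<rho>\<^sub>0" using \<kappa> H_pos by (simp add: \<rho>\<^sub>0_def)

text \<open>Both regularity bounds enter: the ball has radius \<open>\<kappa>\<close> times a
  diameter that is itself at least \<open>\<kappa> * H\<close>. So \<open>\<rho>\<^sub>0\<close> is
  a radius common to all elements.\<close>

lemma inscribed_ball: assumes "T \<in> \<T>" shows "\<exists>c. cball c \<rho>\<^sub>0 \<subseteq> T"
proof -
  obtain c where c: "cball c (\<kappa> * diameter T) \<subseteq> T" using mesh assms by (auto simp: periodic_mesh_def)
  have "\<kappa> * H \<le> diameter T" using mesh assms by (auto simp: periodic_mesh_def)
  then have "\<kappa> * (\<kappa> * H) \<le> \<kappa> * diameter T" using \<kappa> by (intro mult_left_mono) auto
  then have "\<rho>\<^sub>0 \<le> \<kappa> * diameter T" by (simp add: \<rho>\<^sub>0_def power2_eq_square mult.assoc)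
  then show ?thesis using c cball_subset_cball_iff[of c \<rho>\<^sub>0 c "\<kappa> * diameter T"] by auto
qed

lemma dist_le_H: "T \<in> \<T> \<Longrightarrow> x \<in> T \<Longrightarrow> y \<in> T \<Longrightarrow> dist x y \<le> H"
  using diameter_bounded_bound[OF compact_imp_bounded[OF T_compact]] diameter_le_H order_trans by blast

subsection \<open>The hat functions\<close>

text \<open>Singles out the elements on which \<open>\<phi> j\<close> does not vanish identically,
  also across the periodic identification.\<close>

definition touches :: "(real ^ 'd) set \<Rightarrow> nat \<Rightarrow> bool"
  where "touches T j \<longleftrightarrow> (\<exists>v. v extreme_point_of T \<and> per_eq v (z j))"

lemma \<phi>_H1P: "j \<in> {1..N} \<Longrightarrow> \<phi> j \<in> H1P"
  using nodal by (simp add: nodal_basis_def P1_space_def)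

lemma \<phi>_vertex: "j \<in> {1..N} \<Longrightarrow> v \<in> mesh_vertices \<T> \<Longrightarrow> \<phi> j v = (if per_eq v (z j) then 1 else 0)"
  using nodal by (simp add: nodal_basis_def)

lemma vertex_index: "v \<in> mesh_vertices \<T> \<Longrightarrow> \<exists>!j. j \<in> {1..N} \<and> per_eq v (z j)"
  using nodal by (simp add: nodal_basis_def)

lemma z_vertex: "j \<in> {1..N} \<Longrightarrow> z j \<in> mesh_vertices \<T>"
  using nodal by (simp add: nodal_basis_def)

lemma z_inj: "j \<in> {1..N} \<Longrightarrow> k \<in> {1..N} \<Longrightarrow> per_eq (z j) (z k) \<longleftrightarrow> j = k"
  using vertex_index[OF z_vertex[of j]] per_eq_refl by blast

lemma \<phi>_affine:
  assumes "j \<in> {1..N}" "T \<in> \<T>"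
  shows "affine_on T (\<lambda>x. Re (\<phi> j x))" "affine_on T (\<lambda>x. Im (\<phi> j x))"
proof -
  have "\<phi> j \<in> P1_space \<T>" using nodal assms(1) by (simp add: nodal_basis_def)
  then have "\<forall>T\<in>\<T>. \<exists>(a :: complex ^ 'd) b. \<forall>x\<in>T. \<phi> j x = b + (\<Sum>i\<in>UNIV. a $ i * complex_of_real (x $ i))"
    by (simp add: P1_space_def)
  then have "\<exists>(a :: complex ^ 'd) b. \<forall>x\<in>T. \<phi> j x = b + (\<Sum>i\<in>UNIV. a $ i * complex_of_real (x $ i))"
    using assms(2) by (rule bspec)
  then obtain a :: "complex ^ 'd" and b where
    ab': "\<forall>x\<in>T. \<phi> j x = b + (\<Sum>i\<in>UNIV. a $ i * complex_of_real (x $ i))" by (elim exE)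
  note ab = bspec[OF ab']
  have "Re (\<phi> j x) = Re b + (\<chi> i. Re (a $ i)) \<bullet> x" "Im (\<phi> j x) = Im b + (\<chi> i. Im (a $ i)) \<bullet> x" if "x \<in> T" for x
    by (simp_all add: ab[OF that] inner_vec_def)
  then show "affine_on T (\<lambda>x. Re (\<phi> j x))" "affine_on T (\<lambda>x. Im (\<phi> j x))" unfolding affine_on_def by blast+
qed

lemma \<phi>_bounds:
  assumes j: "j \<in> {1..N}" and x: "x \<in> Omega"
  shows "0 \<le> Re (\<phi> j x)" "Re (\<phi> j x) \<le> 1" "Im (\<phi> j x) = 0"
proof -
  obtain T where T: "T \<in> \<T>" "x \<in> T" using x Union_\<T> by blast
  have v: "\<phi> j v = (if per_eq v (z j) then 1 else 0)" if "v \<in> {v. v extreme_point_of T}" for v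
    using \<phi>_vertex[OF j] vertex[OF T(1)] that by simp
  show "0 \<le> Re (\<phi> j x)" "Re (\<phi> j x) \<le> 1"
    using affine_on_bounds[OF \<phi>_affine(1)[OF j T(1)] T_hull[OF T(1)] _ T(2), of 0 1] v by auto
  show "Im (\<phi> j x) = 0"
    by (rule affine_on_eq[OF \<phi>_affine(2)[OF j T(1)] T_hull[OF T(1)] _ T(2)]) (use v in auto)
qed

lemma \<phi>_real: "j \<in> {1..N} \<Longrightarrow> x \<in> Omega \<Longrightarrow> \<phi> j x = complex_of_real (Re (\<phi> j x))"
  using \<phi>_bounds(3) by (simp add: complex_eq_iff)

lemma norm_\<phi>: "j \<in> {1..N} \<Longrightarrow> x \<in> Omega \<Longrightarrow> norm (\<phi> j x) = Re (\<phi> j x)"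
  using \<phi>_bounds(1,3) by (simp add: cmod_def)

lemma \<phi>_zero:
  assumes "j \<in> {1..N}" "T \<in> \<T>" "\<not> touches T j" "x \<in> T" shows "\<phi> j x = 0"
proof -
  have "Re (\<phi> j x) = 0"
  proof (rule affine_on_eq[OF \<phi>_affine(1)[OF assms(1,2)] T_hull[OF assms(2)] _ assms(4)])
    fix v assume "v \<in> {v. v extreme_point_of T}"
    then have v: "v extreme_point_of T" by simp
    then have "\<not> per_eq v (z j)" using assms(3) unfolding touches_def by blast
    then show "Re (\<phi> j v) = 0" using \<phi>_vertex[OF assms(1)] vertex[OF assms(2) v] by simp
  qed
  then show ?thesis using \<phi>_bounds(3)[OF assms(1)] T_Omega[OF assms(2)] assms(4) by (auto simp: complex_eq_iff)
qed

text \<open>At a vertex exactly one hat function equals one, since a vertex class has a unique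
  index; affinity carries this over to the element.\<close>

lemma sum_\<phi>: assumes "x \<in> Omega" shows "(\<Sum>j\<in>{1..N}. Re (\<phi> j x)) = 1"
proof -
  obtain T where T: "T \<in> \<T>" "x \<in> T" using assms Union_\<T> by blast
  show ?thesis
  proof (rule affine_on_eq[OF affine_on_sum T_hull[OF T(1)] _ T(2)])
    fix v assume "v \<in> {v. v extreme_point_of T}"
    then have v: "v \<in> mesh_vertices \<T>" using vertex[OF T(1)] by simp
    obtain j where j: "j \<in> {1..N}" "per_eq v (z j)" "\<And>k. k \<in> {1..N} \<Longrightarrow> per_eq v (z k) \<Longrightarrow> k = j"
      using vertex_index[OF v] by blast
    have "(\<Sum>k\<in>{1..N}. Re (\<phi> k v)) = (\<Sum>k\<in>{1..N}. if k = j then 1 else 0)"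
    proof (rule sum.cong[OF refl])
      fix k assume k: "k \<in> {1..N}"
      show "Re (\<phi> k v) = (if k = j then 1 else 0)"
      proof (cases "k = j")
        case True
        then show ?thesis using \<phi>_vertex[OF k v] j(2) by simp
      next
        case False
        then have "\<not> per_eq v (z k)" using j(3)[OF k] by blast
        then show ?thesis using \<phi>_vertex[OF k v] False by simp
      qed
    qed
    then show "(\<Sum>k\<in>{1..N}. Re (\<phi> k v)) = 1" using j(1) by simp
  qed (use \<phi>_affine(1)[OF _ T(1)] in auto)
qed

text \<open>Different indices belong to different vertex classes, hence to different vertices of
  \<open>T\<close>. This later limits how many bubbles can share an element.\<close>

lemma card_touches: assumes "T \<in> \<T>" shows "card {j \<in> {1..N}. touches T j} \<le> CARD('d) + 1"
proof -
  define v where "v j = (SOME v. v extreme_point_of T \<and> per_eq v (z j))" for j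
  have v: "v j extreme_point_of T \<and> per_eq (v j) (z j)" if "touches T j" for j
    using someI_ex[OF that[unfolded touches_def]] unfolding v_def .
  have "inj_on v {j \<in> {1..N}. touches T j}"
  proof (rule inj_onI)
    fix j k assume jk: "j \<in> {j \<in> {1..N}. touches T j}" "k \<in> {j \<in> {1..N}. touches T j}" "v j = v k"
    then have "per_eq (z j) (z k)" using v[of j] v[of k] per_eq_sym per_eq_trans by (metis (lifting) mem_Collect_eq)
    then show "j = k" using z_inj jk by simp
  qed
  moreover have "v ` {j \<in> {1..N}. touches T j} \<subseteq> {v. v extreme_point_of T}" using v by auto
  ultimately have "card {j \<in> {1..N}. touches T j} \<le> card {v. v extreme_point_of T}"
    using T_vertices(1)[OF assms] by (rule card_inj_on_le)
  then show ?thesis using T_vertices(2)[OF assms] by linarith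
qed

text \<open>Membership in \<open>H1P\<close> equates traces only in the \<open>L2\<close> sense;
  pointwise periodicity is read off the vertices instead. Where \<open>T\<close> meets a translate
  of \<open>G\<close>, they share a common face. Its vertices are vertices of both simplices, and
  there the difference of the two affine pieces vanishes.\<close>

lemma \<phi>_per:
  assumes j: "j \<in> {1..N}" and xy: "x \<in> Omega" "y \<in> Omega" "per_eq x y"
  shows "Re (\<phi> j x) = Re (\<phi> j y)"
proof -
  obtain G where G: "G \<in> \<T>" "y \<in> G" using xy Union_\<T> by blast
  obtain T where T: "T \<in> \<T>" "x \<in> T" using xy Union_\<T> by blast
  define p where "p = x - y"
  have p: "per_eq p 0" unfolding p_def by (rule per_eq_diff_0[THEN iffD1, OF xy(3)])
  define F where "F = T \<inter> (\<lambda>x. p + x) ` G"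
  have F: "F face_of T" "F face_of ((\<lambda>x. p + x) ` G)"
  proof -
    have "\<forall>T\<in>\<T>. \<forall>G\<in>\<T>. \<forall>p. per_eq p 0 \<longrightarrow>
       (T \<inter> (\<lambda>x. p + x) ` G) face_of T \<and> (T \<inter> (\<lambda>x. p + x) ` G) face_of ((\<lambda>x. p + x) ` G)"
      using mesh by (simp add: periodic_mesh_def)
    then have "F face_of T \<and> F face_of ((\<lambda>x. p + x) ` G)" unfolding F_def using T(1) G(1) p by (elim ballE allE) auto
    then show "F face_of T" "F face_of ((\<lambda>x. p + x) ` G)" by auto
  qed
  have xF: "x \<in> F" using T G by (auto simp: F_def p_def)
  obtain \<beta> \<alpha> where f: "\<And>x. x \<in> T \<Longrightarrow> Re (\<phi> j x) = \<beta> + \<alpha> \<bullet> x"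
    using \<phi>_affine(1)[OF j T(1)] unfolding affine_on_def by blast
  obtain \<beta>' \<alpha>' where g: "\<And>x. x \<in> G \<Longrightarrow> Re (\<phi> j x) = \<beta>' + \<alpha>' \<bullet> x"
    using \<phi>_affine(1)[OF j G(1)] unfolding affine_on_def by blast
  have eq: "Re (\<phi> j w) - Re (\<phi> j (w - p)) = (\<beta> - \<beta>' + \<alpha>' \<bullet> p) + (\<alpha> - \<alpha>') \<bullet> w" if "w \<in> F" for w
  proof -
    have "w - p \<in> G" using that by (auto simp: F_def)
    then show ?thesis using f[of w] g[of "w - p"] that by (auto simp: F_def inner_simps)
  qed
  have "Re (\<phi> j x) - Re (\<phi> j (x - p)) = 0"
  proof (rule affine_on_eq[where f = "\<lambda>w. Re (\<phi> j w) - Re (\<phi> j (w - p))" and T = F])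
    show "affine_on F (\<lambda>w. Re (\<phi> j w) - Re (\<phi> j (w - p)))" using eq unfolding affine_on_def by blast
    show "F = convex hull {v. v extreme_point_of F}"
      by (intro Krein_Milman_Minkowski face_of_imp_convex[OF F(1)] face_of_imp_compact[OF T_convex T_compact F(1)] T(1))
    fix v assume "v \<in> {v. v extreme_point_of F}"
    then have v: "v extreme_point_of T" "v extreme_point_of ((\<lambda>x. p + x) ` G)"
      using extreme_point_of_face[OF F(1)] extreme_point_of_face[OF F(2)] by auto
    then have "(v - p) extreme_point_of G" using extreme_point_of_translation_eq[of p "v - p" G] by simp
    then have m: "v \<in> mesh_vertices \<T>" "v - p \<in> mesh_vertices \<T>" using vertex T(1) G(1) v(1) by blast+
    have "per_eq v (v - p)" using per_eq_diff_0[of v "v - p"] p by simp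
    then have "per_eq v (z j) \<longleftrightarrow> per_eq (v - p) (z j)" using per_eq_sym per_eq_trans by blast
    then show "Re (\<phi> j v) - Re (\<phi> j (v - p)) = 0" using \<phi>_vertex[OF j] m by simp
  qed (rule xF)
  then show ?thesis by (simp add: p_def)
qed

subsection \<open>Patches\<close>

definition unions :: "(real ^ 'd) set set" where "unions = {\<Union>\<K> | \<K>. \<K> \<subseteq> \<T>}"

lemma unions_patch: "patch \<T> K \<in> unions"
  unfolding unions_def patch_def by blast

lemma unions_Omega: "K \<in> unions \<Longrightarrow> K \<subseteq> Omega"
  unfolding unions_def using Union_\<T> by blast

lemma subset_patch: assumes "K \<subseteq> Omega" shows "K \<subseteq> patch \<T> K"
proof
  fix x assume x: "x \<in> K"
  then obtain T where "T \<in> \<T>" "x \<in> T" using assms Union_\<T> by blast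
  then show "x \<in> patch \<T> K" using per_ext_self[OF x] by (auto simp: patch_def)
qed

lemma patch_pow_Suc: "patch_pow \<T> (Suc m) K = patch \<T> (patch_pow \<T> m K)"
  by (simp add: patch_pow_def)

lemma patch_pow_0: "patch_pow \<T> 0 K = K"
  by (simp add: patch_pow_def)

lemma unions_patch_pow: "K \<in> unions \<Longrightarrow> patch_pow \<T> m K \<in> unions"
  by (cases m) (simp_all add: patch_pow_0 patch_pow_Suc unions_patch)

lemma patch_pow_mono: assumes "K \<in> unions" "m \<le> n" shows "patch_pow \<T> m K \<subseteq> patch_pow \<T> n K"
  using assms(2)
proof (induction n rule: dec_induct)
  case (step n)
  then show ?case
    using subset_patch[OF unions_Omega[OF unions_patch_pow[OF assms(1)]], of n] by (simp add: patch_pow_Suc)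
qed simp

text \<open>On an element touching \<open>j\<close> the hat function is affine and nonnegative, so a
  zero in the interior would force zero slope and contradict the value \<open>1\<close> at a vertex.
  Hence the interior lies in the set where \<open>\<phi> j\<close> is nonzero, and its closure is
  the element.\<close>

lemma supp_\<phi>: assumes j: "j \<in> {1..N}" shows "supp (\<phi> j) = \<Union>{T \<in> \<T>. touches T j}"
proof
  show "supp (\<phi> j) \<subseteq> \<Union>{T \<in> \<T>. touches T j}"
    unfolding supp_def
  proof (rule closure_minimal)
    show "{x \<in> Omega. \<phi> j x \<noteq> 0} \<subseteq> \<Union>{T \<in> \<T>. touches T j}"
      using \<phi>_zero[OF j] Union_\<T> by blast
    show "closed (\<Union>{T \<in> \<T>. touches T j})"
      using finite_\<T> T_compact by (intro closed_Union) (auto intro: compact_imp_closed)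
  qed
  show "\<Union>{T \<in> \<T>. touches T j} \<subseteq> supp (\<phi> j)"
  proof (rule Union_least)
    fix T assume "T \<in> {T \<in> \<T>. touches T j}"
    then have T: "T \<in> \<T>" "touches T j" by auto
    obtain \<beta> \<alpha> where f: "\<And>x. x \<in> T \<Longrightarrow> Re (\<phi> j x) = \<beta> + \<alpha> \<bullet> x"
      using \<phi>_affine(1)[OF j T(1)] unfolding affine_on_def by blast
    have pos: "\<phi> j x \<noteq> 0" if x: "x \<in> interior T" for x
    proof
      assume "\<phi> j x = 0"
      then have 0: "\<beta> + \<alpha> \<bullet> x = 0" using f[of x] x interior_subset by force
      obtain e where e: "e > 0" "cball x e \<subseteq> T" using x mem_interior_cball by blast
      have "\<alpha> = 0"
      proof (rule ccontr)
        assume nz: "\<alpha> \<noteq> 0"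
        \<comment> \<open>Starting from the assumed zero, a move inside the element against the
          slope would make the hat function negative.\<close>
        define y where "y = x - (e / norm \<alpha>) *\<^sub>R \<alpha>"
        have "y \<in> cball x e" using nz e(1) by (simp add: y_def dist_norm)
        then have y: "y \<in> T" using e(2) by blast
        have "0 \<le> Re (\<phi> j y)" using \<phi>_bounds(1)[OF j] T_Omega[OF T(1)] y by blast
        then have "0 \<le> \<beta> + \<alpha> \<bullet> x - e * norm \<alpha>"
          using nz f[OF y] by (simp add: y_def inner_simps dot_square_norm power2_eq_square)
        then show False using 0 e(1) nz by (simp add: mult_le_0_iff)
      qed
      obtain v where v: "v extreme_point_of T" "per_eq v (z j)" using T(2) by (auto simp: touches_def)
      then have "\<phi> j v = 1" using \<phi>_vertex[OF j] vertex[OF T(1)] by simp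
      moreover have "Re (\<phi> j v) = 0" using f[of v] vertex[OF T(1) v(1)] \<open>\<alpha> = 0\<close> 0 by simp
      ultimately show False by simp
    qed
    obtain c where c: "cball c \<rho>\<^sub>0 \<subseteq> T" using inscribed_ball[OF T(1)] by blast
    have "ball c \<rho>\<^sub>0 \<subseteq> interior T" using c by (intro interior_maximal) auto
    then have ne: "interior T \<noteq> {}" using \<rho>0_pos by auto
    have "T = closure (interior T)"
      using convex_closure_interior[OF T_convex[OF T(1)] ne] T_compact[OF T(1)] by (simp add: compact_imp_closed)
    also have "\<dots> \<subseteq> supp (\<phi> j)"
      unfolding supp_def using pos T_Omega[OF T(1)] interior_subset by (intro closure_mono) blast
    finally show "T \<subseteq> supp (\<phi> j)" .
  qed
qed

lemma supp_\<phi>_unions: "j \<in> {1..N} \<Longrightarrow> supp (\<phi> j) \<in> unions"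
  unfolding supp_\<phi> unions_def by blast

text \<open>A Lipschitz cutoff between \<open>K\<close> and its patch.\<close>
definition chi :: "(real ^ 'd) set \<Rightarrow> real ^ 'd \<Rightarrow> real"
  where "chi K x = (\<Sum>j\<in>{j\<in>{1..N}. z j \<in> per_ext K}. Re (\<phi> j x))"

lemma chi_affine: "T \<in> \<T> \<Longrightarrow> affine_on T (chi K)"
  unfolding chi_def[abs_def] by (intro affine_on_sum \<phi>_affine(1)) auto

lemma chi_bounds: assumes "x \<in> Omega" shows "0 \<le> chi K x \<and> chi K x \<le> 1"
proof
  show "0 \<le> chi K x" unfolding chi_def using \<phi>_bounds(1) assms by (intro sum_nonneg) auto
  have "chi K x \<le> (\<Sum>j\<in>{1..N}. Re (\<phi> j x))"
    unfolding chi_def using \<phi>_bounds(1) assms by (intro sum_mono2) auto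
  then show "chi K x \<le> 1" using sum_\<phi>[OF assms] by simp
qed

lemma chi_per: "x \<in> Omega \<Longrightarrow> y \<in> Omega \<Longrightarrow> per_eq x y \<Longrightarrow> chi K x = chi K y"
  unfolding chi_def by (rule sum.cong[OF refl]) (simp add: \<phi>_per)

lemma chi_one: assumes K: "K \<in> unions" and x: "x \<in> K" shows "chi K x = 1"
proof -
  obtain \<K> where "K = \<Union>\<K>" "\<K> \<subseteq> \<T>" using K unfolding unions_def by auto
  then obtain T where T: "T \<in> \<T>" "T \<subseteq> K" "x \<in> T" using x by auto
  have "chi K x = (\<Sum>j\<in>{1..N}. Re (\<phi> j x))"
    unfolding chi_def
  proof (rule sum.mono_neutral_left)
    show "\<forall>j\<in>{1..N} - {j \<in> {1..N}. z j \<in> per_ext K}. Re (\<phi> j x) = 0"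
    proof
      fix j assume j: "j \<in> {1..N} - {j \<in> {1..N}. z j \<in> per_ext K}"
      have "\<not> touches T j"
      proof
        assume "touches T j"
        then obtain v where "v extreme_point_of T" "per_eq v (z j)" by (auto simp: touches_def)
        then have "v \<in> K" "per_eq (z j) v" using vertex[OF T(1)] T(2) per_eq_sym by auto
        then show False using j by (auto simp: per_ext_def)
      qed
      then show "Re (\<phi> j x) = 0" using \<phi>_zero[OF _ T(1) _ T(3)] j by simp
    qed
  qed auto
  then show ?thesis using sum_\<phi> T_Omega[OF T(1)] T(3) by auto
qed

lemma chi_zero: assumes "x \<in> Omega" "chi K x \<noteq> 0" shows "x \<in> patch \<T> K"
proof -
  obtain T where T: "T \<in> \<T>" "x \<in> T" using assms(1) Union_\<T> by blast
  obtain j where j: "j \<in> {1..N}" "z j \<in> per_ext K" "Re (\<phi> j x) \<noteq> 0"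
  proof -
    have "\<exists>j\<in>{j\<in>{1..N}. z j \<in> per_ext K}. Re (\<phi> j x) \<noteq> 0"
      using assms(2) unfolding chi_def by (meson sum.neutral)
    then show ?thesis using that by auto
  qed
  then have "touches T j" using \<phi>_zero[OF j(1) T(1) _ T(2)] by fastforce
  then obtain v where v: "v extreme_point_of T" "per_eq v (z j)" by (auto simp: touches_def)
  obtain y where "y \<in> K" "per_eq (z j) y" using j(2) by (auto simp: per_ext_def)
  then have "v \<in> per_ext K" using per_eq_trans[OF v(2)] unfolding per_ext_def by blast
  then have "v \<in> T \<inter> per_ext K" using vertex[OF T(1) v(1)] by simp
  then show ?thesis using T by (auto simp: patch_def)
qed

section \<open>Width of one layer of elements in the periodic distance\<close>

lemma finite_lattice: "finite {p :: real ^ 'd. \<forall>i. \<exists>k::int. \<bar>k\<bar> \<le> M \<and> p $ i = 2 * pi * of_int k}"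
proof (rule finite_subset)
  let ?A = "{k :: int. \<bar>k\<bar> \<le> M}"
  show "{p :: real ^ 'd. \<forall>i. \<exists>k::int. \<bar>k\<bar> \<le> M \<and> p $ i = 2 * pi * of_int k}
      \<subseteq> (\<lambda>k. \<chi> i. 2 * pi * of_int (k i)) ` (PiE UNIV (\<lambda>_. ?A))"
  proof
    fix p :: "real ^ 'd" assume "p \<in> {p. \<forall>i. \<exists>k::int. \<bar>k\<bar> \<le> M \<and> p $ i = 2 * pi * of_int k}"
    then have "\<forall>i. \<exists>k::int. \<bar>k\<bar> \<le> M \<and> p $ i = 2 * pi * of_int k" by simp
    then have "\<exists>k. \<forall>i. \<bar>k i :: int\<bar> \<le> M \<and> p $ i = 2 * pi * of_int (k i)" by (rule choice)
    then obtain k where k: "\<forall>i. \<bar>k i :: int\<bar> \<le> M \<and> p $ i = 2 * pi * of_int (k i)" ..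
    then have "p = (\<chi> i. 2 * pi * of_int (k i))" "k \<in> PiE UNIV (\<lambda>_. ?A)" by (auto simp: vec_eq_iff)
    then show "p \<in> (\<lambda>k. \<chi> i. 2 * pi * of_int (k i)) ` (PiE UNIV (\<lambda>_. ?A))" by blast
  qed
  have "?A = {-M..M}" by auto
  then show "finite ((\<lambda>k. (\<chi> i. 2 * pi * of_int (k i)) :: real ^ 'd) ` (PiE UNIV (\<lambda>_. ?A)))"
    by (intro finite_imageI finite_PiE) auto
qed

text \<open>Along the segment from \<open>x\<close> to \<open>y'\<close> in the whole space, the
  periodic extension of \<open>chi K\<close> is affine on finitely many closed pieces that cover it.
  On each piece the slope is at most \<open>1 / (2 * \<rho>\<^sub>0)\<close>, because
  \<open>chi K\<close> takes values in the unit interval on an element containing a ball of radius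
  \<open>\<rho>\<^sub>0\<close>.\<close>

lemma chi_lipschitz:
  assumes x: "x \<in> Omega" and y: "y \<in> Omega" "per_eq y' y"
  shows "\<bar>chi K x - chi K y\<bar> \<le> dist x y' / (2 * \<rho>\<^sub>0)"
proof -
  \<comment> \<open>A representative in the cube. Boundary points have several, but
    \<open>chi_per\<close> makes the value \<open>g\<close> independent of the choice.\<close>
  define rep where "rep x = (SOME y. y \<in> Omega \<and> per_eq x y)" for x :: "real ^ 'd"
  have rep: "rep x \<in> Omega \<and> per_eq x (rep x)" for x
    unfolding rep_def by (rule someI_ex[OF Omega_representative])
  define g where "g x = chi K (rep x)" for x
  have g_eq: "g x = chi K w" if "w \<in> Omega" "per_eq x w" for x w
    unfolding g_def using rep[of x] that by (intro chi_per) (auto intro: per_eq_trans per_eq_sym)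
  define f where "f t = g (x + t *\<^sub>R (y' - x))" for t
  obtain B where B: "\<And>t. t \<in> {0..1} \<Longrightarrow> norm (x + t *\<^sub>R (y' - x)) \<le> B"
  proof -
    have "compact ((\<lambda>t. x + t *\<^sub>R (y' - x)) ` {0..1})"
      by (intro compact_continuous_image continuous_intros) auto
    then have "bounded ((\<lambda>t. x + t *\<^sub>R (y' - x)) ` {0..1})" by (rule compact_imp_bounded)
    then obtain B where "\<forall>w\<in>(\<lambda>t. x + t *\<^sub>R (y' - x)) ` {0..1}. norm w \<le> B" unfolding bounded_iff by (elim exE)
    then show ?thesis by (intro that[of B]) simp
  qed
  \<comment> \<open>Only lattice vectors of this size can carry a point of the segment into the
    cube, so finitely many translated elements suffice.\<close>
  define M :: int where "M = \<lceil>B / (2 * pi)\<rceil> + 2"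
  define P where "P = {p :: real ^ 'd. \<forall>i. \<exists>k::int. \<bar>k\<bar> \<le> M \<and> p $ i = 2 * pi * of_int k}"
  have P: "per_eq p 0" if "p \<in> P" for p using that by (auto simp: P_def per_eq_def)
  define U where "U q = {t. x + t *\<^sub>R (y' - x) - fst q \<in> snd q}" for q :: "(real ^ 'd) \<times> (real ^ 'd) set"
  have "lipschitz_on (dist x y' / (2 * \<rho>\<^sub>0)) {0..1} f"
  proof (rule lipschitz_on_closed_Union[where I = "P \<times> \<T>" and U = U])
    fix q assume "q \<in> P \<times> \<T>"
    then obtain p T where q: "q = (p, T)" "p \<in> P" "T \<in> \<T>" by auto
    show "closed (U q)"
    proof -
      have "U q = (\<lambda>t. x + t *\<^sub>R (y' - x) - p) -` T" by (auto simp: U_def q)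
      moreover have "closed ((\<lambda>t. x + t *\<^sub>R (y' - x) - p) -` T)"
        by (intro closed_vimage compact_imp_closed[OF T_compact[OF q(3)]] continuous_intros)
      ultimately show ?thesis by simp
    qed
    obtain \<beta> \<alpha> where chi: "\<And>x. x \<in> T \<Longrightarrow> chi K x = \<beta> + \<alpha> \<bullet> x"
      using chi_affine[OF q(3)] unfolding affine_on_def by blast
    obtain c where c: "cball c \<rho>\<^sub>0 \<subseteq> T" using inscribed_ball[OF q(3)] by blast
    have \<alpha>: "norm \<alpha> \<le> 1 / (2 * \<rho>\<^sub>0)"
    proof (rule affine_on_slope[OF chi c \<rho>0_pos])
      fix x assume "x \<in> T"
      then have "x \<in> Omega" using T_Omega[OF q(3)] by blast
      then show "0 \<le> chi K x \<and> chi K x \<le> 1" by (rule chi_bounds)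
    qed
    have f: "f t = \<beta> + \<alpha> \<bullet> (x + t *\<^sub>R (y' - x) - p)" if "t \<in> U q" for t
    proof -
      have m: "x + t *\<^sub>R (y' - x) - p \<in> T" using that by (simp add: U_def q)
      have "per_eq (x + t *\<^sub>R (y' - x)) (x + t *\<^sub>R (y' - x) - p)"
        using P[OF q(2)] by (subst per_eq_diff_0) simp
      then show ?thesis unfolding f_def using g_eq[of "x + t *\<^sub>R (y' - x) - p"] T_Omega[OF q(3)] m chi[OF m] by auto
    qed
    show "lipschitz_on (dist x y' / (2 * \<rho>\<^sub>0)) (U q) f"
    proof (rule lipschitz_onI)
      fix s t assume st: "s \<in> U q" "t \<in> U q"
      have "f s - f t = (s - t) * (\<alpha> \<bullet> (y' - x))"
        unfolding f[OF st(1)] f[OF st(2)] by (simp add: inner_simps algebra_simps)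
      then have "dist (f s) (f t) = \<bar>s - t\<bar> * \<bar>\<alpha> \<bullet> (y' - x)\<bar>" by (simp add: dist_real_def abs_mult)
      also have "\<dots> \<le> \<bar>s - t\<bar> * (1 / (2 * \<rho>\<^sub>0) * norm (y' - x))"
        using order_trans[OF Cauchy_Schwarz_ineq2 mult_right_mono[OF \<alpha> norm_ge_zero]] by (intro mult_left_mono) auto
      finally show "dist (f s) (f t) \<le> dist x y' / (2 * \<rho>\<^sub>0) * dist s t"
        by (simp add: dist_norm norm_minus_commute mult_ac)
    qed (use \<rho>0_pos in auto)
  next
    show "finite (P \<times> \<T>)" using finite_lattice finite_\<T> by (simp add: P_def)
    show "{0..1} \<subseteq> (\<Union>q\<in>P \<times> \<T>. U q)"
    proof
      fix t :: real assume t: "t \<in> {0..1}"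
      let ?w = "x + t *\<^sub>R (y' - x)"
      define p where "p = ?w - rep ?w"
      have "\<exists>k::int. \<bar>k\<bar> \<le> M \<and> p $ i = 2 * pi * of_int k" for i
      proof -
        obtain k :: int where k: "?w $ i - rep ?w $ i = 2 * pi * of_int k"
          using rep[of ?w] unfolding per_eq_def by blast
        have "\<bar>?w $ i\<bar> \<le> B" using component_le_norm_cart[of ?w i] B[OF t] by linarith
        moreover have "0 \<le> rep ?w $ i \<and> rep ?w $ i \<le> 2 * pi" using rep[of ?w] by (simp add: mem_Omega)
        ultimately have "\<bar>2 * pi * of_int k\<bar> \<le> B + 2 * pi" unfolding k[symmetric] by linarith
        then have "2 * pi * \<bar>of_int k\<bar> \<le> B + 2 * pi" by (simp add: abs_mult)
        then have "\<bar>of_int k\<bar> \<le> B / (2 * pi) + 1" by (simp add: field_simps)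
        moreover have "B / (2 * pi) \<le> of_int \<lceil>B / (2 * pi)\<rceil>" by (rule le_of_int_ceiling)
        moreover have "real_of_int M = of_int \<lceil>B / (2 * pi)\<rceil> + 2" by (simp add: M_def)
        ultimately have "\<bar>of_int k\<bar> \<le> real_of_int M" by linarith
        then have "\<bar>k\<bar> \<le> M" by linarith
        then show ?thesis using k by (intro exI[of _ k]) (simp add: p_def)
      qed
      then have "p \<in> P" by (simp add: P_def)
      moreover obtain T where "T \<in> \<T>" "rep ?w \<in> T" using rep[of ?w] Union_\<T> by blast
      ultimately show "t \<in> (\<Union>q\<in>P \<times> \<T>. U q)" by (intro UN_I[of "(p, T)"]) (auto simp: U_def p_def)
    qed
  qed (use \<rho>0_pos in auto)
  then have "dist (f 0) (f 1) \<le> dist x y' / (2 * \<rho>\<^sub>0) * dist (0 :: real) 1"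
    by (rule lipschitz_onD) auto
  moreover have "f 0 = chi K x" using g_eq[OF x per_eq_refl] by (simp add: f_def)
  moreover have "f 1 = chi K y" using g_eq[OF y] by (simp add: f_def)
  ultimately show ?thesis by (simp add: dist_real_def)
qed

text \<open>\<open>chi K\<close> is \<open>1\<close> on \<open>K\<close>, vanishes off the patch,
  and cannot drop from \<open>1\<close> to \<open>0\<close> over a distance below
  \<open>2 * \<rho>\<^sub>0\<close>. This is how shape regularity gives a layer of elements a
  positive width.\<close>

lemma near_imp_patch:
  assumes K: "K \<in> unions" and "x \<in> Omega" "y \<in> K" "per_eq y' y" "dist x y' < 2 * \<rho>\<^sub>0"
  shows "x \<in> patch \<T> K"
proof -
  have "y \<in> Omega" using unions_Omega[OF K] assms(3) by blast
  then have "\<bar>chi K x - chi K y\<bar> \<le> dist x y' / (2 * \<rho>\<^sub>0)" by (intro chi_lipschitz assms)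
  also have "\<dots> < 1" using assms(5) \<rho>0_pos by simp
  finally have "chi K x \<noteq> 0" using chi_one[OF K assms(3)] by auto
  then show ?thesis by (rule chi_zero[OF assms(2)])
qed

end

section \<open>Local norms\<close>

text \<open>Written as an integral over the whole cube, so that sums over elements become integrals
  of counting functions.\<close>

definition nsq :: "(real ^ 'd::finite) set \<Rightarrow> (real ^ 'd \<Rightarrow> 'b::euclidean_space) \<Rightarrow> real"
  where "nsq K f = (\<integral>x. indicat_real K x * (norm (f x))\<^sup>2 \<partial>\<mu>)"

lemma nsq_nonneg: "0 \<le> nsq K f"
  by (simp add: nsq_def integral_nonneg_AE)

lemma norm_L2_sq:
  fixes f :: "real ^ 'd::finite \<Rightarrow> 'b::euclidean_space"
  assumes "K \<in> sets lebesgue" "K \<subseteq> Omega"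
  shows "(norm_L2 K f)\<^sup>2 = nsq K f"
proof -
  have "(\<integral>x. (norm (f x))\<^sup>2 \<partial>lebesgue_on K) = (\<integral>x. indicat_real K x *\<^sub>R (norm (f x))\<^sup>2 \<partial>lebesgue)"
    by (rule integral_restrict_space) (use assms in auto)
  also have "\<dots> = (\<integral>x. indicat_real Omega x *\<^sub>R (indicat_real K x * (norm (f x))\<^sup>2) \<partial>lebesgue)"
    using assms(2) by (intro Bochner_Integration.integral_cong) (auto simp: indicator_def)
  also have "\<dots> = nsq K f"
    unfolding nsq_def by (rule integral_restrict_space[symmetric]) simp
  finally show ?thesis by (simp add: norm_L2_def nsq_nonneg)
qed

lemma indicator_measurable: "K \<in> sets lebesgue \<Longrightarrow> indicat_real K \<in> borel_measurable (\<mu> :: (real ^ 'd::finite) measure)"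
  by (intro measurable_restrict_space1 borel_measurable_indicator)

lemma nsq_integrable:
  fixes f :: "real ^ 'd::finite \<Rightarrow> 'b::euclidean_space"
  assumes "K \<in> sets lebesgue" "f \<in> sq_int \<mu>"
  shows "integrable \<mu> (\<lambda>x. indicat_real K x * (norm (f x))\<^sup>2)"
proof (rule Bochner_Integration.integrable_bound)
  show "integrable \<mu> (\<lambda>x. (norm (f x))\<^sup>2)" using assms(2) by (simp add: sq_int_def)
  show "(\<lambda>x. indicat_real K x * (norm (f x))\<^sup>2) \<in> borel_measurable \<mu>"
  proof -
    have [measurable]: "f \<in> borel_measurable \<mu>" using assms(2) by (simp add: sq_int_def)
    have [measurable]: "indicat_real K \<in> borel_measurable \<mu>" by (rule indicator_measurable[OF assms(1)])
    show ?thesis by measurable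
  qed
  have "norm (indicat_real K x * (norm (f x))\<^sup>2) \<le> norm ((norm (f x))\<^sup>2)" for x
    by (cases "x \<in> K") auto
  then show "AE x in \<mu>. norm (indicat_real K x * (norm (f x))\<^sup>2) \<le> norm ((norm (f x))\<^sup>2)"
    by simp
qed

lemma nsq_mono:
  fixes f :: "real ^ 'd::finite \<Rightarrow> 'b::euclidean_space" and g :: "real ^ 'd \<Rightarrow> 'c::euclidean_space"
  assumes "K \<in> sets lebesgue" "L \<in> sets lebesgue" "f \<in> sq_int \<mu>" "g \<in> sq_int \<mu>"
    and "AE x in \<mu>. x \<in> K \<longrightarrow> x \<in> L \<and> norm (f x) \<le> norm (g x)"
  shows "nsq K f \<le> nsq L g"
  unfolding nsq_def
proof (rule integral_mono_AE)
  show "AE x in \<mu>. indicat_real K x * (norm (f x))\<^sup>2 \<le> indicat_real L x * (norm (g x))\<^sup>2"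
    using assms(5) by eventually_elim (auto simp: indicator_def)
qed (rule nsq_integrable; fact)+

lemma nsq_Omega:
  fixes f :: "real ^ 'd::finite \<Rightarrow> 'b::euclidean_space"
  assumes "f \<in> sq_int \<mu>" shows "nsq Omega f = (L2.nrm \<mu> f)\<^sup>2"
proof -
  have "nsq Omega f = (\<integral>x. (norm (f x))\<^sup>2 \<partial>\<mu>)"
    unfolding nsq_def by (intro Bochner_Integration.integral_cong) auto
  then show ?thesis using L2.nrm_sq[OF assms] by (simp add: dot_square_norm)
qed

lemma nsq_le_bound:
  fixes f :: "real ^ 'd::finite \<Rightarrow> 'b::euclidean_space"
  assumes "K \<in> sets lebesgue" "f \<in> sq_int \<mu>" "\<And>x. x \<in> K \<Longrightarrow> norm (f x) \<le> B"
    and v: "K \<subseteq> cbox a b" "cbox a b \<subseteq> Omega"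
  shows "nsq K f \<le> B\<^sup>2 * measure lebesgue (cbox a b)"
proof -
  have sets: "cbox a b \<in> sets \<mu>" using v by (simp add: sets_restrict_space_iff)
  interpret finite_measure "\<mu> :: (real ^ 'd) measure" by (rule finite_measure_Omega)
  have "nsq K f \<le> (\<integral>x. B\<^sup>2 * indicat_real (cbox a b) x \<partial>\<mu>)"
    unfolding nsq_def
  proof (rule integral_mono_AE[OF nsq_integrable[OF assms(1,2)]])
    show "integrable \<mu> (\<lambda>x. B\<^sup>2 * indicat_real (cbox a b) x)"
      using sets by (intro integrable_mult_right integrable_real_indicator) (auto simp: less_top[symmetric])
    have "(norm (f x))\<^sup>2 \<le> B\<^sup>2" if "x \<in> K" for x using assms(3)[OF that] by (intro power_mono) auto
    then show "AE x in \<mu>. indicat_real K x * (norm (f x))\<^sup>2 \<le> B\<^sup>2 * indicat_real (cbox a b) x"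
      using v(1) by (auto simp: indicator_def intro!: AE_I2)
  qed
  also have "\<dots> = B\<^sup>2 * measure \<mu> (cbox a b)" using sets v(2) by (simp add: Int_absorb2)
  also have "measure \<mu> (cbox a b) = measure lebesgue (cbox a b)"
    using v(2) by (intro measure_restrict_space) auto
  finally show ?thesis .
qed

lemma (in mesh) T_sets: "T \<in> \<T> \<Longrightarrow> T \<in> sets lebesgue"
  using T_compact by (intro sets_completionI_sets) (simp add: borel_compact)

lemma (in mesh) unions_sets: assumes "K \<in> unions" shows "K \<in> sets lebesgue"
proof -
  obtain \<K> where "K = \<Union>\<K>" "\<K> \<subseteq> \<T>" using assms unfolding unions_def by auto
  moreover have "\<K> \<subseteq> sets lebesgue" using \<open>\<K> \<subseteq> \<T>\<close> T_sets by blast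
  ultimately show ?thesis using finite_subset[OF _ finite_\<T>] by (simp add: sets.finite_Union)
qed

section \<open>Finite overlap and summed interpolation estimates\<close>

locale interp_mesh = mesh \<kappa> H \<T> N z \<phi>
  for \<kappa> H :: real and \<T> :: "(real ^ 'd::finite) set set" and N z \<phi> +
  fixes Col CI :: real
  assumes Col: "0 < Col" "overlap_constant \<T> Col"
    and CI: "0 < CI" "interpolation_constant \<T> H N \<phi> CI"
begin

text \<open>A non-negligible intersection of two elements has full dimension; being a face of both
  simplices, it equals both.\<close>

lemma AE_unique_element: "AE x in \<mu>. \<forall>T\<in>\<T>. \<forall>G\<in>\<T>. x \<in> T \<and> x \<in> G \<longrightarrow> T = G"
proof -
  have neg: "negligible (T \<inter> G)" if TG: "T \<in> \<T>" "G \<in> \<T>" "T \<noteq> G" for T G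
  proof (rule ccontr)
    assume n: "\<not> negligible (T \<inter> G)"
    have conv: "convex (T \<inter> G)" using T_convex TG by (intro convex_Int)
    have "interior (T \<inter> G) \<noteq> {}" using n negligible_convex_interior[OF conv] by simp
    then have dim: "aff_dim (T \<inter> G) = int CARD('d)" using aff_dim_nonempty_interior[of "T \<inter> G"] by simp
    have full: "A \<inter> B = A" if AB: "A \<in> \<T>" "B \<in> \<T>" "aff_dim (A \<inter> B) = int CARD('d)" for A B
    proof (rule ccontr)
      assume "A \<inter> B \<noteq> A"
      moreover have "(A \<inter> B) face_of A" using mesh AB by (simp add: periodic_mesh_def triangulation_def)
      ultimately have "aff_dim (A \<inter> B) < aff_dim A" by (intro face_of_aff_dim_lt T_convex AB)
      then show False using AB(3) aff_dim_simplex[OF T_simplex[OF AB(1)]] by simp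
    qed
    have "T \<inter> G = T" "G \<inter> T = G" using full[OF TG(1,2)] full[OF TG(2,1)] dim by (simp_all add: Int_commute)
    then show False using TG(3) by blast
  qed
  define Z where "Z = \<Union>((\<lambda>q. fst q \<inter> snd q) ` {q \<in> \<T> \<times> \<T>. fst q \<noteq> snd q})"
  have "negligible Z"
    unfolding Z_def
  proof (rule negligible_Union)
    show "finite ((\<lambda>q. fst q \<inter> snd q) ` {q \<in> \<T> \<times> \<T>. fst q \<noteq> snd q})" using finite_\<T> by simp
    fix t assume "t \<in> (\<lambda>q. fst q \<inter> snd q) ` {q \<in> \<T> \<times> \<T>. fst q \<noteq> snd q}"
    then obtain q where q: "t = fst q \<inter> snd q" "q \<in> {q \<in> \<T> \<times> \<T>. fst q \<noteq> snd q}" by (rule imageE)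
    then have "fst q \<in> \<T>" "snd q \<in> \<T>" "fst q \<noteq> snd q" by (simp_all add: mem_Times_iff)
    then show "negligible t" unfolding q(1) by (rule neg)
  qed
  then have "AE x in lebesgue. x \<notin> Z" by (intro AE_not_in) (simp only: negligible_iff_null_sets)
  then have "AE x in lebesgue. x \<in> Omega \<longrightarrow> (\<forall>T\<in>\<T>. \<forall>G\<in>\<T>. x \<in> T \<and> x \<in> G \<longrightarrow> T = G)"
    by eventually_elim (auto simp: Z_def)
  then show ?thesis by (simp add: AE_restrict_space_iff)
qed

text \<open>\<open>overlap_constant\<close> counts the elements inside the patch of
  \<open>G\<close>, whereas sums over patches need the elements whose patch contains
  \<open>G\<close>. Periodic adjacency is symmetric, so the latter are among the former.\<close>

lemma card_overlap: assumes "G \<in> \<T>" shows "real (card {T \<in> \<T>. G \<inter> per_ext T \<noteq> {}}) \<le> Col"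
proof -
  have "{T \<in> \<T>. G \<inter> per_ext T \<noteq> {}} \<subseteq> {T \<in> \<T>. T \<subseteq> patch \<T> G}"
  proof
    fix T assume T: "T \<in> {T \<in> \<T>. G \<inter> per_ext T \<noteq> {}}"
    then have "T \<inter> per_ext G \<noteq> {}" using Int_per_ext_commute[of G T] by simp
    then show "T \<in> {T \<in> \<T>. T \<subseteq> patch \<T> G}" using T by (auto simp: patch_def)
  qed
  then have "card {T \<in> \<T>. G \<inter> per_ext T \<noteq> {}} \<le> card {T \<in> \<T>. T \<subseteq> patch \<T> G}"
    using finite_\<T> by (intro card_mono) auto
  also have "real \<dots> \<le> Col" using Col(2) assms by (simp add: overlap_constant_def)
  finally show ?thesis by simp
qed

text \<open>Almost every point lies in a single element \<open>G\<close>, and the patch of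
  \<open>T\<close> reaches it only if \<open>G\<close> meets \<open>T\<close> periodically.\<close>

lemma sum_patch:
  fixes f :: "real ^ 'd \<Rightarrow> 'b::euclidean_space"
  assumes T': "\<T>' \<subseteq> \<T>" and f: "f \<in> sq_int \<mu>" and A: "A \<in> sets lebesgue" "\<And>T. T \<in> \<T>' \<Longrightarrow> patch \<T> T \<subseteq> A"
  shows "(\<Sum>T\<in>\<T>'. nsq (patch \<T> T) f) \<le> Col * nsq A f"
proof -
  have s: "patch \<T> T \<in> sets lebesgue" for T by (rule unions_sets[OF unions_patch])
  have "(\<Sum>T\<in>\<T>'. nsq (patch \<T> T) f) = (\<integral>x. (\<Sum>T\<in>\<T>'. indicat_real (patch \<T> T) x * (norm (f x))\<^sup>2) \<partial>\<mu>)"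
    unfolding nsq_def by (intro Bochner_Integration.integral_sum[symmetric] nsq_integrable s f)
  also have "\<dots> \<le> (\<integral>x. Col * (indicat_real A x * (norm (f x))\<^sup>2) \<partial>\<mu>)"
  proof (rule integral_mono_AE)
    show "integrable \<mu> (\<lambda>x. \<Sum>T\<in>\<T>'. indicat_real (patch \<T> T) x * (norm (f x))\<^sup>2)"
      by (intro Bochner_Integration.integrable_sum nsq_integrable s f)
    show "integrable \<mu> (\<lambda>x. Col * (indicat_real A x * (norm (f x))\<^sup>2))"
      by (intro integrable_mult_right nsq_integrable A f)
    have "AE x in \<mu>. x \<in> Omega" by (rule AE_I2) simp
    then show "AE x in \<mu>. (\<Sum>T\<in>\<T>'. indicat_real (patch \<T> T) x * (norm (f x))\<^sup>2) \<le> Col * (indicat_real A x * (norm (f x))\<^sup>2)"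
      using AE_unique_element
    proof eventually_elim
      case (elim x)
      obtain G where G: "G \<in> \<T>" "x \<in> G" using elim(1) Union_\<T> by blast
      have "(\<Sum>T\<in>\<T>'. indicat_real (patch \<T> T) x) \<le> Col * indicat_real A x"
      proof (cases "x \<in> A")
        case True
        have fin: "finite \<T>'" using T' finite_\<T> finite_subset by blast
        have "(\<Sum>T\<in>\<T>'. indicat_real (patch \<T> T) x) = real (card {T \<in> \<T>'. x \<in> patch \<T> T})"
          using fin by (simp add: indicator_def sum.If_cases Int_def)
        also have "card {T \<in> \<T>'. x \<in> patch \<T> T} \<le> card {T \<in> \<T>. G \<inter> per_ext T \<noteq> {}}"
        proof (rule card_mono)
          show "{T \<in> \<T>'. x \<in> patch \<T> T} \<subseteq> {T \<in> \<T>. G \<inter> per_ext T \<noteq> {}}"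
            using T' elim(2) G unfolding patch_def by blast
        qed (use finite_\<T> in auto)
        also have "real (card {T \<in> \<T>. G \<inter> per_ext T \<noteq> {}}) \<le> Col" by (rule card_overlap[OF G(1)])
        finally show ?thesis using True by simp
      next
        case False
        then have "indicat_real (patch \<T> T) x = 0" if "T \<in> \<T>'" for T using A(2)[OF that] by (auto simp: indicator_def)
        then show ?thesis using False by simp
      qed
      then have "(\<Sum>T\<in>\<T>'. indicat_real (patch \<T> T) x) * (norm (f x))\<^sup>2 \<le> Col * indicat_real A x * (norm (f x))\<^sup>2"
        by (intro mult_right_mono) auto
      then show ?case by (simp add: sum_distrib_right mult.assoc)
    qed
  qed
  also have "\<dots> = Col * nsq A f" by (simp add: nsq_def)
  finally show ?thesis .
qed

lemma nsq_cover:
  fixes f :: "real ^ 'd \<Rightarrow> 'b::euclidean_space"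
  assumes T': "\<T>' \<subseteq> \<T>" and f: "f \<in> sq_int \<mu>" and B: "B \<in> sets lebesgue" "B \<subseteq> \<Union>\<T>'"
  shows "nsq B f \<le> (\<Sum>T\<in>\<T>'. nsq T f)"
proof -
  have s: "T \<in> sets lebesgue" if "T \<in> \<T>'" for T using T_sets T' that by blast
  have fin: "finite \<T>'" using T' finite_\<T> finite_subset by blast
  have "nsq B f \<le> (\<integral>x. (\<Sum>T\<in>\<T>'. indicat_real T x * (norm (f x))\<^sup>2) \<partial>\<mu>)"
    unfolding nsq_def
  proof (rule integral_mono_AE)
    show "AE x in \<mu>. indicat_real B x * (norm (f x))\<^sup>2 \<le> (\<Sum>T\<in>\<T>'. indicat_real T x * (norm (f x))\<^sup>2)"
    proof (rule AE_I2)
      fix x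
      have "indicat_real B x \<le> (\<Sum>T\<in>\<T>'. indicat_real T x)"
      proof (cases "x \<in> B")
        case True
        then obtain T where T: "T \<in> \<T>'" "x \<in> T" using B(2) by blast
        have "indicat_real T x \<le> (\<Sum>T\<in>\<T>'. indicat_real T x)"
          using fin T(1) by (intro member_le_sum) auto
        then show ?thesis using True T(2) by simp
      qed (simp add: sum_nonneg)
      then have "indicat_real B x * (norm (f x))\<^sup>2 \<le> (\<Sum>T\<in>\<T>'. indicat_real T x) * (norm (f x))\<^sup>2"
        by (intro mult_right_mono) auto
      then show "indicat_real B x * (norm (f x))\<^sup>2 \<le> (\<Sum>T\<in>\<T>'. indicat_real T x * (norm (f x))\<^sup>2)"
        by (simp add: sum_distrib_right)
    qed
    show "integrable \<mu> (\<lambda>x. indicat_real B x * (norm (f x))\<^sup>2)" by (rule nsq_integrable[OF B(1) f])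
    show "integrable \<mu> (\<lambda>x. \<Sum>T\<in>\<T>'. indicat_real T x * (norm (f x))\<^sup>2)"
      by (intro Bochner_Integration.integrable_sum nsq_integrable s f)
  qed
  also have "\<dots> = (\<Sum>T\<in>\<T>'. nsq T f)"
    unfolding nsq_def by (intro Bochner_Integration.integral_sum nsq_integrable s f)
  finally show ?thesis .
qed

lemma clement_H1P: "clement N \<phi> v \<in> H1P"
proof -
  have "clement N \<phi> v = (\<lambda>x. \<Sum>j\<in>{1..N}. inner_L2 v (\<phi> j) / inner_L2 (\<lambda>_. 1) (\<phi> j) * \<phi> j x)"
    by (simp add: clement_def fun_eq_iff)
  then show ?thesis by (simp only:) (intro H1P_sum H1P_cmult \<phi>_H1P)
qed

text \<open>The local interpolation estimate, squared and summed. Keeping \<open>B\<close> and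
  \<open>A\<close> general covers both the whole cube and the exterior of a patch, where only
  gradients outside a smaller patch may enter.\<close>

lemma clement_error:
  assumes v: "v \<in> H1P" and T': "\<T>' \<subseteq> \<T>" and B: "B \<in> sets lebesgue" "B \<subseteq> \<Union>\<T>'"
    and A: "A \<in> sets lebesgue" "\<And>T. T \<in> \<T>' \<Longrightarrow> patch \<T> T \<subseteq> A"
  shows "nsq B (\<lambda>x. v x - clement N \<phi> v x) \<le> (CI * H)\<^sup>2 * Col * nsq A (grad v)"
proof -
  let ?e = "\<lambda>x. v x - clement N \<phi> v x"
  have e: "?e \<in> sq_int \<mu>" by (rule H1_D(1)[OF H1P_H1[OF H1P_diff[OF v clement_H1P]]])
  have g: "grad v \<in> sq_int \<mu>" by (rule H1_D(2)[OF H1P_H1[OF v]])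
  have local: "nsq T ?e \<le> (CI * H)\<^sup>2 * nsq (patch \<T> T) (grad v)" if T: "T \<in> \<T>'" for T
  proof -
    have TT: "T \<in> \<T>" using T T' by blast
    have "inverse H * norm_L2 T ?e + norm_L2 T (grad ?e) \<le> CI * norm_L2 (patch \<T> T) (grad v)"
      using CI(2) TT v by (simp add: interpolation_constant_def)
    moreover have "0 \<le> norm_L2 T (grad ?e)" by (simp add: norm_L2_def integral_nonneg_AE)
    ultimately have "inverse H * norm_L2 T ?e \<le> CI * norm_L2 (patch \<T> T) (grad v)" by linarith
    then have "norm_L2 T ?e \<le> CI * H * norm_L2 (patch \<T> T) (grad v)"
      using H_pos by (simp add: field_simps)
    then have "(norm_L2 T ?e)\<^sup>2 \<le> (CI * H * norm_L2 (patch \<T> T) (grad v))\<^sup>2"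
      by (intro power_mono) (auto simp: norm_L2_def integral_nonneg_AE)
    then show ?thesis
      using norm_L2_sq[OF T_sets[OF TT] T_Omega[OF TT], of ?e]
        norm_L2_sq[OF unions_sets[OF unions_patch] unions_Omega[OF unions_patch], of T "grad v"]
      by (simp add: power_mult_distrib)
  qed
  have "nsq B ?e \<le> (\<Sum>T\<in>\<T>'. nsq T ?e)" by (rule nsq_cover[OF T' e B])
  also have "\<dots> \<le> (\<Sum>T\<in>\<T>'. (CI * H)\<^sup>2 * nsq (patch \<T> T) (grad v))" by (intro sum_mono local)
  also have "\<dots> = (CI * H)\<^sup>2 * (\<Sum>T\<in>\<T>'. nsq (patch \<T> T) (grad v))" by (simp add: sum_distrib_left)
  also have "\<dots> \<le> (CI * H)\<^sup>2 * (Col * nsq A (grad v))"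
    by (intro mult_left_mono sum_patch[OF T' g A]) auto
  finally show ?thesis by (simp add: mult.assoc)
qed

lemma clement_error_Omega:
  assumes v: "v \<in> H1P"
  shows "L2.nrm \<mu> (\<lambda>x. v x - clement N \<phi> v x) \<le> CI * sqrt Col * H * L2.nrm \<mu> (grad v)"
proof -
  have p: "patch \<T> T \<subseteq> Omega" for T by (rule unions_Omega[OF unions_patch])
  have "nsq Omega (\<lambda>x. v x - clement N \<phi> v x) \<le> (CI * H)\<^sup>2 * Col * nsq Omega (grad v)"
    by (rule clement_error[OF v order_refl]) (use Union_\<T> p in auto)
  then have "(L2.nrm \<mu> (\<lambda>x. v x - clement N \<phi> v x))\<^sup>2 \<le> (CI * sqrt Col * H * L2.nrm \<mu> (grad v))\<^sup>2"
    using Col(1) nsq_Omega[OF H1_D(1)[OF H1P_H1[OF H1P_diff[OF v clement_H1P]]]] nsq_Omega[OF H1_D(2)[OF H1P_H1[OF v]]]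
    by (simp add: power_mult_distrib mult_ac)
  then show ?thesis
  proof (rule power2_le_imp_le)
    show "0 \<le> CI * sqrt Col * H * L2.nrm \<mu> (grad v)"
      using CI(1) Col(1) H_pos L2.nrm_nonneg[OF H1_D(2)[OF H1P_H1[OF v]]] by simp
  qed
qed

section \<open>Volume of elements and integrals of hat functions\<close>

lemma T_volume: assumes "T \<in> \<T>" shows "measure lebesgue T \<le> (2 * H) ^ CARD('d)"
proof -
  obtain x where x: "x \<in> T" using inscribed_ball[OF assms] \<rho>0_pos by (metis centre_in_cball less_imp_le subsetD)
  define a b where "a = (\<chi> i. x $ i - H)" and "b = (\<chi> i. x $ i + H)"
  have "T \<subseteq> cbox a b"
  proof
    fix y assume y: "y \<in> T"
    have "\<bar>(y - x) $ i\<bar> \<le> H" for i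
      using component_le_norm_cart[of "y - x" i] dist_le_H[OF assms y x] by (simp add: dist_norm)
    then have "x $ i - H \<le> y $ i \<and> y $ i \<le> x $ i + H" for i by (simp add: abs_le_iff) (smt (verit, best))
    then show "y \<in> cbox a b" by (simp add: a_def b_def mem_box_cart)
  qed
  then have "measure lebesgue T \<le> measure lebesgue (cbox a b)"
    using T_sets[OF assms] by (intro measure_mono_fmeasurable) auto
  also have "\<dots> = (2 * H) ^ CARD('d)"
  proof -
    have "a \<in> cbox a b" using H_pos by (simp add: a_def b_def mem_box_cart)
    then have "measure lborel (cbox a b) = (\<Prod>i\<in>UNIV. b $ i - a $ i)" by (intro content_cbox_cart) auto
    then show ?thesis by (simp add: a_def b_def)
  qed
  finally show ?thesis .
qed

lemma \<phi>_sq_int: "j \<in> {1..N} \<Longrightarrow> \<phi> j \<in> sq_int \<mu>"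
  by (rule H1_D(1)[OF H1P_H1[OF \<phi>_H1P]])

lemma Re_\<phi>_integrable: "j \<in> {1..N} \<Longrightarrow> integrable \<mu> (\<lambda>x. Re (\<phi> j x))"
  by (rule integrable_bounded_linear[OF bounded_linear_Re sq_int_integrable[OF \<phi>_sq_int]])

lemma \<phi>_integral: assumes j: "j \<in> {1..N}" shows "(\<integral>x. Re (\<phi> j x) \<partial>\<mu>) \<le> Col * (2 * H) ^ CARD('d)"
proof -
  interpret finite_measure "\<mu> :: (real ^ 'd) measure" by (rule finite_measure_Omega)
  let ?S = "{T \<in> \<T>. touches T j}"
  have s: "T \<in> sets \<mu>" if "T \<in> ?S" for T
    using T_sets[of T] T_Omega[of T] that by (simp add: sets_restrict_space_iff)
  have fin: "finite ?S" using finite_\<T> by simp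
  have int: "integrable \<mu> (indicat_real T)" if "T \<in> ?S" for T
    using s[OF that] by (intro integrable_real_indicator) (auto simp: less_top[symmetric])
  have "(\<integral>x. Re (\<phi> j x) \<partial>\<mu>) \<le> (\<integral>x. (\<Sum>T\<in>?S. indicat_real T x) \<partial>\<mu>)"
  proof (rule integral_mono_AE[OF Re_\<phi>_integrable[OF j]])
    show "integrable \<mu> (\<lambda>x. \<Sum>T\<in>?S. indicat_real T x)" by (intro Bochner_Integration.integrable_sum int)
    show "AE x in \<mu>. Re (\<phi> j x) \<le> (\<Sum>T\<in>?S. indicat_real T x)"
    proof (rule AE_I2)
      fix x :: "real ^ 'd" assume "x \<in> space \<mu>"
      then have x: "x \<in> Omega" by simp
      obtain T where T: "T \<in> \<T>" "x \<in> T" using x Union_\<T> by blast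
      show "Re (\<phi> j x) \<le> (\<Sum>T\<in>?S. indicat_real T x)"
      proof (cases "touches T j")
        case True
        have "indicat_real T x \<le> (\<Sum>T\<in>?S. indicat_real T x)"
          by (rule member_le_sum) (use T True fin in auto)
        then show ?thesis using \<phi>_bounds(2)[OF j x] T(2) by simp
      next
        case False
        then show ?thesis using \<phi>_zero[OF j T(1) False T(2)] by (simp add: sum_nonneg)
      qed
    qed
  qed
  also have "\<dots> = (\<Sum>T\<in>?S. measure \<mu> T)"
    using int s T_Omega by (subst Bochner_Integration.integral_sum) (auto simp: Int_absorb2 intro!: sum.cong)
  also have "\<dots> \<le> (\<Sum>T\<in>?S. (2 * H) ^ CARD('d))"
  proof (rule sum_mono)
    fix T assume T: "T \<in> ?S"
    then have "measure \<mu> T = measure lebesgue T" using T_Omega by (intro measure_restrict_space) auto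
    then show "measure \<mu> T \<le> (2 * H) ^ CARD('d)" using T_volume T by simp
  qed
  also have "\<dots> = real (card ?S) * (2 * H) ^ CARD('d)" by simp
  also have "\<dots> \<le> Col * (2 * H) ^ CARD('d)"
  proof (rule mult_right_mono)
    \<comment> \<open>All elements touching \<open>j\<close> meet, up to periods, one element that
      has \<open>z j\<close> as a vertex; so the overlap constant bounds their number.\<close>
    obtain G where G: "G \<in> \<T>" "z j extreme_point_of G" using z_vertex[OF j] by (auto simp: mesh_vertices_def)
    have "?S \<subseteq> {T \<in> \<T>. G \<inter> per_ext T \<noteq> {}}"
    proof
      fix T assume T: "T \<in> ?S"
      then obtain v where v: "v extreme_point_of T" "per_eq v (z j)" by (auto simp: touches_def)
      have "v \<in> T" "z j \<in> G" using vertex G v T by auto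
      moreover have "per_eq (z j) v" by (rule per_eq_sym[OF v(2)])
      ultimately show "T \<in> {T \<in> \<T>. G \<inter> per_ext T \<noteq> {}}" using T by (auto simp: per_ext_def)
    qed
    then have "card ?S \<le> card {T \<in> \<T>. G \<inter> per_ext T \<noteq> {}}" using finite_\<T> by (intro card_mono) auto
    then show "real (card ?S) \<le> Col" using card_overlap[OF G(1)] by linarith
  qed (use H_pos in simp)
  finally show ?thesis .
qed

end

section \<open>Smooth cutoff functions\<close>

text \<open>The integer translates of \<open>grid_bump\<close> form a partition of unity.\<close>
definition grid_bump :: "nat \<Rightarrow> real \<Rightarrow> real"
  where "grid_bump n t = step_seq n (t + 1) - step_seq n t"

lemma smooth_grid_bump: "smooth_seq grid_bump"
proof -
  have "smooth_seq (\<lambda>n t. 1 ^ n * step_seq n (1 * t + 1) - step_seq n t)"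
    by (intro smooth_seq_diff smooth_seq_affine step_seq(1))
  then show ?thesis by (simp add: grid_bump_def[abs_def])
qed

lemma grid_bump_0: "1 \<le> \<bar>t\<bar> \<Longrightarrow> grid_bump 0 t = 0"
  using step_seq(2)[of t] step_seq(2)[of "t + 1"] step_seq(3)[of t] step_seq(3)[of "t + 1"]
  by (cases "t \<ge> 0") (auto simp: grid_bump_def)

lemma grid_bump_abs: "\<bar>grid_bump 0 t\<bar> \<le> 1"
  using step_seq(4,5)[of t] step_seq(4,5)[of "t + 1"] unfolding grid_bump_def by linarith

lemma grid_bump_1: assumes "1 < \<bar>t\<bar>" shows "grid_bump 1 t = 0"
proof (rule DERIV_unique)
  show "DERIV (grid_bump 0) t :> grid_bump 1 t" using smooth_grid_bump by (simp add: smooth_seq_def)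
  have "open {s :: real. 1 < \<bar>s\<bar>}" by (intro open_Collect_less continuous_intros)
  then show "DERIV (grid_bump 0) t :> 0"
    by (rule has_field_derivative_transform_within_open[OF DERIV_const[of 0]])
      (use assms grid_bump_0 in \<open>auto simp: less_imp_le\<close>)
qed

lemma grid_bump_1_bound: "\<exists>B>0. \<forall>t. \<bar>grid_bump 1 t\<bar> \<le> B"
proof -
  have "continuous_on {-1..1} (grid_bump 1)"
    using smooth_grid_bump unfolding smooth_seq_def by (meson DERIV_continuous_on has_field_derivative_at_within)
  then have "bounded (grid_bump 1 ` {-1..1})" by (intro compact_imp_bounded compact_continuous_image) auto
  then obtain B where "\<forall>y\<in>grid_bump 1 ` {-1..1}. norm y \<le> B" unfolding bounded_iff by (elim exE)
  then have B: "\<bar>grid_bump 1 t\<bar> \<le> B" if "\<bar>t\<bar> \<le> 1" for t using that by (auto simp: abs_le_iff)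
  have "\<bar>grid_bump 1 t\<bar> \<le> max B 1" for t
    using B[of t] grid_bump_1[of t] by (cases "\<bar>t\<bar> \<le> 1") auto
  then show ?thesis by (intro exI[of _ "max B 1"]) auto
qed

text \<open>The sum telescopes to a difference of two steps. The offset \<open>2\<close> and the
  \<open>n + 5\<close> terms keep the argument of the first step above \<open>1\<close> and that of
  the last below \<open>0\<close> on the whole range, endpoints included.\<close>

lemma sum_grid_bump:
  assumes "0 \<le> t" "t \<le> real n"
  shows "(\<Sum>j<n + 5. grid_bump 0 (t + 2 - real j)) = 1"
proof -
  have "(\<Sum>j<m. grid_bump 0 (t + 2 - real j)) = step_seq 0 (t + 3) - step_seq 0 (t + 3 - real m)" for m
  proof (induction m)
    case (Suc m)
    have "t + 2 - real m + 1 = t + 3 - real m" "t + 2 - real m = t + 3 - real (Suc m)" by simp_all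
    then have "grid_bump 0 (t + 2 - real m) = step_seq 0 (t + 3 - real m) - step_seq 0 (t + 3 - real (Suc m))"
      unfolding grid_bump_def by metis
    then show ?case using Suc by simp
  qed simp
  moreover have "step_seq 0 (t + 3) = 1" "step_seq 0 (t + 3 - real (n + 5)) = 0"
    using assms by (auto intro!: step_seq)
  ultimately show ?thesis by (simp del: of_nat_add)
qed

text \<open>A number attached to the fixed step function, hence free of the mesh and of all
  parameters.\<close>

definition grid_slope :: real where "grid_slope = (SOME B. 0 < B \<and> (\<forall>t. \<bar>grid_bump 1 t\<bar> \<le> B))"

lemma grid_slope: "0 < grid_slope" "\<bar>grid_bump 1 t\<bar> \<le> grid_slope"
  using someI_ex[OF grid_bump_1_bound] unfolding grid_slope_def by blast+

section \<open>Periodic smooth cutoffs adapted to the mesh\<close>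

lemma pd_tensor:
  fixes F :: "'d::finite \<Rightarrow> nat \<Rightarrow> real \<Rightarrow> real"
  assumes "\<And>i. smooth_seq (F i)"
  shows "pd (\<lambda>x :: real ^ 'd. \<Prod>j\<in>UNIV. F j 0 (x $ j)) i x = F i 1 (x $ i) * (\<Prod>j\<in>UNIV - {i}. F j 0 (x $ j))"
proof -
  have a: "all_partials UNIV (\<lambda>x :: real ^ 'd. \<Prod>i\<in>UNIV. F i 0 (x $ i)) (\<lambda>\<sigma> x. \<Prod>i\<in>UNIV. F i (\<sigma> i) (x $ i))"
    by (rule all_partials_tensor[OF assms])
  have d: "((\<lambda>x :: real ^ 'd. \<Prod>i\<in>UNIV. F i 0 (x $ i)) has_derivative
      (\<lambda>h. \<Sum>i\<in>UNIV. h $ i * (\<Prod>j\<in>UNIV. F j (((\<lambda>_. 0)(i := Suc 0)) j) (x $ j)))) (at x)"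
    using a[unfolded all_partials_def, THEN conjunct2, rule_format, of x "\<lambda>_. 0"] by simp
  have "pd (\<lambda>x :: real ^ 'd. \<Prod>j\<in>UNIV. F j 0 (x $ j)) i x = (\<Prod>j\<in>UNIV. F j (((\<lambda>_. 0)(i := Suc 0)) j) (x $ j))"
    by (rule pd_eq_sum[OF d])
  also have "\<dots> = F i 1 (x $ i) * (\<Prod>j\<in>UNIV - {i}. F j 0 (x $ j))"
    by (subst prod.remove[of UNIV i]) (auto intro!: prod.cong)
  finally show ?thesis .
qed

lemma pd_sum:
  fixes f :: "'k \<Rightarrow> real ^ 'd::finite \<Rightarrow> real"
  assumes "\<And>k. k \<in> I \<Longrightarrow> smooth_fn (f k)"
  shows "pd (\<lambda>x. \<Sum>k\<in>I. f k x) i x = (\<Sum>k\<in>I. pd (f k) i x)"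
proof (rule pd_eq_sum)
  have "((\<lambda>x. \<Sum>k\<in>I. f k x) has_derivative (\<lambda>h. \<Sum>k\<in>I. \<Sum>i\<in>UNIV. h $ i * pd (f k) i x)) (at x)"
    by (intro has_derivative_sum smooth_fn_has_derivative(1) assms)
  then show "((\<lambda>x. \<Sum>k\<in>I. f k x) has_derivative (\<lambda>h. \<Sum>i\<in>UNIV. h $ i * (\<Sum>k\<in>I. pd (f k) i x))) (at x)"
    by (subst (asm) sum.swap) (simp add: sum_distrib_left)
qed

lemma card_near_nat: "card {j :: nat. j < M \<and> \<bar>t - real j\<bar> \<le> 1} \<le> 3"
proof -
  let ?m = "nat \<lceil>t - 1\<rceil>"
  have "{j :: nat. j < M \<and> \<bar>t - real j\<bar> \<le> 1} \<subseteq> {?m..?m + 2}"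
  proof
    fix j assume "j \<in> {j. j < M \<and> \<bar>t - real j\<bar> \<le> 1}"
    then have "t - 1 \<le> real j" "real j \<le> t + 1" by (auto simp: abs_le_iff)
    then have "\<lceil>t - 1\<rceil> \<le> int j" "int j \<le> \<lceil>t - 1\<rceil> + 2" by linarith+
    then have "?m \<le> j" "j \<le> ?m + 2" by arith+
    then show "j \<in> {?m..?m + 2}" by simp
  qed
  then have "card {j :: nat. j < M \<and> \<bar>t - real j\<bar> \<le> 1} \<le> card {?m..?m + 2}" by (rule card_mono[rotated]) simp
  then show ?thesis by simp
qed

text \<open>At most \<open>3^d\<close> grid bumps are active at a point, each of slope at most
  \<open>grid_slope\<close> over the grid width; the last factor divided by \<open>H\<close> bounds
  the inverse of that width.\<close>

definition cutoff_slope :: "real \<Rightarrow> real \<Rightarrow> real"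
  where "cutoff_slope d \<kappa> = 3 powr d * grid_slope * (3 * d / \<kappa>\<^sup>2 + d)"

text \<open>The cutoff adds up those members of a tensor product partition of unity whose nodes are
  close to \<open>K\<close> in the periodic sense. The grid is fine against the layer width
  \<open>2 * \<rho>\<^sub>0\<close>, which keeps the support in one patch, but still comparable to
  \<open>H\<close>, which keeps the slope of order \<open>1 / H\<close>.\<close>

lemma (in mesh) cutoff_exists:
  assumes K: "K \<in> unions"
  shows "\<exists>\<eta>. smooth_fn \<eta> \<and>
    (\<forall>i. \<forall>x\<in>Omega. \<eta> (set_coord i 0 x) = \<eta> (set_coord i (2 * pi) x)) \<and>
    (\<forall>x\<in>Omega. \<bar>\<eta> x\<bar> \<le> 3 ^ CARD('d)) \<and>
    (\<forall>x\<in>K. x \<in> interior Omega \<longrightarrow> \<eta> x = 1 \<and> (\<forall>i. pd \<eta> i x = 0)) \<and>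
    (\<forall>x\<in>Omega. \<eta> x \<noteq> 0 \<longrightarrow> x \<in> patch \<T> K) \<and>
    (\<forall>x\<in>Omega. \<forall>i. \<bar>pd \<eta> i x\<bar> \<le> cutoff_slope (real CARD('d)) \<kappa> / H)"
proof -
  define d where "d = real CARD('d)"
  have d: "1 \<le> d" by (simp add: d_def)
  \<comment> \<open>Rounding up the number of cells makes the grid fit the period exactly and yields
    \<open>3 * (d * s) \<le> \<rho>\<^sub>0\<close>.\<close>
  define n where "n = nat \<lceil>2 * pi * (3 * d / \<rho>\<^sub>0)\<rceil>"
  define s where "s = 2 * pi / real n"
  have q: "0 < 2 * pi * (3 * d / \<rho>\<^sub>0)" using d \<rho>0_pos by simp
  have n_ge: "2 * pi * (3 * d / \<rho>\<^sub>0) \<le> real n" unfolding n_def by linarith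
  have n_le: "real n \<le> 2 * pi * (3 * d / \<rho>\<^sub>0) + 1" unfolding n_def using q by linarith
  have n: "0 < real n" using n_ge q by linarith
  have s: "0 < s" using n by (simp add: s_def)
  have sn: "s * real n = 2 * pi" using n by (simp add: s_def)
  have s_le: "3 * (d * s) < 2 * \<rho>\<^sub>0"
  proof -
    have "2 * pi * (3 * d) \<le> \<rho>\<^sub>0 * real n" using n_ge \<rho>0_pos by (simp add: field_simps)
    then have "3 * (d * s) \<le> \<rho>\<^sub>0" using n by (simp add: s_def field_simps)
    then show ?thesis using \<rho>0_pos by linarith
  qed
  \<comment> \<open>The cell gained by rounding costs \<open>1 / (2 * pi)\<close>, which
    \<open>H_le\<close> bounds by \<open>d / H\<close>.\<close>
  have s_ge: "1 / s \<le> (3 * d / \<kappa>\<^sup>2 + d) / H"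
  proof -
    have "1 / s = real n / (2 * pi)" by (simp add: s_def)
    also have "\<dots> \<le> (2 * pi * (3 * d / \<rho>\<^sub>0) + 1) / (2 * pi)" using n_le by (intro divide_right_mono) auto
    also have "\<dots> = 3 * d / \<kappa>\<^sup>2 / H + 1 / (2 * pi)"
      using \<kappa> H_pos by (simp add: \<rho>\<^sub>0_def add_divide_distrib)
    also have "1 / (2 * pi) \<le> d / H" using H_le H_pos by (simp add: d_def field_simps)
    finally show ?thesis by (simp add: add_divide_distrib)
  qed
  define F where "F k i m t = (1 / s) ^ m * grid_bump m ((1 / s) * t + (2 - real (k i)))" for k :: "'d \<Rightarrow> nat" and i m t
  have F: "smooth_seq (F k i)" for k i unfolding F_def by (intro smooth_seq_affine smooth_grid_bump)
  define \<tau> where "\<tau> x i = x $ i / s + 2" for x :: "real ^ 'd" and i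
  define trm where "trm k x = (\<Prod>i\<in>UNIV. F k i 0 (x $ i))" for k and x :: "real ^ 'd"
  have F0: "F k i 0 (x $ i) = grid_bump 0 (\<tau> x i - real (k i))" for k i and x :: "real ^ 'd"
    by (simp add: F_def \<tau>_def algebra_simps)
  have F1: "F k i 1 (x $ i) = (1 / s) * grid_bump 1 (\<tau> x i - real (k i))" for k i and x :: "real ^ 'd"
    by (simp add: F_def \<tau>_def algebra_simps)
  have trm_smooth: "smooth_fn (trm k)" for k
    using all_partials_tensor[of "F k", OF F] unfolding smooth_fn_def trm_def[abs_def] by blast
  define I where "I = (PiE UNIV (\<lambda>_ :: 'd. {..<n + 5}))"
  have finI: "finite I" unfolding I_def by (intro finite_PiE) auto
  define active where "active x k \<longleftrightarrow> (\<forall>i. \<bar>\<tau> x i - real (k i)\<bar> \<le> 1)" for x k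
  have trm_active: "active x k" if "trm k x \<noteq> 0" for x k
    unfolding active_def
  proof (rule allI, rule ccontr)
    fix i assume "\<not> \<bar>\<tau> x i - real (k i)\<bar> \<le> 1"
    then have "F k i 0 (x $ i) = 0" unfolding F0 by (intro grid_bump_0) simp
    then show False using that unfolding trm_def by (auto simp: prod_zero_iff)
  qed
  have trm_abs: "\<bar>trm k x\<bar> \<le> 1" for k x
    unfolding trm_def abs_prod F0 by (intro prod_le_1) (auto simp: grid_bump_abs)
  have pd_trm: "pd (trm k) i x = (1 / s) * grid_bump 1 (\<tau> x i - real (k i)) * (\<Prod>j\<in>UNIV - {i}. grid_bump 0 (\<tau> x j - real (k j)))" for k i x
    using pd_tensor[of "F k" i x, OF F] unfolding trm_def[abs_def] F0 F1 .
  have pd_trm_active: "active x k" if "pd (trm k) i x \<noteq> 0" for x k i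
    unfolding active_def
  proof (rule allI, rule ccontr)
    fix j assume j: "\<not> \<bar>\<tau> x j - real (k j)\<bar> \<le> 1"
    show False
    proof (cases "j = i")
      case True
      then show ?thesis using that grid_bump_1[of "\<tau> x i - real (k i)"] j unfolding pd_trm by simp
    next
      case False
      have "grid_bump 0 (\<tau> x j - real (k j)) = 0" using j by (intro grid_bump_0) simp
      then have "(\<Prod>j\<in>UNIV - {i}. grid_bump 0 (\<tau> x j - real (k j))) = 0"
        using False by (intro prod_zero) auto
      then show ?thesis using that unfolding pd_trm by simp
    qed
  qed
  have pd_trm_abs: "\<bar>pd (trm k) i x\<bar> \<le> grid_slope / s" for k i x
  proof -
    have "\<bar>\<Prod>j\<in>UNIV - {i}. grid_bump 0 (\<tau> x j - real (k j))\<bar> \<le> 1"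
      unfolding abs_prod by (intro prod_le_1) (auto simp: grid_bump_abs)
    then have "\<bar>grid_bump 1 (\<tau> x i - real (k i))\<bar> * \<bar>\<Prod>j\<in>UNIV - {i}. grid_bump 0 (\<tau> x j - real (k j))\<bar> \<le> grid_slope * 1"
      using grid_slope by (intro mult_mono) (auto simp: less_imp_le)
    then show ?thesis unfolding pd_trm abs_mult using s by (simp add: divide_right_mono)
  qed
  have card_active: "real (card {k \<in> I. active x k}) \<le> 3 ^ CARD('d)" for x
  proof -
    let ?P = "PiE UNIV (\<lambda>i. {j. j < n + 5 \<and> \<bar>\<tau> x i - real j\<bar> \<le> 1})"
    have "{k \<in> I. active x k} \<subseteq> ?P" by (auto simp: I_def active_def PiE_def Pi_def)
    moreover have "finite ?P" by (intro finite_PiE) auto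
    ultimately have "card {k \<in> I. active x k} \<le> card ?P" by (intro card_mono)
    also have "card ?P = (\<Prod>i\<in>UNIV. card {j. j < n + 5 \<and> \<bar>\<tau> x i - real j\<bar> \<le> 1})" by (rule card_PiE) simp
    also have "\<dots> \<le> (\<Prod>i\<in>(UNIV :: 'd set). 3)" by (intro prod_mono) (auto simp: card_near_nat)
    also have "\<dots> = 3 ^ CARD('d)" by simp
    finally show ?thesis using of_nat_mono by fastforce
  qed
  have sum_active: "\<bar>\<Sum>k\<in>J. f k\<bar> \<le> 3 ^ CARD('d) * C"
    if "J \<subseteq> I" "\<And>k. \<bar>f k\<bar> \<le> C" "\<And>k. f k \<noteq> 0 \<Longrightarrow> active x k" "0 \<le> C" for J and f :: "('d \<Rightarrow> nat) \<Rightarrow> real" and C x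
  proof -
    have fin: "finite J" using that(1) finI finite_subset by blast
    have "(\<Sum>k\<in>J. f k) = (\<Sum>k\<in>{k \<in> J. active x k}. f k)"
      using fin that(3) by (intro sum.mono_neutral_right) auto
    then have "\<bar>\<Sum>k\<in>J. f k\<bar> \<le> (\<Sum>k\<in>{k \<in> J. active x k}. \<bar>f k\<bar>)" by simp
    also have "\<dots> \<le> (\<Sum>k\<in>{k \<in> J. active x k}. C)" by (intro sum_mono that(2))
    also have "\<dots> = real (card {k \<in> J. active x k}) * C" by simp
    also have "real (card {k \<in> J. active x k}) \<le> real (card {k \<in> I. active x k})"
      using that(1) finI by (intro of_nat_mono card_mono) auto
    also have "\<dots> \<le> 3 ^ CARD('d)" by (rule card_active)
    finally show ?thesis using that(4) by (simp add: mult_right_mono)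
  qed
  have total: "(\<Sum>k\<in>I. trm k x) = 1" if x: "x \<in> Omega" for x
  proof -
    have "(\<Sum>j<n + 5. grid_bump 0 (\<tau> x i - real j)) = 1" for i
    proof -
      have "0 \<le> x $ i / s" "x $ i / s \<le> real n"
        using x s sn by (auto simp: mem_Omega divide_le_eq mult.commute)
      from sum_grid_bump[OF this] show ?thesis by (simp add: \<tau>_def)
    qed
    then have "1 = (\<Prod>i\<in>(UNIV :: 'd set). \<Sum>j<n + 5. grid_bump 0 (\<tau> x i - real j))" by simp
    also have "\<dots> = (\<Sum>k\<in>I. \<Prod>i\<in>UNIV. grid_bump 0 (\<tau> x i - real (k i)))"
      unfolding I_def by (rule prod_sum_PiE) auto
    finally show ?thesis unfolding trm_def F0 by simp
  qed
  \<comment> \<open>The node at which bump \<open>k\<close> is centred; the offset \<open>2\<close>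
    is that of \<open>sum_grid_bump\<close>.\<close>
  define pt where "pt k = (\<chi> i. s * (real (k i) - 2))" for k :: "'d \<Rightarrow> nat"
  have dist_pt: "dist x (pt k) \<le> d * s" if "active x k" for x k
  proof -
    have "\<bar>(x - pt k) $ i\<bar> \<le> s" for i
    proof -
      have "(x - pt k) $ i = s * (\<tau> x i - real (k i))" using s by (simp add: pt_def \<tau>_def field_simps)
      then show ?thesis using that s unfolding active_def by (simp add: abs_mult mult_left_le)
    qed
    then have "norm (x - pt k) \<le> (\<Sum>i\<in>(UNIV :: 'd set). s)"
      by (intro order_trans[OF norm_le_l1_cart] sum_mono)
    then show ?thesis by (simp add: dist_norm d_def)
  qed
  \<comment> \<open>A bump active within \<open>d * s\<close> of a point of \<open>K\<close> has its
    node within \<open>2 * (d * s)\<close> of that point. This margin makes the cutoff equal to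
    \<open>1\<close> not only on \<open>K\<close> but also nearby in the cube, so that its
    derivatives vanish at interior points of the cube in \<open>K\<close>.\<close>
  define near where "near k \<longleftrightarrow> (\<exists>y\<in>K. \<exists>y'. per_eq y' y \<and> dist (pt k) y' \<le> 2 * (d * s))" for k
  define J where "J = {k \<in> I. near k}"
  have JI: "J \<subseteq> I" by (auto simp: J_def)
  define \<eta> where "\<eta> x = (\<Sum>k\<in>J. trm k x)" for x
  have smooth: "smooth_fn \<eta>" unfolding \<eta>_def[abs_def] by (intro smooth_fn_sum trm_smooth)
  have one: "\<eta> x' = 1" if "x \<in> K" "x' \<in> Omega" "dist x' x \<le> d * s" for x x'
  proof -
    have "trm k x' = 0" if k: "k \<in> I - J" for k
    proof (rule ccontr)
      assume "trm k x' \<noteq> 0"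
      then have "dist x' (pt k) \<le> d * s" by (intro dist_pt trm_active)
      then have "dist (pt k) x \<le> 2 * (d * s)"
        using \<open>dist x' x \<le> d * s\<close> dist_triangle[of "pt k" x x'] by (simp add: dist_commute)
      then have "near k" using \<open>x \<in> K\<close> per_eq_refl unfolding near_def by blast
      then show False using k by (simp add: J_def)
    qed
    then have "\<eta> x' = (\<Sum>k\<in>I. trm k x')"
      unfolding \<eta>_def using JI finI by (intro sum.mono_neutral_left) auto
    then show ?thesis using total[OF that(2)] by simp
  qed
  have ds: "0 < d * s" using d s by simp
  have P1: "\<eta> x = 1 \<and> (\<forall>i. pd \<eta> i x = 0)" if x: "x \<in> K" "x \<in> interior Omega" for x
  proof
    have xO: "x \<in> Omega" using x(2) interior_subset by blast
    show "\<eta> x = 1" using one[OF x(1) xO] ds by simp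
    show "\<forall>i. pd \<eta> i x = 0"
    proof
      fix i
      have "((\<lambda>_ :: real ^ 'd. 1 :: real) has_derivative (\<lambda>h. \<Sum>i\<in>UNIV. h $ i * 0)) (at x)" by simp
      then have "(\<eta> has_derivative (\<lambda>h. \<Sum>i\<in>UNIV. h $ i * 0)) (at x)"
      proof (rule has_derivative_transform_within_open[where s = "ball x (d * s) \<inter> interior Omega"])
        show "x \<in> ball x (d * s) \<inter> interior Omega" using x(2) ds by simp
        fix x' assume "x' \<in> ball x (d * s) \<inter> interior Omega"
        then have "x' \<in> Omega" "dist x' x \<le> d * s" using interior_subset by (auto simp: dist_commute)
        then show "1 = \<eta> x'" using one[OF x(1)] by simp
      qed auto
      then show "pd \<eta> i x = 0" by (rule pd_eq_sum)
    qed
  qed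
  have P2: "x \<in> patch \<T> K" if x: "x \<in> Omega" "\<eta> x \<noteq> 0" for x
  proof -
    obtain k where k: "k \<in> J" "trm k x \<noteq> 0"
      using x(2) unfolding \<eta>_def by (meson sum.neutral)
    obtain y y' where y: "y \<in> K" "per_eq y' y" "dist (pt k) y' \<le> 2 * (d * s)"
      using k(1) unfolding J_def near_def by blast
    have "dist x y' \<le> dist x (pt k) + dist (pt k) y'" by (rule dist_triangle)
    also have "\<dots> \<le> d * s + 2 * (d * s)" using dist_pt[OF trm_active[OF k(2)]] y(3) by linarith
    also have "\<dots> < 2 * \<rho>\<^sub>0" using s_le by simp
    finally show ?thesis by (rule near_imp_patch[OF K x(1) y(1,2)])
  qed
  have P3: "\<bar>\<eta> x\<bar> \<le> 3 ^ CARD('d)" for x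
    using sum_active[OF JI trm_abs trm_active, where x = x] unfolding \<eta>_def by simp
  have P4: "\<bar>pd \<eta> i x\<bar> \<le> cutoff_slope (real CARD('d)) \<kappa> / H" for i x
  proof -
    have "pd \<eta> i x = (\<Sum>k\<in>J. pd (trm k) i x)" unfolding \<eta>_def[abs_def] by (intro pd_sum trm_smooth)
    then have "\<bar>pd \<eta> i x\<bar> \<le> 3 ^ CARD('d) * (grid_slope / s)"
      using sum_active[OF JI pd_trm_abs pd_trm_active, where x = x] grid_slope(1) s by simp
    also have "\<dots> = 3 ^ CARD('d) * grid_slope * (1 / s)" by simp
    also have "\<dots> \<le> 3 ^ CARD('d) * grid_slope * ((3 * d / \<kappa>\<^sup>2 + d) / H)"
      using s_ge grid_slope(1) by (intro mult_left_mono) auto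
    also have "\<dots> = cutoff_slope (real CARD('d)) \<kappa> / H"
      by (simp add: cutoff_slope_def d_def powr_realpow)
    finally show ?thesis .
  qed
  \<comment> \<open>On the face where coordinate \<open>i\<close> is zero only bumps with
    \<open>k i = 2\<close> are alive, on the opposite face only those with
    \<open>k i = n + 2\<close>. A shift by one period matches the two families and preserves
    \<open>near\<close>, which is formulated periodically.\<close>
  have P5: "\<eta> (set_coord i 0 x) = \<eta> (set_coord i (2 * pi) x)" if x: "x \<in> Omega" for i x
  proof -
    have t0: "\<tau> (set_coord i 0 x) i = 2" and t1: "\<tau> (set_coord i (2 * pi) x) i = real n + 2"
      using s sn by (simp_all add: \<tau>_def set_coord_def field_simps)
    have tj: "\<tau> (set_coord i 0 x) j = \<tau> (set_coord i (2 * pi) x) j" if "j \<noteq> i" for j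
      using that by (simp add: \<tau>_def set_coord_def)
    have z0: "trm k (set_coord i 0 x) = 0" if "k i \<noteq> 2" for k
    proof -
      have "1 \<le> \<bar>2 - real (k i)\<bar>" using that by (cases "k i < 2") auto
      then have "F k i 0 (set_coord i 0 x $ i) = 0" unfolding F0 t0 by (rule grid_bump_0)
      then show ?thesis unfolding trm_def by (intro prod_zero) auto
    qed
    have z1: "trm k (set_coord i (2 * pi) x) = 0" if "k i \<noteq> n + 2" for k
    proof -
      have "1 \<le> \<bar>real n + 2 - real (k i)\<bar>" using that by (cases "k i < n + 2") auto
      then have "F k i 0 (set_coord i (2 * pi) x $ i) = 0" unfolding F0 t1 by (rule grid_bump_0)
      then show ?thesis unfolding trm_def by (intro prod_zero) auto
    qed
    have pt_shift: "pt (k(i := n + 2)) = pt (k(i := 2)) + axis i (2 * pi)" for k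
      using sn by (auto simp: vec_eq_iff pt_def axis_def algebra_simps)
    have per_shift: "per_eq (y + axis i (2 * pi)) y" "per_eq (y - axis i (2 * pi)) y" for y :: "real ^ 'd"
    proof -
      have "\<exists>l::int. (axis i (2 * pi) :: real ^ 'd) $ j = 2 * pi * of_int l" for j
        by (auto simp: axis_def intro: exI[of _ 1] exI[of _ 0])
      then show "per_eq (y + axis i (2 * pi)) y" by (simp add: per_eq_def)
      have "\<exists>l::int. - (axis i (2 * pi) :: real ^ 'd) $ j = 2 * pi * of_int l" for j
        by (auto simp: axis_def intro: exI[of _ "-1"] exI[of _ 0])
      then show "per_eq (y - axis i (2 * pi)) y" by (simp add: per_eq_def)
    qed
    have near_up: "near (k(i := n + 2))" if "near (k(i := 2))" for k
    proof -
      obtain y y' where y: "y \<in> K" "per_eq y' y" "dist (pt (k(i := 2))) y' \<le> 2 * (d * s)"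
        using \<open>near (k(i := 2))\<close> unfolding near_def by blast
      have "per_eq (y' + axis i (2 * pi)) y" by (rule per_eq_trans[OF per_shift(1) y(2)])
      moreover have "dist (pt (k(i := n + 2))) (y' + axis i (2 * pi)) \<le> 2 * (d * s)"
        using y(3) unfolding pt_shift by (simp add: dist_norm)
      ultimately show ?thesis using y(1) unfolding near_def by blast
    qed
    have near_down: "near (k(i := 2))" if "near (k(i := n + 2))" for k
    proof -
      obtain y y' where y: "y \<in> K" "per_eq y' y" "dist (pt (k(i := n + 2))) y' \<le> 2 * (d * s)"
        using \<open>near (k(i := n + 2))\<close> unfolding near_def by blast
      have "per_eq (y' - axis i (2 * pi)) y" by (rule per_eq_trans[OF per_shift(2) y(2)])
      moreover have "dist (pt (k(i := 2))) (y' - axis i (2 * pi)) \<le> 2 * (d * s)"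
        using y(3) unfolding pt_shift by (simp add: dist_norm algebra_simps)
      ultimately show ?thesis using y(1) unfolding near_def by blast
    qed
    have finJ: "finite J" using JI finI finite_subset by blast
    have "\<eta> (set_coord i 0 x) = (\<Sum>k\<in>{k \<in> J. k i = 2}. trm k (set_coord i 0 x))"
      unfolding \<eta>_def using finJ z0 by (intro sum.mono_neutral_right) auto
    also have "\<dots> = (\<Sum>k\<in>{k \<in> J. k i = n + 2}. trm k (set_coord i (2 * pi) x))"
    proof (rule sum.reindex_bij_witness[where i = "\<lambda>k. k(i := 2)" and j = "\<lambda>k. k(i := n + 2)"])
      fix k assume k: "k \<in> {k \<in> J. k i = 2}"
      then have kk: "k(i := 2) = k" by auto
      then show "(k(i := n + 2))(i := 2) = k" by simp
      have "near (k(i := n + 2))" using k kk by (intro near_up) (simp add: J_def)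
      moreover have "k(i := n + 2) \<in> I" using k by (auto simp: J_def I_def PiE_def Pi_def)
      ultimately show "k(i := n + 2) \<in> {k \<in> J. k i = n + 2}" by (simp add: J_def)
      show "trm (k(i := n + 2)) (set_coord i (2 * pi) x) = trm k (set_coord i 0 x)"
        unfolding trm_def F0
      proof (rule prod.cong[OF refl])
        fix j
        show "grid_bump 0 (\<tau> (set_coord i (2 * pi) x) j - real ((k(i := n + 2)) j))
            = grid_bump 0 (\<tau> (set_coord i 0 x) j - real (k j))"
          using t0 t1 tj[of j] k by (cases "j = i") auto
      qed
    next
      fix k assume k: "k \<in> {k \<in> J. k i = n + 2}"
      then have kk: "k(i := n + 2) = k" by auto
      then show "(k(i := 2))(i := n + 2) = k" by simp
      have "near (k(i := 2))" using k kk by (intro near_down) (simp add: J_def)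
      moreover have "k(i := 2) \<in> I" using k by (auto simp: J_def I_def PiE_def Pi_def)
      ultimately show "k(i := 2) \<in> {k \<in> J. k i = 2}" by (simp add: J_def)
    qed
    also have "\<dots> = \<eta> (set_coord i (2 * pi) x)"
      unfolding \<eta>_def using finJ z1 by (intro sum.mono_neutral_left) auto
    finally show ?thesis .
  qed
  show ?thesis
    using smooth P1 P2 P3 P4 P5 by (intro exI[of _ \<eta>]) simp
qed

section \<open>Local dual functions\<close>

text \<open>An even spline supported in the interval from -1 to 1. It has one continuous derivative,
  which is the regularity asked for by \<open>H1P_C1_compact_support\<close>.\<close>

definition qb :: "real \<Rightarrow> real" where "qb t = (max 0 (1 - t\<^sup>2))\<^sup>2"
definition qb' :: "real \<Rightarrow> real" where "qb' t = - 4 * t * max 0 (1 - t\<^sup>2)"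

lemma max0_sq_deriv: "((\<lambda>t :: real. (max 0 t)\<^sup>2) has_real_derivative 2 * max 0 t) (at t)"
proof -
  consider "t < 0" | "t = 0" | "t > 0" by linarith
  then show ?thesis
  proof cases
    case 1
    have "((\<lambda>_. 0) has_real_derivative 2 * max 0 t) (at t)" using 1 by simp
    then show ?thesis
      by (rule has_field_derivative_transform_within_open[where S = "{..<0}"]) (use 1 in auto)
  next
    case 2
    have "((max 0 (0 + h))\<^sup>2 - (max 0 (0 :: real))\<^sup>2) / h = max 0 h" for h :: real
      by (cases "h > 0") (auto simp: power2_eq_square max_def)
    moreover have "((\<lambda>h :: real. max 0 h) \<longlongrightarrow> max 0 0) (at 0)"
      by (intro tendsto_max tendsto_const tendsto_ident_at)
    ultimately show ?thesis unfolding 2 DERIV_def by simp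
  next
    case 3
    have "((\<lambda>t. t\<^sup>2) has_real_derivative 2 * max 0 t) (at t)"
      using 3 by (auto intro!: derivative_eq_intros)
    then show ?thesis
      by (rule has_field_derivative_transform_within_open[where S = "{0<..}"]) (use 3 in auto)
  qed
qed

lemma qb_deriv: "(qb has_real_derivative qb' t) (at t)"
proof -
  have "((\<lambda>t. 1 - t\<^sup>2) has_real_derivative - (2 * t)) (at t)" by (auto intro!: derivative_eq_intros)
  from DERIV_chain2[where f = "\<lambda>t. (max 0 t)\<^sup>2" and g = "\<lambda>t. 1 - t\<^sup>2", OF max0_sq_deriv this]
  show ?thesis unfolding qb_def[abs_def] qb'_def by (simp add: mult_ac)
qed

lemma qb_cont: "continuous_on A qb" and qb'_cont: "continuous_on A qb'"
  unfolding qb_def[abs_def] qb'_def[abs_def] by (intro continuous_intros)+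

lemma qb_zero: assumes "1 \<le> \<bar>t\<bar>" shows "qb t = 0" "qb' t = 0"
proof -
  have "1 \<le> t\<^sup>2" using assms by (simp add: abs_le_square_iff[of 1 t, simplified])
  then show "qb t = 0" "qb' t = 0" by (simp_all add: qb_def qb'_def)
qed

lemma qb_bounds: "0 \<le> qb t" "qb t \<le> 1" "\<bar>qb' t\<bar> \<le> 4"
proof -
  have m: "0 \<le> max 0 (1 - t\<^sup>2)" "max 0 (1 - t\<^sup>2) \<le> 1" by auto
  show "0 \<le> qb t" by (simp add: qb_def)
  show "qb t \<le> 1" unfolding qb_def using m by (simp add: power_le_one)
  show "\<bar>qb' t\<bar> \<le> 4"
  proof (cases "1 \<le> \<bar>t\<bar>")
    case False
    then have "\<bar>t\<bar> * max 0 (1 - t\<^sup>2) \<le> 1 * 1" using m by (intro mult_mono) auto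
    then show ?thesis using m by (simp add: qb'_def abs_mult)
  qed (simp add: qb_zero)
qed

lemma qb_pos: assumes "\<bar>t\<bar> < 1" shows "0 < qb t"
proof -
  have "t\<^sup>2 < 1" using assms by (simp add: abs_square_less_1)
  then show ?thesis by (simp add: qb_def)
qed

lemma qb_even: "qb (- t) = qb t" by (simp add: qb_def)

section \<open>Moments of a tensor product bump\<close>

definition box_bump :: "real ^ 'd \<Rightarrow> real" where "box_bump y = (\<Prod>i\<in>UNIV. qb (y $ i))"

lemma box_bump_cont: "continuous_on A (box_bump :: real ^ 'd::finite \<Rightarrow> real)"
  unfolding box_bump_def[abs_def]
  by (intro continuous_on_prod continuous_on_compose2[OF qb_cont[of UNIV]] continuous_intros) auto

lemma box_bump_zero: assumes "y \<notin> cbox (- 1) 1" shows "box_bump (y :: real ^ 'd::finite) = 0"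
proof -
  obtain i where "\<not> (- 1 \<le> y $ i \<and> y $ i \<le> 1)" using assms by (auto simp: mem_box_cart)
  then have "1 \<le> \<bar>y $ i\<bar>" by linarith
  then have "qb (y $ i) = 0" by (rule qb_zero)
  then show ?thesis unfolding box_bump_def by (intro prod_zero) auto
qed

lemma integrable_bump:
  fixes f :: "real ^ 'd::finite \<Rightarrow> real"
  assumes "continuous_on UNIV f" shows "integrable lborel (\<lambda>y. box_bump y * f y)"
proof -
  have c: "continuous_on UNIV (\<lambda>y. box_bump y * f y)" by (intro continuous_intros box_bump_cont assms)
  have "set_integrable lborel (cbox (- 1) 1) (\<lambda>y. box_bump y * f y)"
    by (rule borel_integrable_compact[unfolded set_integrable_def[symmetric]])
      (auto intro: continuous_on_subset[OF c] compact_cbox)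
  moreover have "(\<lambda>y. indicat_real (cbox (- 1) 1) y *\<^sub>R (box_bump y * f y)) = (\<lambda>y. box_bump y * f y)"
    using box_bump_zero by (auto simp: indicator_def fun_eq_iff)
  ultimately show ?thesis by (simp add: set_integrable_def)
qed

lemma integral_pos_open:
  fixes f :: "'a::euclidean_space \<Rightarrow> real"
  assumes f: "integrable lborel f" "\<And>x. 0 \<le> f x" and U: "open U" "U \<noteq> {}" "\<And>x. x \<in> U \<Longrightarrow> 0 < f x"
  shows "0 < (\<integral>x. f x \<partial>lborel)"
proof (rule ccontr)
  assume "\<not> 0 < (\<integral>x. f x \<partial>lborel)"
  moreover have "0 \<le> (\<integral>x. f x \<partial>lborel)" using f(2) by (intro integral_nonneg_AE) simp
  ultimately have "(\<integral>x. f x \<partial>lborel) = 0" by linarith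
  then have "AE x in lborel. f x = 0" using integral_nonneg_eq_0_iff_AE[OF f(1)] f(2) by simp
  then have "AE x in lborel. x \<notin> U" by eventually_elim (use U(3) in force)
  then have "U \<in> null_sets lborel" using U(1) by (subst (asm) AE_iff_null_sets[symmetric]) auto
  then have "negligible U" by (simp add: negligible_iff_null_sets null_sets_completionI)
  then show False using open_not_negligible[OF U(1,2)] by simp
qed

lemma bump_moment_pos:
  fixes i :: "'d::finite"
  shows "0 < (integral\<^sup>L lborel (\<lambda>y :: real ^ 'd. box_bump y))" "0 < (integral\<^sup>L lborel (\<lambda>y :: real ^ 'd. box_bump y * (y $ i)\<^sup>2))"
proof -
  let ?U = "box 0 1 :: (real ^ 'd) set"
  have U: "?U \<noteq> {}"
  proof -
    have "(\<chi> i. 1 / 2) \<in> ?U" by (simp add: mem_box_cart)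
    then show ?thesis by blast
  qed
  have pos: "0 < box_bump y" "0 < (y $ i)\<^sup>2" if "y \<in> ?U" for y
  proof -
    have y: "0 < y $ j \<and> y $ j < 1" for j using that by (simp add: mem_box_cart)
    have "0 < qb (y $ j)" for j using y[of j] by (intro qb_pos) simp
    then show "0 < box_bump y" unfolding box_bump_def by (intro prod_pos) auto
    show "0 < (y $ i)\<^sup>2" using y[of i] by simp
  qed
  have nn: "0 \<le> box_bump y" for y :: "real ^ 'd" unfolding box_bump_def by (intro prod_nonneg) (simp add: qb_bounds)
  have "integrable lborel (\<lambda>y :: real ^ 'd. box_bump y * 1)" by (intro integrable_bump continuous_intros)
  then show "0 < (integral\<^sup>L lborel (\<lambda>y :: real ^ 'd. box_bump y))"
    by (intro integral_pos_open[OF _ nn open_box U pos(1)]) simp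
  have "integrable lborel (\<lambda>y :: real ^ 'd. box_bump y * (y $ i)\<^sup>2)" by (intro integrable_bump continuous_intros)
  then show "0 < (integral\<^sup>L lborel (\<lambda>y :: real ^ 'd. box_bump y * (y $ i)\<^sup>2))"
    by (intro integral_pos_open[OF _ _ open_box U]) (use pos nn in auto)
qed

text \<open>Reflection in one coordinate preserves Lebesgue measure, so the integral equals its own
  negative.\<close>

lemma integral_odd:
  fixes f :: "real ^ 'd::finite \<Rightarrow> real" and i :: 'd
  assumes f: "f \<in> borel_measurable borel" and odd: "\<And>y. f (\<chi> j. if j = i then - y $ j else y $ j) = - f y"
  shows "(\<integral>y. f y \<partial>lborel) = 0"
proof -
  define c where "c j = (if j = axis i (1::real) then - 1 else 1 :: real)" for j :: "real ^ 'd"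
  define T where "T x = 0 + (\<Sum>j\<in>Basis. (c j * (x \<bullet> j)) *\<^sub>R j)" for x :: "real ^ 'd"
  have T: "T x = (\<chi> j. if j = i then - x $ j else x $ j)" for x
  proof -
    have "T x $ k = (if k = i then - x $ k else x $ k)" for k
    proof -
      have b: "axis k (1::real) \<in> (Basis :: (real ^ 'd) set)" by (simp add: axis_in_Basis_iff)
      have "T x $ k = T x \<bullet> axis k 1" by (simp add: inner_axis)
      also have "\<dots> = c (axis k 1) * (x \<bullet> axis k 1)" unfolding T_def using b by simp
      finally show ?thesis by (simp add: c_def inner_axis axis_eq_axis)
    qed
    then show ?thesis by (simp add: vec_eq_iff)
  qed
  have m: "T \<in> borel_measurable borel" unfolding T_def[abs_def] by measurable
  have "lborel = density (distr lborel borel T) (\<lambda>_. (\<Prod>j\<in>Basis. \<bar>c j\<bar>))"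
    unfolding T_def[abs_def] by (rule lborel_affine_euclidean) (simp add: c_def)
  moreover have "(\<Prod>j\<in>Basis. \<bar>c j\<bar>) = 1" by (intro prod.neutral) (simp add: c_def)
  ultimately have l: "lborel = distr lborel borel T" by (simp add: density_1)
  have "(\<integral>y. f y \<partial>lborel) = (\<integral>y. f y \<partial>distr lborel borel T)" using l by simp
  also have "\<dots> = (\<integral>y. f (T y) \<partial>lborel)" by (rule integral_distr) (use m f in auto)
  also have "\<dots> = - (\<integral>y. f y \<partial>lborel)" unfolding T odd by simp
  finally show ?thesis by simp
qed

lemma box_bump_reflect: "box_bump (\<chi> j. if j = i then - y $ j else y $ j) = box_bump (y :: real ^ 'd::finite)"
  unfolding box_bump_def by (intro prod.cong refl) (simp add: qb_even)

lemma bump_moments_zero: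
  fixes i :: "'d::finite"
  shows "(integral\<^sup>L lborel (\<lambda>y :: real ^ 'd. box_bump y * y $ i)) = 0"
    "k \<noteq> i \<Longrightarrow> (integral\<^sup>L lborel (\<lambda>y :: real ^ 'd. box_bump y * (y $ i * y $ k))) = 0"
proof -
  have "continuous_on UNIV (\<lambda>y :: real ^ 'd. box_bump y * y $ i)" "continuous_on UNIV (\<lambda>y :: real ^ 'd. box_bump y * (y $ i * y $ k))"
    by (intro continuous_intros box_bump_cont)+
  note m = this[THEN borel_measurable_continuous_onI]
  show "(integral\<^sup>L lborel (\<lambda>y :: real ^ 'd. box_bump y * y $ i)) = 0"
    by (rule integral_odd[OF m(1), of i]) (simp add: box_bump_reflect)
  show "(integral\<^sup>L lborel (\<lambda>y :: real ^ 'd. box_bump y * (y $ i * y $ k))) = 0" if "k \<noteq> i"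
    by (rule integral_odd[OF m(2), of i]) (use that in \<open>simp add: box_bump_reflect\<close>)
qed

lemma integral_rescale:
  fixes f :: "real ^ 'd::finite \<Rightarrow> real"
  assumes f: "f \<in> borel_measurable borel" and r: "0 < r"
  shows "(\<integral>x. f x \<partial>lborel) = r ^ CARD('d) * (\<integral>y. f (c + r *\<^sub>R y) \<partial>lborel)"
proof -
  let ?D = "distr lborel borel (\<lambda>x. c + r *\<^sub>R x)"
  have "lborel = density ?D (\<lambda>_. ennreal (\<bar>r\<bar> ^ DIM(real ^ 'd)))" using r lborel_affine[of r c] by simp
  then have "(\<integral>x. f x \<partial>lborel) = (\<integral>x. f x \<partial>density ?D (\<lambda>_. ennreal (\<bar>r\<bar> ^ DIM(real ^ 'd))))" by simp
  also have "\<dots> = (\<integral>x. (\<bar>r\<bar> ^ DIM(real ^ 'd)) *\<^sub>R f x \<partial>?D)"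
    using r f by (intro integral_density) auto
  also have "\<dots> = (\<integral>y. (\<bar>r\<bar> ^ DIM(real ^ 'd)) *\<^sub>R f (c + r *\<^sub>R y) \<partial>lborel)"
    using f by (intro integral_distr) auto
  also have "\<dots> = r ^ CARD('d) * (\<integral>y. f (c + r *\<^sub>R y) \<partial>lborel)" using r by simp
  finally show ?thesis .
qed

text \<open>Since \<open>w\<close> may lie outside of the cube, a multiple of a single positive bump does not suffice.\<close>
lemma bubble_exists:
  fixes Z :: real
  assumes Z: "0 \<le> Z"
  shows "\<exists>C>0. \<forall>(c :: real ^ 'd::finite) w r. 0 < r \<longrightarrow> (\<forall>i. \<bar>w $ i - c $ i\<bar> \<le> Z * r) \<longrightarrow>
    (\<exists>b P. (\<forall>x. (b has_derivative (\<lambda>h. \<Sum>i\<in>UNIV. h $ i * P i x)) (at x)) \<and> (\<forall>i. continuous_on UNIV (P i)) \<and>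
      (\<forall>x. x \<notin> cbox (\<chi> i. c $ i - r) (\<chi> i. c $ i + r) \<longrightarrow> b x = 0 \<and> (\<forall>i. P i x = 0)) \<and>
      (\<forall>x. \<bar>b x\<bar> \<le> C / r ^ CARD('d)) \<and> (\<forall>i x. \<bar>P i x\<bar> \<le> C / r ^ (CARD('d) + 1)) \<and>
      (\<forall>\<beta> \<alpha>. (\<integral>x. b x * (\<beta> + \<alpha> \<bullet> x) \<partial>lborel) = \<beta> + \<alpha> \<bullet> w))"
proof -
  define m0 where "m0 = (integral\<^sup>L lborel (\<lambda>y :: real ^ 'd. box_bump y))"
  define m2 where "m2 i = (integral\<^sup>L lborel (\<lambda>y :: real ^ 'd. box_bump y * (y $ i)\<^sup>2))" for i
  have m0: "0 < m0" and m2: "0 < m2 i" for i unfolding m0_def m2_def by (rule bump_moment_pos)+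
  \<comment> \<open>\<open>L\<close> bounds the affine factor \<open>l\<close> on the cube. In
    \<open>C\<close> the number \<open>4\<close> is the bound for \<open>qb'\<close>, and the second
    summand comes from differentiating \<open>l\<close>.\<close>
  define L where "L = 1 / m0 + Z * (\<Sum>i\<in>UNIV. 1 / m2 i)"
  define C where "C = 4 * L + Z * (\<Sum>i\<in>UNIV. 1 / m2 i)"
  have S0: "0 \<le> (\<Sum>i\<in>UNIV. 1 / m2 i)" using m2 by (intro sum_nonneg) (simp add: less_imp_le)
  have L: "0 < L" unfolding L_def using m0 Z S0 by (intro add_pos_nonneg mult_nonneg_nonneg) auto
  have C: "0 < C" "L \<le> C" unfolding C_def using L Z S0 mult_nonneg_nonneg[OF Z S0] by linarith+
  show ?thesis
  proof (intro exI[of _ C] conjI C(1) allI impI)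
    fix c w :: "real ^ 'd" and r :: real
    assume r: "0 < r" and w: "\<forall>i. \<bar>w $ i - c $ i\<bar> \<le> Z * r"
    define d where "d = CARD('d)"
    define \<zeta> where "\<zeta> i = (w $ i - c $ i) / r" for i
    have \<zeta>: "\<bar>\<zeta> i\<bar> \<le> Z" for i using w r by (simp add: \<zeta>_def field_simps)
    define Y where "Y x i = (x $ i - c $ i) / r" for x :: "real ^ 'd" and i
    define B where "B x = (\<Prod>i\<in>UNIV. qb (Y x i))" for x
    \<comment> \<open>This affine weight represents evaluation at \<open>w\<close> through the
      moments of the bump: \<open>1 / m0\<close> reproduces constants, and division by
      \<open>m2 i\<close> lets coordinate \<open>i\<close> return the scaled offset
      \<open>\<zeta> i\<close>. First and mixed second moments vanish, so nothing else
      survives.\<close>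
    define l where "l x = 1 / m0 + (\<Sum>i\<in>UNIV. \<zeta> i * Y x i / m2 i)" for x
    define dB where "dB i x = qb' (Y x i) / r * (\<Prod>j\<in>UNIV - {i}. qb (Y x j))" for i x
    define b where "b x = 1 / r ^ d * (B x * l x)" for x
    define P where "P i x = 1 / r ^ d * (B x * (\<zeta> i / m2 i / r) + dB i x * l x)" for i x
    have dY: "((\<lambda>x. Y x i) has_derivative (\<lambda>h. h $ i / r)) (at x)" for i x
      unfolding Y_def by (rule has_derivative_divide[OF has_derivative_diff[OF bounded_linear_imp_has_derivative[OF bounded_linear_vec_nth] has_derivative_const], where g = "\<lambda>_. r" and g' = "\<lambda>_. 0", THEN has_derivative_eq_rhs]) (use r in auto)
    have dqY: "((\<lambda>x. qb (Y x i)) has_derivative (\<lambda>h. qb' (Y x i) * (h $ i / r))) (at x)" for i x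
      using has_derivative_compose[OF dY qb_deriv[unfolded has_field_derivative_def], of i x] .
    have dBd: "(B has_derivative (\<lambda>h. \<Sum>i\<in>UNIV. h $ i * dB i x)) (at x)" for x
    proof -
      have "(B has_derivative (\<lambda>h. \<Sum>i\<in>UNIV. (qb' (Y x i) * (h $ i / r)) * (\<Prod>j\<in>UNIV - {i}. qb (Y x j)))) (at x)"
        unfolding B_def[abs_def] by (rule has_derivative_prod[OF dqY])
      then show ?thesis by (simp add: dB_def mult_ac)
    qed
    have dl: "(l has_derivative (\<lambda>h. \<Sum>i\<in>UNIV. h $ i * (\<zeta> i / m2 i / r))) (at x)" for x
    proof -
      have "(l has_derivative (\<lambda>h. 0 + (\<Sum>i\<in>UNIV. (\<zeta> i / m2 i) * (h $ i / r)))) (at x)"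
      proof -
        have "l = (\<lambda>x. 1 / m0 + (\<Sum>i\<in>UNIV. (\<zeta> i / m2 i) * Y x i))" by (simp add: l_def fun_eq_iff)
        then show ?thesis
          by (simp only:) (intro has_derivative_add has_derivative_const has_derivative_sum has_derivative_mult_right dY)
      qed
      then show ?thesis by (simp add: mult_ac)
    qed
    have db: "(b has_derivative (\<lambda>h. \<Sum>i\<in>UNIV. h $ i * P i x)) (at x)" for x
    proof -
      have "(b has_derivative (\<lambda>h. 1 / r ^ d * (\<Sum>i\<in>UNIV. h $ i * (B x * (\<zeta> i / m2 i / r) + dB i x * l x)))) (at x)"
        unfolding b_def[abs_def] by (intro has_derivative_mult_right has_derivative_mult_sum dBd dl)
      moreover have "1 / r ^ d * (\<Sum>i\<in>UNIV. h $ i * (B x * (\<zeta> i / m2 i / r) + dB i x * l x)) = (\<Sum>i\<in>UNIV. h $ i * P i x)" for h :: "real ^ 'd"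
        unfolding P_def sum_distrib_left by (intro sum.cong refl) (simp add: mult_ac)
      ultimately show ?thesis by simp
    qed
    have Yc: "continuous_on UNIV (\<lambda>x. Y x i)" for i unfolding Y_def using r by (intro continuous_intros) auto
    have qYc: "continuous_on UNIV (\<lambda>x. qb (Y x i))" "continuous_on UNIV (\<lambda>x. qb' (Y x i))" for i
      by (rule continuous_on_compose2[OF qb_cont[of UNIV] Yc], simp, rule continuous_on_compose2[OF qb'_cont[of UNIV] Yc], simp)
    have Bc: "continuous_on UNIV B" unfolding B_def[abs_def] by (intro continuous_on_prod qYc)
    have lc: "continuous_on UNIV l"
      unfolding l_def[abs_def] by (intro continuous_intros Yc) (use m2 less_imp_neq in fastforce)
    have dBc: "continuous_on UNIV (dB i)" for i
      unfolding dB_def[abs_def] using r by (intro continuous_intros continuous_on_prod qYc) auto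
    have Pc: "continuous_on UNIV (P i)" for i
      unfolding P_def[abs_def] by (intro continuous_intros Bc lc dBc)
    have bc: "continuous_on UNIV b" unfolding b_def[abs_def] by (intro continuous_intros Bc lc)
    have outside: "B x = 0 \<and> (\<forall>i. dB i x = 0)" if ex: "\<exists>j. 1 \<le> \<bar>Y x j\<bar>" for x
    proof -
      obtain j where j: "1 \<le> \<bar>Y x j\<bar>" using ex by blast
      have "B x = 0" unfolding B_def by (intro prod_zero) (auto intro: qb_zero j)
      moreover have "dB i x = 0" for i
      proof (cases "i = j")
        case True then show ?thesis using qb_zero(2)[OF j] by (simp add: dB_def)
      next
        case False
        then have "(\<Prod>j\<in>UNIV - {i}. qb (Y x j)) = 0" by (intro prod_zero) (auto intro!: bexI[of _ j] qb_zero j)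
        then show ?thesis by (simp add: dB_def)
      qed
      ultimately show ?thesis by blast
    qed
    have Bb: "0 \<le> B x" "B x \<le> 1" for x
      unfolding B_def by (auto intro!: prod_nonneg prod_le_1 simp: qb_bounds)
    have dBb: "\<bar>dB i x\<bar> \<le> 4 / r" for i x
    proof -
      have "\<bar>\<Prod>j\<in>UNIV - {i}. qb (Y x j)\<bar> \<le> 1" unfolding abs_prod by (intro prod_le_1) (simp add: qb_bounds)
      then have "\<bar>qb' (Y x i)\<bar> * \<bar>\<Prod>j\<in>UNIV - {i}. qb (Y x j)\<bar> \<le> 4 * 1" by (intro mult_mono qb_bounds) auto
      then show ?thesis unfolding dB_def abs_mult abs_divide using r by (simp add: divide_right_mono)
    qed
    have lb: "\<bar>l x\<bar> \<le> L" if "\<And>j. \<bar>Y x j\<bar> < 1" for x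
    proof -
      have "\<bar>\<zeta> i * Y x i / m2 i\<bar> \<le> Z * (1 / m2 i)" for i
      proof -
        have "\<bar>\<zeta> i\<bar> * \<bar>Y x i\<bar> \<le> Z * 1" using \<zeta> that[of i] Z by (intro mult_mono) auto
        then show ?thesis using m2[of i] by (simp add: abs_mult divide_right_mono)
      qed
      then have "\<bar>\<Sum>i\<in>UNIV. \<zeta> i * Y x i / m2 i\<bar> \<le> (\<Sum>i\<in>UNIV. Z * (1 / m2 i))"
        by (intro order_trans[OF sum_abs] sum_mono)
      then have "\<bar>\<Sum>i\<in>UNIV. \<zeta> i * Y x i / m2 i\<bar> \<le> Z * (\<Sum>i\<in>UNIV. 1 / m2 i)"
        by (simp only: sum_distrib_left)
      moreover have "0 < 1 / m0" using m0 by simp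
      ultimately show ?thesis unfolding l_def L_def by linarith
    qed
    have b_bound: "\<bar>b x\<bar> \<le> C / r ^ d" for x
    proof (cases "\<exists>j. 1 \<le> \<bar>Y x j\<bar>")
      case True then show ?thesis using outside[OF True] C r by (simp add: b_def)
    next
      case False
      then have "\<bar>B x\<bar> * \<bar>l x\<bar> \<le> 1 * L" using Bb[of x] by (intro mult_mono lb) (auto simp: not_le)
      then have "\<bar>B x * l x\<bar> \<le> C" using C(2) by (simp add: abs_mult)
      then show ?thesis using r by (simp add: b_def abs_mult divide_right_mono)
    qed
    have P_bound: "\<bar>P i x\<bar> \<le> C / r ^ (d + 1)" for i x
    proof (cases "\<exists>j. 1 \<le> \<bar>Y x j\<bar>")
      case True then show ?thesis using outside[OF True] C r by (simp add: P_def)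
    next
      case False
      have "\<bar>dB i x\<bar> * \<bar>l x\<bar> \<le> 4 / r * L"
        using False r by (intro mult_mono dBb lb) (auto simp: not_le)
      moreover have "\<bar>B x\<bar> * \<bar>\<zeta> i / m2 i / r\<bar> \<le> 1 * (Z * (\<Sum>i\<in>UNIV. 1 / m2 i) / r)"
      proof (rule mult_mono)
        have "\<bar>\<zeta> i\<bar> * (1 / m2 i) \<le> Z * (\<Sum>i\<in>UNIV. 1 / m2 i)"
          using \<zeta> Z m2 by (intro mult_mono member_le_sum) (auto simp: less_imp_le)
        then have "\<bar>\<zeta> i\<bar> * (1 / m2 i) / r \<le> Z * (\<Sum>i\<in>UNIV. 1 / m2 i) / r"
          using r by (intro divide_right_mono) auto
        moreover have "\<bar>\<zeta> i / m2 i / r\<bar> = \<bar>\<zeta> i\<bar> * (1 / m2 i) / r"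
          using m2[of i] r by (simp add: abs_mult)
        ultimately show "\<bar>\<zeta> i / m2 i / r\<bar> \<le> Z * (\<Sum>i\<in>UNIV. 1 / m2 i) / r" by (simp only:)
      qed (use Bb[of x] in auto)
      ultimately have "\<bar>B x * (\<zeta> i / m2 i / r) + dB i x * l x\<bar> \<le> Z * (\<Sum>i\<in>UNIV. 1 / m2 i) / r + 4 / r * L"
        using abs_triangle_ineq[of "B x * (\<zeta> i / m2 i / r)" "dB i x * l x"] unfolding abs_mult by linarith
      also have "\<dots> = C / r" by (simp add: C_def add_divide_distrib)
      finally have "1 / r ^ d * \<bar>B x * (\<zeta> i / m2 i / r) + dB i x * l x\<bar> \<le> 1 / r ^ d * (C / r)"
        using r by (intro mult_left_mono) auto
      then show ?thesis using r by (simp add: P_def abs_mult mult.commute)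
    qed
    have support: "b x = 0 \<and> (\<forall>i. P i x = 0)" if out: "x \<notin> cbox (\<chi> i. c $ i - r) (\<chi> i. c $ i + r)" for x
    proof -
      obtain j where "\<not> (c $ j - r \<le> x $ j \<and> x $ j \<le> c $ j + r)" using out by (auto simp: mem_box_cart)
      then have "r \<le> \<bar>x $ j - c $ j\<bar>" by linarith
      then have "1 \<le> \<bar>Y x j\<bar>" using r by (simp add: Y_def)
      then have "B x = 0 \<and> (\<forall>i. dB i x = 0)" using outside[of x] by blast
      then show ?thesis by (simp add: b_def P_def)
    qed
    have moment: "(\<integral>x. b x * (\<beta> + \<alpha> \<bullet> x) \<partial>lborel) = \<beta> + \<alpha> \<bullet> w" for \<beta> and \<alpha> :: "real ^ 'd"
    proof -
      define \<beta>' where "\<beta>' = \<beta> + \<alpha> \<bullet> c"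
      define I where "I f = (\<integral>y. box_bump y * f y \<partial>lborel)" for f :: "real ^ 'd \<Rightarrow> real"
      have I_add: "I (\<lambda>y. f y + g y) = I f + I g" if "continuous_on UNIV f" "continuous_on UNIV g" for f g
        unfolding I_def distrib_left by (intro Bochner_Integration.integral_add integrable_bump that)
      have I_mult: "I (\<lambda>y. k * f y) = k * I f" for k f
        unfolding I_def by (simp add: mult.left_commute)
      have I_sum: "I (\<lambda>y. \<Sum>i\<in>A. f i y) = (\<Sum>i\<in>A. I (f i))" if "\<And>i. continuous_on UNIV (f i)" for f :: "'d \<Rightarrow> _" and A
        unfolding I_def sum_distrib_left by (intro Bochner_Integration.integral_sum integrable_bump that)
      have I1: "I (\<lambda>y. 1) = m0" by (simp add: I_def m0_def)
      have Ii: "I (\<lambda>y. y $ i) = 0" for i by (simp add: I_def bump_moments_zero)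
      have Iik: "I (\<lambda>y. y $ i * y $ k) = (if k = i then m2 i else 0)" for i k
        using bump_moments_zero(2)[of k i] by (auto simp: I_def m2_def power2_eq_square)
      have ci: "continuous_on UNIV (\<lambda>y :: real ^ 'd. y $ i)" for i by (intro continuous_intros)
      have "(\<integral>x. b x * (\<beta> + \<alpha> \<bullet> x) \<partial>lborel) = r ^ d * (\<integral>y. b (c + r *\<^sub>R y) * (\<beta> + \<alpha> \<bullet> (c + r *\<^sub>R y)) \<partial>lborel)"
        unfolding d_def using r
        by (intro integral_rescale borel_measurable_continuous_onI continuous_intros bc)
      also have "(\<lambda>y. b (c + r *\<^sub>R y) * (\<beta> + \<alpha> \<bullet> (c + r *\<^sub>R y)))
          = (\<lambda>y. 1 / r ^ d * (box_bump y * ((1 / m0 + (\<Sum>i\<in>UNIV. (\<zeta> i / m2 i) * y $ i)) * (\<beta>' + r * (\<Sum>k\<in>UNIV. \<alpha> $ k * y $ k)))))"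
      proof
        fix y
        have "\<alpha> \<bullet> (r *\<^sub>R y) = r * (\<Sum>k\<in>UNIV. \<alpha> $ k * y $ k)"
          by (simp only: inner_scaleR_right) (simp add: inner_vec_def)
        then have 1: "\<beta> + \<alpha> \<bullet> (c + r *\<^sub>R y) = \<beta>' + r * (\<Sum>k\<in>UNIV. \<alpha> $ k * y $ k)"
          by (simp add: \<beta>'_def inner_add_right)
        have "Y (c + r *\<^sub>R y) i = y $ i" for i using r by (simp add: Y_def)
        then have 2: "b (c + r *\<^sub>R y) = 1 / r ^ d * (box_bump y * (1 / m0 + (\<Sum>i\<in>UNIV. (\<zeta> i / m2 i) * y $ i)))"
          by (simp add: b_def B_def l_def box_bump_def)
        show "b (c + r *\<^sub>R y) * (\<beta> + \<alpha> \<bullet> (c + r *\<^sub>R y)) = 1 / r ^ d * (box_bump y * ((1 / m0 + (\<Sum>i\<in>UNIV. (\<zeta> i / m2 i) * y $ i)) * (\<beta>' + r * (\<Sum>k\<in>UNIV. \<alpha> $ k * y $ k))))"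
          unfolding 1 2 by (simp only: mult.assoc)
      qed
      also have "r ^ d * (\<integral>y. 1 / r ^ d * (box_bump y * ((1 / m0 + (\<Sum>i\<in>UNIV. (\<zeta> i / m2 i) * y $ i)) * (\<beta>' + r * (\<Sum>k\<in>UNIV. \<alpha> $ k * y $ k)))) \<partial>lborel)
          = I (\<lambda>y. (1 / m0 + (\<Sum>i\<in>UNIV. (\<zeta> i / m2 i) * y $ i)) * (\<beta>' + r * (\<Sum>k\<in>UNIV. \<alpha> $ k * y $ k)))"
        using r by (simp add: I_def)
      \<comment> \<open>Expansion into monomials of degree at most two, whose moments are all
        known.\<close>
      also have "(\<lambda>y :: real ^ 'd. (1 / m0 + (\<Sum>i\<in>UNIV. (\<zeta> i / m2 i) * y $ i)) * (\<beta>' + r * (\<Sum>k\<in>UNIV. \<alpha> $ k * y $ k)))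
          = (\<lambda>y. (\<beta>' / m0) * 1 + ((\<Sum>k\<in>UNIV. (r / m0 * \<alpha> $ k) * y $ k) + ((\<Sum>i\<in>UNIV. (\<zeta> i / m2 i * \<beta>') * y $ i)
              + (\<Sum>i\<in>UNIV. \<Sum>k\<in>UNIV. (\<zeta> i / m2 i * r * \<alpha> $ k) * (y $ i * y $ k)))))"
      proof
        fix y :: "real ^ 'd"
        have 1: "(\<Sum>i\<in>UNIV. (\<zeta> i / m2 i) * y $ i) * (r * (\<Sum>k\<in>UNIV. \<alpha> $ k * y $ k))
            = (\<Sum>i\<in>UNIV. \<Sum>k\<in>UNIV. (\<zeta> i / m2 i * r * \<alpha> $ k) * (y $ i * y $ k))"
          by (simp add: sum_product sum_distrib_left mult_ac)
        have 2: "1 / m0 * (r * (\<Sum>k\<in>UNIV. \<alpha> $ k * y $ k)) = (\<Sum>k\<in>UNIV. (r / m0 * \<alpha> $ k) * y $ k)"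
          by (simp add: sum_distrib_left mult_ac sum_divide_distrib)
        have 3: "(\<Sum>i\<in>UNIV. (\<zeta> i / m2 i) * y $ i) * \<beta>' = (\<Sum>i\<in>UNIV. (\<zeta> i / m2 i * \<beta>') * y $ i)"
          unfolding sum_distrib_right by (intro sum.cong refl) (simp add: mult_ac)
        show "(1 / m0 + (\<Sum>i\<in>UNIV. (\<zeta> i / m2 i) * y $ i)) * (\<beta>' + r * (\<Sum>k\<in>UNIV. \<alpha> $ k * y $ k))
          = (\<beta>' / m0) * 1 + ((\<Sum>k\<in>UNIV. (r / m0 * \<alpha> $ k) * y $ k) + ((\<Sum>i\<in>UNIV. (\<zeta> i / m2 i * \<beta>') * y $ i)
              + (\<Sum>i\<in>UNIV. \<Sum>k\<in>UNIV. (\<zeta> i / m2 i * r * \<alpha> $ k) * (y $ i * y $ k))))"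
          unfolding distrib_left distrib_right 1 2 3 by simp
      qed
      also have "I \<dots> = \<beta>' / m0 * m0 + ((\<Sum>k\<in>UNIV. (r / m0 * \<alpha> $ k) * 0) + ((\<Sum>i\<in>UNIV. (\<zeta> i / m2 i * \<beta>') * 0)
              + (\<Sum>i\<in>UNIV. \<Sum>k\<in>UNIV. (\<zeta> i / m2 i * r * \<alpha> $ k) * (if k = i then m2 i else 0))))"
        by (subst I_add I_sum, (intro continuous_intros)+)+ (simp only: I_sum I_mult I1 Ii Iik continuous_intros)
      also have "\<dots> = \<beta>' + r * (\<Sum>i\<in>UNIV. \<zeta> i * \<alpha> $ i)"
      proof -
        have "(\<Sum>k\<in>UNIV. (\<zeta> i / m2 i * r * \<alpha> $ k) * (if k = i then m2 i else 0)) = r * (\<zeta> i * \<alpha> $ i)" for i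
          using m2[of i] by (simp add: if_distrib[of "\<lambda>u. _ * u"] cong: if_cong)
        then show ?thesis using m0 by (simp add: sum_distrib_left)
      qed
      also have "\<dots> = \<beta> + \<alpha> \<bullet> w"
      proof -
        have "r * (\<Sum>i\<in>UNIV. \<zeta> i * \<alpha> $ i) = \<alpha> \<bullet> (w - c)"
          unfolding inner_vec_def sum_distrib_left using r by (intro sum.cong refl) (simp add: \<zeta>_def)
        then show ?thesis by (simp add: \<beta>'_def inner_diff_right)
      qed
      finally show ?thesis .
    qed
    show "\<exists>b P. (\<forall>x. (b has_derivative (\<lambda>h. \<Sum>i\<in>UNIV. h $ i * P i x)) (at x)) \<and> (\<forall>i. continuous_on UNIV (P i)) \<and>
      (\<forall>x. x \<notin> cbox (\<chi> i. c $ i - r) (\<chi> i. c $ i + r) \<longrightarrow> b x = 0 \<and> (\<forall>i. P i x = 0)) \<and>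
      (\<forall>x. \<bar>b x\<bar> \<le> C / r ^ CARD('d)) \<and> (\<forall>i x. \<bar>P i x\<bar> \<le> C / r ^ (CARD('d) + 1)) \<and>
      (\<forall>\<beta> \<alpha>. (\<integral>x. b x * (\<beta> + \<alpha> \<bullet> x) \<partial>lborel) = \<beta> + \<alpha> \<bullet> w)"
      using db Pc support b_bound P_bound moment unfolding d_def by blast
  qed
qed

lemma L2_support_bound:
  fixes f :: "real ^ 'd::finite \<Rightarrow> 'b::euclidean_space"
  assumes f: "f \<in> sq_int \<mu>" and zero: "\<And>x. x \<notin> cbox a b \<Longrightarrow> f x = 0" and bound: "\<And>x. norm (f x) \<le> B"
    and sub: "cbox a b \<subseteq> Omega"
  shows "(L2.nrm \<mu> f)\<^sup>2 \<le> B\<^sup>2 * measure lebesgue (cbox a b)"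
proof -
  have "nsq Omega f = nsq (cbox a b) f"
    unfolding nsq_def using zero sub by (intro Bochner_Integration.integral_cong) (auto simp: indicator_def)
  also have "\<dots> \<le> B\<^sup>2 * measure lebesgue (cbox a b)"
    by (intro nsq_le_bound f bound sub) auto
  finally show ?thesis using nsq_Omega[OF f] by simp
qed

section \<open>The complex inner product and its real part\<close>

lemma inner_L2_Re:
  fixes f v :: "real ^ 'd::finite \<Rightarrow> complex"
  assumes "f \<in> sq_int \<mu>" "v \<in> sq_int \<mu>"
  shows "integrable \<mu> (\<lambda>x. f x * cnj (v x))" "Re (inner_L2 f v) = (\<integral>x. f x \<bullet> v x \<partial>\<mu>)"
proof -
  have "(\<lambda>x. f x * cnj (v x)) \<in> borel_measurable \<mu>"
    using assms by (intro borel_measurable_times borel_measurable_continuous_on[of cnj] continuous_intros) (auto simp: sq_int_def)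
  then show int: "integrable \<mu> (\<lambda>x. f x * cnj (v x))" by (intro sq_int_prod[OF assms]) (auto simp: norm_mult)
  have "Re (inner_L2 f v) = (\<integral>x. Re (f x * cnj (v x)) \<partial>\<mu>)"
    unfolding inner_L2_def by (rule integral_bounded_linear[OF bounded_linear_Re int, symmetric])
  then show "Re (inner_L2 f v) = (\<integral>x. f x \<bullet> v x \<partial>\<mu>)" by (simp add: inner_complex_def)
qed

lemma inner_L2_ii: "inner_L2 f (\<lambda>x. \<i> * v x) = - \<i> * inner_L2 f v"
proof -
  have "inner_L2 f (\<lambda>x. \<i> * v x) = (\<integral>x. - \<i> * (f x * cnj (v x)) \<partial>\<mu>)"
    unfolding inner_L2_def by (intro Bochner_Integration.integral_cong) (auto simp: mult_ac)
  then show ?thesis unfolding inner_L2_def by (simp only: integral_mult_right_zero)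
qed

lemma inner_L2_diff:
  fixes f g v :: "real ^ 'd::finite \<Rightarrow> complex"
  assumes "f \<in> sq_int \<mu>" "g \<in> sq_int \<mu>" "v \<in> sq_int \<mu>"
  shows "inner_L2 (\<lambda>x. f x - g x) v = inner_L2 f v - inner_L2 g v"
  using inner_L2_Re(1)[OF assms(1,3)] inner_L2_Re(1)[OF assms(2,3)]
  by (simp add: inner_L2_def left_diff_distrib)

lemma inner_L2_add:
  fixes f g v :: "real ^ 'd::finite \<Rightarrow> complex"
  assumes "f \<in> sq_int \<mu>" "g \<in> sq_int \<mu>" "v \<in> sq_int \<mu>"
  shows "inner_L2 (\<lambda>x. f x + g x) v = inner_L2 f v + inner_L2 g v"
  using inner_L2_Re(1)[OF assms(1,3)] inner_L2_Re(1)[OF assms(2,3)]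
  by (simp add: inner_L2_def distrib_right)

lemma inner_L2_cmult: "inner_L2 (\<lambda>x. c * f x) v = c * inner_L2 f v"
proof -
  have "inner_L2 (\<lambda>x. c * f x) v = (\<integral>x. c * (f x * cnj (v x)) \<partial>\<mu>)" by (simp add: inner_L2_def mult.assoc)
  then show ?thesis unfolding inner_L2_def by (simp only: integral_mult_right_zero)
qed

lemma inner_L2_scaleR: "inner_L2 (\<lambda>x. r *\<^sub>R f x) v = r *\<^sub>R inner_L2 f v"
  using inner_L2_cmult[of "complex_of_real r" f v] by (simp add: scaleR_conv_of_real[where 'a = complex])

lemma inner_L2_sum:
  fixes v :: "real ^ 'd::finite \<Rightarrow> complex"
  assumes "\<And>k. k \<in> A \<Longrightarrow> f k \<in> sq_int \<mu>" "v \<in> sq_int \<mu>"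
  shows "inner_L2 (\<lambda>x. \<Sum>k\<in>A. f k x) v = (\<Sum>k\<in>A. inner_L2 (f k) v)"
  unfolding inner_L2_def sum_distrib_right
  by (rule Bochner_Integration.integral_sum) (rule inner_L2_Re(1)[OF assms])

lemma inner_L2_bound:
  fixes f v :: "real ^ 'd::finite \<Rightarrow> complex"
  assumes "f \<in> sq_int \<mu>" "v \<in> sq_int \<mu>"
  shows "norm (inner_L2 f v) \<le> L2.nrm \<mu> f * L2.nrm \<mu> v"
proof -
  have nn: "(\<lambda>x. norm (f x)) \<in> sq_int \<mu>" "(\<lambda>x. norm (v x)) \<in> sq_int \<mu>"
    using assms by (auto simp: sq_int_def)
  have "norm (inner_L2 f v) \<le> (\<integral>x. norm (f x * cnj (v x)) \<partial>\<mu>)" unfolding inner_L2_def by (rule integral_norm_bound)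
  also have "\<dots> = (\<integral>x. norm (f x) \<bullet> norm (v x) \<partial>\<mu>)" by (simp add: norm_mult)
  also have "\<dots> \<le> L2.nrm \<mu> (\<lambda>x. norm (f x)) * L2.nrm \<mu> (\<lambda>x. norm (v x))"
    using L2.cauchy_schwarz[OF nn] by linarith
  also have "\<dots> = L2.nrm \<mu> f * L2.nrm \<mu> v" unfolding L2_nrm_eq by simp
  finally show ?thesis .
qed

text \<open>Each bubble sits in a cube inside a ball contained in one element that has
  \<open>z j\<close> as a vertex. On that element all hat functions are affine, so reproducing
  values at \<open>z j\<close> gives duality to all of them at once. Everything scales with
  \<open>H\<close>, and the constant is fixed before the mesh.\<close>

lemma mesh_bubbles:
  fixes \<kappa> :: real
  assumes "0 < \<kappa>"
  shows "\<exists>C>0. \<forall>H (\<T> :: (real ^ 'd::finite) set set) N z \<phi>. mesh \<kappa> H \<T> N z \<phi> \<longrightarrow> (\<forall>j\<in>{1..N}. \<exists>T b.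
    T \<in> \<T> \<and> z j extreme_point_of T \<and> b \<in> H1P \<and> (\<forall>x. x \<notin> T \<longrightarrow> b x = 0) \<and>
    (AE x in \<mu>. x \<notin> T \<longrightarrow> grad b x = 0) \<and> biorthogonal N \<phi> j b \<and>
    (L2.nrm \<mu> b)\<^sup>2 \<le> C / H ^ CARD('d) \<and> (L2.nrm \<mu> (grad b))\<^sup>2 \<le> C / H ^ (CARD('d) + 2))"
proof -
  define d where "d = CARD('d)"
  define D where "D = real d"
  have D: "1 \<le> D" by (simp add: D_def d_def Suc_le_eq)
  \<comment> \<open>A cube of half-width \<open>q * H\<close> has half diagonal at most
    \<open>\<rho>\<^sub>0 / 2\<close>, and \<open>1 / q\<close> bounds the distance from its centre
    to the vertex in units of that half-width.\<close>
  define q where "q = \<kappa>\<^sup>2 / (2 * D)"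
  have q: "0 < q" using assms D by (simp add: q_def)
  have "0 \<le> 1 / q" using q by simp
  from bubble_exists[OF this, where 'd = 'd] obtain C0 where C0: "C0 > 0"
    "\<And>(c :: real ^ 'd) w r. 0 < r \<Longrightarrow> (\<forall>i. \<bar>w $ i - c $ i\<bar> \<le> 1 / q * r) \<Longrightarrow>
    \<exists>b P. (\<forall>x. (b has_derivative (\<lambda>h. \<Sum>i\<in>UNIV. h $ i * P i x)) (at x)) \<and> (\<forall>i. continuous_on UNIV (P i)) \<and>
      (\<forall>x. x \<notin> cbox (\<chi> i. c $ i - r) (\<chi> i. c $ i + r) \<longrightarrow> b x = 0 \<and> (\<forall>i. P i x = 0)) \<and>
      (\<forall>x. \<bar>b x\<bar> \<le> C0 / r ^ CARD('d)) \<and> (\<forall>i x. \<bar>P i x\<bar> \<le> C0 / r ^ (CARD('d) + 1)) \<and>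
      (\<forall>\<beta> \<alpha>. (\<integral>x. b x * (\<beta> + \<alpha> \<bullet> x) \<partial>lborel) = \<beta> + \<alpha> \<bullet> w)" by blast
  \<comment> \<open>Squared supremum bounds of the bubble and of its gradient times the volume
    \<open>(2 * r)^d\<close>, with \<open>r = q * H\<close>.\<close>
  define C where "C = C0\<^sup>2 * 2 ^ d / q ^ d + (D * C0)\<^sup>2 * 2 ^ d / q ^ (d + 2)"
  have Cpos: "0 < C" unfolding C_def using C0(1) q D by (intro add_pos_pos) simp_all
  have Cge: "C0\<^sup>2 * 2 ^ d / q ^ d \<le> C" "(D * C0)\<^sup>2 * 2 ^ d / q ^ (d + 2) \<le> C"
    unfolding C_def using q by simp_all
  show ?thesis
  proof (intro exI[of _ C] conjI Cpos allI impI ballI)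
    fix H :: real and \<T> :: "(real ^ 'd) set set" and N z \<phi> j
    assume m: "mesh \<kappa> H \<T> N z \<phi>" and j: "j \<in> {1..N}"
    interpret mesh \<kappa> H \<T> N z \<phi> by (rule m)
    obtain T where T: "T \<in> \<T>" "z j extreme_point_of T" using z_vertex[OF j] by (auto simp: mesh_vertices_def)
    obtain c where c: "cball c \<rho>\<^sub>0 \<subseteq> T" using inscribed_ball[OF T(1)] by blast
    have cT: "c \<in> T" using c \<rho>0_pos by (simp add: subset_iff)
    have zT: "z j \<in> T" using vertex[OF T] by simp
    define r where "r = q * H"
    have r: "0 < r" using q H_pos by (simp add: r_def)
    have Dr: "2 * D * r = \<rho>\<^sub>0" using D by (simp add: r_def q_def \<rho>\<^sub>0_def)
    define S where "S = cbox (\<chi> i. c $ i - r) (\<chi> i. c $ i + r)"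
    have "S \<subseteq> ball c \<rho>\<^sub>0"
    proof
      fix x assume "x \<in> S"
      then have x: "c $ i - r \<le> x $ i \<and> x $ i \<le> c $ i + r" for i by (simp add: S_def mem_box_cart)
      have "\<bar>(x - c) $ i\<bar> \<le> r" for i using x[of i] by (simp add: abs_le_iff)
      then have "norm (x - c) \<le> (\<Sum>i\<in>(UNIV :: 'd set). r)"
        by (intro order_trans[OF norm_le_l1_cart] sum_mono)
      also have "\<dots> = D * r" by (simp add: D_def d_def)
      also have "\<dots> < \<rho>\<^sub>0" unfolding Dr[symmetric] using D r by simp
      finally show "x \<in> ball c \<rho>\<^sub>0" by (simp add: dist_norm norm_minus_commute)
    qed
    then have ST: "S \<subseteq> T" using c ball_subset_cball by blast
    have "ball c \<rho>\<^sub>0 \<subseteq> interior Omega"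
      using c T_Omega[OF T(1)] ball_subset_cball by (intro interior_maximal) blast+
    then have SI: "S \<subseteq> interior Omega" using \<open>S \<subseteq> ball c \<rho>\<^sub>0\<close> by blast
    then have SO: "S \<subseteq> Omega" using interior_subset by blast
    have w: "\<forall>i. \<bar>z j $ i - c $ i\<bar> \<le> 1 / q * r"
    proof
      fix i
      have "\<bar>(z j - c) $ i\<bar> \<le> H" using component_le_norm_cart[of "z j - c" i] dist_le_H[OF T(1) zT cT] by (simp add: dist_norm)
      then show "\<bar>z j $ i - c $ i\<bar> \<le> 1 / q * r" using q by (simp add: r_def)
    qed
    obtain b P where bP: "\<And>x. (b has_derivative (\<lambda>h. \<Sum>i\<in>UNIV. h $ i * P i x)) (at x)" "\<And>i. continuous_on UNIV (P i)"
      "\<And>x. x \<notin> S \<Longrightarrow> b x = 0" "\<And>i x. x \<notin> S \<Longrightarrow> P i x = 0"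
      "\<And>x. \<bar>b x\<bar> \<le> C0 / r ^ d" "\<And>i x. \<bar>P i x\<bar> \<le> C0 / r ^ (d + 1)"
      "\<And>\<beta> \<alpha>. (\<integral>x. b x * (\<beta> + \<alpha> \<bullet> x) \<partial>lborel) = \<beta> + \<alpha> \<bullet> z j"
      using C0(2)[OF r w] unfolding S_def d_def by blast
    have Sc: "compact S" by (simp add: S_def compact_cbox)
    define bb where "bb = (\<lambda>x. complex_of_real (b x))"
    define G where "G = (\<lambda>x. (\<chi> i. complex_of_real (P i x)))"
    have bH: "bb \<in> H1P" and gr: "AE x in \<mu>. grad bb x = G x"
      unfolding bb_def G_def by (rule H1P_C1_compact_support[OF bP(1,2) Sc SI bP(3,4)]; simp)+
    have zero: "\<forall>x. x \<notin> T \<longrightarrow> bb x = 0" using bP(3) ST by (auto simp: bb_def)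
    have gzero: "AE x in \<mu>. x \<notin> T \<longrightarrow> grad bb x = 0"
      using gr
    proof eventually_elim
      case (elim x)
      show ?case
      proof
        assume "x \<notin> T"
        then have "x \<notin> S" using ST by blast
        then show "grad bb x = 0" using elim by (simp add: G_def bP(4) vec_eq_iff)
      qed
    qed
    have vol: "measure lebesgue S = (2 * r) ^ d"
    proof -
      have "c \<in> S" using r by (simp add: S_def mem_box_cart)
      then have "measure lborel S = (\<Prod>i\<in>(UNIV :: 'd set). (\<chi> i. c $ i + r) $ i - (\<chi> i. c $ i - r) $ i)"
        unfolding S_def by (intro content_cbox_cart) auto
      then show ?thesis by (simp add: S_def d_def)
    qed
    have "(L2.nrm \<mu> bb)\<^sup>2 \<le> (C0 / r ^ d)\<^sup>2 * measure lebesgue S"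
      unfolding S_def
      by (rule L2_support_bound[OF H1_D(1)[OF H1P_H1[OF bH]]]) (use bP SO in \<open>auto simp: bb_def S_def\<close>)
    also have "\<dots> = C0\<^sup>2 * 2 ^ d / r ^ d"
      unfolding vol using r by (simp add: power2_eq_square power_mult_distrib)
    also have "\<dots> = (C0\<^sup>2 * 2 ^ d / q ^ d) / H ^ d" by (simp add: r_def power_mult_distrib)
    also have "\<dots> \<le> C / H ^ d" using H_pos Cge(1) by (intro divide_right_mono) auto
    finally have n1: "(L2.nrm \<mu> bb)\<^sup>2 \<le> C / H ^ d" .
    have Gc: "continuous_on Omega G" unfolding G_def by (intro continuous_intros continuous_on_subset[OF bP(2)]) auto
    have Gs: "G \<in> sq_int \<mu>" by (rule sq_int_continuous[OF Gc])
    have Gb: "norm (G x) \<le> D * C0 / r ^ (d + 1)" for x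
    proof -
      have "norm (G x) \<le> (\<Sum>i\<in>UNIV. norm (G x $ i))" by (rule norm_vec_le_sum)
      also have "\<dots> \<le> (\<Sum>i\<in>(UNIV :: 'd set). C0 / r ^ (d + 1))" using bP(6) by (intro sum_mono) (simp add: G_def)
      finally show ?thesis by (simp add: D_def d_def)
    qed
    have "L2.nrm \<mu> (grad bb) = L2.nrm \<mu> G"
      using gr Gs H1_D(2)[OF H1P_H1[OF bH]] by (intro L2_nrm_cong_AE) (auto simp: sq_int_def)
    then have "(L2.nrm \<mu> (grad bb))\<^sup>2 = (L2.nrm \<mu> G)\<^sup>2" by simp
    also have "\<dots> \<le> (D * C0 / r ^ (d + 1))\<^sup>2 * measure lebesgue S"
      unfolding S_def
      by (rule L2_support_bound[OF Gs _ Gb]) (use bP SO in \<open>auto simp: G_def S_def vec_eq_iff\<close>)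
    also have "\<dots> = (D * C0)\<^sup>2 * 2 ^ d / r ^ (d + 2)"
      unfolding vol using r by (simp add: power2_eq_square power_mult_distrib power_add)
    also have "\<dots> = ((D * C0)\<^sup>2 * 2 ^ d / q ^ (d + 2)) / H ^ (d + 2)" by (simp add: r_def power_mult_distrib)
    also have "\<dots> \<le> C / H ^ (d + 2)" using H_pos Cge(2) by (intro divide_right_mono) auto
    finally have n2: "(L2.nrm \<mu> (grad bb))\<^sup>2 \<le> C / H ^ (d + 2)" .
    have bio: "biorthogonal N \<phi> j bb"
      unfolding biorthogonal_def
    proof
      fix k assume k: "k \<in> {1..N}"
      obtain \<beta> \<alpha> where f: "\<And>x. x \<in> T \<Longrightarrow> Re (\<phi> k x) = \<beta> + \<alpha> \<bullet> x"
        using \<phi>_affine(1)[OF k T(1)] unfolding affine_on_def by blast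
      have b_cont: "continuous_on UNIV b" using bP(1) by (meson has_derivative_at_withinI has_derivative_continuous_on)
      have "inner_L2 bb (\<phi> k) = (\<integral>x. complex_of_real (b x * (\<beta> + \<alpha> \<bullet> x)) \<partial>\<mu>)"
        unfolding inner_L2_def
      proof (rule Bochner_Integration.integral_cong[OF refl])
        fix x :: "real ^ 'd" assume "x \<in> space \<mu>"
        then have x: "x \<in> Omega" by simp
        show "bb x * cnj (\<phi> k x) = complex_of_real (b x * (\<beta> + \<alpha> \<bullet> x))"
        proof (cases "x \<in> S")
          case True
          then have "\<phi> k x = complex_of_real (\<beta> + \<alpha> \<bullet> x)" using \<phi>_real[OF k x] f[of x] ST by auto
          then show ?thesis by (simp add: bb_def)
        qed (simp add: bb_def bP(3))
      qed
      also have "\<dots> = complex_of_real (\<integral>x. b x * (\<beta> + \<alpha> \<bullet> x) \<partial>\<mu>)" by (rule integral_complex_of_real)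
      also have "(\<integral>x. b x * (\<beta> + \<alpha> \<bullet> x) \<partial>\<mu>) = (\<integral>x. b x * (\<beta> + \<alpha> \<bullet> x) \<partial>lborel)"
      proof -
        have "(\<integral>x. b x * (\<beta> + \<alpha> \<bullet> x) \<partial>\<mu>) = (\<integral>x. indicat_real Omega x *\<^sub>R (b x * (\<beta> + \<alpha> \<bullet> x)) \<partial>lebesgue)"
          by (rule integral_restrict_space) simp
        also have "(\<lambda>x. indicat_real Omega x *\<^sub>R (b x * (\<beta> + \<alpha> \<bullet> x))) = (\<lambda>x. b x * (\<beta> + \<alpha> \<bullet> x))"
        proof
          fix x show "indicat_real Omega x *\<^sub>R (b x * (\<beta> + \<alpha> \<bullet> x)) = b x * (\<beta> + \<alpha> \<bullet> x)"
            using SO bP(3)[of x] by (cases "x \<in> S") auto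
        qed
        also have "(\<integral>x. b x * (\<beta> + \<alpha> \<bullet> x) \<partial>lebesgue) = (\<integral>x. b x * (\<beta> + \<alpha> \<bullet> x) \<partial>lborel)"
          using b_cont by (intro integral_completion)
            (simp, intro borel_measurable_continuous_onI continuous_intros)
        finally show ?thesis .
      qed
      also have "\<dots> = \<beta> + \<alpha> \<bullet> z j" by (rule bP(7))
      also have "\<dots> = Re (\<phi> k (z j))" using f[OF zT] by simp
      also have "\<dots> = (if j = k then 1 else 0)" using \<phi>_vertex[OF k z_vertex[OF j]] z_inj[OF j k] by simp
      finally show "inner_L2 bb (\<phi> k) = (if j = k then 1 else 0)" by simp
    qed
    show "\<exists>T b. T \<in> \<T> \<and> z j extreme_point_of T \<and> b \<in> H1P \<and> (\<forall>x. x \<notin> T \<longrightarrow> b x = 0) \<and>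
      (AE x in \<mu>. x \<notin> T \<longrightarrow> grad b x = 0) \<and> biorthogonal N \<phi> j b \<and>
      (L2.nrm \<mu> b)\<^sup>2 \<le> C / H ^ CARD('d) \<and> (L2.nrm \<mu> (grad b))\<^sup>2 \<le> C / H ^ (CARD('d) + 2)"
      using T bH zero gzero bio n1 n2 unfolding d_def by blast
  qed
qed

lemma smooth_fn_one_minus:
  fixes \<eta> :: "real ^ 'd::finite \<Rightarrow> real"
  assumes "smooth_fn \<eta>"
  shows "smooth_fn (\<lambda>x. 1 - \<eta> x)" "pd (\<lambda>x. 1 - \<eta> x) i x = - pd \<eta> i x"
proof -
  obtain A where A: "all_partials UNIV \<eta> A" using assms unfolding smooth_fn_def by blast
  define c where "c \<sigma> = (if \<sigma> = (\<lambda>_. 0) then 1 else 0 :: real)" for \<sigma> :: "'d \<Rightarrow> nat"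
  have c0: "c (\<sigma>(i := Suc (\<sigma> i))) = 0" for \<sigma> i
    by (auto simp: c_def fun_eq_iff intro!: exI[of _ i])
  have "all_partials UNIV (\<lambda>x. 1 - \<eta> x) (\<lambda>\<sigma> x. c \<sigma> - A \<sigma> x)"
    unfolding all_partials_def
  proof (intro conjI allI ballI)
    fix \<sigma> and x :: "real ^ 'd"
    have "(A \<sigma> has_derivative (\<lambda>h. \<Sum>i\<in>UNIV. h $ i * A (\<sigma>(i := Suc (\<sigma> i))) x)) (at x)"
      using A by (simp add: all_partials_def)
    from has_derivative_diff[OF has_derivative_const[of "c \<sigma>"] this]
    show "((\<lambda>x. c \<sigma> - A \<sigma> x) has_derivative
        (\<lambda>h. \<Sum>i\<in>UNIV. h $ i * (c (\<sigma>(i := Suc (\<sigma> i))) - A (\<sigma>(i := Suc (\<sigma> i))) x))) (at x)"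
      by (simp add: c0 sum_negf)
  qed (use A in \<open>simp add: all_partials_def c_def\<close>)
  then show "smooth_fn (\<lambda>x. 1 - \<eta> x)" unfolding smooth_fn_def by blast
  have "((\<lambda>x. 1 - \<eta> x) has_derivative (\<lambda>h. \<Sum>i\<in>UNIV. h $ i * (- pd \<eta> i x))) (at x)"
    using has_derivative_diff[OF has_derivative_const[of 1] smooth_fn_has_derivative(1)[OF assms]]
    by (simp add: sum_negf)
  then show "pd (\<lambda>x. 1 - \<eta> x) i x = - pd \<eta> i x" by (rule pd_eq_sum)
qed

lemma form_a_Re:
  fixes v w :: "real ^ 'd::finite \<Rightarrow> complex"
  assumes "v \<in> H1" "w \<in> H1" and V: "(\<lambda>x. complex_of_real (V x) * v x) \<in> sq_int \<mu>"
  shows "Re (form_a \<epsilon> V v w) = en (\<epsilon>\<^sup>2 / 2) V v w"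
proof -
  note g = H1_D(2)[OF assms(1)] H1_D(2)[OF assms(2)]
  have int: "integrable \<mu> (\<lambda>x. \<Sum>i\<in>UNIV. grad v x $ i * cnj (grad w x $ i))"
    by (intro Bochner_Integration.integrable_sum inner_L2_Re(1) sq_int_nth g)
  have "Re (inner_L2_vec (grad v) (grad w)) = (\<integral>x. Re (\<Sum>i\<in>UNIV. grad v x $ i * cnj (grad w x $ i)) \<partial>\<mu>)"
    unfolding inner_L2_vec_def by (rule integral_bounded_linear[OF bounded_linear_Re int, symmetric])
  then have "Re (inner_L2_vec (grad v) (grad w)) = (\<integral>x. grad v x \<bullet> grad w x \<partial>\<mu>)"
    by (simp add: inner_vec_def inner_complex_def)
  moreover have "Re (inner_L2 (\<lambda>x. complex_of_real (V x) * v x) w) = (\<integral>x. (V x *\<^sub>R v x) \<bullet> w x \<partial>\<mu>)"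
    using inner_L2_Re(2)[OF V H1_D(1)[OF assms(2)]] by (simp add: scaleR_conv_of_real[where 'a = complex])
  ultimately show ?thesis by (simp add: form_a_def en_def)
qed

lemma form_a_ii:
  fixes v w :: "real ^ 'd::finite \<Rightarrow> complex"
  assumes "v \<in> H1" "w \<in> H1"
  shows "form_a \<epsilon> V v (\<lambda>x. \<i> * w x) = - \<i> * form_a \<epsilon> V v w"
proof -
  note g = H1_D(2)[OF assms(1)] H1_D(2)[OF assms(2)] H1_D(2)[OF H1_cmult(1)[OF assms(2), of \<i>]]
  have int: "integrable \<mu> (\<lambda>x. \<Sum>i\<in>UNIV. grad v x $ i * cnj (grad (\<lambda>x. \<i> * w x) x $ i))"
    "integrable \<mu> (\<lambda>x. \<Sum>i\<in>UNIV. grad v x $ i * cnj (grad w x $ i))"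
    by (intro Bochner_Integration.integrable_sum inner_L2_Re(1) sq_int_nth g)+
  have "inner_L2_vec (grad v) (grad (\<lambda>x. \<i> * w x)) = (\<integral>x. - \<i> * (\<Sum>i\<in>UNIV. grad v x $ i * cnj (grad w x $ i)) \<partial>\<mu>)"
    unfolding inner_L2_vec_def
  proof (rule integral_cong_AE)
    show "AE x in \<mu>. (\<Sum>i\<in>UNIV. grad v x $ i * cnj (grad (\<lambda>x. \<i> * w x) x $ i)) = - \<i> * (\<Sum>i\<in>UNIV. grad v x $ i * cnj (grad w x $ i))"
      using H1_cmult(2)[OF assms(2), of \<i>]
    proof eventually_elim
      case (elim x)
      show ?case unfolding elim sum_distrib_left by (intro sum.cong refl) (simp add: mult_ac)
    qed
  qed (use int in auto)
  also have "\<dots> = - \<i> * inner_L2_vec (grad v) (grad w)"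
    unfolding inner_L2_vec_def by (simp only: integral_mult_right_zero)
  finally show ?thesis
    unfolding form_a_def inner_L2_ii by (simp only: distrib_left mult.left_commute[of "complex_of_real _" "- \<i>"])
qed

section \<open>The multiscale method\<close>

text \<open>The resolution condition enters as \<open>H \<le> R * \<epsilon>\<close>, which keeps
  the contribution of the potential at the scale of the gradient term. The bubbles supplied by
  \<open>mesh_bubbles\<close> are fixed as \<open>b\<close>, with their elements
  \<open>Tb\<close>.\<close>

locale lod = interp_mesh \<kappa> H \<T> N z \<phi> Col CI
  for \<kappa> H :: real and \<T> :: "(real ^ 'd::finite) set set" and N z \<phi> Col CI +
  fixes \<epsilon> Vmin Vmax R Cb :: real and V :: "real ^ 'd \<Rightarrow> real"
    and Tb :: "nat \<Rightarrow> (real ^ 'd) set" and b :: "nat \<Rightarrow> real ^ 'd \<Rightarrow> complex"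
  assumes \<epsilon>: "0 < \<epsilon>" and Vmin: "0 < Vmin" and V_meas: "V \<in> borel_measurable \<mu>"
    and V_bounds: "\<And>x. x \<in> Omega \<Longrightarrow> Vmin \<le> V x \<and> V x \<le> Vmax"
    and H_le_\<epsilon>: "H \<le> R * \<epsilon>"
    and Tb: "\<And>j. j \<in> {1..N} \<Longrightarrow> Tb j \<in> \<T>" "\<And>j. j \<in> {1..N} \<Longrightarrow> z j extreme_point_of Tb j"
    and b_H1P: "\<And>j. j \<in> {1..N} \<Longrightarrow> b j \<in> H1P"
    and b_zero: "\<And>j x. j \<in> {1..N} \<Longrightarrow> x \<notin> Tb j \<Longrightarrow> b j x = 0"
    and grad_b_zero: "\<And>j. j \<in> {1..N} \<Longrightarrow> AE x in \<mu>. x \<notin> Tb j \<longrightarrow> grad (b j) x = 0"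
    and b_biorthogonal: "\<And>j. j \<in> {1..N} \<Longrightarrow> biorthogonal N \<phi> j (b j)"
    and b_bound: "\<And>j. j \<in> {1..N} \<Longrightarrow> (L2.nrm \<mu> (b j))\<^sup>2 \<le> Cb / H ^ CARD('d)"
      "\<And>j. j \<in> {1..N} \<Longrightarrow> (L2.nrm \<mu> (grad (b j)))\<^sup>2 \<le> Cb / H ^ (CARD('d) + 2)"
    and Cb: "0 < Cb"
begin

section \<open>Energy norm and existence of weak solutions\<close>

lemma Vmax: "0 < Vmax"
proof -
  have "(0 :: real ^ 'd) \<in> Omega" by (simp add: mem_Omega)
  from V_bounds[OF this] Vmin show ?thesis by linarith
qed

lemma R: "0 < R"
proof -
  have "0 < R * \<epsilon>" using H_pos H_le_\<epsilon> by linarith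
  then show ?thesis using \<epsilon> by (simp add: zero_less_mult_iff)
qed

sublocale E: energy "\<epsilon>\<^sup>2 / 2" V Vmax
proof
  show "0 \<le> \<epsilon>\<^sup>2 / 2" by simp
  show "V \<in> borel_measurable \<mu>" by (rule V_meas)
  fix x :: "real ^ 'd" assume "x \<in> Omega"
  from V_bounds[OF this] Vmin show "0 \<le> V x" "V x \<le> Vmax" by linarith+
qed

lemma form_a_energy: "v \<in> H1 \<Longrightarrow> w \<in> H1 \<Longrightarrow> Re (form_a \<epsilon> V v w) = en (\<epsilon>\<^sup>2 / 2) V v w"
  using E.sq_int_weight[OF H1_D(1), of v] by (intro form_a_Re) (simp_all add: scaleR_conv_of_real)

lemma norm_e_eq: "v \<in> H1 \<Longrightarrow> norm_e \<epsilon> V v = E.nrm v"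
  by (simp add: norm_e_def form_a_energy E.nrm_def)

lemma energy_ge:
  assumes "u \<in> H1"
  shows "(L2.nrm \<mu> (grad u))\<^sup>2 \<le> 2 / \<epsilon>\<^sup>2 * (E.nrm u)\<^sup>2" "(L2.nrm \<mu> u)\<^sup>2 \<le> (E.nrm u)\<^sup>2 / Vmin"
proof -
  have le: "\<epsilon>\<^sup>2 / 2 * (L2.nrm \<mu> (grad u))\<^sup>2 + Vmin * (L2.nrm \<mu> u)\<^sup>2 \<le> (E.nrm u)\<^sup>2"
    using V_bounds by (intro E.nrm_ge assms) blast
  have nn: "0 \<le> \<epsilon>\<^sup>2 / 2 * (L2.nrm \<mu> (grad u))\<^sup>2" "0 \<le> Vmin * (L2.nrm \<mu> u)\<^sup>2" using Vmin by simp_all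
  have "\<epsilon>\<^sup>2 / 2 * (L2.nrm \<mu> (grad u))\<^sup>2 \<le> (E.nrm u)\<^sup>2" using le nn by linarith
  then show "(L2.nrm \<mu> (grad u))\<^sup>2 \<le> 2 / \<epsilon>\<^sup>2 * (E.nrm u)\<^sup>2" using \<epsilon> by (simp add: field_simps)
  have "Vmin * (L2.nrm \<mu> u)\<^sup>2 \<le> (E.nrm u)\<^sup>2" using le nn by linarith
  then show "(L2.nrm \<mu> u)\<^sup>2 \<le> (E.nrm u)\<^sup>2 / Vmin" using Vmin by (simp add: field_simps)
qed

lemma energy_ge':
  assumes "u \<in> H1"
  shows "L2.nrm \<mu> (grad u) \<le> sqrt 2 / \<epsilon> * E.nrm u" "L2.nrm \<mu> u \<le> E.nrm u / sqrt Vmin"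
proof -
  have nn: "0 \<le> E.nrm u" using assms by (rule E.nrm_nonneg)
  have "(L2.nrm \<mu> (grad u))\<^sup>2 \<le> (sqrt 2 / \<epsilon> * E.nrm u)\<^sup>2"
    using energy_ge(1)[OF assms] by (simp add: power_mult_distrib power_divide)
  then show "L2.nrm \<mu> (grad u) \<le> sqrt 2 / \<epsilon> * E.nrm u" by (rule power2_le_imp_le) (use nn \<epsilon> in simp)
  have "(L2.nrm \<mu> u)\<^sup>2 \<le> (E.nrm u / sqrt Vmin)\<^sup>2"
    using energy_ge(2)[OF assms] Vmin by (simp add: power_divide)
  then show "L2.nrm \<mu> u \<le> E.nrm u / sqrt Vmin" by (rule power2_le_imp_le) (use nn Vmin in simp)
qed

text \<open>The constants may degenerate with \<epsilon>, because the equivalence serves only to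
  transfer completeness.\<close>

lemma energy_H1_equiv:
  assumes "u \<in> H1"
  shows "norm_H1 u \<le> (1 / sqrt Vmin + sqrt 2 / \<epsilon>) * E.nrm u" "E.nrm u \<le> sqrt (\<epsilon>\<^sup>2 / 2 + Vmax) * norm_H1 u"
proof -
  show "norm_H1 u \<le> (1 / sqrt Vmin + sqrt 2 / \<epsilon>) * E.nrm u"
    using norm_H1_le_sum[OF assms] energy_ge'[OF assms] by (simp add: algebra_simps)
  have nn: "0 \<le> norm_H1 u" by (simp add: norm_H1_def)
  have "(E.nrm u)\<^sup>2 \<le> \<epsilon>\<^sup>2 / 2 * (L2.nrm \<mu> (grad u))\<^sup>2 + Vmax * (L2.nrm \<mu> u)\<^sup>2" by (rule E.nrm_le[OF assms])
  also have "\<dots> \<le> (\<epsilon>\<^sup>2 / 2 + Vmax) * (norm_H1 u)\<^sup>2"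
    using Vmax by (simp add: norm_H1_sq algebra_simps)
  also have "\<dots> = (sqrt (\<epsilon>\<^sup>2 / 2 + Vmax) * norm_H1 u)\<^sup>2"
    using Vmax by (simp add: power_mult_distrib add_nonneg_nonneg)
  finally show "E.nrm u \<le> sqrt (\<epsilon>\<^sup>2 / 2 + Vmax) * norm_H1 u" by (rule power2_le_imp_le) (use nn Vmax in simp)
qed

lemma energy_complete:
  assumes w: "\<forall>n::nat. w n \<in> H1P"
    and cauchy: "\<forall>e>0. \<exists>n0. \<forall>m\<ge>n0. \<forall>n\<ge>n0. E.nrm (\<lambda>x. w m x - w n x) < e"
  shows "\<exists>u\<in>H1P. (\<lambda>n. E.nrm (\<lambda>x. w n x - u x)) \<longlonglongrightarrow> 0 \<and> (\<lambda>n. L2.nrm \<mu> (\<lambda>x. w n x - u x)) \<longlonglongrightarrow> 0"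
proof -
  define K where "K = 1 / sqrt Vmin + sqrt 2 / \<epsilon>"
  have K: "0 < K" using Vmin \<epsilon> by (simp add: K_def add_pos_pos)
  have H1: "w n \<in> H1" for n using w H1P_H1 by blast
  have "\<exists>n0. \<forall>m\<ge>n0. \<forall>n\<ge>n0. norm_H1 (\<lambda>x. w m x - w n x) < e" if e: "e > 0" for e
  proof -
    have "0 < e / K" using K e by simp
    then obtain n0 where n0: "\<And>m n. m \<ge> n0 \<Longrightarrow> n \<ge> n0 \<Longrightarrow> E.nrm (\<lambda>x. w m x - w n x) < e / K"
      using cauchy by meson
    have "norm_H1 (\<lambda>x. w m x - w n x) < e" if "m \<ge> n0" "n \<ge> n0" for m n
    proof -
      have "norm_H1 (\<lambda>x. w m x - w n x) \<le> K * E.nrm (\<lambda>x. w m x - w n x)"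
        unfolding K_def by (intro energy_H1_equiv H1_diff H1)
      also have "\<dots> < K * (e / K)" using n0[OF that] K by (intro mult_strict_left_mono)
      finally show ?thesis using K by simp
    qed
    then show ?thesis by blast
  qed
  from H1P_complete[OF _ this] w obtain u where u: "u \<in> H1P" "(\<lambda>n. norm_H1 (\<lambda>x. w n x - u x)) \<longlonglongrightarrow> 0" by blast
  have d: "(\<lambda>x. w n x - u x) \<in> H1" for n by (intro H1_diff H1 H1P_H1 u)
  have lim: "(\<lambda>n. sqrt (\<epsilon>\<^sup>2 / 2 + Vmax) * norm_H1 (\<lambda>x. w n x - u x)) \<longlonglongrightarrow> 0"
    using tendsto_mult_right_zero[OF u(2)] .
  have "norm (E.nrm (\<lambda>x. w n x - u x)) \<le> sqrt (\<epsilon>\<^sup>2 / 2 + Vmax) * norm_H1 (\<lambda>x. w n x - u x)" for n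
    using energy_H1_equiv(2)[OF d, of n] E.nrm_nonneg[OF d, of n] by simp
  then have "(\<lambda>n. E.nrm (\<lambda>x. w n x - u x)) \<longlonglongrightarrow> 0"
    by (intro Lim_null_comparison[OF always_eventually[OF allI] lim])
  moreover have "norm (L2.nrm \<mu> (\<lambda>x. w n x - u x)) \<le> norm_H1 (\<lambda>x. w n x - u x)" for n
    using norm_H1_ge(1)[of "\<lambda>x. w n x - u x"] L2.nrm_nonneg[OF H1_D(1)[OF d], of n] by simp
  then have "(\<lambda>n. L2.nrm \<mu> (\<lambda>x. w n x - u x)) \<longlonglongrightarrow> 0"
    by (intro Lim_null_comparison[OF always_eventually[OF allI] u(2)])
  ultimately show ?thesis using u by blast
qed

lemma H1P_average: "u \<in> H1P \<Longrightarrow> v \<in> H1P \<Longrightarrow> (\<lambda>x. (1/2) *\<^sub>R (u x + v x)) \<in> (H1P :: (real ^ 'd \<Rightarrow> complex) set)"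
  by (intro H1P_scale H1P_add)

text \<open>Riesz representation by minimising the quadratic functional. It supplies the dual
  solution, whose right-hand side is the Galerkin error.\<close>

lemma weak_solution_exists:
  assumes f: "f \<in> sq_int \<mu>"
  shows "\<exists>u\<in>H1P. \<forall>v\<in>H1P. en (\<epsilon>\<^sup>2 / 2) V u v = (\<integral>x. f x \<bullet> v x \<partial>\<mu>)"
proof -
  define l where "l v = (\<integral>x. v x \<bullet> f x \<partial>\<mu>)" for v :: "real ^ 'd \<Rightarrow> complex"
  have l_add: "l (\<lambda>x. u x + v x) = l u + l v" if "u \<in> H1" "v \<in> H1" for u v
    unfolding l_def using L2.B_add[OF H1_D(1)[OF that(1)] H1_D(1)[OF that(2)] f] .
  have l_scale: "l (\<lambda>x. c *\<^sub>R u x) = c * l u" if "u \<in> H1" for u c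
    unfolding l_def using L2.B_scale[OF H1_D(1)[OF that] f] .
  have l_bound: "\<bar>l u\<bar> \<le> (L2.nrm \<mu> f / sqrt Vmin) * E.nrm u" if "u \<in> H1" for u
  proof -
    have "\<bar>l u\<bar> \<le> L2.nrm \<mu> u * L2.nrm \<mu> f" unfolding l_def by (intro L2.cauchy_schwarz H1_D(1)[OF that] f)
    also have "\<dots> \<le> (E.nrm u / sqrt Vmin) * L2.nrm \<mu> f"
      by (intro mult_right_mono energy_ge' that L2.nrm_nonneg f)
    finally show ?thesis by (simp add: mult.commute)
  qed
  have "\<exists>u\<in>H1P. \<forall>v\<in>H1P. en (\<epsilon>\<^sup>2 / 2) V u u - 2 * l u \<le> en (\<epsilon>\<^sup>2 / 2) V v v - 2 * l v"
  proof (rule E.minimiser_exists)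
    show "H1P \<subseteq> (H1 :: (real ^ 'd \<Rightarrow> complex) set)" using H1P_H1 by blast
    show "H1P \<noteq> ({} :: (real ^ 'd \<Rightarrow> complex) set)" using H1P_zero by blast
    show "(\<lambda>x. (1/2) *\<^sub>R (u x + v x)) \<in> H1P" if "u \<in> H1P" "v \<in> H1P" for u v :: "real ^ 'd \<Rightarrow> complex"
      using that by (rule H1P_average)
    show "\<exists>u\<in>H1P. (\<lambda>n. E.nrm (\<lambda>x. w n x - u x)) \<longlonglongrightarrow> 0"
      if "\<forall>n::nat. w n \<in> H1P" "\<forall>e>0. \<exists>n0. \<forall>m\<ge>n0. \<forall>n\<ge>n0. E.nrm (\<lambda>x. w m x - w n x) < e" for w
      using energy_complete[OF that] by blast
  qed (fact l_add l_scale l_bound)+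
  then obtain u where u: "u \<in> H1P" and min: "\<And>v. v \<in> H1P \<Longrightarrow> en (\<epsilon>\<^sup>2 / 2) V u u - 2 * l u \<le> en (\<epsilon>\<^sup>2 / 2) V v v - 2 * l v"
    by blast
  have "en (\<epsilon>\<^sup>2 / 2) V u v = l v" if v: "v \<in> H1P" for v
    by (rule E.minimiser_orthogonal[OF H1P_H1[OF u] H1P_H1[OF v] l_add l_scale]) (auto intro!: min H1P_add H1P_scale u v)
  then show ?thesis using u unfolding l_def by (auto simp: inner_commute)
qed

text \<open>Testing with \<open>\<i>\<close> times \<open>v\<close> turns the imaginary part of the
  identity into its real part, so on spaces closed under this multiplication the real problem
  contains the complex one.\<close>

lemma galerkin_solution_energy:
  assumes X: "X \<subseteq> H1" "\<And>v. v \<in> X \<Longrightarrow> (\<lambda>x. \<i> * v x) \<in> X" and f: "f \<in> sq_int \<mu>"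
  shows "galerkin_solution \<epsilon> V X f u \<longleftrightarrow> u \<in> X \<and> (\<forall>v\<in>X. en (\<epsilon>\<^sup>2 / 2) V u v = (\<integral>x. f x \<bullet> v x \<partial>\<mu>))"
proof -
  have Re: "Re (form_a \<epsilon> V u v) = en (\<epsilon>\<^sup>2 / 2) V u v" "Re (inner_L2 f v) = (\<integral>x. f x \<bullet> v x \<partial>\<mu>)"
    if "u \<in> X" "v \<in> X" for v
    using that X(1) by (auto intro!: form_a_energy inner_L2_Re f H1_D)
  have Im: "Im (form_a \<epsilon> V u v) = Im (inner_L2 f v)"
    if u: "u \<in> X" and eq: "\<forall>v\<in>X. en (\<epsilon>\<^sup>2 / 2) V u v = (\<integral>x. f x \<bullet> v x \<partial>\<mu>)" and v: "v \<in> X" for v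
  proof -
    have iv: "(\<lambda>x. \<i> * v x) \<in> X" by (rule X(2)[OF v])
    have "u \<in> H1" "v \<in> H1" using u v X(1) by auto
    then have "Re (- \<i> * form_a \<epsilon> V u v) = Re (- \<i> * inner_L2 f v)"
      using Re[OF u iv] eq iv form_a_ii[of u v] inner_L2_ii[of f v] by metis
    then show ?thesis by simp
  qed
  show ?thesis unfolding galerkin_solution_def
  proof (intro conj_cong refl iffI ballI)
    show "en (\<epsilon>\<^sup>2 / 2) V u v = (\<integral>x. f x \<bullet> v x \<partial>\<mu>)"
      if "u \<in> X" "\<forall>v\<in>X. form_a \<epsilon> V u v = inner_L2 f v" "v \<in> X" for v
      using Re[OF that(1,3)] that by simp
    show "form_a \<epsilon> V u v = inner_L2 f v"
      if "u \<in> X" "\<forall>v\<in>X. en (\<epsilon>\<^sup>2 / 2) V u v = (\<integral>x. f x \<bullet> v x \<partial>\<mu>)" "v \<in> X" for v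
      using Re[OF that(1,3)] Im[OF that] that by (simp add: complex_eq_iff)
  qed
qed

section \<open>Kernel of the interpolation and the global basis\<close>

definition kernel :: "(real ^ 'd \<Rightarrow> complex) set"
  where "kernel = {w \<in> H1P. \<forall>k\<in>{1..N}. inner_L2 w (\<phi> k) = 0}"

lemma kernel_H1P: "w \<in> kernel \<Longrightarrow> w \<in> H1P" by (simp add: kernel_def)

text \<open>The interpolation of a kernel function is zero, so the function is its own interpolation
  error. This is the source of the factor \<open>H / \<epsilon>\<close> in the ideal energy
  estimate.\<close>

lemma kernel_bound:
  assumes w: "w \<in> kernel"
  shows "L2.nrm \<mu> w \<le> CI * sqrt Col * sqrt 2 * (H / \<epsilon>) * E.nrm w"
proof -
  have wH: "w \<in> H1P" by (rule kernel_H1P[OF w])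
  have "clement N \<phi> w = (\<lambda>x. 0)" using w by (simp add: clement_def kernel_def fun_eq_iff)
  then have "L2.nrm \<mu> w \<le> CI * sqrt Col * H * L2.nrm \<mu> (grad w)" using clement_error_Omega[OF wH] by simp
  also have "\<dots> \<le> CI * sqrt Col * H * (sqrt 2 / \<epsilon> * E.nrm w)"
    using CI Col H_pos by (intro mult_left_mono energy_ge' H1P_H1 wH) simp
  finally show ?thesis by (simp add: mult_ac)
qed

lemma kernel_cmult: "w \<in> kernel \<Longrightarrow> (\<lambda>x. c * w x) \<in> kernel"
  by (auto simp: kernel_def inner_L2_cmult intro: H1P_cmult)

lemma biorthogonal_add_kernel:
  assumes "v \<in> H1P" "biorthogonal N \<phi> j v" "w \<in> kernel"
  shows "biorthogonal N \<phi> j (\<lambda>x. v x + w x)"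
  unfolding biorthogonal_def
proof
  fix k assume k: "k \<in> {1..N}"
  have "inner_L2 (\<lambda>x. v x + w x) (\<phi> k) = inner_L2 v (\<phi> k) + inner_L2 w (\<phi> k)"
    using assms by (intro inner_L2_add H1_D(1) H1P_H1 \<phi>_H1P k) (auto simp: kernel_H1P)
  then show "inner_L2 (\<lambda>x. v x + w x) (\<phi> k) = (if j = k then 1 else 0)"
    using assms k by (simp add: biorthogonal_def kernel_def)
qed

lemma biorthogonal_diff:
  assumes "v \<in> H1P" "biorthogonal N \<phi> j v" "w \<in> H1P" "biorthogonal N \<phi> j w"
  shows "(\<lambda>x. v x - w x) \<in> kernel"
  unfolding kernel_def
proof (intro CollectI conjI ballI)
  fix k assume k: "k \<in> {1..N}"
  have "inner_L2 (\<lambda>x. v x - w x) (\<phi> k) = inner_L2 v (\<phi> k) - inner_L2 w (\<phi> k)"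
    using assms by (intro inner_L2_diff H1_D(1) H1P_H1 \<phi>_H1P k)
  then show "inner_L2 (\<lambda>x. v x - w x) (\<phi> k) = 0"
    using assms k by (simp add: biorthogonal_def)
qed (intro H1P_diff assms)

lemma global_basis_iff:
  "global_basis \<epsilon> V N \<phi> j \<psi> \<longleftrightarrow> \<psi> \<in> H1P \<and> biorthogonal N \<phi> j \<psi> \<and>
     (\<forall>w. w \<in> H1P \<and> biorthogonal N \<phi> j w \<longrightarrow> en (\<epsilon>\<^sup>2 / 2) V \<psi> \<psi> \<le> en (\<epsilon>\<^sup>2 / 2) V w w)"
  unfolding global_basis_def energy_minimizer_def by (auto simp: form_a_energy H1P_H1)

text \<open>The bubble \<open>b j\<close> shows that the constraint set is nonempty. The constraints
  survive limits because they are continuous in \<open>L2\<close>, where energy Cauchy sequences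
  converge as well.\<close>

lemma global_basis_exists:
  assumes j: "j \<in> {1..N}"
  shows "\<exists>\<psi>. global_basis \<epsilon> V N \<phi> j \<psi>"
proof -
  define A where "A = {w \<in> (H1P :: (real ^ 'd \<Rightarrow> complex) set). biorthogonal N \<phi> j w}"
  have "\<exists>u\<in>A. \<forall>v\<in>A. en (\<epsilon>\<^sup>2 / 2) V u u - 2 * 0 \<le> en (\<epsilon>\<^sup>2 / 2) V v v - 2 * 0"
  proof (rule E.minimiser_exists[where l = "\<lambda>_. 0" and K = 0])
    show "A \<subseteq> H1" using H1P_H1 by (auto simp: A_def)
    show "A \<noteq> {}" using b_H1P[OF j] b_biorthogonal[OF j] by (auto simp: A_def)
    show "(\<lambda>x. (1/2) *\<^sub>R (u x + v x)) \<in> A" if "u \<in> A" "v \<in> A" for u v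
    proof -
      have uv: "u \<in> H1P" "v \<in> H1P" using that by (auto simp: A_def)
      have "inner_L2 (\<lambda>x. (1/2) *\<^sub>R (u x + v x)) (\<phi> k) = (1/2) *\<^sub>R (inner_L2 u (\<phi> k) + inner_L2 v (\<phi> k))"
        if k: "k \<in> {1..N}" for k
        unfolding inner_L2_scaleR by (subst inner_L2_add) (auto intro!: H1_D(1) H1P_H1 \<phi>_H1P k uv)
      then show ?thesis using that H1P_average[OF uv] by (simp add: A_def biorthogonal_def)
    qed
    show "\<exists>u\<in>A. (\<lambda>n. E.nrm (\<lambda>x. w n x - u x)) \<longlonglongrightarrow> 0"
      if wA: "\<forall>n::nat. w n \<in> A" and cauchy: "\<forall>e>0. \<exists>n0. \<forall>m\<ge>n0. \<forall>n\<ge>n0. E.nrm (\<lambda>x. w m x - w n x) < e" for w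
    proof -
      have wH: "w n \<in> H1P" for n using wA by (simp add: A_def)
      obtain u where u: "u \<in> H1P" "(\<lambda>n. E.nrm (\<lambda>x. w n x - u x)) \<longlonglongrightarrow> 0" "(\<lambda>n. L2.nrm \<mu> (\<lambda>x. w n x - u x)) \<longlonglongrightarrow> 0"
        using energy_complete[OF _ cauchy] wH by blast
      have "inner_L2 u (\<phi> k) = (if j = k then 1 else 0)" if k: "k \<in> {1..N}" for k
      proof -
        define \<delta> where "\<delta> = (if j = k then 1 else 0 :: complex) - inner_L2 u (\<phi> k)"
        have le: "norm \<delta> \<le> L2.nrm \<mu> (\<lambda>x. w n x - u x) * L2.nrm \<mu> (\<phi> k)" for n
        proof -
          have "inner_L2 (\<lambda>x. w n x - u x) (\<phi> k) = inner_L2 (w n) (\<phi> k) - inner_L2 u (\<phi> k)"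
            by (intro inner_L2_diff H1_D(1) H1P_H1 \<phi>_H1P k u wH)
          also have "\<dots> = \<delta>" using wA k by (simp add: \<delta>_def A_def biorthogonal_def)
          finally show ?thesis
            using inner_L2_bound[OF H1_D(1)[OF H1P_H1[OF H1P_diff[OF wH u(1)]]] H1_D(1)[OF H1P_H1[OF \<phi>_H1P[OF k]]], of n] by simp
        qed
        have lim: "(\<lambda>n. L2.nrm \<mu> (\<lambda>x. w n x - u x) * L2.nrm \<mu> (\<phi> k)) \<longlonglongrightarrow> 0"
          using tendsto_mult_left_zero[OF u(3)] .
        have "norm \<delta> \<le> 0" by (rule tendsto_lowerbound[OF lim]) (auto intro: always_eventually le)
        then show ?thesis by (simp add: \<delta>_def)
      qed
      then show ?thesis using u by (auto simp: A_def biorthogonal_def)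
    qed
  qed auto
  then show ?thesis unfolding global_basis_iff A_def by auto
qed

text \<open>First-order condition in the directions that leave the moments unchanged.\<close>

lemma global_basis_orthogonal:
  assumes \<psi>: "global_basis \<epsilon> V N \<phi> j \<psi>" and w: "w \<in> kernel"
  shows "en (\<epsilon>\<^sup>2 / 2) V \<psi> w = 0"
proof -
  have p: "\<psi> \<in> H1P" "biorthogonal N \<phi> j \<psi>" using \<psi> by (auto simp: global_basis_iff)
  have tw: "(\<lambda>x. t *\<^sub>R w x) \<in> kernel" for t
    using kernel_cmult[OF w, of "complex_of_real t"] by (simp add: scaleR_conv_of_real[where 'a = complex])
  show ?thesis
  proof (rule E.minimiser_orthogonal[where l = "\<lambda>_. 0"])
    show "\<psi> \<in> H1" "w \<in> H1" using p w by (auto intro: H1P_H1 kernel_H1P)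
    show "en (\<epsilon>\<^sup>2 / 2) V \<psi> \<psi> - 2 * 0 \<le> en (\<epsilon>\<^sup>2 / 2) V (\<lambda>x. \<psi> x + t *\<^sub>R w x) (\<lambda>x. \<psi> x + t *\<^sub>R w x) - 2 * 0" for t
      using \<psi> biorthogonal_add_kernel[OF p tw] H1P_add[OF p(1) kernel_H1P[OF tw]] by (simp add: global_basis_iff)
  qed simp_all
qed

text \<open>\<open>H \<le> R * \<epsilon>\<close> brings the mass term to the scale
  \<open>\<epsilon>^2 / H^(d+2)\<close> of the gradient term.\<close>

lemma bubble_energy:
  assumes j: "j \<in> {1..N}"
  shows "(E.nrm (b j))\<^sup>2 \<le> (1/2 + Vmax * R\<^sup>2) * Cb * \<epsilon>\<^sup>2 / H ^ (CARD('d) + 2)"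
proof -
  have "Cb / H ^ CARD('d) = Cb * H\<^sup>2 / H ^ (CARD('d) + 2)" using H_pos by (simp add: power_add power2_eq_square)
  also have "\<dots> \<le> Cb * (R * \<epsilon>)\<^sup>2 / H ^ (CARD('d) + 2)"
    using H_le_\<epsilon> H_pos Cb by (intro divide_right_mono mult_left_mono power_mono) auto
  finally have le: "Cb / H ^ CARD('d) \<le> Cb * (R * \<epsilon>)\<^sup>2 / H ^ (CARD('d) + 2)" .
  have "(E.nrm (b j))\<^sup>2 \<le> \<epsilon>\<^sup>2 / 2 * (L2.nrm \<mu> (grad (b j)))\<^sup>2 + Vmax * (L2.nrm \<mu> (b j))\<^sup>2"
    by (intro E.nrm_le H1P_H1 b_H1P j)
  also have "\<dots> \<le> \<epsilon>\<^sup>2 / 2 * (Cb / H ^ (CARD('d) + 2)) + Vmax * (Cb * (R * \<epsilon>)\<^sup>2 / H ^ (CARD('d) + 2))"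
    using b_bound[OF j] le Vmax by (intro add_mono mult_left_mono) auto
  also have "\<dots> = (1/2 + Vmax * R\<^sup>2) * Cb * \<epsilon>\<^sup>2 / H ^ (CARD('d) + 2)"
    by (simp add: add_divide_distrib power_mult_distrib algebra_simps)
  finally show ?thesis .
qed

end

subsection \<open>Localisation of the basis\<close>

lemma L2_nrm_sq_le:
  fixes f :: "real ^ 'd::finite \<Rightarrow> 'a::euclidean_space" and p :: "real ^ 'd \<Rightarrow> 'b::euclidean_space"
    and q :: "real ^ 'd \<Rightarrow> 'c::euclidean_space"
  assumes f: "f \<in> sq_int \<mu>" and p: "p \<in> sq_int \<mu>" and q: "q \<in> sq_int \<mu>" and L: "L \<in> sets lebesgue"
    and le: "AE x in \<mu>. norm (f x) \<le> indicat_real L x * (a * norm (p x) + c * norm (q x))"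
  shows "(L2.nrm \<mu> f)\<^sup>2 \<le> 2 * a\<^sup>2 * nsq L p + 2 * c\<^sup>2 * nsq L q"
proof -
  have int: "integrable \<mu> (\<lambda>x. 2 * a\<^sup>2 * (indicat_real L x * (norm (p x))\<^sup>2))"
    "integrable \<mu> (\<lambda>x. 2 * c\<^sup>2 * (indicat_real L x * (norm (q x))\<^sup>2))"
    using nsq_integrable[OF L p] nsq_integrable[OF L q] by auto
  have "(L2.nrm \<mu> f)\<^sup>2 = (\<integral>x. (norm (f x))\<^sup>2 \<partial>\<mu>)"
    by (simp add: L2_nrm_eq)
  also have "\<dots> \<le> (\<integral>x. 2 * a\<^sup>2 * (indicat_real L x * (norm (p x))\<^sup>2) + 2 * c\<^sup>2 * (indicat_real L x * (norm (q x))\<^sup>2) \<partial>\<mu>)"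
  proof (rule integral_mono_AE)
    show "integrable \<mu> (\<lambda>x. (norm (f x))\<^sup>2)" using f by (simp add: sq_int_def)
    show "integrable \<mu> (\<lambda>x. 2 * a\<^sup>2 * (indicat_real L x * (norm (p x))\<^sup>2) + 2 * c\<^sup>2 * (indicat_real L x * (norm (q x))\<^sup>2))"
      using int by (rule Bochner_Integration.integrable_add)
    show "AE x in \<mu>. (norm (f x))\<^sup>2 \<le> 2 * a\<^sup>2 * (indicat_real L x * (norm (p x))\<^sup>2) + 2 * c\<^sup>2 * (indicat_real L x * (norm (q x))\<^sup>2)"
      using le
    proof eventually_elim
      fix x assume le: "norm (f x) \<le> indicat_real L x * (a * norm (p x) + c * norm (q x))"
      show "(norm (f x))\<^sup>2 \<le> 2 * a\<^sup>2 * (indicat_real L x * (norm (p x))\<^sup>2) + 2 * c\<^sup>2 * (indicat_real L x * (norm (q x))\<^sup>2)"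
      proof (cases "x \<in> L")
        case True
        then have "(norm (f x))\<^sup>2 \<le> (a * norm (p x) + c * norm (q x))\<^sup>2" using le by (intro power_mono) auto
        also have "\<dots> \<le> 2 * (a * norm (p x))\<^sup>2 + 2 * (c * norm (q x))\<^sup>2"
          using sum_squares_bound[of "a * norm (p x)" "c * norm (q x)"] unfolding power2_sum by linarith
        finally show ?thesis using True by (simp add: power_mult_distrib)
      qed (use le in simp)
    qed
  qed
  also have "\<dots> = 2 * a\<^sup>2 * nsq L p + 2 * c\<^sup>2 * nsq L q"
    by (subst Bochner_Integration.integral_add[OF int]) (simp add: nsq_def)
  finally show ?thesis .
qed

text \<open>\<open>1 + 3^d\<close> bounds one minus the cutoff; \<open>A\<close> times
  \<open>H^2\<close> times the squared gradient tail bounds the squared \<open>L2\<close> norm of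
  the removed part; the last summand is the cost of the bubbles. The factor \<open>2\<close> in
  front of the terms comes from splitting the energy of a difference.\<close>

definition corrector_const :: "nat \<Rightarrow> real \<Rightarrow> real \<Rightarrow> real \<Rightarrow> real \<Rightarrow> real \<Rightarrow> real \<Rightarrow> real"
  where "corrector_const d \<kappa> Col CI Vmax R B =
    (let A = 2 * (1 + 3 ^ d)\<^sup>2 * CI\<^sup>2 * Col in
      2 * (1 + 3 ^ d)\<^sup>2 + 2 * (real d * cutoff_slope (real d) \<kappa>)\<^sup>2 * CI\<^sup>2 * Col + 2 * Vmax * A * R\<^sup>2
        + 2 * (real d + 1) * Col * 2 ^ d * A * B)"

text \<open>\<open>\<beta> ^ 8\<close> is the square of the decay over the four layers that the
  corrector consumes; the summand \<open>1\<close> covers oversampling sizes below four.\<close>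

definition localisation_const :: "nat \<Rightarrow> real \<Rightarrow> real \<Rightarrow> real \<Rightarrow> real \<Rightarrow> real \<Rightarrow> real \<Rightarrow> real \<Rightarrow> real"
  where "localisation_const d \<kappa> Col CI Vmax R B \<beta> =
    (2 * corrector_const d \<kappa> Col CI Vmax R B + 1) * B / \<beta> ^ 8"

lemma corrector_const_nonneg:
  "0 < Col \<Longrightarrow> 0 < Vmax \<Longrightarrow> 0 < B \<Longrightarrow> 0 \<le> corrector_const d \<kappa> Col CI Vmax R B"
  by (simp add: corrector_const_def Let_def)

context lod begin

abbreviation "Bb \<equiv> (1/2 + Vmax * R\<^sup>2) * Cb"

lemma Bb: "0 < Bb" using Vmax Cb R by (intro mult_pos_pos add_pos_nonneg) auto

lemma Tb_supp: assumes j: "j \<in> {1..N}" shows "Tb j \<subseteq> supp (\<phi> j)"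
proof -
  have "touches (Tb j) j" using Tb(2)[OF j] per_eq_refl by (auto simp: touches_def)
  then show ?thesis using supp_\<phi>[OF j] Tb(1)[OF j] by auto
qed

lemma supp_patch_pow: "j \<in> {1..N} \<Longrightarrow> supp (\<phi> j) \<subseteq> patch_pow \<T> m (supp (\<phi> j))"
  using patch_pow_mono[OF supp_\<phi>_unions, of j 0 m] by (simp add: patch_pow_0)

text \<open>Pythagoras: the difference of two functions with the same moments lies in the kernel, to
  which the global basis function is orthogonal.\<close>

lemma energy_diff_global_basis:
  assumes \<psi>: "global_basis \<epsilon> V N \<phi> j \<psi>" and v: "v \<in> H1P" "biorthogonal N \<phi> j v"
  shows "(E.nrm (\<lambda>x. \<psi> x - v x))\<^sup>2 = (E.nrm v)\<^sup>2 - (E.nrm \<psi>)\<^sup>2"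
proof -
  have p: "\<psi> \<in> H1P" "biorthogonal N \<phi> j \<psi>" using \<psi> by (auto simp: global_basis_iff)
  note H = H1P_H1[OF p(1)] H1P_H1[OF v(1)]
  have "en (\<epsilon>\<^sup>2 / 2) V \<psi> (\<lambda>x. \<psi> x - v x) = 0"
    by (rule global_basis_orthogonal[OF \<psi> biorthogonal_diff[OF p v]])
  then have "en (\<epsilon>\<^sup>2 / 2) V \<psi> v = en (\<epsilon>\<^sup>2 / 2) V \<psi> \<psi>" using E.B_diff_right[OF H(1,2,1)] by simp
  then show ?thesis using E.B_diff_self[OF H] by (simp add: E.nrm_sq H H1_diff(1))
qed

text \<open>By Pythagoras, least energy under the constraints is the same as least distance to the
  global basis function.\<close>

lemma local_basis_quasi_optimal:
  assumes \<psi>: "global_basis \<epsilon> V N \<phi> j \<psi>" and \<psi>': "local_basis \<epsilon> V \<T> N \<phi> m j \<psi>'"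
    and w: "w \<in> H1P" "biorthogonal N \<phi> j w" "AE x in \<mu>. x \<notin> patch_pow \<T> m (supp (\<phi> j)) \<longrightarrow> w x = 0"
  shows "(E.nrm (\<lambda>x. \<psi> x - \<psi>' x))\<^sup>2 \<le> (E.nrm (\<lambda>x. \<psi> x - w x))\<^sup>2"
proof -
  have p: "\<psi>' \<in> H1P" "biorthogonal N \<phi> j \<psi>'"
    using \<psi>' unfolding local_basis_def energy_minimizer_def by auto
  have "Re (form_a \<epsilon> V \<psi>' \<psi>') \<le> Re (form_a \<epsilon> V w w)"
    using \<psi>' w unfolding local_basis_def energy_minimizer_def by blast
  then have "(E.nrm \<psi>')\<^sup>2 \<le> (E.nrm w)\<^sup>2" using p w by (simp add: form_a_energy H1P_H1 E.nrm_sq)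
  then show ?thesis by (simp add: energy_diff_global_basis[OF \<psi>] p w)
qed

lemma bubble_orthogonal:
  assumes k: "k \<in> {1..N}" and l: "l \<in> {1..N}" and ne: "Tb k \<noteq> Tb l"
  shows "en (\<epsilon>\<^sup>2 / 2) V (\<lambda>x. c * b k x) (\<lambda>x. c' * b l x) = 0"
proof -
  have sep: "AE x in \<mu>. x \<notin> Tb k \<or> x \<notin> Tb l"
    using AE_unique_element by eventually_elim (use Tb(1)[OF k] Tb(1)[OF l] ne in blast)
  have "(\<integral>x. grad (\<lambda>x. c * b k x) x \<bullet> grad (\<lambda>x. c' * b l x) x \<partial>\<mu>) = 0"
  proof (rule integral_eq_zero_AE)
    show "AE x in \<mu>. grad (\<lambda>x. c * b k x) x \<bullet> grad (\<lambda>x. c' * b l x) x = 0"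
      using sep H1_cmult(2)[OF H1P_H1[OF b_H1P[OF k]], of c] H1_cmult(2)[OF H1P_H1[OF b_H1P[OF l]], of c']
        grad_b_zero[OF k] grad_b_zero[OF l]
    proof eventually_elim
      fix x
      assume a: "x \<notin> Tb k \<or> x \<notin> Tb l" "grad (\<lambda>x. c * b k x) x = c *s grad (b k) x"
        "grad (\<lambda>x. c' * b l x) x = c' *s grad (b l) x" "x \<notin> Tb k \<longrightarrow> grad (b k) x = 0" "x \<notin> Tb l \<longrightarrow> grad (b l) x = 0"
      from a(1) show "grad (\<lambda>x. c * b k x) x \<bullet> grad (\<lambda>x. c' * b l x) x = 0"
        unfolding a(2,3) using a(4,5) by auto
    qed
  qed
  moreover have "(\<integral>x. (V x *\<^sub>R (c * b k x)) \<bullet> (c' * b l x) \<partial>\<mu>) = 0"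
  proof (rule integral_eq_zero_AE)
    show "AE x in \<mu>. (V x *\<^sub>R (c * b k x)) \<bullet> (c' * b l x) = 0"
      using sep by eventually_elim (auto simp: b_zero[OF k] b_zero[OF l])
  qed
  ultimately show ?thesis by (simp add: en_def)
qed

text \<open>Bubbles in different elements are orthogonal and at most \<open>d + 1\<close> of them
  share an element, so the double sum is controlled by the row sums of the symmetric zero-one matrix
  \<open>J\<close>.\<close>

lemma bubble_sum_energy:
  "(E.nrm (\<lambda>x. \<Sum>k\<in>{1..N}. e k * b k x))\<^sup>2
     \<le> (real CARD('d) + 1) * (\<Sum>k\<in>{1..N}. (norm (e k))\<^sup>2) * (Bb * \<epsilon>\<^sup>2 / H ^ (CARD('d) + 2))"
proof -
  define f where "f k = (\<lambda>x. e k * b k x)" for k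
  define a where "a k = (E.nrm (f k))\<^sup>2" for k
  define J where "J k l = (if Tb k = Tb l then 1 else 0 :: real)" for k l
  have f: "f k \<in> H1" if "k \<in> {1..N}" for k unfolding f_def by (intro H1_cmult H1P_H1 b_H1P that)
  have le: "en (\<epsilon>\<^sup>2 / 2) V (f k) (f l) \<le> J k l * a k / 2 + J k l * a l / 2" if kl: "k \<in> {1..N}" "l \<in> {1..N}" for k l
  proof (cases "Tb k = Tb l")
    case True
    have "en (\<epsilon>\<^sup>2 / 2) V (f k) (f l) \<le> E.nrm (f k) * E.nrm (f l)" using E.cauchy_schwarz[OF f[OF kl(1)] f[OF kl(2)]] by linarith
    also have "\<dots> \<le> a k / 2 + a l / 2" using sum_squares_bound[of "E.nrm (f k)" "E.nrm (f l)"] by (simp add: a_def)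
    finally show ?thesis using True by (simp add: J_def)
  next
    case False
    then show ?thesis using bubble_orthogonal[OF kl] by (simp add: f_def J_def)
  qed
  have J: "(\<Sum>l\<in>{1..N}. J k l) \<le> real CARD('d) + 1" if k: "k \<in> {1..N}" for k
  proof -
    have tch: "touches (Tb k) l" if "l \<in> {1..N}" "Tb k = Tb l" for l
      unfolding touches_def using Tb(2)[OF that(1)] that(2) per_eq_refl by metis
    have "(\<Sum>l\<in>{1..N}. J k l) = real (card {l \<in> {1..N}. Tb k = Tb l})"
      by (simp add: J_def sum.If_cases Int_def)
    also have "\<dots> \<le> real (card {l \<in> {1..N}. touches (Tb k) l})"
      using tch by (intro of_nat_mono card_mono) auto
    also have "\<dots> \<le> real (CARD('d) + 1)" by (intro of_nat_mono card_touches Tb k)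
    finally show ?thesis by simp
  qed
  have a: "a k \<le> (norm (e k))\<^sup>2 * (Bb * \<epsilon>\<^sup>2 / H ^ (CARD('d) + 2))" if k: "k \<in> {1..N}" for k
    unfolding a_def f_def E.nrm_cmult[OF H1P_H1[OF b_H1P[OF k]]] power_mult_distrib
    by (intro mult_left_mono bubble_energy k) simp
  have sF: "(\<lambda>x. \<Sum>k\<in>{1..N}. f k x) \<in> H1" by (intro E.sum_closed f)
  have "(E.nrm (\<lambda>x. \<Sum>k\<in>{1..N}. f k x))\<^sup>2 = (\<Sum>k\<in>{1..N}. en (\<epsilon>\<^sup>2 / 2) V (f k) (\<lambda>x. \<Sum>l\<in>{1..N}. f l x))"
    unfolding E.nrm_sq[OF sF] by (intro E.B_sum f sF)
  also have "\<dots> = (\<Sum>k\<in>{1..N}. \<Sum>l\<in>{1..N}. en (\<epsilon>\<^sup>2 / 2) V (f k) (f l))"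
  proof (intro sum.cong refl)
    fix k assume k: "k \<in> {1..N}"
    have "en (\<epsilon>\<^sup>2 / 2) V (f k) (\<lambda>x. \<Sum>l\<in>{1..N}. f l x) = en (\<epsilon>\<^sup>2 / 2) V (\<lambda>x. \<Sum>l\<in>{1..N}. f l x) (f k)"
      by (rule E.B_sym[OF f[OF k] sF])
    also have "\<dots> = (\<Sum>l\<in>{1..N}. en (\<epsilon>\<^sup>2 / 2) V (f l) (f k))" by (intro E.B_sum f k)
    also have "\<dots> = (\<Sum>l\<in>{1..N}. en (\<epsilon>\<^sup>2 / 2) V (f k) (f l))" by (intro sum.cong refl E.B_sym f k)
    finally show "en (\<epsilon>\<^sup>2 / 2) V (f k) (\<lambda>x. \<Sum>l\<in>{1..N}. f l x) = (\<Sum>l\<in>{1..N}. en (\<epsilon>\<^sup>2 / 2) V (f k) (f l))" .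
  qed
  also have "\<dots> \<le> (\<Sum>k\<in>{1..N}. \<Sum>l\<in>{1..N}. J k l * a k / 2 + J k l * a l / 2)"
    by (intro sum_mono le)
  also have "\<dots> = (\<Sum>k\<in>{1..N}. \<Sum>l\<in>{1..N}. J k l * a k / 2) + (\<Sum>k\<in>{1..N}. \<Sum>l\<in>{1..N}. J k l * a l / 2)"
    by (simp only: sum.distrib)
  also have "(\<Sum>k\<in>{1..N}. \<Sum>l\<in>{1..N}. J k l * a l / 2) = (\<Sum>k\<in>{1..N}. \<Sum>l\<in>{1..N}. J k l * a k / 2)"
    by (subst sum.swap) (auto intro!: sum.cong simp: J_def)
  also have "(\<Sum>k\<in>{1..N}. \<Sum>l\<in>{1..N}. J k l * a k / 2) + (\<Sum>k\<in>{1..N}. \<Sum>l\<in>{1..N}. J k l * a k / 2)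
      = (\<Sum>k\<in>{1..N}. (\<Sum>l\<in>{1..N}. J k l) * a k)"
    by (simp add: sum.distrib[symmetric] sum_distrib_left mult.commute)
  also have "\<dots> \<le> (\<Sum>k\<in>{1..N}. (real CARD('d) + 1) * ((norm (e k))\<^sup>2 * (Bb * \<epsilon>\<^sup>2 / H ^ (CARD('d) + 2))))"
    by (intro sum_mono mult_mono J a) (auto simp: a_def)
  also have "\<dots> = (real CARD('d) + 1) * (\<Sum>k\<in>{1..N}. (norm (e k))\<^sup>2) * (Bb * \<epsilon>\<^sup>2 / H ^ (CARD('d) + 2))"
    by (simp only: sum_distrib_left sum_distrib_right mult.assoc)
  finally show ?thesis by (simp add: f_def)
qed

lemma norm_inner_\<phi>:
  assumes r: "r \<in> sq_int \<mu>" and k: "k \<in> {1..N}"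
  shows "norm (inner_L2 r (\<phi> k)) \<le> (\<integral>x. norm (r x) * Re (\<phi> k x) \<partial>\<mu>)"
proof -
  have "norm (inner_L2 r (\<phi> k)) \<le> (\<integral>x. norm (r x * cnj (\<phi> k x)) \<partial>\<mu>)"
    unfolding inner_L2_def by (rule integral_norm_bound)
  also have "\<dots> = (\<integral>x. norm (r x) * Re (\<phi> k x) \<partial>\<mu>)"
    by (intro Bochner_Integration.integral_cong refl) (simp add: norm_mult norm_\<phi>[OF k])
  finally show ?thesis .
qed

lemma Re_\<phi>_meas: "k \<in> {1..N} \<Longrightarrow> (\<lambda>x. Re (\<phi> k x)) \<in> borel_measurable \<mu>"
  using Re_\<phi>_integrable by (rule borel_measurable_integrable)

text \<open>Cauchy-Schwarz with the weight \<open>\<phi> k\<close> split into two square roots.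
  Summed over \<open>k\<close>, the partition of unity collects the weighted norms of
  \<open>r\<close> into the full norm.\<close>

lemma inner_\<phi>_sum_sq:
  assumes r: "r \<in> sq_int \<mu>"
  shows "(\<Sum>k\<in>{1..N}. (norm (inner_L2 r (\<phi> k)))\<^sup>2) \<le> Col * (2 * H) ^ CARD('d) * (L2.nrm \<mu> r)\<^sup>2"
proof -
  define g where "g k x = sqrt (Re (\<phi> k x))" for k and x :: "real ^ 'd"
  have rm: "r \<in> borel_measurable \<mu>" using r by (simp add: sq_int_def)
  have g01: "0 \<le> g k x" "g k x \<le> 1" "(g k x)\<^sup>2 = Re (\<phi> k x)" if "k \<in> {1..N}" "x \<in> Omega" for k x
    using \<phi>_bounds[OF that] by (simp_all add: g_def)
  have gm: "g k \<in> borel_measurable \<mu>" if "k \<in> {1..N}" for k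
    unfolding g_def[abs_def] using Re_\<phi>_meas[OF that] by simp
  have gs: "g k \<in> sq_int \<mu>" if k: "k \<in> {1..N}" for k
    by (rule sq_int_bounded[OF gm[OF k], of 1]) (simp add: g01[OF k])
  have rg: "(\<lambda>x. norm (r x) * g k x) \<in> sq_int \<mu>" if k: "k \<in> {1..N}" for k
  proof (rule sq_int_bound[OF r, where K = 1])
    show "(\<lambda>x. norm (r x) * g k x) \<in> borel_measurable \<mu>" using rm gm[OF k] by simp
    show "norm (norm (r x) * g k x) \<le> 1 * norm (r x)" if "x \<in> space \<mu>" for x
      using g01[OF k, of x] that by (simp add: abs_mult mult_left_le)
  qed
  have int: "integrable \<mu> (\<lambda>x. (norm (r x))\<^sup>2 * Re (\<phi> k x))" if k: "k \<in> {1..N}" for k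
  proof -
    have "integrable \<mu> (\<lambda>x. (norm (norm (r x) * g k x))\<^sup>2)" using rg[OF k] by (simp add: sq_int_def)
    then show ?thesis
      by (rule iffD1[OF Bochner_Integration.integrable_cong[OF refl], rotated]) (simp add: power_mult_distrib g01[OF k])
  qed
  have "(norm (inner_L2 r (\<phi> k)))\<^sup>2 \<le> (\<integral>x. (norm (r x))\<^sup>2 * Re (\<phi> k x) \<partial>\<mu>) * (Col * (2 * H) ^ CARD('d))"
    if k: "k \<in> {1..N}" for k
  proof -
    have sq1: "(L2.nrm \<mu> (\<lambda>x. norm (r x) * g k x))\<^sup>2 = (\<integral>x. (norm (r x))\<^sup>2 * Re (\<phi> k x) \<partial>\<mu>)"
      unfolding L2_nrm_eq
      by (simp, intro Bochner_Integration.integral_cong) (simp_all add: power_mult_distrib g01[OF k])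
    have sq2: "(L2.nrm \<mu> (g k))\<^sup>2 = (\<integral>x. Re (\<phi> k x) \<partial>\<mu>)"
      unfolding L2_nrm_eq by (simp, intro Bochner_Integration.integral_cong) (simp_all add: g01[OF k])
    have "norm (inner_L2 r (\<phi> k)) \<le> (\<integral>x. (norm (r x) * g k x) \<bullet> g k x \<partial>\<mu>)"
      using norm_inner_\<phi>[OF r k]
      by (rule order_trans) (intro eq_refl Bochner_Integration.integral_cong refl, simp add: mult.assoc power2_eq_square[symmetric] g01[OF k])
    also have "\<dots> \<le> L2.nrm \<mu> (\<lambda>x. norm (r x) * g k x) * L2.nrm \<mu> (g k)"
      using L2.cauchy_schwarz[OF rg[OF k] gs[OF k]] by linarith
    finally have "(norm (inner_L2 r (\<phi> k)))\<^sup>2 \<le> (L2.nrm \<mu> (\<lambda>x. norm (r x) * g k x) * L2.nrm \<mu> (g k))\<^sup>2"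
      by (intro power_mono) auto
    also have "\<dots> = (\<integral>x. (norm (r x))\<^sup>2 * Re (\<phi> k x) \<partial>\<mu>) * (\<integral>x. Re (\<phi> k x) \<partial>\<mu>)"
      by (simp only: power_mult_distrib sq1 sq2)
    also have "\<dots> \<le> (\<integral>x. (norm (r x))\<^sup>2 * Re (\<phi> k x) \<partial>\<mu>) * (Col * (2 * H) ^ CARD('d))"
      unfolding sq1[symmetric] by (intro mult_left_mono \<phi>_integral k) simp
    finally show ?thesis .
  qed
  then have "(\<Sum>k\<in>{1..N}. (norm (inner_L2 r (\<phi> k)))\<^sup>2)
      \<le> (\<Sum>k\<in>{1..N}. (\<integral>x. (norm (r x))\<^sup>2 * Re (\<phi> k x) \<partial>\<mu>) * (Col * (2 * H) ^ CARD('d)))"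
    by (rule sum_mono)
  also have "\<dots> = (\<Sum>k\<in>{1..N}. \<integral>x. (norm (r x))\<^sup>2 * Re (\<phi> k x) \<partial>\<mu>) * (Col * (2 * H) ^ CARD('d))"
    by (simp only: sum_distrib_right)
  also have "(\<Sum>k\<in>{1..N}. \<integral>x. (norm (r x))\<^sup>2 * Re (\<phi> k x) \<partial>\<mu>) = (\<integral>x. (\<Sum>k\<in>{1..N}. (norm (r x))\<^sup>2 * Re (\<phi> k x)) \<partial>\<mu>)"
    by (rule Bochner_Integration.integral_sum[symmetric]) (rule int)
  also have "\<dots> = (\<integral>x. (norm (r x))\<^sup>2 \<partial>\<mu>)"
    by (intro Bochner_Integration.integral_cong refl) (simp add: sum_distrib_left[symmetric] sum_\<phi>[unfolded One_nat_def])
  also have "\<dots> = (L2.nrm \<mu> r)\<^sup>2" by (simp add: L2_nrm_eq)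
  finally show ?thesis by (simp add: mult_ac)
qed

text \<open>The moments of \<open>\<psi>\<close> leave only \<open>\<phi> j\<close> in its
  interpolation, so off the support of \<open>\<phi> j\<close> the function equals its own
  interpolation error. Two layers are lost: one for the elements, one for their patches.\<close>

lemma tail_bound:
  assumes j: "j \<in> {1..N}" and \<psi>: "\<psi> \<in> H1P" "biorthogonal N \<phi> j \<psi>"
  shows "nsq (Omega - patch_pow \<T> (n + 2) (supp (\<phi> j))) \<psi>
    \<le> (CI * H)\<^sup>2 * Col * nsq (Omega - patch_pow \<T> n (supp (\<phi> j))) (grad \<psi>)"
proof -
  define K where "K n = patch_pow \<T> n (supp (\<phi> j))" for n
  have K: "K n \<in> unions" for n unfolding K_def by (intro unions_patch_pow supp_\<phi>_unions j)
  have KS: "K (Suc n) = patch \<T> (K n)" for n by (simp add: K_def patch_pow_Suc)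
  have Kl: "Omega - K n \<in> sets lebesgue" for n using unions_sets[OF K] by auto
  \<comment> \<open>Elements away from layer \<open>n + 1\<close> still cover the complement of
    layer \<open>n + 2\<close>, and their patches stay off layer \<open>n\<close>.\<close>
  define \<T>' where "\<T>' = {T \<in> \<T>. T \<inter> per_ext (K (Suc n)) = {}}"
  have B: "Omega - K (n + 2) \<subseteq> \<Union>\<T>'"
  proof
    fix x assume x: "x \<in> Omega - K (n + 2)"
    then obtain T where T: "T \<in> \<T>" "x \<in> T" using Union_\<T> by auto
    have "T \<inter> per_ext (K (Suc n)) = {}" using x T KS[of "Suc n"] by (auto simp: patch_def)
    then show "x \<in> \<Union>\<T>'" using T by (auto simp: \<T>'_def)
  qed
  have A: "patch \<T> T \<subseteq> Omega - K n" if T: "T \<in> \<T>'" for T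
  proof
    fix y assume "y \<in> patch \<T> T"
    then obtain G where G: "G \<in> \<T>" "G \<inter> per_ext T \<noteq> {}" "y \<in> G" by (auto simp: patch_def)
    have "y \<notin> K n"
    proof
      assume "y \<in> K n"
      then have "G \<inter> per_ext (K n) \<noteq> {}" using G(3) per_ext_self by blast
      then have "G \<subseteq> K (Suc n)" using G(1) KS[of n] by (auto simp: patch_def)
      moreover have "T \<inter> per_ext G \<noteq> {}" using G(2) Int_per_ext_commute by metis
      ultimately have "T \<inter> per_ext (K (Suc n)) \<noteq> {}" by (auto simp: per_ext_def)
      then show False using T by (simp add: \<T>'_def)
    qed
    then show "y \<in> Omega - K n" using G T_Omega by auto
  qed
  have "(\<lambda>x. \<psi> x - clement N \<phi> \<psi> x) \<in> H1P" by (intro H1P_diff \<psi> clement_H1P)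
  note sq = H1_D(1)[OF H1P_H1[OF this]] H1_D(1)[OF H1P_H1[OF \<psi>(1)]]
  have "nsq (Omega - K (n + 2)) \<psi> \<le> nsq (Omega - K (n + 2)) (\<lambda>x. \<psi> x - clement N \<phi> \<psi> x)"
  proof (intro nsq_mono Kl sq AE_I2 impI conjI)
    fix x assume x: "x \<in> Omega - K (n + 2)"
    then have "x \<notin> supp (\<phi> j)" using supp_patch_pow[OF j] by (auto simp: K_def)
    then have "\<phi> j x = 0" using x closure_subset[of "{x \<in> Omega. \<phi> j x \<noteq> 0}"] unfolding supp_def by blast
    then have "clement N \<phi> \<psi> x = 0"
      unfolding clement_def using \<psi>(2) by (intro sum.neutral ballI) (auto simp: biorthogonal_def)
    then show "norm (\<psi> x) \<le> norm (\<psi> x - clement N \<phi> \<psi> x)" by simp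
  qed
  also have "\<dots> \<le> (CI * H)\<^sup>2 * Col * nsq (Omega - K n) (grad \<psi>)"
    by (rule clement_error[OF \<psi>(1) _ Kl B Kl A]) (auto simp: \<T>'_def)
  finally show ?thesis unfolding K_def .
qed

end

context lod begin

text \<open>The corrector removes the tail of the global basis function by a cutoff and restores the
  constraints with bubbles; only bubbles near the support of the cutoff are needed, since farther away
  the constraints already hold.\<close>
lemma corrector_exists:
  assumes j: "j \<in> {1..N}" and \<psi>: "\<psi> \<in> H1P" "biorthogonal N \<phi> j \<psi>"
  shows "\<exists>w\<in>H1P. biorthogonal N \<phi> j w \<and> (\<forall>x\<in>Omega. x \<notin> patch_pow \<T> (n + 4) (supp (\<phi> j)) \<longrightarrow> w x = 0) \<and>
    (E.nrm (\<lambda>x. \<psi> x - w x))\<^sup>2 \<le> corrector_const CARD('d) \<kappa> Col CI Vmax R Bb * \<epsilon>\<^sup>2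
      * nsq (Omega - patch_pow \<T> n (supp (\<phi> j))) (grad \<psi>)"
proof -
  define d where "d = CARD('d)"
  define K where "K n = patch_pow \<T> n (supp (\<phi> j))" for n
  have K: "K n \<in> unions" for n unfolding K_def by (intro unions_patch_pow supp_\<phi>_unions j)
  have KS: "K (Suc n) = patch \<T> (K n)" for n by (simp add: K_def patch_pow_Suc)
  have Kl: "Omega - K n \<in> sets lebesgue" for n using unions_sets[OF K] by auto
  have Kmono: "K i \<subseteq> K l" if "i \<le> l" for i l unfolding K_def by (intro patch_pow_mono supp_\<phi>_unions j that)
  \<comment> \<open>Count of layers: up to \<open>n + 2\<close> the cutoff is one, so the removed
    part lives in \<open>L\<close>, where \<open>tail_bound\<close> applies. The cutoff ends in
    layer \<open>n + 3\<close>, and the bubbles reach layer \<open>n + 4\<close>.\<close>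
  define L where "L = Omega - K (n + 2)"
  define g where "g = nsq (Omega - K n) (grad \<psi>)"
  define c where "c = real d * cutoff_slope (real d) \<kappa>"
  define a where "a = 1 + (3::real) ^ d"
  define A where "A = 2 * a\<^sup>2 * CI\<^sup>2 * Col"
  have K3: "patch \<T> (K (n + 2)) = K (n + 3)" using KS[of "n + 2"] by (simp add: eval_nat_numeral)
  obtain \<eta> where "smooth_fn \<eta> \<and>
    (\<forall>i. \<forall>x\<in>Omega. \<eta> (set_coord i 0 x) = \<eta> (set_coord i (2 * pi) x)) \<and>
    (\<forall>x\<in>Omega. \<bar>\<eta> x\<bar> \<le> 3 ^ d) \<and>
    (\<forall>x\<in>K (n + 2). x \<in> interior Omega \<longrightarrow> \<eta> x = 1 \<and> (\<forall>i. pd \<eta> i x = 0)) \<and>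
    (\<forall>x\<in>Omega. \<eta> x \<noteq> 0 \<longrightarrow> x \<in> K (n + 3)) \<and>
    (\<forall>x\<in>Omega. \<forall>i. \<bar>pd \<eta> i x\<bar> \<le> cutoff_slope (real d) \<kappa> / H)"
    using cutoff_exists[OF K[of "n + 2"]] unfolding K3 d_def by (rule exE)
  then have \<eta>: "smooth_fn \<eta>" "\<And>i x. x \<in> Omega \<Longrightarrow> \<eta> (set_coord i 0 x) = \<eta> (set_coord i (2 * pi) x)"
    "\<And>x. x \<in> Omega \<Longrightarrow> \<bar>\<eta> x\<bar> \<le> 3 ^ d"
    "\<And>x. x \<in> K (n + 2) \<Longrightarrow> x \<in> interior Omega \<Longrightarrow> \<eta> x = 1 \<and> (\<forall>i. pd \<eta> i x = 0)"
    "\<And>x. x \<in> Omega \<Longrightarrow> \<eta> x \<noteq> 0 \<Longrightarrow> x \<in> K (n + 3)"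
    "\<And>x i. x \<in> Omega \<Longrightarrow> \<bar>pd \<eta> i x\<bar> \<le> cutoff_slope (real d) \<kappa> / H"
    by blast+
  define \<theta> where "\<theta> x = 1 - \<eta> x" for x
  have \<theta>: "smooth_fn \<theta>" "pd \<theta> i x = - pd \<eta> i x" for i x
    unfolding \<theta>_def[abs_def] using smooth_fn_one_minus[OF \<eta>(1)] by auto
  \<comment> \<open>The removed tail. Its removal changes the moments by \<open>e\<close>, and
    \<open>s\<close> is the combination of bubbles with exactly these moments.\<close>
  define r where "r x = \<theta> x *\<^sub>R \<psi> x" for x
  have r: "r \<in> H1P" unfolding r_def[abs_def]
    by (intro H1P_smooth_mult \<psi> \<theta>) (simp add: \<theta>_def \<eta>(2))
  define e where "e k = inner_L2 r (\<phi> k)" for k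
  define s where "s x = (\<Sum>k\<in>{1..N}. e k * b k x)" for x
  have s: "s \<in> H1P" unfolding s_def[abs_def] by (intro H1P_sum H1P_cmult b_H1P)
  define w where "w x = \<psi> x - (r x - s x)" for x
  have w: "w \<in> H1P" unfolding w_def[abs_def] by (intro H1P_diff \<psi> r s)
  have sq: "\<psi> \<in> sq_int \<mu>" "r \<in> sq_int \<mu>" "s \<in> sq_int \<mu>" "(\<lambda>x. r x - s x) \<in> sq_int \<mu>"
    using \<psi> r s H1P_diff[OF r s] H1P_H1 H1_D(1) by blast+
  have gsq: "grad \<psi> \<in> sq_int \<mu>" "grad r \<in> sq_int \<mu>" using \<psi> r H1P_H1 H1_D(2) by blast+
  have \<phi>s: "\<phi> k \<in> sq_int \<mu>" if "k \<in> {1..N}" for k by (rule \<phi>_sq_int[OF that])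
  have s_inner: "inner_L2 s (\<phi> k) = e k" if k: "k \<in> {1..N}" for k
  proof -
    have "inner_L2 s (\<phi> k) = (\<Sum>l\<in>{1..N}. inner_L2 (\<lambda>x. e l * b l x) (\<phi> k))"
      unfolding s_def[abs_def] by (intro inner_L2_sum \<phi>s k sq_int_cmult H1_D(1) H1P_H1 b_H1P)
    also have "\<dots> = (\<Sum>l\<in>{1..N}. if l = k then e l else 0)"
      using b_biorthogonal k by (intro sum.cong refl) (auto simp: inner_L2_cmult biorthogonal_def)
    also have "\<dots> = e k" using k by (subst sum.delta) auto
    finally show ?thesis .
  qed
  have w_bi: "biorthogonal N \<phi> j w" unfolding biorthogonal_def
  proof
    fix k assume k: "k \<in> {1..N}"
    have "inner_L2 w (\<phi> k) = inner_L2 \<psi> (\<phi> k) - (inner_L2 r (\<phi> k) - inner_L2 s (\<phi> k))"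
      unfolding w_def[abs_def] using inner_L2_diff[OF sq(1,4) \<phi>s[OF k]] inner_L2_diff[OF sq(2,3) \<phi>s[OF k]] by simp
    then show "inner_L2 w (\<phi> k) = (if j = k then 1 else 0)"
      using \<psi>(2) k s_inner[OF k] by (simp add: biorthogonal_def e_def)
  qed
  \<comment> \<open>For \<open>k \<noteq> j\<close> a nonzero \<open>e k\<close> forces
    \<open>\<phi> k\<close> to overlap the cutoff; otherwise \<open>e k\<close> would be the moment
    of \<open>\<psi>\<close> itself, which is zero. Hence \<open>z k\<close> is congruent to a
    vertex in layer \<open>n + 3\<close>, and its bubble lies at most one layer further out.\<close>
  have e_supp: "Tb k \<subseteq> K (n + 4)" if k: "k \<in> {1..N}" and ne: "e k \<noteq> 0" for k
  proof (cases "k = j")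
    case True
    then show ?thesis using Tb_supp[OF j] supp_patch_pow[OF j, of "n + 4"] by (simp add: K_def)
  next
    case False
    have "\<exists>x\<in>Omega. \<eta> x \<noteq> 0 \<and> \<phi> k x \<noteq> 0"
    proof (rule ccontr)
      assume no: "\<not> ?thesis"
      have "e k = inner_L2 \<psi> (\<phi> k)" unfolding e_def inner_L2_def
      proof (intro Bochner_Integration.integral_cong refl)
        fix x :: "real ^ 'd" assume "x \<in> space \<mu>"
        then have "\<eta> x = 0 \<or> \<phi> k x = 0" using no by auto
        then show "r x * cnj (\<phi> k x) = \<psi> x * cnj (\<phi> k x)" by (auto simp: r_def \<theta>_def)
      qed
      then show False using ne \<psi>(2) k False by (simp add: biorthogonal_def)
    qed
    then obtain x where x: "x \<in> Omega" "\<eta> x \<noteq> 0" "\<phi> k x \<noteq> 0" by blast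
    have "x \<in> K (n + 3)" by (rule \<eta>(5)[OF x(1,2)])
    then obtain G where G: "G \<in> \<T>" "x \<in> G" "G \<subseteq> K (n + 3)" using K[of "n + 3"] unfolding unions_def by blast
    have "touches G k" using \<phi>_zero[OF k G(1) _ G(2)] x(3) by blast
    then obtain v where v: "v extreme_point_of G" "per_eq v (z k)" by (auto simp: touches_def)
    have "v \<in> K (n + 3)" using vertex[OF G(1) v(1)] G(3) by blast
    then have "z k \<in> per_ext (K (n + 3))" using per_eq_sym[OF v(2)] by (auto simp: per_ext_def)
    moreover have "z k \<in> Tb k" using Tb(2)[OF k] by (simp add: extreme_point_of_def)
    ultimately have "Tb k \<subseteq> patch \<T> (K (n + 3))" using Tb(1)[OF k] by (auto simp: patch_def)
    also have "\<dots> = K (n + 4)" using KS[of "n + 3"] by (simp add: eval_nat_numeral)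
    finally show ?thesis .
  qed
  have w_supp: "w x = 0" if x: "x \<in> Omega" "x \<notin> K (n + 4)" for x
  proof -
    have "\<eta> x = 0" using \<eta>(5)[OF x(1)] Kmono[of "n + 3" "n + 4"] x(2) by auto
    moreover have "s x = 0" unfolding s_def
    proof (intro sum.neutral ballI)
      fix k assume k: "k \<in> {1..N}"
      show "e k * b k x = 0" using e_supp[OF k] b_zero[OF k, of x] x(2) by (cases "e k = 0") auto
    qed
    ultimately show ?thesis by (simp add: w_def r_def \<theta>_def)
  qed
  have c0: "0 \<le> real d * (cutoff_slope (real d) \<kappa> / H)"
  proof -
    have "(0 :: real ^ 'd) \<in> Omega" by (simp add: mem_Omega)
    from \<eta>(6)[OF this] show ?thesis by (intro mult_nonneg_nonneg) (auto intro: order_trans[OF abs_ge_zero])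
  qed
  have \<theta>_le: "\<bar>\<theta> x\<bar> \<le> a" if "x \<in> Omega" for x using \<eta>(3)[OF that] unfolding \<theta>_def a_def by linarith
  have pd_le: "(\<Sum>i\<in>UNIV. \<bar>pd \<theta> i x\<bar>) \<le> c / H" if x: "x \<in> Omega" for x
  proof -
    have "(\<Sum>i\<in>(UNIV :: 'd set). \<bar>pd \<theta> i x\<bar>) \<le> (\<Sum>i\<in>(UNIV :: 'd set). cutoff_slope (real d) \<kappa> / H)"
      using \<eta>(6)[OF x] by (intro sum_mono) (simp add: \<theta>)
    then show ?thesis by (simp add: c_def d_def)
  qed
  have in_L: "AE x in \<mu>. x \<in> L \<and> x \<in> Omega \<or> \<theta> x = 0 \<and> (\<forall>i. pd \<theta> i x = 0)"
    using AE_interior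
  proof eventually_elim
    fix x :: "real ^ 'd" assume "x \<in> interior Omega"
    then show "x \<in> L \<and> x \<in> Omega \<or> \<theta> x = 0 \<and> (\<forall>i. pd \<theta> i x = 0)"
      using \<eta>(4)[of x] interior_subset by (cases "x \<in> K (n + 2)") (auto simp: L_def \<theta>_def \<theta>(2))
  qed
  have Ll: "L \<in> sets lebesgue" unfolding L_def by (rule Kl)
  have g0: "0 \<le> g" by (simp add: g_def nsq_nonneg)
  have tail: "nsq L \<psi> \<le> (CI * H)\<^sup>2 * Col * g" unfolding L_def g_def K_def by (rule tail_bound[OF j \<psi>])
  have gtail: "nsq L (grad \<psi>) \<le> g"
    unfolding g_def L_def using Kmono[of n "n + 2"] by (intro nsq_mono Kl gsq AE_I2) auto
  have a0: "0 \<le> a" by (simp add: a_def)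
  have "(L2.nrm \<mu> r)\<^sup>2 \<le> 2 * a\<^sup>2 * nsq L \<psi> + 2 * 0\<^sup>2 * nsq L \<psi>"
  proof (rule L2_nrm_sq_le[OF sq(2) sq(1) sq(1) Ll])
    show "AE x in \<mu>. norm (r x) \<le> indicat_real L x * (a * norm (\<psi> x) + 0 * norm (\<psi> x))"
      using in_L
    proof eventually_elim
      fix x assume "x \<in> L \<and> x \<in> Omega \<or> \<theta> x = 0 \<and> (\<forall>i. pd \<theta> i x = 0)"
      then show "norm (r x) \<le> indicat_real L x * (a * norm (\<psi> x) + 0 * norm (\<psi> x))"
        using a0 \<theta>_le[of x] by (auto simp: r_def intro!: mult_right_mono)
    qed
  qed
  also have "\<dots> \<le> 2 * a\<^sup>2 * ((CI * H)\<^sup>2 * Col * g)" using tail by (simp add: mult_left_mono)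
  finally have r_L2: "(L2.nrm \<mu> r)\<^sup>2 \<le> A * H\<^sup>2 * g" by (simp add: A_def power_mult_distrib mult_ac)
  have "(L2.nrm \<mu> (grad r))\<^sup>2 \<le> 2 * a\<^sup>2 * nsq L (grad \<psi>) + 2 * (c / H)\<^sup>2 * nsq L \<psi>"
  proof (rule L2_nrm_sq_le[OF gsq(2) gsq(1) sq(1) Ll])
    show "AE x in \<mu>. norm (grad r x) \<le> indicat_real L x * (a * norm (grad \<psi> x) + c / H * norm (\<psi> x))"
      using in_L H1_smooth_mult(2)[OF H1P_H1[OF \<psi>(1)] \<theta>(1)]
    proof eventually_elim
      fix x assume L: "x \<in> L \<and> x \<in> Omega \<or> \<theta> x = 0 \<and> (\<forall>i. pd \<theta> i x = 0)"
        and le: "norm (grad (\<lambda>x. \<theta> x *\<^sub>R \<psi> x) x) \<le> \<bar>\<theta> x\<bar> * norm (grad \<psi> x) + (\<Sum>i\<in>UNIV. \<bar>pd \<theta> i x\<bar>) * norm (\<psi> x)"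
      have le': "norm (grad r x) \<le> \<bar>\<theta> x\<bar> * norm (grad \<psi> x) + (\<Sum>i\<in>UNIV. \<bar>pd \<theta> i x\<bar>) * norm (\<psi> x)"
        using le unfolding r_def[abs_def] .
      from L show "norm (grad r x) \<le> indicat_real L x * (a * norm (grad \<psi> x) + c / H * norm (\<psi> x))"
      proof
        assume x: "x \<in> L \<and> x \<in> Omega"
        then have "\<bar>\<theta> x\<bar> * norm (grad \<psi> x) + (\<Sum>i\<in>UNIV. \<bar>pd \<theta> i x\<bar>) * norm (\<psi> x) \<le> a * norm (grad \<psi> x) + c / H * norm (\<psi> x)"
          using \<theta>_le[of x] pd_le[of x] by (intro add_mono mult_right_mono) auto
        then show ?thesis using le' x by simp
      next
        assume "\<theta> x = 0 \<and> (\<forall>i. pd \<theta> i x = 0)"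
        then have "norm (grad r x) \<le> 0" using le' by simp
        moreover have "0 \<le> c / H" using c0 by (simp add: c_def)
        then have "0 \<le> indicat_real L x * (a * norm (grad \<psi> x) + c / H * norm (\<psi> x))"
          using a0 by (intro mult_nonneg_nonneg add_nonneg_nonneg) auto
        ultimately show ?thesis by linarith
      qed
    qed
  qed
  also have "\<dots> \<le> 2 * a\<^sup>2 * g + 2 * (c / H)\<^sup>2 * ((CI * H)\<^sup>2 * Col * g)"
    using tail gtail by (intro add_mono mult_left_mono) auto
  also have "\<dots> = (2 * a\<^sup>2 + 2 * c\<^sup>2 * CI\<^sup>2 * Col) * g"
    using H_pos by (simp add: power_mult_distrib power_divide field_simps)
  finally have r_grad: "(L2.nrm \<mu> (grad r))\<^sup>2 \<le> (2 * a\<^sup>2 + 2 * c\<^sup>2 * CI\<^sup>2 * Col) * g" .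
  have A0: "0 \<le> A" using Col by (simp add: A_def)
  have H2: "H\<^sup>2 \<le> R\<^sup>2 * \<epsilon>\<^sup>2" using H_le_\<epsilon> H_pos power_mono[of H "R * \<epsilon>" 2] by (simp add: power_mult_distrib)
  have "(E.nrm r)\<^sup>2 \<le> \<epsilon>\<^sup>2 / 2 * (L2.nrm \<mu> (grad r))\<^sup>2 + Vmax * (L2.nrm \<mu> r)\<^sup>2"
    by (intro E.nrm_le H1P_H1 r)
  also have "\<dots> \<le> \<epsilon>\<^sup>2 / 2 * ((2 * a\<^sup>2 + 2 * c\<^sup>2 * CI\<^sup>2 * Col) * g) + Vmax * (A * (R\<^sup>2 * \<epsilon>\<^sup>2) * g)"
  proof (intro add_mono mult_left_mono r_grad)
    show "(L2.nrm \<mu> r)\<^sup>2 \<le> A * (R\<^sup>2 * \<epsilon>\<^sup>2) * g"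
      by (rule order_trans[OF r_L2]) (intro mult_right_mono mult_left_mono H2 A0 g0)
  qed (use Vmax in auto)
  finally have Er: "(E.nrm r)\<^sup>2 \<le> (a\<^sup>2 + c\<^sup>2 * CI\<^sup>2 * Col + Vmax * A * R\<^sup>2) * \<epsilon>\<^sup>2 * g"
    by (simp add: algebra_simps)
  have "(E.nrm s)\<^sup>2 \<le> (real d + 1) * (\<Sum>k\<in>{1..N}. (norm (e k))\<^sup>2) * (Bb * \<epsilon>\<^sup>2 / H ^ (d + 2))"
    unfolding s_def[abs_def] d_def by (rule bubble_sum_energy)
  \<comment> \<open>The powers of \<open>H\<close> cancel: \<open>d\<close> from the moments and
    \<open>2\<close> from the tail against \<open>d + 2\<close> from the bubble energy.\<close>
  also have "\<dots> \<le> (real d + 1) * (Col * (2 * H) ^ d * (A * H\<^sup>2 * g)) * (Bb * \<epsilon>\<^sup>2 / H ^ (d + 2))"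
  proof (intro mult_right_mono mult_left_mono)
    have "(\<Sum>k\<in>{1..N}. (norm (e k))\<^sup>2) \<le> Col * (2 * H) ^ d * (L2.nrm \<mu> r)\<^sup>2"
      unfolding e_def d_def by (rule inner_\<phi>_sum_sq[OF sq(2)])
    also have "\<dots> \<le> Col * (2 * H) ^ d * (A * H\<^sup>2 * g)"
      using Col H_pos by (intro mult_left_mono r_L2) auto
    finally show "(\<Sum>k\<in>{1..N}. (norm (e k))\<^sup>2) \<le> Col * (2 * H) ^ d * (A * H\<^sup>2 * g)" .
    show "0 \<le> Bb * \<epsilon>\<^sup>2 / H ^ (d + 2)" using H_pos by (intro divide_nonneg_pos[OF mult_nonneg_nonneg[OF less_imp_le[OF Bb] zero_le_power2]]) simp
  qed simp
  also have "\<dots> = (real d + 1) * Col * 2 ^ d * A * Bb * \<epsilon>\<^sup>2 * g"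
    using H_pos by (simp add: power_add power_mult_distrib power2_eq_square)
  finally have Es: "(E.nrm s)\<^sup>2 \<le> (real d + 1) * Col * 2 ^ d * A * Bb * \<epsilon>\<^sup>2 * g" .
  have "(E.nrm (\<lambda>x. r x - s x))\<^sup>2 \<le> (E.nrm r + E.nrm s)\<^sup>2"
    by (intro power_mono E.nrm_triangle_diff E.nrm_nonneg H1_diff(1) H1P_H1 r s)
  also have "\<dots> \<le> 2 * (E.nrm r)\<^sup>2 + 2 * (E.nrm s)\<^sup>2"
    using sum_squares_bound[of "E.nrm r" "E.nrm s"] unfolding power2_sum by linarith
  also have "\<dots> \<le> 2 * ((a\<^sup>2 + c\<^sup>2 * CI\<^sup>2 * Col + Vmax * A * R\<^sup>2) * \<epsilon>\<^sup>2 * g) + 2 * ((real d + 1) * Col * 2 ^ d * A * Bb * \<epsilon>\<^sup>2 * g)"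
    using Er Es by linarith
  also have "\<dots> = corrector_const d \<kappa> Col CI Vmax R Bb * \<epsilon>\<^sup>2 * g"
    unfolding corrector_const_def Let_def a_def[symmetric] c_def[symmetric] A_def[symmetric] by (simp only: algebra_simps)
  finally have "(E.nrm (\<lambda>x. \<psi> x - w x))\<^sup>2 \<le> corrector_const d \<kappa> Col CI Vmax R Bb * \<epsilon>\<^sup>2 * g"
    by (simp add: w_def)
  then show ?thesis using w w_bi w_supp unfolding K_def d_def g_def by blast
qed

text \<open>For \<open>m \<ge> 4\<close> the corrector with \<open>n = m - 4\<close> is an
  admissible competitor. Its distance is governed by the decaying gradient tail, and the energy of
  the global function is at most that of the bubble. For smaller \<open>m\<close> the bubble itself
  competes.\<close>

lemma localisation_error:
  assumes j: "j \<in> {1..N}" and \<psi>: "global_basis \<epsilon> V N \<phi> j \<psi>" and \<psi>': "local_basis \<epsilon> V \<T> N \<phi> m j \<psi>'"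
    and decay: "decay_rate \<epsilon> V \<T> N \<phi> \<beta>" and \<beta>: "0 < \<beta>" "\<beta> < 1"
  shows "(E.nrm (\<lambda>x. \<psi> x - \<psi>' x))\<^sup>2
    \<le> localisation_const CARD('d) \<kappa> Col CI Vmax R Bb \<beta> * \<epsilon>\<^sup>2 * \<beta> ^ (2 * m) / H ^ (CARD('d) + 2)"
proof -
  define M where "M = corrector_const CARD('d) \<kappa> Col CI Vmax R Bb"
  define h where "h = \<epsilon>\<^sup>2 / H ^ (CARD('d) + 2)"
  have h: "0 \<le> h" using H_pos by (simp add: h_def)
  have M: "0 \<le> M" unfolding M_def by (intro corrector_const_nonneg Col Vmax Bb)
  have p: "\<psi> \<in> H1P" "biorthogonal N \<phi> j \<psi>" using \<psi> by (auto simp: global_basis_iff)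
  have \<psi>b: "(E.nrm \<psi>)\<^sup>2 \<le> (E.nrm (b j))\<^sup>2"
    using \<psi> b_H1P[OF j] b_biorthogonal[OF j] by (simp add: global_basis_iff E.nrm_sq H1P_H1)
  have bh: "(E.nrm (b j))\<^sup>2 \<le> Bb * h" using bubble_energy[OF j] by (simp add: h_def)
  have goal: "(E.nrm (\<lambda>x. \<psi> x - \<psi>' x))\<^sup>2 \<le> (2 * M + 1) * Bb * h * (\<beta> ^ (2 * m) / \<beta> ^ 8)"
  proof (cases "m < 4")
    case True
    have "(E.nrm (\<lambda>x. \<psi> x - \<psi>' x))\<^sup>2 \<le> (E.nrm (\<lambda>x. \<psi> x - b j x))\<^sup>2"
      using b_zero[OF j] Tb_supp[OF j] supp_patch_pow[OF j, of m]
      by (intro local_basis_quasi_optimal[OF \<psi> \<psi>'] b_H1P b_biorthogonal j AE_I2) blast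
    also have "\<dots> \<le> (E.nrm (b j))\<^sup>2" by (simp add: energy_diff_global_basis[OF \<psi> b_H1P[OF j] b_biorthogonal[OF j]])
    also have "\<dots> \<le> 1 * Bb * h * 1" using bh by simp
    also have "\<dots> \<le> (2 * M + 1) * Bb * h * (\<beta> ^ (2 * m) / \<beta> ^ 8)"
    proof (rule mult_mono)
      show "1 * Bb * h \<le> (2 * M + 1) * Bb * h" using M Bb h by (intro mult_right_mono) auto
      have "\<beta> ^ 8 \<le> \<beta> ^ (2 * m)" using True \<beta> by (intro power_decreasing) auto
      then show "1 \<le> \<beta> ^ (2 * m) / \<beta> ^ 8" using \<beta> by simp
      show "0 \<le> (2 * M + 1) * Bb * h"
        by (rule mult_nonneg_nonneg[OF mult_nonneg_nonneg]) (use M Bb h in linarith)+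
    qed simp
    finally show ?thesis .
  next
    case False
    define n where "n = m - 4"
    have m: "m = n + 4" using False by (simp add: n_def)
    define K where "K = Omega - patch_pow \<T> n (supp (\<phi> j))"
    have K: "K \<in> sets lebesgue" "K \<subseteq> Omega"
      using unions_sets[OF unions_patch_pow[OF supp_\<phi>_unions[OF j]]] by (auto simp: K_def)
    obtain w where w: "w \<in> H1P" "biorthogonal N \<phi> j w" "\<And>x. x \<in> Omega \<Longrightarrow> x \<notin> patch_pow \<T> m (supp (\<phi> j)) \<Longrightarrow> w x = 0"
      "(E.nrm (\<lambda>x. \<psi> x - w x))\<^sup>2 \<le> M * \<epsilon>\<^sup>2 * nsq K (grad \<psi>)"
      using corrector_exists[OF j p, of n] unfolding m K_def M_def by blast
    have "norm_L2 K (grad \<psi>) \<le> \<beta> ^ n * norm_L2 Omega (grad \<psi>)"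
      using decay j \<psi> unfolding decay_rate_def K_def by blast
    then have "(norm_L2 K (grad \<psi>))\<^sup>2 \<le> (\<beta> ^ n * norm_L2 Omega (grad \<psi>))\<^sup>2"
      by (intro power_mono) (auto simp: norm_L2_def)
    then have "nsq K (grad \<psi>) \<le> \<beta> ^ (2 * n) * (L2.nrm \<mu> (grad \<psi>))\<^sup>2"
      by (simp add: norm_L2_sq[OF K] norm_L2_eq power_mult_distrib power_mult[symmetric] mult.commute)
    also have "\<dots> \<le> \<beta> ^ (2 * n) * (2 / \<epsilon>\<^sup>2 * (Bb * h))"
      using energy_ge(1)[OF H1P_H1[OF p(1)]] \<psi>b bh \<beta>
      by (intro mult_left_mono order_trans[OF energy_ge(1)[OF H1P_H1[OF p(1)]]]) auto
    finally have nsq: "nsq K (grad \<psi>) \<le> \<beta> ^ (2 * n) * (2 / \<epsilon>\<^sup>2 * (Bb * h))" .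
    have "(E.nrm (\<lambda>x. \<psi> x - \<psi>' x))\<^sup>2 \<le> (E.nrm (\<lambda>x. \<psi> x - w x))\<^sup>2"
      by (intro local_basis_quasi_optimal[OF \<psi> \<psi>'] w AE_I2) (use w(3) in simp)
    also note w(4)
    also have "M * \<epsilon>\<^sup>2 * nsq K (grad \<psi>) \<le> M * \<epsilon>\<^sup>2 * (\<beta> ^ (2 * n) * (2 / \<epsilon>\<^sup>2 * (Bb * h)))"
      using M by (intro mult_left_mono nsq) auto
    also have "\<dots> = (2 * M) * Bb * h * \<beta> ^ (2 * n)" using \<epsilon> by simp
    also have "\<dots> \<le> (2 * M + 1) * Bb * h * \<beta> ^ (2 * n)"
      using Bb h \<beta> by (intro mult_right_mono) auto
    also have "\<beta> ^ (2 * n) = \<beta> ^ (2 * m) / \<beta> ^ 8" using \<beta> by (simp add: m power_add)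
    finally show ?thesis .
  qed
  then show ?thesis by (simp add: localisation_const_def M_def h_def mult_ac)
qed

end

subsection \<open>Error of the Galerkin approximation\<close>

text \<open>Derivatives of \<open>V\<close> are given only inside the cube, where they make
  \<open>V\<close> continuous; the faces are a null set and do not affect Lebesgue
  measurability.\<close>

lemma potential_measurable:
  assumes "potential Vmin Vmax CV \<delta> V"
  shows "V \<in> borel_measurable (\<mu> :: (real ^ 'd::finite) measure)"
proof -
  from assms obtain P where P: "all_partials (interior Omega) V P" unfolding potential_def by blast
  have "continuous_on (interior Omega) (P (\<lambda>_. 0))"
  proof (rule continuous_at_imp_continuous_on, rule ballI)
    fix x :: "real ^ 'd" assume "x \<in> interior Omega"
    then have "(P (\<lambda>_. 0) has_derivative (\<lambda>h. \<Sum>i\<in>UNIV. h $ i * P ((\<lambda>_. 0)(i := Suc 0)) x)) (at x)"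
      using P unfolding all_partials_def by blast
    then show "isCont (P (\<lambda>_. 0)) x" by (rule has_derivative_continuous)
  qed
  then have "continuous_on (interior Omega) V"
    by (rule continuous_on_eq) (use P in \<open>simp add: all_partials_def\<close>)
  then have "V \<in> borel_measurable (lebesgue_on (interior Omega))"
    by (rule continuous_imp_measurable_on_sets_lebesgue) (simp add: lmeasurable_interior sets_completionI_sets)
  then have m: "(\<lambda>x. if x \<in> interior Omega then V x else 0) \<in> borel_measurable lebesgue"
    by (rule borel_measurable_if_I) (simp add: sets_completionI_sets)
  have "AE x :: real ^ 'd in lebesgue. x \<in> Omega \<longrightarrow> x \<in> interior Omega"
    using AE_interior by (simp add: AE_restrict_space_iff)
  then have "AE x in lebesgue. (if x \<in> interior Omega then V x else 0) = (if x \<in> Omega then V x else 0)"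
    by eventually_elim (use interior_subset in auto)
  then have "(\<lambda>x. if x \<in> Omega then V x else 0) \<in> borel_measurable lebesgue" by (rule borel_measurable_AE[OF m])
  then show ?thesis by (rule borel_measurable_if_D)
qed

text \<open>The summands belong to the ideal error for \<open>f\<close> in \<open>L2\<close>, the
  ideal error for \<open>f\<close> in \<open>H1P\<close>, and the localisation error; in the latter
  the powers of \<open>2 * pi * d\<close> dominate \<open>H^d\<close> and
  \<open>H^(d-1)\<close>.\<close>

definition galerkin_const :: "nat \<Rightarrow> real \<Rightarrow> real \<Rightarrow> real \<Rightarrow> real \<Rightarrow> real \<Rightarrow> real \<Rightarrow> real \<Rightarrow> real \<Rightarrow> real"
  where "galerkin_const d \<kappa> Col CI Vmin Vmax R B \<beta> =
    CI * sqrt Col * sqrt 2 + CI\<^sup>2 * Col * sqrt 2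
    + sqrt (localisation_const d \<kappa> Col CI Vmax R B \<beta>) * sqrt ((2 * pi) ^ d) / sqrt Vmin
      * ((2 * pi * real d) ^ d + (2 * pi * real d) ^ (d - 1))"

lemma localisation_const_nonneg:
  "0 < Col \<Longrightarrow> 0 < Vmax \<Longrightarrow> 0 < B \<Longrightarrow> 0 < \<beta> \<Longrightarrow> 0 \<le> localisation_const d \<kappa> Col CI Vmax R B \<beta>"
  using corrector_const_nonneg[of Col Vmax B d \<kappa> CI R]
  unfolding localisation_const_def by (intro divide_nonneg_pos mult_nonneg_nonneg) auto

text \<open>The oversampling condition, multiplied by the positive
  \<open>\<bar>ln \<beta>\<bar>\<close> and exponentiated.\<close>

lemma oversampling_decay:
  fixes m :: nat
  assumes \<beta>: "0 < \<beta>" "\<beta> < 1" and pos: "0 < H" "0 < s"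
    and m: "real m \<ge> (p * ln (1 / H) + ln s) / \<bar>ln \<beta>\<bar>"
  shows "\<beta> ^ m \<le> H powr p / s"
proof -
  have lb: "ln \<beta> < 0" using \<beta> by simp
  then have ab: "0 < \<bar>ln \<beta>\<bar>" by simp
  have "p * ln (1 / H) + ln s \<le> real m * \<bar>ln \<beta>\<bar>" by (rule iffD1[OF pos_divide_le_eq[OF ab] m])
  then have le: "real m * ln \<beta> \<le> p * ln H - ln s" using lb pos by (simp add: ln_div)
  have "\<beta> ^ m = exp (real m * ln \<beta>)" using \<beta> by (simp add: exp_of_nat_mult)
  also have "\<dots> \<le> exp (p * ln H - ln s)" using le by simp
  also have "\<dots> = H powr p / s" using pos by (simp add: powr_def exp_diff)
  finally show ?thesis .
qed

lemma L2_nrm_one: "L2.nrm (\<mu> :: (real ^ 'd::finite) measure) (\<lambda>_. 1 :: real) = sqrt ((2 * pi) ^ CARD('d))"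
proof -
  have ne: "(cbox 0 (\<chi> i. 2 * pi) :: (real ^ 'd) set) \<noteq> {}"
    by (simp add: interval_ne_empty_cart)
  have "measure (\<mu> :: (real ^ 'd) measure) Omega = measure lebesgue (Omega :: (real ^ 'd) set)"
    by (simp add: measure_restrict_space)
  also have "\<dots> = measure lborel (cbox 0 (\<chi> i. 2 * pi) :: (real ^ 'd) set)"
    unfolding Omega_def by (simp add: measure_completion)
  also have "\<dots> = (2 * pi) ^ CARD('d)" by (subst content_cbox_cart[OF ne]) simp
  finally show ?thesis unfolding L2_nrm_eq by simp
qed

text \<open>Absolute values are summed, not squares: since the hat functions add up to one, the
  \<open>L1\<close> norm of \<open>u\<close> bounds the sum, and the number of vertices does not
  appear.\<close>

lemma (in lod) inner_\<phi>_sum: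
  assumes u: "u \<in> sq_int \<mu>"
  shows "(\<Sum>k\<in>{1..N}. norm (inner_L2 u (\<phi> k))) \<le> sqrt ((2 * pi) ^ CARD('d)) * L2.nrm \<mu> u"
proof -
  have um: "u \<in> borel_measurable \<mu>" using u by (simp add: sq_int_def)
  have nu: "(\<lambda>x. norm (u x)) \<in> sq_int \<mu>" by (rule sq_int_bound[OF u, where K = 1]) (use um in auto)
  have one: "(\<lambda>_. 1 :: real) \<in> sq_int (\<mu> :: (real ^ 'd) measure)" by (rule sq_int_bounded[where K = 1]) auto
  have int: "integrable \<mu> (\<lambda>x. norm (u x) * Re (\<phi> k x))" if k: "k \<in> {1..N}" for k
    by (rule sq_int_prod[OF u \<phi>_sq_int[OF k]])
      (use um Re_\<phi>_meas[OF k] \<phi>_bounds[OF k] norm_\<phi>[OF k] in \<open>auto simp: abs_mult\<close>)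
  have "(\<Sum>k\<in>{1..N}. norm (inner_L2 u (\<phi> k))) \<le> (\<Sum>k\<in>{1..N}. \<integral>x. norm (u x) * Re (\<phi> k x) \<partial>\<mu>)"
    by (intro sum_mono norm_inner_\<phi> u)
  also have "\<dots> = (\<integral>x. (\<Sum>k\<in>{1..N}. norm (u x) * Re (\<phi> k x)) \<partial>\<mu>)"
    by (rule Bochner_Integration.integral_sum[symmetric]) (rule int)
  also have "\<dots> = (\<integral>x. norm (u x) \<bullet> 1 \<partial>\<mu>)"
    by (intro Bochner_Integration.integral_cong refl) (simp add: sum_distrib_left[symmetric] sum_\<phi>[unfolded One_nat_def])
  also have "\<dots> \<le> L2.nrm \<mu> (\<lambda>x. norm (u x)) * L2.nrm \<mu> (\<lambda>_ :: real ^ 'd. 1 :: real)"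
    using L2.cauchy_schwarz[OF nu one] by linarith
  also have "L2.nrm \<mu> (\<lambda>x. norm (u x)) = L2.nrm \<mu> u" unfolding L2_nrm_eq by simp
  finally show ?thesis unfolding L2_nrm_one by (simp only: mult.commute)
qed

context lod begin

lemma complex_span_closed:
  assumes X: "\<And>j. j \<in> {1..N} \<Longrightarrow> \<psi> j \<in> H1P"
  shows "complex_span N \<psi> \<subseteq> H1P"
    and "v \<in> complex_span N \<psi> \<Longrightarrow> (\<lambda>x. c * v x) \<in> complex_span N \<psi>"
    and "v \<in> complex_span N \<psi> \<Longrightarrow> w \<in> complex_span N \<psi> \<Longrightarrow> (\<lambda>x. v x - w x) \<in> complex_span N \<psi>"
proof -
  show "complex_span N \<psi> \<subseteq> H1P"
    unfolding complex_span_def by (auto intro!: H1P_sum H1P_cmult X)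
  show "(\<lambda>x. c * v x) \<in> complex_span N \<psi>" if "v \<in> complex_span N \<psi>"
  proof -
    from that obtain a where "v = (\<lambda>x. \<Sum>j\<in>{1..N}. a j * \<psi> j x)" by (auto simp: complex_span_def)
    then have "(\<lambda>x. c * v x) = (\<lambda>x. \<Sum>j\<in>{1..N}. (c * a j) * \<psi> j x)"
      by (simp add: sum_distrib_left mult.assoc)
    then show ?thesis unfolding complex_span_def mem_Collect_eq by (rule exI[where x = "\<lambda>j. c * a j"])
  qed
  show "(\<lambda>x. v x - w x) \<in> complex_span N \<psi>" if vw: "v \<in> complex_span N \<psi>" "w \<in> complex_span N \<psi>"
  proof -
    from vw obtain a a' where "v = (\<lambda>x. \<Sum>j\<in>{1..N}. a j * \<psi> j x)" "w = (\<lambda>x. \<Sum>j\<in>{1..N}. a' j * \<psi> j x)"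
      by (auto simp: complex_span_def)
    then have "(\<lambda>x. v x - w x) = (\<lambda>x. \<Sum>j\<in>{1..N}. (a j - a' j) * \<psi> j x)"
      by (simp add: sum_subtractf left_diff_distrib)
    then show ?thesis unfolding complex_span_def mem_Collect_eq by (rule exI[where x = "\<lambda>j. a j - a' j"])
  qed
qed

text \<open>The coefficients \<open>inner_L2 u (\<phi> j)\<close> are chosen so that the error has
  vanishing moments. It is then orthogonal to the approximation, and its squared energy reduces to
  the load tested with it.\<close>

lemma ideal_error:
  assumes f: "f \<in> sq_int \<mu>" and u: "u \<in> H1P" "\<And>v. v \<in> H1P \<Longrightarrow> en (\<epsilon>\<^sup>2 / 2) V u v = (\<integral>x. f x \<bullet> v x \<partial>\<mu>)"
    and \<psi>: "\<And>j. j \<in> {1..N} \<Longrightarrow> global_basis \<epsilon> V N \<phi> j (\<psi> j)"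
  defines "w \<equiv> \<lambda>x. u x - (\<Sum>j\<in>{1..N}. inner_L2 u (\<phi> j) * \<psi> j x)"
  shows "E.nrm w \<le> CI * sqrt Col * sqrt 2 * (H / \<epsilon>) * L2.nrm \<mu> f"
    and "f \<in> H1P \<Longrightarrow> E.nrm w \<le> CI\<^sup>2 * Col * sqrt 2 * (H\<^sup>2 / \<epsilon>) * norm_H1 f"
proof -
  define c where "c j = inner_L2 u (\<phi> j)" for j
  define uH where "uH x = (\<Sum>j\<in>{1..N}. c j * \<psi> j x)" for x
  have w_eq: "w = (\<lambda>x. u x - uH x)" by (simp add: w_def uH_def c_def)
  have p: "\<psi> j \<in> H1P" "biorthogonal N \<phi> j (\<psi> j)" if "j \<in> {1..N}" for j
    using \<psi>[OF that] by (auto simp: global_basis_iff)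
  have cp: "(\<lambda>x. c j * \<psi> j x) \<in> H1P" if "j \<in> {1..N}" for j by (intro H1P_cmult p that)
  have uH: "uH \<in> H1P" unfolding uH_def[abs_def] by (intro H1P_sum cp)
  have wH: "w \<in> H1P" unfolding w_eq by (intro H1P_diff u uH)
  have "inner_L2 w (\<phi> k) = 0" if k: "k \<in> {1..N}" for k
  proof -
    note \<phi>k = \<phi>_sq_int[OF k]
    have "inner_L2 uH (\<phi> k) = (\<Sum>j\<in>{1..N}. inner_L2 (\<lambda>x. c j * \<psi> j x) (\<phi> k))"
      unfolding uH_def[abs_def] by (intro inner_L2_sum \<phi>k H1_D(1) H1P_H1 cp)
    also have "\<dots> = (\<Sum>j\<in>{1..N}. if j = k then c j else 0)"
      using p k by (intro sum.cong refl) (auto simp: inner_L2_cmult biorthogonal_def)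
    also have "\<dots> = c k" using k by (subst sum.delta) auto
    finally have "inner_L2 uH (\<phi> k) = c k" .
    then show ?thesis
      unfolding w_eq using inner_L2_diff[OF H1_D(1)[OF H1P_H1[OF u(1)]] H1_D(1)[OF H1P_H1[OF uH]] \<phi>k] by (simp add: c_def)
  qed
  then have wk: "w \<in> kernel" using wH by (simp add: kernel_def)
  have "en (\<epsilon>\<^sup>2 / 2) V uH w = (\<Sum>j\<in>{1..N}. en (\<epsilon>\<^sup>2 / 2) V (\<lambda>x. c j * \<psi> j x) w)"
    unfolding uH_def[abs_def] by (intro E.B_sum H1P_H1 cp wH)
  also have "\<dots> = 0"
  proof (intro sum.neutral ballI)
    fix j assume j: "j \<in> {1..N}"
    show "en (\<epsilon>\<^sup>2 / 2) V (\<lambda>x. c j * \<psi> j x) w = 0"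
      using E.en_cmult[OF H1P_H1[OF p(1)[OF j]] H1P_H1[OF wH], of "c j"]
        global_basis_orthogonal[OF \<psi>[OF j] kernel_cmult[OF wk, of "cnj (c j)"]] by simp
  qed
  finally have "en (\<epsilon>\<^sup>2 / 2) V uH w = 0" .
  then have "en (\<epsilon>\<^sup>2 / 2) V w w = en (\<epsilon>\<^sup>2 / 2) V u w"
    using E.B_diff[OF H1P_H1[OF u(1)] H1P_H1[OF uH] H1P_H1[OF wH]] by (simp add: w_eq)
  then have sq: "(E.nrm w)\<^sup>2 = (\<integral>x. f x \<bullet> w x \<partial>\<mu>)" by (simp add: E.nrm_sq H1P_H1 wH u(2))
  have ws: "w \<in> sq_int \<mu>" by (intro H1_D(1) H1P_H1 wH)
  \<comment> \<open>Stated for any load \<open>g\<close> acting on \<open>w\<close> like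
    \<open>f\<close>. It is used for \<open>f\<close> itself and for \<open>f\<close> minus its
    interpolation; the two differ by a combination of hat functions, which acts as zero on the
    kernel.\<close>
  have step: "E.nrm w \<le> F * (CI * sqrt Col * sqrt 2 * (H / \<epsilon>))"
    if g: "g \<in> sq_int \<mu>" and eq: "(E.nrm w)\<^sup>2 = (\<integral>x. g x \<bullet> w x \<partial>\<mu>)" and F: "L2.nrm \<mu> g \<le> F" for g F
  proof -
    have F0: "0 \<le> F" using L2.nrm_nonneg[OF g] F by linarith
    have "E.nrm w * E.nrm w \<le> L2.nrm \<mu> g * L2.nrm \<mu> w"
      using L2.cauchy_schwarz[OF g ws] eq by (simp add: power2_eq_square)
    also have "\<dots> \<le> F * (CI * sqrt Col * sqrt 2 * (H / \<epsilon>) * E.nrm w)"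
      by (intro mult_mono F kernel_bound wk F0 L2.nrm_nonneg ws)
    finally have "E.nrm w * E.nrm w \<le> (F * (CI * sqrt Col * sqrt 2 * (H / \<epsilon>))) * E.nrm w" by (simp only: mult.assoc)
    moreover have "0 \<le> F * (CI * sqrt Col * sqrt 2 * (H / \<epsilon>))"
      using F0 CI Col H_pos \<epsilon> by simp
    moreover have "0 \<le> E.nrm w" by (rule E.nrm_nonneg[OF H1P_H1[OF wH]])
    ultimately show ?thesis
      using mult_right_le_imp_le[of "E.nrm w" "E.nrm w" "F * (CI * sqrt Col * sqrt 2 * (H / \<epsilon>))"]
      by (cases "E.nrm w = 0") linarith+
  qed
  show "E.nrm w \<le> CI * sqrt Col * sqrt 2 * (H / \<epsilon>) * L2.nrm \<mu> f"
    using step[OF f sq order_refl] by (simp only: mult_ac)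
  show "E.nrm w \<le> CI\<^sup>2 * Col * sqrt 2 * (H\<^sup>2 / \<epsilon>) * norm_H1 f" if fH: "f \<in> H1P"
  proof -
    define a where "a j = inner_L2 f (\<phi> j) / inner_L2 (\<lambda>_. 1) (\<phi> j)" for j
    have If: "clement N \<phi> f = (\<lambda>x. \<Sum>j\<in>{1..N}. a j * \<phi> j x)" by (simp add: clement_def a_def fun_eq_iff)
    have Is: "clement N \<phi> f \<in> sq_int \<mu>" by (intro H1_D(1) H1P_H1 clement_H1P)
    have gs: "(\<lambda>x. f x - clement N \<phi> f x) \<in> sq_int \<mu>" by (intro L2.diff_closed f Is)
    have "(\<integral>x. clement N \<phi> f x \<bullet> w x \<partial>\<mu>) = (\<Sum>j\<in>{1..N}. \<integral>x. (a j * \<phi> j x) \<bullet> w x \<partial>\<mu>)"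
      unfolding If by (rule L2.B_sum[OF _ ws]) (intro sq_int_cmult \<phi>_sq_int)
    also have "\<dots> = 0"
    proof (intro sum.neutral ballI)
      fix j assume j: "j \<in> {1..N}"
      have "(\<integral>x. (a j * \<phi> j x) \<bullet> w x \<partial>\<mu>) = (\<integral>x. (cnj (a j) * w x) \<bullet> \<phi> j x \<partial>\<mu>)"
        unfolding complex_inner_mult_left[of "a j"] by (simp only: inner_commute)
      also have "\<dots> = Re (inner_L2 (\<lambda>x. cnj (a j) * w x) (\<phi> j))"
        by (rule inner_L2_Re(2)[symmetric]) (intro sq_int_cmult ws \<phi>_sq_int j)+
      also have "\<dots> = 0" using wk j by (simp add: inner_L2_cmult kernel_def)
      finally show "(\<integral>x. (a j * \<phi> j x) \<bullet> w x \<partial>\<mu>) = 0" .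
    qed
    finally have "(E.nrm w)\<^sup>2 = (\<integral>x. (f x - clement N \<phi> f x) \<bullet> w x \<partial>\<mu>)"
      using sq L2.B_diff[OF f Is ws] by simp
    moreover have "L2.nrm \<mu> (\<lambda>x. f x - clement N \<phi> f x) \<le> CI * sqrt Col * H * norm_H1 f"
      by (rule order_trans[OF clement_error_Omega[OF fH]])
        (use CI Col H_pos in \<open>intro mult_left_mono norm_H1_ge, simp\<close>)
    ultimately have "E.nrm w \<le> CI * sqrt Col * H * norm_H1 f * (CI * sqrt Col * sqrt 2 * (H / \<epsilon>))"
      using step[OF gs] by blast
    also have "\<dots> = CI\<^sup>2 * (sqrt Col * sqrt Col) * sqrt 2 * (H\<^sup>2 / \<epsilon>) * norm_H1 f"
      by (simp only: power2_eq_square times_divide_eq_right times_divide_eq_left mult_ac)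
    finally show ?thesis using Col by simp
  qed
qed

end

context lod begin

abbreviation "K\<^sub>G d \<beta> \<equiv> galerkin_const d \<kappa> Col CI Vmin Vmax R Bb \<beta>"

text \<open>The ideal approximation keeps its coefficients, and only the global basis functions are
  exchanged for localised ones. The coefficient sum is of order \<open>Cst\<close> times the norm of
  \<open>f\<close>; the factor \<open>Cst\<close> in the denominator of the assumption on
  \<open>\<beta> ^ m\<close> compensates it.\<close>

lemma best_approximation:
  assumes f: "f \<in> sq_int \<mu>" and u: "u \<in> H1P" "\<And>v. v \<in> H1P \<Longrightarrow> en (\<epsilon>\<^sup>2 / 2) V u v = (\<integral>x. f x \<bullet> v x \<partial>\<mu>)"
    and Cst: "0 < Cst" and stab: "E.nrm u \<le> Cst * L2.nrm \<mu> f"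
    and decay: "decay_rate \<epsilon> V \<T> N \<phi> \<beta>" and \<beta>: "0 < \<beta>" "\<beta> < 1"
    and loc: "\<And>j. j \<in> {1..N} \<Longrightarrow> local_basis \<epsilon> V \<T> N \<phi> m j (\<psi>' j)"
    and m: "\<beta> ^ m \<le> H powr (3 * real CARD('d) / 2 + 2) / (\<epsilon>\<^sup>2 * Cst)"
  shows "\<exists>v\<in>complex_span N \<psi>'. E.nrm (\<lambda>x. u x - v x) \<le> K\<^sub>G CARD('d) \<beta> * (H / \<epsilon>) * L2.nrm \<mu> f \<and>
    (f \<in> H1P \<longrightarrow> E.nrm (\<lambda>x. u x - v x) \<le> K\<^sub>G CARD('d) \<beta> * (H\<^sup>2 / \<epsilon>) * norm_H1 f)"
proof -
  define d where "d = CARD('d)"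
  have d: "1 \<le> d" by (simp add: d_def Suc_leI)
  define \<psi> where "\<psi> j = (SOME p. global_basis \<epsilon> V N \<phi> j p)" for j
  have \<psi>: "global_basis \<epsilon> V N \<phi> j (\<psi> j)" if "j \<in> {1..N}" for j
    unfolding \<psi>_def by (rule someI_ex[OF global_basis_exists[OF that]])
  have p: "\<psi> j \<in> H1P" if "j \<in> {1..N}" for j using \<psi>[OF that] by (auto simp: global_basis_iff)
  have p': "\<psi>' j \<in> H1P" if "j \<in> {1..N}" for j
    using loc[OF that] unfolding local_basis_def energy_minimizer_def by blast
  define c where "c j = inner_L2 u (\<phi> j)" for j
  define uH where "uH x = (\<Sum>j\<in>{1..N}. c j * \<psi> j x)" for x
  define v where "v x = (\<Sum>j\<in>{1..N}. c j * \<psi>' j x)" for x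
  have uH: "uH \<in> H1" unfolding uH_def[abs_def] by (intro H1P_H1 H1P_sum H1P_cmult p)
  have vH: "v \<in> H1" unfolding v_def[abs_def] by (intro H1P_H1 H1P_sum H1P_cmult p')
  have v: "v \<in> complex_span N \<psi>'" unfolding complex_span_def v_def[abs_def] by blast
  note uH1 = H1P_H1[OF u(1)]
  define A where "A = localisation_const d \<kappa> Col CI Vmax R Bb \<beta>"
  have A: "0 \<le> A" unfolding A_def by (intro localisation_const_nonneg Col Vmax Bb \<beta>)
  define S where "S = sqrt A * sqrt ((2 * pi) ^ d) / sqrt Vmin"
  have S: "0 \<le> S" using A Vmin by (simp add: S_def)
  \<comment> \<open>The bound for a single basis function. It rests on
    \<open>3 * d + 4 = 2 * (d + 1) + (d + 2)\<close>: the squared decay \<open>H^(3d+4)\<close> pays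
    for the factor \<open>1 / H^(d+2)\<close> of the localisation error and leaves the square of
    \<open>H^(d+1)\<close>.\<close>
  define q where "q = sqrt A * (H ^ (d + 1) / (\<epsilon> * Cst))"
  have q: "E.nrm (\<lambda>x. \<psi> j x - \<psi>' j x) \<le> q" if j: "j \<in> {1..N}" for j
  proof -
    have "\<beta> ^ (2 * m) = (\<beta> ^ m)\<^sup>2" by (simp add: power_mult[symmetric] mult.commute)
    also have "\<dots> \<le> (H powr (3 * real d / 2 + 2) / (\<epsilon>\<^sup>2 * Cst))\<^sup>2"
      using m \<beta> unfolding d_def by (intro power_mono) auto
    also have "\<dots> = (H powr (3 * real d / 2 + 2))\<^sup>2 / (\<epsilon>\<^sup>2 * Cst)\<^sup>2" by (rule power_divide)
    also have "(H powr (3 * real d / 2 + 2))\<^sup>2 = H powr real (3 * d + 4)"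
      by (simp add: power2_eq_square powr_add[symmetric])
    also have "\<dots> = H ^ (3 * d + 4)" using H_pos by (rule powr_realpow)
    finally have \<beta>m: "\<beta> ^ (2 * m) \<le> H ^ (3 * d + 4) / (\<epsilon>\<^sup>2 * Cst)\<^sup>2" .
    have "(E.nrm (\<lambda>x. \<psi> j x - \<psi>' j x))\<^sup>2 \<le> A * \<epsilon>\<^sup>2 * \<beta> ^ (2 * m) / H ^ (d + 2)"
      unfolding A_def d_def by (rule localisation_error[OF j \<psi>[OF j] loc[OF j] decay \<beta>])
    also have "\<dots> \<le> A * \<epsilon>\<^sup>2 * (H ^ (3 * d + 4) / (\<epsilon>\<^sup>2 * Cst)\<^sup>2) / H ^ (d + 2)"
      using A H_pos by (intro divide_right_mono mult_left_mono \<beta>m) auto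
    also have "H ^ (3 * d + 4) = (H ^ (d + 1))\<^sup>2 * H ^ (d + 2)"
      unfolding power_mult[symmetric] power_add[symmetric] by (rule arg_cong[where f = "power H"]) simp
    also have "A * \<epsilon>\<^sup>2 * ((H ^ (d + 1))\<^sup>2 * H ^ (d + 2) / (\<epsilon>\<^sup>2 * Cst)\<^sup>2) / H ^ (d + 2) = q\<^sup>2"
    proof -
      have "q\<^sup>2 = A * (H ^ (d + 1) / (\<epsilon> * Cst))\<^sup>2" using A by (simp only: q_def power_mult_distrib real_sqrt_pow2)
      moreover have "H ^ (d + 2) \<noteq> 0" using H_pos by simp
      ultimately show ?thesis using \<epsilon> Cst by (simp add: field_simps power2_eq_square del: power_Suc)
    qed
    finally show ?thesis by (rule power2_le_imp_le) (use A H_pos \<epsilon> Cst in \<open>simp add: q_def\<close>)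
  qed
  have "E.nrm (\<lambda>x. uH x - v x) = E.nrm (\<lambda>x. \<Sum>j\<in>{1..N}. c j * (\<psi> j x - \<psi>' j x))"
    by (simp add: uH_def v_def sum_subtractf right_diff_distrib)
  also have "\<dots> \<le> (\<Sum>j\<in>{1..N}. E.nrm (\<lambda>x. c j * (\<psi> j x - \<psi>' j x)))"
    by (intro E.nrm_sum H1_cmult H1_diff H1P_H1 p p')
  also have "\<dots> \<le> (\<Sum>j\<in>{1..N}. norm (c j) * q)"
  proof (intro sum_mono)
    fix j assume j: "j \<in> {1..N}"
    show "E.nrm (\<lambda>x. c j * (\<psi> j x - \<psi>' j x)) \<le> norm (c j) * q"
      using mult_left_mono[OF q[OF j] norm_ge_zero[of "c j"]] E.nrm_cmult[OF H1_diff(1)[OF H1P_H1[OF p[OF j]] H1P_H1[OF p'[OF j]]]]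
      by simp
  qed
  also have "\<dots> = (\<Sum>j\<in>{1..N}. norm (c j)) * q" by (simp only: sum_distrib_right)
  also have "\<dots> \<le> sqrt ((2 * pi) ^ d) * (Cst * L2.nrm \<mu> f / sqrt Vmin) * q"
  proof (rule mult_right_mono)
    have "(\<Sum>j\<in>{1..N}. norm (c j)) \<le> sqrt ((2 * pi) ^ d) * L2.nrm \<mu> u"
      unfolding c_def d_def by (rule inner_\<phi>_sum[OF H1_D(1)[OF uH1]])
    also have "\<dots> \<le> sqrt ((2 * pi) ^ d) * (Cst * L2.nrm \<mu> f / sqrt Vmin)"
    proof (rule mult_left_mono)
      show "L2.nrm \<mu> u \<le> Cst * L2.nrm \<mu> f / sqrt Vmin"
        using energy_ge'(2)[OF uH1] by (rule order_trans) (use stab Vmin in \<open>intro divide_right_mono, auto\<close>)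
    qed simp
    finally show "(\<Sum>j\<in>{1..N}. norm (c j)) \<le> sqrt ((2 * pi) ^ d) * (Cst * L2.nrm \<mu> f / sqrt Vmin)" .
    show "0 \<le> q" using A H_pos \<epsilon> Cst by (simp add: q_def)
  qed
  also have "\<dots> = S * (H ^ (d + 1) / \<epsilon>) * L2.nrm \<mu> f"
    using Cst \<epsilon> Vmin by (simp add: S_def q_def field_simps)
  finally have locerr: "E.nrm (\<lambda>x. uH x - v x) \<le> S * (H ^ (d + 1) / \<epsilon>) * L2.nrm \<mu> f" .
  have f0: "0 \<le> L2.nrm \<mu> f" by (rule L2.nrm_nonneg[OF f])
  have Hd: "H ^ k \<le> (2 * pi * real d) ^ k" for k using H_le H_pos unfolding d_def by (intro power_mono) auto
  have P0: "0 \<le> (2 * pi * real d) ^ k" for k by simp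
  have K: "K\<^sub>G CARD('d) \<beta> = CI * sqrt Col * sqrt 2 + CI\<^sup>2 * Col * sqrt 2 + S * ((2 * pi * real d) ^ d + (2 * pi * real d) ^ (d - 1))"
    by (simp add: galerkin_const_def S_def A_def d_def)
  have pos: "0 \<le> CI * sqrt Col * sqrt 2" "0 \<le> CI\<^sup>2 * Col * sqrt 2" "0 \<le> S * (2 * pi * real d) ^ k" for k
    using CI Col S by simp_all
  have tri: "E.nrm (\<lambda>x. u x - v x) \<le> E.nrm (\<lambda>x. u x - uH x) + S * (H ^ (d + 1) / \<epsilon>) * L2.nrm \<mu> f"
    using E.nrm_triangle3[OF uH1 uH vH] locerr by linarith
  have ideal: "E.nrm (\<lambda>x. u x - uH x) \<le> CI * sqrt Col * sqrt 2 * (H / \<epsilon>) * L2.nrm \<mu> f"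
    unfolding uH_def c_def by (rule ideal_error(1)[OF f u \<psi>])
  have ideal': "E.nrm (\<lambda>x. u x - uH x) \<le> CI\<^sup>2 * Col * sqrt 2 * (H\<^sup>2 / \<epsilon>) * norm_H1 f" if "f \<in> H1P"
    unfolding uH_def c_def by (rule ideal_error(2)[OF f u \<psi> that])
  have "E.nrm (\<lambda>x. u x - v x) \<le> K\<^sub>G CARD('d) \<beta> * (H / \<epsilon>) * L2.nrm \<mu> f"
  proof -
    have "S * (H ^ (d + 1) / \<epsilon>) * L2.nrm \<mu> f = S * H ^ d * (H / \<epsilon>) * L2.nrm \<mu> f" by simp
    also have "\<dots> \<le> S * (2 * pi * real d) ^ d * (H / \<epsilon>) * L2.nrm \<mu> f"
      using S H_pos \<epsilon> f0 by (intro mult_right_mono mult_left_mono Hd) auto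
    finally have "E.nrm (\<lambda>x. u x - v x) \<le> CI * sqrt Col * sqrt 2 * (H / \<epsilon>) * L2.nrm \<mu> f + S * (2 * pi * real d) ^ d * (H / \<epsilon>) * L2.nrm \<mu> f"
      using tri ideal by linarith
    also have "\<dots> = (CI * sqrt Col * sqrt 2 + S * (2 * pi * real d) ^ d) * ((H / \<epsilon>) * L2.nrm \<mu> f)"
      by (simp only: distrib_right mult.assoc)
    also have "\<dots> \<le> K\<^sub>G CARD('d) \<beta> * ((H / \<epsilon>) * L2.nrm \<mu> f)"
    proof (rule mult_right_mono)
      show "CI * sqrt Col * sqrt 2 + S * (2 * pi * real d) ^ d \<le> K\<^sub>G CARD('d) \<beta>"
        unfolding K distrib_left using pos(2) pos(3)[of "d - 1"] by linarith
    qed (use H_pos \<epsilon> f0 in simp)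
    finally show ?thesis by (simp only: mult.assoc)
  qed
  moreover have "E.nrm (\<lambda>x. u x - v x) \<le> K\<^sub>G CARD('d) \<beta> * (H\<^sup>2 / \<epsilon>) * norm_H1 f" if fH: "f \<in> H1P"
  proof -
    \<comment> \<open>Since \<open>d \<ge> 1\<close>, two powers of \<open>H\<close> are left for
      the estimate; the remaining ones go into the constant.\<close>
    have "H ^ (d + 1) = H ^ (d - 1) * H\<^sup>2" using d by (simp add: power_add[symmetric])
    then have "S * (H ^ (d + 1) / \<epsilon>) * L2.nrm \<mu> f = S * H ^ (d - 1) * (H\<^sup>2 / \<epsilon>) * L2.nrm \<mu> f" by simp
    also have "\<dots> \<le> S * (2 * pi * real d) ^ (d - 1) * (H\<^sup>2 / \<epsilon>) * norm_H1 f"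
      using S H_pos \<epsilon> f0 norm_H1_ge(1)[of f] by (intro mult_mono mult_left_mono Hd mult_nonneg_nonneg P0) auto
    finally have "E.nrm (\<lambda>x. u x - v x) \<le> CI\<^sup>2 * Col * sqrt 2 * (H\<^sup>2 / \<epsilon>) * norm_H1 f + S * (2 * pi * real d) ^ (d - 1) * (H\<^sup>2 / \<epsilon>) * norm_H1 f"
      using tri ideal'[OF fH] by linarith
    also have "\<dots> = (CI\<^sup>2 * Col * sqrt 2 + S * (2 * pi * real d) ^ (d - 1)) * ((H\<^sup>2 / \<epsilon>) * norm_H1 f)"
      by (simp only: distrib_right mult.assoc)
    also have "\<dots> \<le> K\<^sub>G CARD('d) \<beta> * ((H\<^sup>2 / \<epsilon>) * norm_H1 f)"
    proof (rule mult_right_mono)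
      show "CI\<^sup>2 * Col * sqrt 2 + S * (2 * pi * real d) ^ (d - 1) \<le> K\<^sub>G CARD('d) \<beta>"
        unfolding K distrib_left using pos(1) pos(3)[of d] by linarith
    qed (use H_pos \<epsilon> in \<open>simp add: norm_H1_def\<close>)
    finally show ?thesis by (simp only: mult.assoc)
  qed
  ultimately show ?thesis using v by blast
qed

text \<open>The \<open>L2\<close> bound is stated relative to the energy norm of the error, so that
  one duality argument improves both energy bounds by a factor of order
  \<open>H / \<epsilon>\<close>.\<close>

lemma galerkin_error:
  assumes f: "f \<in> L2" and u: "galerkin_solution \<epsilon> V H1P f u"
    and u': "galerkin_solution \<epsilon> V (complex_span N \<psi>') f u'"
    and stab: "stability_constant \<epsilon> V Cst"
    and decay: "decay_rate \<epsilon> V \<T> N \<phi> \<beta>" and \<beta>: "0 < \<beta>" "\<beta> < 1"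
    and loc: "\<And>j. j \<in> {1..N} \<Longrightarrow> local_basis \<epsilon> V \<T> N \<phi> m j (\<psi>' j)"
    and m: "\<beta> ^ m \<le> H powr (3 * real CARD('d) / 2 + 2) / (\<epsilon>\<^sup>2 * Cst)"
  defines "e \<equiv> \<lambda>x. u x - u' x"
  shows "norm_e \<epsilon> V e \<le> K\<^sub>G CARD('d) \<beta> * (H / \<epsilon>) * norm_L2 Omega f"
    and "f \<in> H1P \<Longrightarrow> norm_e \<epsilon> V e \<le> K\<^sub>G CARD('d) \<beta> * (H\<^sup>2 / \<epsilon>) * norm_H1 f"
    and "norm_L2 Omega e \<le> K\<^sub>G CARD('d) \<beta> * (H / \<epsilon>) * norm_e \<epsilon> V e"
proof -
  define X where "X = complex_span N \<psi>'"
  have p': "\<psi>' j \<in> H1P" if "j \<in> {1..N}" for j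
    using loc[OF that] unfolding local_basis_def energy_minimizer_def by blast
  have XP: "X \<subseteq> H1P" unfolding X_def by (rule complex_span_closed(1)[OF p'])
  have X1: "v \<in> H1" if "v \<in> X" for v using XP that H1P_H1 by blast
  have Xi: "(\<lambda>x. \<i> * v x) \<in> X" if "v \<in> X" for v
    using complex_span_closed(2)[OF p' that[unfolded X_def], of \<i>] unfolding X_def .
  have Xd: "(\<lambda>x. v x - w x) \<in> X" if "v \<in> X" "w \<in> X" for v w
    using complex_span_closed(3)[OF p' that[unfolded X_def]] unfolding X_def .
  have gP: "galerkin_solution \<epsilon> V H1P g w \<longleftrightarrow> w \<in> H1P \<and> (\<forall>v\<in>H1P. en (\<epsilon>\<^sup>2 / 2) V w v = (\<integral>x. g x \<bullet> v x \<partial>\<mu>))"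
    if "g \<in> sq_int \<mu>" for g w
    by (rule galerkin_solution_energy[OF _ H1P_cmult that]) (use H1P_H1 in blast)
  have fs: "f \<in> sq_int \<mu>" using f by (simp add: L2_eq)
  have uP: "u \<in> H1P" and uw: "\<And>v. v \<in> H1P \<Longrightarrow> en (\<epsilon>\<^sup>2 / 2) V u v = (\<integral>x. f x \<bullet> v x \<partial>\<mu>)"
    using u gP[OF fs] by blast+
  have "u' \<in> X \<and> (\<forall>v\<in>X. en (\<epsilon>\<^sup>2 / 2) V u' v = (\<integral>x. f x \<bullet> v x \<partial>\<mu>))"
    using u' unfolding X_def[symmetric] by (subst (asm) galerkin_solution_energy) (use X1 Xi fs in auto)
  then have u'X: "u' \<in> X" and u'w: "\<And>v. v \<in> X \<Longrightarrow> en (\<epsilon>\<^sup>2 / 2) V u' v = (\<integral>x. f x \<bullet> v x \<partial>\<mu>)" by blast+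
  have eP: "e \<in> H1P" unfolding e_def by (intro H1P_diff uP) (use u'X XP in blast)
  note eH = H1P_H1[OF eP]
  have orth: "en (\<epsilon>\<^sup>2 / 2) V e v = 0" if v: "v \<in> X" for v
    unfolding e_def using E.B_diff[OF H1P_H1[OF uP] X1[OF u'X] X1[OF v]] uw[of v] u'w[OF v] v XP by auto
  have Cst: "0 < Cst" using stab by (simp add: stability_constant_def)
  have st: "E.nrm w \<le> Cst * L2.nrm \<mu> g"
    if "g \<in> sq_int \<mu>" "w \<in> H1P" "\<And>v. v \<in> H1P \<Longrightarrow> en (\<epsilon>\<^sup>2 / 2) V w v = (\<integral>x. g x \<bullet> v x \<partial>\<mu>)" for g w
  proof -
    have "galerkin_solution \<epsilon> V H1P g w" using gP[OF that(1), of w] that(2,3) by blast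
    then have "norm_e \<epsilon> V w \<le> Cst * norm_L2 Omega g"
      using stab that(1) unfolding stability_constant_def L2_eq by blast
    then show ?thesis by (simp only: norm_e_eq[OF H1P_H1[OF that(2)]] norm_L2_eq)
  qed
  \<comment> \<open>Stated for an arbitrary load, because it is used for \<open>f\<close> and, in
    the duality argument, for the error \<open>e\<close>.\<close>
  have approx: "\<exists>v\<in>X. E.nrm (\<lambda>x. w x - v x) \<le> K\<^sub>G CARD('d) \<beta> * (H / \<epsilon>) * L2.nrm \<mu> g \<and>
      (g \<in> H1P \<longrightarrow> E.nrm (\<lambda>x. w x - v x) \<le> K\<^sub>G CARD('d) \<beta> * (H\<^sup>2 / \<epsilon>) * norm_H1 g)"
    if "g \<in> sq_int \<mu>" "w \<in> H1P" "\<And>v. v \<in> H1P \<Longrightarrow> en (\<epsilon>\<^sup>2 / 2) V w v = (\<integral>x. g x \<bullet> v x \<partial>\<mu>)" for g w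
    unfolding X_def by (rule best_approximation[OF that Cst st[OF that] decay \<beta> loc m])
  \<comment> \<open>Cea's lemma with constant one, as the form is symmetric and defines the
    norm.\<close>
  have cea: "E.nrm e \<le> E.nrm (\<lambda>x. u x - v x)" if v: "v \<in> X" for v
  proof -
    have uv: "(\<lambda>x. u x - v x) \<in> H1" by (intro H1_diff H1P_H1 uP X1 v)
    have vu: "(\<lambda>x. v x - u' x) \<in> X" by (intro Xd v u'X)
    have "(\<lambda>x. (u x - v x) + (v x - u' x)) = e" by (simp add: e_def)
    then have "en (\<epsilon>\<^sup>2 / 2) V e e = en (\<epsilon>\<^sup>2 / 2) V e (\<lambda>x. u x - v x)"
      using E.B_add_right[OF uv X1[OF vu] eH] orth[OF vu] by simp
    also have "\<dots> \<le> E.nrm e * E.nrm (\<lambda>x. u x - v x)" using E.cauchy_schwarz[OF eH uv] by linarith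
    finally have "E.nrm e * E.nrm e \<le> E.nrm e * E.nrm (\<lambda>x. u x - v x)"
      unfolding E.nrm_sq[OF eH, symmetric] power2_eq_square[of "E.nrm e"] .
    then show ?thesis
      using E.nrm_nonneg[OF eH] E.nrm_nonneg[OF uv] mult_left_le_imp_le[of "E.nrm e" "E.nrm e" "E.nrm (\<lambda>x. u x - v x)"]
      by (cases "E.nrm e = 0") linarith+
  qed
  obtain v where v: "v \<in> X" "E.nrm (\<lambda>x. u x - v x) \<le> K\<^sub>G CARD('d) \<beta> * (H / \<epsilon>) * L2.nrm \<mu> f"
    "f \<in> H1P \<longrightarrow> E.nrm (\<lambda>x. u x - v x) \<le> K\<^sub>G CARD('d) \<beta> * (H\<^sup>2 / \<epsilon>) * norm_H1 f"
    using approx[OF fs uP uw] by blast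
  show "norm_e \<epsilon> V e \<le> K\<^sub>G CARD('d) \<beta> * (H / \<epsilon>) * norm_L2 Omega f"
    using cea[OF v(1)] v(2) by (simp only: norm_e_eq[OF eH] norm_L2_eq)
  show "norm_e \<epsilon> V e \<le> K\<^sub>G CARD('d) \<beta> * (H\<^sup>2 / \<epsilon>) * norm_H1 f" if "f \<in> H1P"
    using cea[OF v(1)] v(3) that unfolding norm_e_eq[OF eH] by linarith
  have es: "e \<in> sq_int \<mu>" by (rule H1_D(1)[OF eH])
  \<comment> \<open>Aubin-Nitsche: the error is tested with its own dual solution, from which the
    discrete approximation \<open>y\<close> may be subtracted because \<open>e\<close> is orthogonal
    to the discrete space.\<close>
  obtain w where w: "w \<in> H1P" "\<And>v. v \<in> H1P \<Longrightarrow> en (\<epsilon>\<^sup>2 / 2) V w v = (\<integral>x. e x \<bullet> v x \<partial>\<mu>)"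
    using weak_solution_exists[OF es] by blast
  note wH = H1P_H1[OF w(1)]
  obtain y where y: "y \<in> X" "E.nrm (\<lambda>x. w x - y x) \<le> K\<^sub>G CARD('d) \<beta> * (H / \<epsilon>) * L2.nrm \<mu> e"
    using approx[OF es w] by blast
  note yH = X1[OF y(1)]
  have "(L2.nrm \<mu> e)\<^sup>2 = en (\<epsilon>\<^sup>2 / 2) V w e" by (simp add: L2.nrm_sq[OF es] w(2)[OF eP])
  also have "\<dots> = en (\<epsilon>\<^sup>2 / 2) V (\<lambda>x. w x - y x) e"
    using E.B_diff[OF wH yH eH] E.B_sym[OF yH eH] orth[OF y(1)] by simp
  also have "\<dots> \<le> E.nrm (\<lambda>x. w x - y x) * E.nrm e"
    using E.cauchy_schwarz[OF H1_diff(1)[OF wH yH] eH] by linarith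
  also have "\<dots> \<le> K\<^sub>G CARD('d) \<beta> * (H / \<epsilon>) * L2.nrm \<mu> e * E.nrm e"
    by (intro mult_right_mono y E.nrm_nonneg eH)
  finally have le: "L2.nrm \<mu> e * L2.nrm \<mu> e \<le> L2.nrm \<mu> e * (K\<^sub>G CARD('d) \<beta> * (H / \<epsilon>) * E.nrm e)"
    by (simp only: power2_eq_square mult_ac)
  have nn: "0 \<le> K\<^sub>G CARD('d) \<beta> * (H / \<epsilon>) * E.nrm e"
  proof (intro mult_nonneg_nonneg E.nrm_nonneg eH)
    show "0 \<le> K\<^sub>G CARD('d) \<beta>"
      unfolding galerkin_const_def using CI Col Vmin localisation_const_nonneg[OF Col(1) Vmax Bb \<beta>(1)]
      by (intro add_nonneg_nonneg mult_nonneg_nonneg divide_nonneg_nonneg) auto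
  qed (use H_pos \<epsilon> in simp)
  have "L2.nrm \<mu> e \<le> K\<^sub>G CARD('d) \<beta> * (H / \<epsilon>) * E.nrm e"
    using L2.nrm_nonneg[OF es] nn mult_left_le_imp_le[OF le] by (cases "L2.nrm \<mu> e = 0") linarith+
  then show "norm_L2 Omega e \<le> K\<^sub>G CARD('d) \<beta> * (H / \<epsilon>) * norm_e \<epsilon> V e"
    by (simp only: norm_e_eq[OF eH] norm_L2_eq)
qed

end

theorem theorem3p3:
  fixes Vmin Vmax \<kappa> Col CI \<gamma> \<beta> :: real
    and CV :: "('d::finite \<Rightarrow> nat) \<Rightarrow> real"
  assumes "0 < Vmin" "Vmin \<le> Vmax"
    and "0 < \<kappa>" "0 < Col" "0 < CI" "0 < \<gamma>"
    and "0 < \<beta>" "\<beta> < 1"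
  shows "\<exists>C>0. \<forall>\<epsilon> \<delta> H Cst (V :: real ^ 'd \<Rightarrow> real) \<T> N z \<phi> m \<psi>loc.
    0 < \<epsilon> \<and> \<epsilon> < 1 \<and> 0 < \<delta> \<and> \<delta> < 1 \<and>
    potential Vmin Vmax CV \<delta> V \<and>
    stability_constant \<epsilon> V Cst \<and>
    periodic_mesh \<kappa> H \<T> \<and>
    nodal_basis \<T> N z \<phi> \<and>
    overlap_constant \<T> Col \<and>
    interpolation_constant \<T> H N \<phi> CI \<and>
    cutoff_constant \<T> H \<gamma> \<and>
    decay_rate \<epsilon> V \<T> N \<phi> \<beta> \<and>
    (\<forall>j\<in>{1..N}. local_basis \<epsilon> V \<T> N \<phi> m j (\<psi>loc j)) \<and>
    H / \<epsilon> \<le> inverse (2 * CI * sqrt (Col * Vmax * (1 + CI * Col * \<gamma>))) \<and>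
    real m \<ge> ((3 * real CARD('d) / 2 + 2) * ln (1 / H) + ln (\<epsilon>\<^sup>2 * Cst)) / \<bar>ln \<beta>\<bar>
    \<longrightarrow>
    (\<forall>f\<in>L2. \<forall>u uHm.
       galerkin_solution \<epsilon> V H1P f u \<and>
       galerkin_solution \<epsilon> V (complex_span N \<psi>loc) f uHm \<longrightarrow>
         norm_e \<epsilon> V (\<lambda>x. u x - uHm x) \<le> C * (H / \<epsilon>) * norm_L2 Omega f \<and>
         norm_L2 Omega (\<lambda>x. u x - uHm x) \<le> C * (H\<^sup>2 / \<epsilon>\<^sup>2) * norm_L2 Omega f \<and>
         (f \<in> H1P \<longrightarrow>
            norm_e \<epsilon> V (\<lambda>x. u x - uHm x) \<le> C * (H\<^sup>2 / \<epsilon>) * norm_H1 f \<and>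
            norm_L2 Omega (\<lambda>x. u x - uHm x) \<le> C * (H ^ 3 / \<epsilon>\<^sup>2) * norm_H1 f))"
proof -
  define d where "d = CARD('d)"
  define R where "R = inverse (2 * CI * sqrt (Col * Vmax * (1 + CI * Col * \<gamma>)))"
  have Vmax: "0 < Vmax" using assms(1,2) by linarith
  \<comment> \<open>Obtained before any mesh, load or small parameter is introduced, which makes the
    final constant uniform.\<close>
  obtain Cb where Cb: "0 < Cb" and bubbles: "\<forall>H (\<T> :: (real ^ 'd) set set) N z \<phi>. mesh \<kappa> H \<T> N z \<phi> \<longrightarrow>
    (\<forall>j\<in>{1..N}. \<exists>T b. T \<in> \<T> \<and> z j extreme_point_of T \<and> b \<in> H1P \<and> (\<forall>x. x \<notin> T \<longrightarrow> b x = 0) \<and>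
      (AE x in \<mu>. x \<notin> T \<longrightarrow> grad b x = 0) \<and> biorthogonal N \<phi> j b \<and>
      (L2.nrm \<mu> b)\<^sup>2 \<le> Cb / H ^ CARD('d) \<and> (L2.nrm \<mu> (grad b))\<^sup>2 \<le> Cb / H ^ (CARD('d) + 2))"
    using mesh_bubbles[OF assms(3), where 'd = 'd] by (elim exE conjE)
  define K where "K = galerkin_const d \<kappa> Col CI Vmin Vmax R ((1/2 + Vmax * R\<^sup>2) * Cb) \<beta>"
  have "0 < (1/2 + Vmax * R\<^sup>2) * Cb" using Vmax Cb by (intro mult_pos_pos add_pos_nonneg) auto
  then have K: "0 \<le> K"
    unfolding K_def galerkin_const_def using assms Vmax
    by (intro add_nonneg_nonneg mult_nonneg_nonneg divide_nonneg_nonneg real_sqrt_ge_zero localisation_const_nonneg) auto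
  show ?thesis
  \<comment> \<open>\<open>K\<close> serves the energy bounds, \<open>K^2\<close> the
    \<open>L2\<close> bounds, where duality brings in the factor a second time, and the
    \<open>1\<close> ensures positivity.\<close>
  proof (intro exI[of _ "K + K\<^sup>2 + 1"] conjI allI impI ballI)
    show "0 < K + K\<^sup>2 + 1" using K by (intro add_nonneg_pos add_nonneg_nonneg) auto
    fix \<epsilon> \<delta> H Cst and V :: "real ^ 'd \<Rightarrow> real" and \<T> N z \<phi> m \<psi>loc and f u uHm :: "real ^ 'd \<Rightarrow> complex"
    assume hyp: "0 < \<epsilon> \<and> \<epsilon> < 1 \<and> 0 < \<delta> \<and> \<delta> < 1 \<and> potential Vmin Vmax CV \<delta> V \<and> stability_constant \<epsilon> V Cst \<and>
        periodic_mesh \<kappa> H \<T> \<and> nodal_basis \<T> N z \<phi> \<and> overlap_constant \<T> Col \<and>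
        interpolation_constant \<T> H N \<phi> CI \<and> cutoff_constant \<T> H \<gamma> \<and> decay_rate \<epsilon> V \<T> N \<phi> \<beta> \<and>
        (\<forall>j\<in>{1..N}. local_basis \<epsilon> V \<T> N \<phi> m j (\<psi>loc j)) \<and>
        H / \<epsilon> \<le> inverse (2 * CI * sqrt (Col * Vmax * (1 + CI * Col * \<gamma>))) \<and>
        ((3 * real CARD('d) / 2 + 2) * ln (1 / H) + ln (\<epsilon>\<^sup>2 * Cst)) / \<bar>ln \<beta>\<bar> \<le> real m"
      and f: "f \<in> L2"
      and gal: "galerkin_solution \<epsilon> V H1P f u \<and> galerkin_solution \<epsilon> V (complex_span N \<psi>loc) f uHm"
    then have \<epsilon>: "0 < \<epsilon>" and V: "potential Vmin Vmax CV \<delta> V" and stab: "stability_constant \<epsilon> V Cst"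
      and decay: "decay_rate \<epsilon> V \<T> N \<phi> \<beta>"
      and mesh: "periodic_mesh \<kappa> H \<T>" "nodal_basis \<T> N z \<phi>"
      and cnst: "overlap_constant \<T> Col" "interpolation_constant \<T> H N \<phi> CI"
      and loc': "\<forall>j\<in>{1..N}. local_basis \<epsilon> V \<T> N \<phi> m j (\<psi>loc j)"
      and res: "H / \<epsilon> \<le> R"
      and over: "((3 * real CARD('d) / 2 + 2) * ln (1 / H) + ln (\<epsilon>\<^sup>2 * Cst)) / \<bar>ln \<beta>\<bar> \<le> real m"
      unfolding R_def by - (elim conjE, assumption)+
    note loc = bspec[OF loc']
    interpret I: interp_mesh \<kappa> H \<T> N z \<phi> Col CI
      by unfold_locales (fact assms mesh cnst)+
    \<comment> \<open>Element and bubble are packed into a pair, so that a single choice yields the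
      families \<open>Tb\<close> and \<open>b\<close>.\<close>
    define P where "P j p \<longleftrightarrow> fst p \<in> \<T> \<and> z j extreme_point_of fst p \<and> snd p \<in> H1P \<and> (\<forall>x. x \<notin> fst p \<longrightarrow> snd p x = 0) \<and>
      (AE x in \<mu>. x \<notin> fst p \<longrightarrow> grad (snd p) x = 0) \<and> biorthogonal N \<phi> j (snd p) \<and>
      (L2.nrm \<mu> (snd p))\<^sup>2 \<le> Cb / H ^ CARD('d) \<and> (L2.nrm \<mu> (grad (snd p)))\<^sup>2 \<le> Cb / H ^ (CARD('d) + 2)" for j p
    have ex: "\<exists>p. P j p" if j: "j \<in> {1..N}" for j
    proof -
      have "\<exists>T b. P j (T, b)" unfolding P_def fst_conv snd_conv
        by (rule bubbles[THEN spec, THEN spec, THEN spec, THEN spec, THEN spec, THEN mp, OF I.mesh_axioms, THEN bspec, OF j])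
      then show ?thesis by blast
    qed
    have P: "P j (SOME p. P j p)" if "j \<in> {1..N}" for j by (rule someI_ex[OF ex[OF that]])
    define Tb where "Tb j = fst (SOME p. P j p)" for j
    define b where "b j = snd (SOME p. P j p)" for j
    interpret L: lod \<kappa> H \<T> N z \<phi> Col CI \<epsilon> Vmin Vmax R Cb V Tb b
    proof unfold_locales
      show "0 < \<epsilon>" "0 < Vmin" "0 < Cb" by fact+
      show "V \<in> borel_measurable \<mu>" by (rule potential_measurable[OF V])
      show "Vmin \<le> V x \<and> V x \<le> Vmax" if "x \<in> Omega" for x using V that by (simp add: potential_def)
      show "H \<le> R * \<epsilon>" using res \<epsilon> by (simp add: pos_divide_le_eq)
    qed (use P in \<open>simp_all add: P_def Tb_def b_def\<close>)
    have Cst: "0 < Cst" using stab by (simp add: stability_constant_def)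
    have m: "\<beta> ^ m \<le> H powr (3 * real CARD('d) / 2 + 2) / (\<epsilon>\<^sup>2 * Cst)"
      by (rule oversampling_decay[OF assms(7,8) I.H_pos _ over]) (use \<epsilon> Cst in simp)
    define e where "e x = u x - uHm x" for x
    note unf = K_def d_def e_def[abs_def]
    note err = L.galerkin_error[OF f conjunct1[OF gal] conjunct2[OF gal] stab decay assms(7,8) loc m]
    have err1: "norm_e \<epsilon> V e \<le> K * (H / \<epsilon>) * norm_L2 Omega f" unfolding unf by (rule err(1))
    have err2: "norm_e \<epsilon> V e \<le> K * (H\<^sup>2 / \<epsilon>) * norm_H1 f" if "f \<in> H1P" unfolding unf by (rule err(2)[OF _ that])
    have err3: "norm_L2 Omega e \<le> K * (H / \<epsilon>) * norm_e \<epsilon> V e" unfolding unf by (rule err(3))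
    have nn: "0 \<le> norm_L2 Omega f" "0 \<le> norm_H1 f" by (simp_all add: norm_L2_def norm_H1_def)
    have Kle: "K \<le> K + K\<^sup>2 + 1" "K\<^sup>2 \<le> K + K\<^sup>2 + 1" using K by simp_all
    have KH: "0 \<le> K * (H / \<epsilon>)" using K \<epsilon> I.H_pos by simp
    show "norm_e \<epsilon> V (\<lambda>x. u x - uHm x) \<le> (K + K\<^sup>2 + 1) * (H / \<epsilon>) * norm_L2 Omega f"
      using err1 unfolding e_def[abs_def]
      by (rule order_trans) (intro mult_right_mono Kle nn, use I.H_pos \<epsilon> in simp)
    show "norm_L2 Omega (\<lambda>x. u x - uHm x) \<le> (K + K\<^sup>2 + 1) * (H\<^sup>2 / \<epsilon>\<^sup>2) * norm_L2 Omega f"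
    proof -
      have "norm_L2 Omega e \<le> K * (H / \<epsilon>) * (K * (H / \<epsilon>) * norm_L2 Omega f)"
        by (rule order_trans[OF err3 mult_left_mono[OF err1 KH]])
      also have "\<dots> = K\<^sup>2 * (H\<^sup>2 / \<epsilon>\<^sup>2) * norm_L2 Omega f" by (simp add: power2_eq_square)
      also have "\<dots> \<le> (K + K\<^sup>2 + 1) * (H\<^sup>2 / \<epsilon>\<^sup>2) * norm_L2 Omega f"
        by (intro mult_right_mono Kle nn) simp
      finally show ?thesis by (simp only: e_def[abs_def])
    qed
    show "norm_e \<epsilon> V (\<lambda>x. u x - uHm x) \<le> (K + K\<^sup>2 + 1) * (H\<^sup>2 / \<epsilon>) * norm_H1 f" if "f \<in> H1P"
      using err2[OF that] unfolding e_def[abs_def]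
      by (rule order_trans) (intro mult_right_mono Kle nn, use \<epsilon> in simp)
    show "norm_L2 Omega (\<lambda>x. u x - uHm x) \<le> (K + K\<^sup>2 + 1) * (H ^ 3 / \<epsilon>\<^sup>2) * norm_H1 f" if "f \<in> H1P"
    proof -
      have "norm_L2 Omega e \<le> K * (H / \<epsilon>) * (K * (H\<^sup>2 / \<epsilon>) * norm_H1 f)"
        by (rule order_trans[OF err3 mult_left_mono[OF err2[OF that] KH]])
      also have "\<dots> = K\<^sup>2 * (H ^ 3 / \<epsilon>\<^sup>2) * norm_H1 f" by (simp add: power2_eq_square power3_eq_cube)
      also have "\<dots> \<le> (K + K\<^sup>2 + 1) * (H ^ 3 / \<epsilon>\<^sup>2) * norm_H1 f"
        using I.H_pos by (intro mult_right_mono Kle nn) simp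
      finally show ?thesis by (simp only: e_def[abs_def])
    qed
  qed
qed

end
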